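(* For each $0<a=\lambda\Delta<\infty$ and $\theta>0$, let $Y_{\theta a}\overset{d}{=}e^{-\lambda\Delta}\int_0^{\Delta}e^{\lambda y}G_\theta(d\lambda y)$ denote an infinitely divisible random variable with Lévy exponent $$\int_{e^{-a}}^1 d_\theta(\omega u)u^{-1}du=\int_{e^{-a}}^1 d_{\theta a}(\omega u)F_a(du)=-\theta\left[Li_2(-\omega)-Li_2(-\omega e^{-a})\right],$$ where $F_a(du)=a^{-1}u^{-1}du$ is the density of a random variable taking its values in $[e^{-a},1]$. Then the following results hold. (i) $Y_{\theta a}\overset{d}{=}T_{\theta a}M_{\theta a}$, where $M_{\theta a}=\int_{e^{-a}}^1xP_{\theta aF_a}(dx)$ is a Dirichlet process mean functional. (ii) The Lévy density of $Y_{\theta a}$ is $\rho_{\theta a}(dy)=\theta y^{-1}[E_1(y)-E_1(ye^{a})]dy$. Hence the cumulants of $Y_{\theta a}$ are, for each integer $j$, $$\theta\int_0^\infty y^{j-1}[E_1(y)-E_1(ye^a)]dy=\theta\,\frac{\Gamma(j)}{j}(1-e^{-aj}).$$ (iii) When $\theta a=1$, the density of $M_1$ is given by $$\frac1\pi\sin\left(\frac{-\pi\log(x)}{a}\right)x^{\frac1a[1-\log(x)]-1}\,e^{\frac{\pi^2}{3a}}\,e^{-\frac1a\left[Li_2(x)+Li_2\left(\frac{e^{-a}}{x}\right)\right]},\qquad e^{-a}\le x\le1.$$ (iv) When $\theta a=1$, the density of $V_a:=-\log(M_1)/a$ is given by $$\frac1\pi\sin(\pi v)\,e^{-[v+v^2]}\,e^{\frac{\pi^2}{3a}}\,e^{-\frac1a\left[Li_2(e^{-av})+Li_2(e^{-a(1-v)})\right]},\qquad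 0\le v\le1.$$ (v) When $\theta a>1$, the density of $M_{\theta a}/a$ is given by $$\frac{\theta a-1}{\pi}\int_{-\log x/a}^{1}(x-e^{-va})^{\theta a-2}\sin(\pi\theta av)\,e^{-\theta a[v+v^2]}\,e^{\frac{\theta\pi^2}{3}}\,e^{-\theta\left[Li_2(e^{-av})+Li_2(e^{-a(1-v)})\right]}dv,$$ for $0\le v\le1$. (vi) If $\theta a=m$, where $m=2,3,\ldots$ is an integer, then $M_m\overset{d}{=}\sum_{i=1}^{m}W_iM_{1,i}$, where $(M_{1,i})$ are iid with the density displayed in (iii) and, independent of $(M_{1,i})$, the vector $\left(W_i=T_{1,i}/\sum_{j=1}^mT_{1,j}\right)$, where $T_{1,i}\overset d=T_1$ are iid, is a $\mathrm{Dirichlet}_m(1,\ldots,1)$ $m$-dimensional vector. (vii) $Y_{\theta a}$ converges in distribution to $v_\theta(0)$ as $e^{-a}\to0$.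
   Context: $T_c$ denotes a Gamma random variable with shape $c$ and scale $1$. The Lévy exponent of a positive random variable $W$ is $-\log E[e^{-\omega W}]$, and $d_\theta(\omega)=\theta\log(1+\omega)$. $G_\theta$ is the homogeneous Gamma process, i.e. the subordinator with $E[e^{-\omega G_\theta(t)}]=(1+\omega)^{-\theta t}$, and $\int_0^{t} g(y)G_\theta(d\lambda y):=\int_0^{\lambda t}g(s/\lambda)G_\theta(ds)$, with $\lambda,\Delta>0$. $Li_2(x)=-\int_0^x\frac{\log(1-u)}{u}du$ is the dilogarithm function and $E_1(y)=\int_y^\infty e^{-u}u^{-1}du$ is the exponential integral. For a probability measure $H$ and $c>0$, $P_{cH}$ is the Dirichlet process with shape measure $cH$, that is $P_{cH}=G_{cH}/G_{cH}(\mathcal X)$ with $G_{cH}$ a Gamma random measure with shape measure $cH$ on the space $\mathcal X$. In the product $T_{\theta a}M_{\theta a}$ the two factors are independent. The dependence of $M_{\theta a}$ on $F_a$ is suppressed in the notation; $M_1$ and $M_m$ denote $M_{\theta a}$ when $\theta a=1$ and $\theta a=m$, i.e. the mean functionals with shape measures $F_a$ and $mF_a$. $v_\theta(0)$ has the stationary law of the Ornstein–Uhlenbeck process driven by $G_\theta$; its Lévy exponent is $\int_0^1d_\theta(\omega u)u^{-1}du=-\theta Li_2(-\omega)$.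
   Formalization: Densities corrected: (iii) has x^{-log x/(2a)-1}; (iv) has a e^{-av²/2} for e^{-[v+v²]}; (v) has sin(πθa(1-v)), e^{θa(av-av²/2)} and a factor a e^{-av}, and is the density of M, that of M/a following by rescaling; (vi) uses the corrected (iii). *)

theory Defs
  imports "HOL-Probability.Probability"
begin

text \<open>Laws on the real line are represented by \<open>real measure\<close>; equality in distribution is
  equality of such measures, and independence is expressed by product measures.\<close>

subsection \<open>Special functions\<close>

text \<open>The interval integral is oriented, so for \<open>x < 0\<close> this is minus the integral over \<open>(x, 0)\<close>.\<close>

definition Li2 :: "real \<Rightarrow> real" where
  "Li2 x = - (LBINT u=0..ereal x. ln (1 - u) / u)"

definition E1 :: "real \<Rightarrow> real" where
  "E1 y = (LBINT u:{y..}. exp (- u) / u)"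

subsection \<open>Laws of positive random variables\<close>

text \<open>For \<open>c = 0\<close> this is the point mass at 0, so that Gamma random measures may have null sets.\<close>

definition gamma_law :: "real \<Rightarrow> real measure" where
  "gamma_law c =
    (if c = 0 then return borel 0
     else density lborel (\<lambda>x. ennreal (if 0 < x then x powr (c - 1) * exp (- x) / Gamma c else 0)))"

definition levy_exponent :: "real measure \<Rightarrow> real \<Rightarrow> real" where
  "levy_exponent L \<omega> = - ln (LINT x|L. exp (- \<omega> * x))"

definition infinitely_divisible :: "real measure \<Rightarrow> bool" where
  "infinitely_divisible L \<longleftrightarrow> prob_space L \<and> sets L = sets borel \<and>
    (\<forall>n::nat. 1 \<le> n \<longrightarrow> (\<exists>\<nu>. prob_space \<nu> \<and> sets \<nu> = sets borel \<and>
      L = distr (PiM {..<n} (\<lambda>_. \<nu>)) borel (\<lambda>x. \<Sum>i<n. x i)))"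

text \<open>Levy--Khintchine representation of a law on the half line with drift \<open>b\<close> and
  Levy measure \<open>\<rho> y dy\<close>.\<close>

definition levy_khintchine :: "real measure \<Rightarrow> real \<Rightarrow> (real \<Rightarrow> real) \<Rightarrow> bool" where
  "levy_khintchine L b \<rho> \<longleftrightarrow>
    0 \<le> b \<and> (\<forall>y>0. 0 \<le> \<rho> y) \<and> set_integrable lborel {0<..} (\<lambda>y. min 1 y * \<rho> y) \<and>
    (\<forall>\<omega>\<ge>0. levy_exponent L \<omega> = b * \<omega> + (LBINT y:{0<..}. (1 - exp (- \<omega> * y)) * \<rho> y))"

text \<open>Finiteness of the moment generating function near 0 makes the cumulant generating function
  analytic there, so that the iterated derivative is genuine.\<close>

definition has_cumulant :: "real measure \<Rightarrow> nat \<Rightarrow> real \<Rightarrow> bool" where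
  "has_cumulant L j \<kappa> \<longleftrightarrow>
    (\<exists>\<epsilon>>0. \<forall>t. \<bar>t\<bar> < \<epsilon> \<longrightarrow> integrable L (\<lambda>x. exp (t * x))) \<and>
    (deriv ^^ j) (\<lambda>t. ln (LINT x|L. exp (t * x))) 0 = \<kappa>"

subsection \<open>Gamma process and Ornstein--Uhlenbeck process\<close>

definition subordinator :: "'a measure \<Rightarrow> (real \<Rightarrow> 'a \<Rightarrow> real) \<Rightarrow> bool" where
  "subordinator M G \<longleftrightarrow>
    prob_space M \<and>
    (\<forall>t\<ge>0. G t \<in> borel_measurable M) \<and>
    (\<forall>w\<in>space M. G 0 w = 0 \<and> (\<forall>s t. 0 \<le> s \<and> s \<le> t \<longrightarrow> G s w \<le> G t w) \<and>
       (\<forall>t\<ge>0. continuous (at_right t) (\<lambda>s. G s w))) \<and>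
    (\<forall>(n::nat) t. 0 \<le> t 0 \<and> (\<forall>i<n. t i \<le> t (Suc i)) \<longrightarrow>
       prob_space.indep_vars M (\<lambda>_. borel) (\<lambda>i w. G (t (Suc i)) w - G (t i) w) {..<n}) \<and>
    (\<forall>s\<ge>0. \<forall>t\<ge>0. distr M borel (\<lambda>w. G (s + t) w - G s w) = distr M borel (G t))"

definition gamma_process :: "'a measure \<Rightarrow> (real \<Rightarrow> 'a \<Rightarrow> real) \<Rightarrow> real \<Rightarrow> bool" where
  "gamma_process M G \<theta> \<longleftrightarrow> subordinator M G \<and>
    (\<forall>t\<ge>0. \<forall>\<omega>\<ge>0. (LINT w|M. exp (- \<omega> * G t w)) = (1 + \<omega>) powr (- \<theta> * t))"

text \<open>The integral of \<open>g y\<close> against \<open>G(d \<lambda> y)\<close> over \<open>(0, t]\<close>, as a pathwise Stieltjes integral.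
  Paths are extended by 0 to the negative half line.\<close>

definition gamma_integral ::
    "(real \<Rightarrow> 'a \<Rightarrow> real) \<Rightarrow> real \<Rightarrow> real \<Rightarrow> (real \<Rightarrow> real) \<Rightarrow> 'a \<Rightarrow> real" where
  "gamma_integral G lam t g w =
    (LINT s:{0<..lam * t}|interval_measure (\<lambda>s. G (max 0 s) w). g (s / lam))"

definition ou_increment :: "(real \<Rightarrow> 'a \<Rightarrow> real) \<Rightarrow> real \<Rightarrow> real \<Rightarrow> 'a \<Rightarrow> real" where
  "ou_increment G lam t w = exp (- lam * t) * gamma_integral G lam t (\<lambda>y. exp (lam * y)) w"

text \<open>\<open>L\<close> is stationary for \<open>dv(t) = - \<lambda> v(t) dt + G(d \<lambda> t)\<close>, whose solution is
  \<open>v(t) = exp (- \<lambda> t) v(0) + ou_increment G \<lambda> t\<close> with \<open>v(0)\<close> independent of \<open>G\<close>.\<close>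

definition ou_stationary_law ::
    "'a measure \<Rightarrow> (real \<Rightarrow> 'a \<Rightarrow> real) \<Rightarrow> real \<Rightarrow> real measure \<Rightarrow> bool" where
  "ou_stationary_law M G lam L \<longleftrightarrow> prob_space L \<and> sets L = sets borel \<and>
    (\<forall>t\<ge>0. distr (L \<Otimes>\<^sub>M M) borel (\<lambda>(x, w). exp (- lam * t) * x + ou_increment G lam t w) = L)"

definition d_exponent :: "real \<Rightarrow> real \<Rightarrow> real" where
  "d_exponent \<theta> \<omega> = \<theta> * ln (1 + \<omega>)"

definition F_law :: "real \<Rightarrow> real measure" where
  "F_law a = density lborel (\<lambda>u. ennreal (indicator {exp (- a)..1} u / (a * u)))"

subsection \<open>Dirichlet process\<close>

definition gamma_random_measure :: "'w measure \<Rightarrow> ('w \<Rightarrow> 'x measure) \<Rightarrow> 'x measure \<Rightarrow> bool" where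
  "gamma_random_measure M \<Gamma> \<mu> \<longleftrightarrow>
    prob_space M \<and> finite_measure \<mu> \<and>
    (\<forall>w\<in>space M. finite_measure (\<Gamma> w) \<and> sets (\<Gamma> w) = sets \<mu>) \<and>
    (\<forall>A\<in>sets \<mu>. (\<lambda>w. measure (\<Gamma> w) A) \<in> borel_measurable M \<and>
       distr M borel (\<lambda>w. measure (\<Gamma> w) A) = gamma_law (measure \<mu> A)) \<and>
    (\<forall>(n::nat) A. (\<forall>i<n. A i \<in> sets \<mu>) \<and> disjoint_family_on A {..<n} \<longrightarrow>
       prob_space.indep_vars M (\<lambda>_. borel) (\<lambda>i w. measure (\<Gamma> w) (A i)) {..<n})"

definition dirichlet_process :: "'w measure \<Rightarrow> ('w \<Rightarrow> 'x measure) \<Rightarrow> 'x measure \<Rightarrow> bool" where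
  "dirichlet_process M P \<mu> \<longleftrightarrow>
    (\<exists>\<Gamma>. gamma_random_measure M \<Gamma> \<mu> \<and>
      (\<forall>w\<in>space M. P w = scale_measure (1 / emeasure (\<Gamma> w) (space (\<Gamma> w))) (\<Gamma> w)))"

definition mean_functional_law :: "'w measure \<Rightarrow> ('w \<Rightarrow> real measure) \<Rightarrow> real \<Rightarrow> real measure" where
  "mean_functional_law M P a = distr M borel (\<lambda>w. LINT x:{exp (- a)..1}|P w. x)"

text \<open>The Dirichlet distribution, given by its density in the first \<open>m - 1\<close> coordinates.\<close>

definition dirichlet_density :: "nat \<Rightarrow> (nat \<Rightarrow> real) \<Rightarrow> (nat \<Rightarrow> real) \<Rightarrow> real" where
  "dirichlet_density m \<alpha> w =
    (if (\<forall>i<m - 1. 0 < w i) \<and> (\<Sum>i<m - 1. w i) < 1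
     then Gamma (\<Sum>i<m. \<alpha> i) / (\<Prod>i<m. Gamma (\<alpha> i)) *
       (\<Prod>i<m - 1. w i powr (\<alpha> i - 1)) * (1 - (\<Sum>i<m - 1. w i)) powr (\<alpha> (m - 1) - 1)
     else 0)"

definition dirichlet_law :: "nat \<Rightarrow> (nat \<Rightarrow> real) \<Rightarrow> (nat \<Rightarrow> real) measure" where
  "dirichlet_law m \<alpha> =
    distr (density (PiM {..<m - 1} (\<lambda>_. lborel)) (\<lambda>w. ennreal (dirichlet_density m \<alpha> w)))
      (PiM {..<m} (\<lambda>_. borel))
      (\<lambda>w. \<lambda>i\<in>{..<m}. if i < m - 1 then w i else 1 - (\<Sum>j<m - 1. w j))"

definition normalized_weights :: "nat \<Rightarrow> (nat \<Rightarrow> real) \<Rightarrow> nat \<Rightarrow> real" where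
  "normalized_weights m t = (\<lambda>i\<in>{..<m}. t i / (\<Sum>j<m. t j))"

subsection \<open>Densities of the mean functional\<close>

text \<open>With \<open>F x = 1 + ln x / a\<close> the distribution function of \<open>F_law a\<close>, and
  \<open>\<Lambda> x\<close> the integral of \<open>ln \<bar>x - u\<bar>\<close> with respect to \<open>F_law a\<close>, one has, for \<open>exp (- a) \<le> x \<le> 1\<close>,
  \<open>a * \<Lambda> x = (ln x)^2 / 2 + a * ln x - pi^2 / 3 + Li2 x + Li2 (exp (- a) / x)\<close>.
  \<open>density_M1\<close> is the Cifarelli--Regazzini density \<open>sin (pi * F x) / pi * exp (- \<Lambda> x)\<close>,
  \<open>density_V\<close> its image under \<open>x \<mapsto> - ln x / a\<close>, and \<open>density_M \<theta> a\<close> is the integral of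
  \<open>(c - 1) * (x - u) powr (c - 2) * sin (pi * c * F u) / pi * exp (- c * \<Lambda> u)\<close> over \<open>u \<le> x\<close>,
  where \<open>c = \<theta> * a\<close>, after the substitution \<open>u = exp (- v * a)\<close>.
  The source prints these with the term \<open>(ln x)^2 / 2 + a * ln x\<close> miscalculated, without the Jacobians
  of the substitutions, and with \<open>sin (pi * \<theta> * a * v)\<close> in place of \<open>sin (pi * \<theta> * a * (1 - v))\<close>;
  as printed they do not in general integrate to 1.\<close>

definition density_M1 :: "real \<Rightarrow> real \<Rightarrow> real" where
  "density_M1 a x =
    (if exp (- a) \<le> x \<and> x \<le> 1
     then 1 / pi * sin (- pi * ln x / a) * x powr (- ln x / (2 * a) - 1) * exp (pi\<^sup>2 / (3 * a)) *
       exp (- (1 / a) * (Li2 x + Li2 (exp (- a) / x)))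
     else 0)"

definition density_V :: "real \<Rightarrow> real \<Rightarrow> real" where
  "density_V a v =
    (if 0 \<le> v \<and> v \<le> 1
     then a / pi * sin (pi * v) * exp (- a * v\<^sup>2 / 2) * exp (pi\<^sup>2 / (3 * a)) *
       exp (- (1 / a) * (Li2 (exp (- a * v)) + Li2 (exp (- a * (1 - v)))))
     else 0)"

definition density_M :: "real \<Rightarrow> real \<Rightarrow> real \<Rightarrow> real" where
  "density_M \<theta> a x =
    (if exp (- a) \<le> x \<and> x \<le> 1
     then (\<theta> * a - 1) / pi *
       (LBINT v:{- ln x / a..1}.
         (x - exp (- v * a)) powr (\<theta> * a - 2) * sin (pi * \<theta> * a * (1 - v)) *
         (a * exp (- a * v)) * exp (\<theta> * a * (a * v - a * v\<^sup>2 / 2)) * exp (\<theta> * pi\<^sup>2 / 3) *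
         exp (- \<theta> * (Li2 (exp (- a * v)) + Li2 (exp (- a * (1 - v))))))
     else 0)"

end

theory Submission
  imports Defs "HOL-Complex_Analysis.Complex_Analysis"
begin

text \<open>
Put \<open>c = \<theta> * a\<close> and \<open>\<ell> \<omega> = \<integral> ln (1 + \<omega> u) / u du\<close> over \<open>[exp (- a), 1]\<close>, which is
\<open>log_transform a \<omega>\<close> below. The increment \<open>Y\<close> and the mean functional are identified
through transforms that are powers of \<open>exp (- \<ell> \<omega>)\<close>.

An integral of \<open>f\<close> against a gamma process or a gamma random measure has Laplace transform
\<open>exp (- \<integral> ln (1 + f) d\<mu>)\<close>: for step functions this is the Laplace transform of independent gamma variables,
and step approximations carry it to continuous \<open>f\<close> that are nonnegative, or decreasing and larger than \<open>- 1\<close>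
(\<open>laplace_gamma_integral\<close>, \<open>laplace_gamma_process_integral\<close>). With \<open>f s = \<omega> exp (s - a)\<close> the increment \<open>Y\<close> gets the
exponent \<open>\<theta> \<ell> \<omega>\<close>, valid for all \<open>\<omega> > - 1\<close>. Its dilogarithm form is a change of variables, its Levy density comes
from Frullani's integral applied to \<open>E1 y - E1 (y exp a) = \<integral> exp (- y exp s) ds\<close> over \<open>[0, a]\<close>, and the cumulants
are read off from the power series of \<open>- \<theta> \<ell> (- t)\<close> in \<open>\<bar>t\<bar> < 1\<close>.

For a gamma random measure with shape \<open>c F\<close>, total mass \<open>S\<close> and mean \<open>Z\<close>, the joint
Laplace transform has a scaling property that forces \<open>S\<close> to be a gamma variable independent of \<open>Z / S\<close>
(\<open>gamma_sum_ratio_independent\<close>). Hence the law \<open>D\<close> of the mean functional satisfies the Markov--Krein identity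
\<open>\<integral> (1 + \<omega> x) powr (- c) dD = exp (- \<theta> \<ell> \<omega>)\<close> (\<open>mean_functional_gamma_mixture\<close>). The left-hand side
is the Laplace transform of a gamma variable times an independent variable with law \<open>D\<close>, which gives the factorisation of \<open>Y\<close>. Since the
moments of a gamma variable do not vanish, such a transform also determines \<open>D\<close> (\<open>finite_measure_eqI_stieltjes\<close>),
so each claim about \<open>D\<close> reduces to computing this transform for the proposed law.

Let \<open>\<Lambda> z = \<integral> ln (z - exp (- a v)) dv\<close> over \<open>[0, 1]\<close>. In the upper half plane
\<open>\<Phi> z = (z - 1) powr (c - 1) * exp (- c * \<Lambda> z)\<close> is holomorphic and decays like \<open>1 / z\<close>; on the real line its imaginary
part vanishes off \<open>[exp (- a), 1]\<close>, and there it is minus \<open>(1 - x) powr (c - 1)\<close> times \<open>pi\<close> times the function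
\<open>cr_fn\<close> of Cifarelli and Regazzini. Cauchy's theorem for \<open>\<Phi> z / (z - p)\<close> with \<open>p < 0\<close> then evaluates the
Stieltjes transform of this boundary function as \<open>(1 - p) powr (c - 1) * exp (- c * Re (\<Lambda> p))\<close>
(\<open>stieltjes_inversion\<close>). For \<open>c = 1\<close> it says that \<open>cr_fn\<close> is the density of \<open>D\<close>. For \<open>c > 1\<close> the density is the
integral of \<open>cr_fn\<close> against the kernel \<open>(c - 1) (x - u) powr (c - 2)\<close>, whose generalised Stieltjes transform
in \<open>x\<close> is \<open>(1 - u) powr (c - 1) (1 + \<omega>) powr (1 - c) / (1 + \<omega> u)\<close> (\<open>beta_kernel_integral\<close>), so Fubini reduces the
claim to the same evaluation. The potential itself is computed in terms of dilogarithms by \<open>rlogpot_exp\<close>.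

Independent exponential weights multiply transforms, so a mixture of \<open>m\<close> independent
copies with shape one has the transform \<open>exp (- \<ell> \<omega> / a) ^ m\<close> required for \<open>c = m\<close>
(\<open>exponential_mixture_stieltjes\<close>). Stationarity factors the characteristic function of the stationary law
\<open>L\<close> at \<open>u\<close> as its value at \<open>u exp (- a)\<close> times the characteristic function of \<open>Y\<close>, and the first factor
tends to 1 as \<open>exp (- a)\<close> tends to 0; this is the weak convergence.
\<close>

section \<open>Measures determined by moments and transforms\<close>

text \<open>On a bounded interval the exponential series may be integrated termwise, so the moments determine the
characteristic function.\<close>

lemma char_eq_suminf_moments:
  fixes M :: "real measure"
  assumes "prob_space M" "sets M = sets borel" "AE x in M. 0 \<le> x \<and> x \<le> 1"
  shows "char M t = (\<Sum>k. ((\<i> * t) ^ k /\<^sub>R fact k) * of_real (LINT x|M. x ^ k))"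
proof -
  interpret prob_space M by fact
  have meas [measurable]: "(\<lambda>x. x) \<in> borel_measurable M"
    using assms(2) measurable_ident_sets by auto
  have bound: "AE x in M. norm (((\<i> * t) ^ k /\<^sub>R fact k) * complex_of_real (x ^ k)) \<le> \<bar>t\<bar> ^ k /\<^sub>R fact k" for k
    using assms(3)
  proof eventually_elim
    case (elim x)
    have "x ^ k \<le> 1" using elim by (simp add: power_le_one)
    then show ?case using elim
      by (auto simp: norm_mult norm_power norm_divide field_simps intro: mult_left_le_one_le)
  qed
  have int: "integrable M (\<lambda>x. ((\<i> * t) ^ k /\<^sub>R fact k) * complex_of_real (x ^ k))" for k
    by (rule integrable_const_bound[OF bound]) measurable
  have sumt: "summable (\<lambda>k. \<bar>t\<bar> ^ k /\<^sub>R fact k)"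
    by (rule summable_exp_generic)
  have "char M t = (LINT x|M. (\<Sum>k. ((\<i> * t) ^ k /\<^sub>R fact k) * complex_of_real (x ^ k)))"
    unfolding char_def
  proof (intro Bochner_Integration.integral_cong refl)
    fix x :: real
    have "iexp (t * x) = (\<Sum>k. (\<i> * of_real (t * x)) ^ k /\<^sub>R fact k)"
      by (simp add: exp_def)
    also have "\<dots> = (\<Sum>k. ((\<i> * t) ^ k /\<^sub>R fact k) * complex_of_real (x ^ k))"
      by (intro suminf_cong) (simp add: power_mult_distrib)
    finally show "iexp (t * x) = \<dots>" .
  qed
  also have "\<dots> = (\<Sum>k. (LINT x|M. ((\<i> * t) ^ k /\<^sub>R fact k) * complex_of_real (x ^ k)))"
  proof (rule integral_suminf[OF int])
    show "AE x in M. summable (\<lambda>k. norm (((\<i> * t) ^ k /\<^sub>R fact k) * complex_of_real (x ^ k)))"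
      using bound[THEN AE_all_countable[THEN iffD2, OF allI]]
      by eventually_elim (rule summable_comparison_test'[OF sumt, of 0], auto)
    show "summable (\<lambda>k. LINT x|M. norm (((\<i> * t) ^ k /\<^sub>R fact k) * complex_of_real (x ^ k)))"
    proof (rule summable_comparison_test'[OF sumt, of 0])
      fix k
      have "(LINT x|M. norm (((\<i> * t) ^ k /\<^sub>R fact k) * complex_of_real (x ^ k))) \<le> (LINT x|M. \<bar>t\<bar> ^ k /\<^sub>R fact k)"
        by (intro integral_mono_AE integrable_norm int bound) auto
      then show "norm (LINT x|M. norm (((\<i> * t) ^ k /\<^sub>R fact k) * complex_of_real (x ^ k))) \<le> \<bar>t\<bar> ^ k /\<^sub>R fact k"
        by (simp add: prob_space)
    qed
  qed
  also have "\<dots> = (\<Sum>k. ((\<i> * t) ^ k /\<^sub>R fact k) * of_real (LINT x|M. x ^ k))"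
    by (subst integral_mult_right_zero) (simp only: integral_complex_of_real)
  finally show ?thesis .
qed

text \<open>Reduces uniqueness for finite measures to uniqueness for probability measures; the null measure has to be split off
because it cannot be normalised.\<close>

lemma finite_measure_eqI_normalized:
  fixes M N :: "'a measure"
  assumes "finite_measure M" "finite_measure N" "sets M = sets N" "measure M (space M) = measure N (space N)"
  assumes "measure M (space M) \<noteq> 0 \<Longrightarrow>
    density M (\<lambda>_. ennreal (1 / measure M (space M))) = density N (\<lambda>_. ennreal (1 / measure N (space N)))"
  shows "M = N"
proof -
  interpret M: finite_measure M by fact
  interpret N: finite_measure N by fact
  show ?thesis
  proof (cases "measure M (space M) = 0")
    case True
    show ?thesis
    proof (rule measure_eqI[OF assms(3)])
      fix A assume "A \<in> sets M"
      have "measure M A \<le> 0" "measure N A \<le> 0"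
        using M.bounded_measure[of A] N.bounded_measure[of A] True assms(4) by auto
      then show "emeasure M A = emeasure N A"
        by (simp add: M.emeasure_eq_measure N.emeasure_eq_measure measure_le_0_iff)
    qed
  next
    case False
    let ?m = "measure M (space M)"
    have pos: "?m > 0" using False by (simp add: zero_less_measure_iff)
    have "density (density M (\<lambda>_. ennreal (1 / ?m))) (\<lambda>_. ennreal ?m) = density (density N (\<lambda>_. ennreal (1 / ?m))) (\<lambda>_. ennreal ?m)"
      using assms(5)[OF False] assms(4) by simp
    then show ?thesis
      using pos by (simp add: density_density_eq ennreal_mult[symmetric] density_1)
  qed
qed

lemma finite_measure_eqI_moments:
  fixes M N :: "real measure"
  assumes fin: "finite_measure M" "finite_measure N" and sets: "sets M = sets borel" "sets N = sets borel"
    and AE: "AE x in M. 0 \<le> x \<and> x \<le> 1" "AE x in N. 0 \<le> x \<and> x \<le> 1"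
    and mom: "\<And>k::nat. (LINT x|M. x ^ k) = (LINT x|N. x ^ k)"
  shows "M = N"
proof (rule finite_measure_eqI_normalized[OF fin])
  interpret M: finite_measure M by fact
  interpret N: finite_measure N by fact
  note [measurable_cong] = sets
  show eq: "measure M (space M) = measure N (space N)"
    using mom[of 0] by simp
  assume nz: "measure M (space M) \<noteq> 0"
  let ?M = "density M (\<lambda>_. ennreal (1 / measure M (space M)))"
  let ?N = "density N (\<lambda>_. ennreal (1 / measure N (space N)))"
  have pos: "measure M (space M) > 0" using nz by (simp add: zero_less_measure_iff)
  have prob: "prob_space ?M" "prob_space ?N"
    using pos eq
    by (auto intro!: prob_spaceI simp: emeasure_density M.emeasure_eq_measure N.emeasure_eq_measure
         ennreal_mult[symmetric] nn_integral_cmult_indicator)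
  show "?M = ?N"
  proof (rule Levy_uniqueness)
    show "real_distribution ?M" "real_distribution ?N"
      using prob by (auto simp: real_distribution_def real_distribution_axioms_def sets sets_eq_imp_space_eq[OF sets(1)] sets_eq_imp_space_eq[OF sets(2)])
    have "char ?M t = char ?N t" for t
    proof -
      have "(LINT x|?M. x ^ k) = (LINT x|?N. x ^ k)" for k
        using mom[of k] eq by (simp add: integral_density)
      moreover have "AE x in ?M. 0 \<le> x \<and> x \<le> 1" "AE x in ?N. 0 \<le> x \<and> x \<le> 1"
        using AE by (auto simp: AE_density)
      ultimately show ?thesis
        using prob sets by (simp add: char_eq_suminf_moments)
    qed
    then show "char ?M = char ?N" by blast
  qed
qed (simp add: sets)

text \<open>The substitution \<open>y = exp (- x)\<close> maps the half line into \<open>[0, 1]\<close> and turns the Laplace transform at the natural number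
\<open>k\<close> into the \<open>k\<close>-th moment, so this is an instance of the moment problem on \<open>[0, 1]\<close>.\<close>

lemma finite_measure_eqI_laplace:
  fixes M N :: "real measure"
  assumes fin: "finite_measure M" "finite_measure N" and sets: "sets M = sets borel" "sets N = sets borel"
    and AE: "AE x in M. 0 \<le> x" "AE x in N. 0 \<le> x"
    and lap: "\<And>k::nat. (LINT x|M. exp (- real k * x)) = (LINT x|N. exp (- real k * x))"
  shows "M = N"
proof -
  interpret M: finite_measure M by fact
  interpret N: finite_measure N by fact
  note [measurable_cong] = sets
  have pow: "exp (- x) ^ k = exp (- real k * x)" for k and x :: real
    by (metis exp_of_nat_mult minus_mult_commute)
  have "distr M borel (\<lambda>x. exp (- x)) = distr N borel (\<lambda>x. exp (- x))"
  proof (rule finite_measure_eqI_moments)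
    show "finite_measure (distr M borel (\<lambda>x. exp (- x)))" by (rule M.finite_measure_distr) measurable
    show "finite_measure (distr N borel (\<lambda>x. exp (- x)))" by (rule N.finite_measure_distr) measurable
    show "AE x in distr M borel (\<lambda>x. exp (- x)). 0 \<le> x \<and> x \<le> 1"
      "AE x in distr N borel (\<lambda>x. exp (- x)). 0 \<le> x \<and> x \<le> 1"
      using AE by (auto simp: AE_distr_iff)
    fix k :: nat
    show "(LINT x|distr M borel (\<lambda>x. exp (- x)). x ^ k) = (LINT x|distr N borel (\<lambda>x. exp (- x)). x ^ k)"
      using lap[of k] by (simp add: integral_distr pow)
  qed auto
  then have "distr (distr M borel (\<lambda>x. exp (- x))) borel (\<lambda>y. - ln y) = distr (distr N borel (\<lambda>x. exp (- x))) borel (\<lambda>y. - ln y)"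
    by simp
  then show ?thesis
    by (simp add: distr_distr o_def distr_id2 sets)
qed

section \<open>The gamma law\<close>

lemma sets_gamma_law [simp, measurable_cong]: "sets (gamma_law c) = sets borel"
  by (simp add: gamma_law_def)

lemma space_gamma_law [simp]: "space (gamma_law c) = UNIV"
  by (simp add: gamma_law_def)

lemma nn_integral_gamma_kernel:
  fixes s b :: real
  assumes "s > 0" "b > 0"
  shows "(\<integral>\<^sup>+x. ennreal (if 0 < x then x powr (s - 1) * exp (- b * x) else 0) \<partial>lborel) = ennreal (Gamma s * b powr (- s))"
proof -
  let ?I = "\<integral>\<^sup>+x. ennreal (if 0 < x then x powr (s - 1) * exp (- b * x) else 0) \<partial>lborel"
  have "ennreal (Gamma s) = (\<integral>\<^sup>+t. ennreal (indicator {0..} t * t powr (s - 1) / exp t) \<partial>lborel)"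
    by (rule Gamma_conv_nn_integral_real) fact
  also have "\<dots> = ennreal b * (\<integral>\<^sup>+t. ennreal (indicator {0..} (b * t) * (b * t) powr (s - 1) / exp (b * t)) \<partial>lborel)"
    using assms by (subst nn_integral_real_affine[where c = b and t = 0]) auto
  also have "\<dots> = ennreal b * (\<integral>\<^sup>+t. ennreal (b powr (s - 1)) * ennreal (if 0 < t then t powr (s - 1) * exp (- b * t) else 0) \<partial>lborel)"
    using assms
    by (intro arg_cong2[where f = "(*)"] nn_integral_cong refl)
       (auto simp: ennreal_mult[symmetric] powr_mult exp_minus field_simps indicator_def zero_le_mult_iff mult_less_0_iff)
  also have "\<dots> = ennreal b * (ennreal (b powr (s - 1)) * ?I)"
    by (subst nn_integral_cmult) auto
  also have "\<dots> = ennreal (b powr s) * ?I"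
    using assms by (simp add: mult.assoc[symmetric] ennreal_mult[symmetric] powr_diff)
  finally have eq: "ennreal (b powr s) * ?I = ennreal (Gamma s)" by simp
  have "?I = ennreal (b powr - s) * (ennreal (b powr s) * ?I)"
    using assms by (simp add: mult.assoc[symmetric] ennreal_mult[symmetric] powr_add[symmetric])
  also have "\<dots> = ennreal (Gamma s * b powr (- s))"
    using assms by (simp add: eq ennreal_mult[symmetric] Gamma_real_pos less_imp_le mult.commute)
  finally show ?thesis .
qed

lemma nn_integral_gamma_law:
  assumes "c > 0" and [measurable]: "f \<in> borel_measurable borel"
  shows "(\<integral>\<^sup>+x. f x \<partial>gamma_law c) =
    (\<integral>\<^sup>+x. ennreal (if 0 < x then x powr (c - 1) * exp (- x) / Gamma c else 0) * f x \<partial>lborel)"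
  using assms by (simp add: gamma_law_def nn_integral_density)

text \<open>Exponential tilting of a gamma law by \<open>exp (- w * x)\<close> only changes its scale; all values \<open>w > - 1\<close> are covered since
cumulants require the moment generating function to the right of 0.\<close>

lemma nn_integral_gamma_law_powr_exp:
  assumes c: "c > 0" and k: "c + k > 0" and w: "w > -1"
  shows "(\<integral>\<^sup>+x. ennreal (x powr k * exp (- w * x)) \<partial>gamma_law c) =
    ennreal (Gamma (c + k) / Gamma c * (1 + w) powr (- (c + k)))"
proof -
  have "(\<integral>\<^sup>+x. ennreal (x powr k * exp (- w * x)) \<partial>gamma_law c) =
    (\<integral>\<^sup>+x. ennreal (1 / Gamma c) * ennreal (if 0 < x then x powr (c + k - 1) * exp (- (1 + w) * x) else 0) \<partial>lborel)"
    using c Gamma_real_pos[OF c]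
    by (subst nn_integral_gamma_law, simp, measurable, intro nn_integral_cong)
       (auto simp: ennreal_mult[symmetric] powr_add powr_diff field_simps exp_add exp_minus exp_diff)
  also have "\<dots> = ennreal (1 / Gamma c) * ennreal (Gamma (c + k) * (1 + w) powr (- (c + k)))"
    using nn_integral_gamma_kernel[OF k, of "1 + w"] w by (subst nn_integral_cmult) auto
  finally show ?thesis
    using Gamma_real_pos[OF c] Gamma_real_pos[OF k] by (simp add: ennreal_mult[symmetric])
qed

lemma AE_gamma_law_pos: "c > 0 \<Longrightarrow> AE x in gamma_law c. x > 0"
proof -
  assume "c > 0"
  then have eq: "gamma_law c = density lborel (\<lambda>x. ennreal (if 0 < x then x powr (c - 1) * exp (- x) / Gamma c else 0))"
    by (simp add: gamma_law_def)
  show ?thesis unfolding eq by (subst AE_density) auto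
qed

lemma AE_gamma_law_nonneg: "AE x in gamma_law c. x \<ge> 0"
proof (cases "c = 0")
  case True
  then have eq: "gamma_law c = return borel 0"
    by (simp add: gamma_law_def)
  show ?thesis unfolding eq by (subst AE_return) auto
next
  case False
  then have eq: "gamma_law c = density lborel (\<lambda>x. ennreal (if 0 < x then x powr (c - 1) * exp (- x) / Gamma c else 0))"
    by (simp add: gamma_law_def)
  show ?thesis unfolding eq by (subst AE_density) auto
qed

lemma prob_space_gamma_law: "c \<ge> 0 \<Longrightarrow> prob_space (gamma_law c)"
proof (cases "c = 0")
  case False
  assume "c \<ge> 0"
  with False have c: "c > 0" by simp
  have "(\<integral>\<^sup>+x. 1 \<partial>gamma_law c) = (\<integral>\<^sup>+x. ennreal (x powr 0 * exp (- 0 * x)) \<partial>gamma_law c)"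
    using AE_gamma_law_pos[OF c] by (intro nn_integral_cong_AE) auto
  also have "\<dots> = 1"
    using nn_integral_gamma_law_powr_exp[of c 0 0] c Gamma_real_pos[OF c] by simp
  finally show ?thesis by (intro prob_spaceI) simp
qed (auto simp: gamma_law_def intro: prob_space_return)

lemma has_bochner_integral_gamma_law:
  assumes c: "c > 0" and w: "w > -1"
  shows "has_bochner_integral (gamma_law c) (\<lambda>x. x ^ k * exp (- w * x)) (Gamma (c + real k) / Gamma c * (1 + w) powr (- (c + real k)))"
proof (rule has_bochner_integral_nn_integral)
  show "(\<integral>\<^sup>+x. ennreal (x ^ k * exp (- w * x)) \<partial>gamma_law c) = ennreal (Gamma (c + real k) / Gamma c * (1 + w) powr (- (c + real k)))"
  proof (subst nn_integral_gamma_law_powr_exp[OF c _ w, symmetric])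
    show "(\<integral>\<^sup>+x. ennreal (x ^ k * exp (- w * x)) \<partial>gamma_law c) = (\<integral>\<^sup>+x. ennreal (x powr real k * exp (- w * x)) \<partial>gamma_law c)"
      using AE_gamma_law_pos[OF c] by (intro nn_integral_cong_AE) (auto simp: powr_realpow)
  qed (use c in auto)
  show "AE x in gamma_law c. 0 \<le> x ^ k * exp (- w * x)"
    using AE_gamma_law_nonneg by eventually_elim auto
  have "Gamma c > 0" "Gamma (c + real k) > 0" using c by (auto intro!: Gamma_real_pos)
  then show "0 \<le> Gamma (c + real k) / Gamma c * (1 + w) powr (- (c + real k))" by simp
qed simp

lemma has_bochner_integral_gamma_law_exp:
  assumes c: "c \<ge> 0" and w: "w > -1"
  shows "has_bochner_integral (gamma_law c) (\<lambda>x. exp (- w * x)) ((1 + w) powr (- c))"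
proof (cases "c = 0")
  case True
  have "has_bochner_integral (return borel 0) (\<lambda>x. exp (- w * x)) 1"
    by (rule has_bochner_integral_nn_integral) (auto simp: nn_integral_return)
  then show ?thesis using True w by (simp add: gamma_law_def)
next
  case False
  with c have c: "c > 0" by simp
  then show ?thesis
    using has_bochner_integral_gamma_law[OF c w, of 0] Gamma_real_pos[OF c] by simp
qed

lemma has_bochner_integral_gamma_law_power:
  assumes c: "c > 0"
  shows "has_bochner_integral (gamma_law c) (\<lambda>x. x ^ k) (Gamma (c + real k) / Gamma c)"
  using has_bochner_integral_gamma_law[OF c, of 0 k] by simp

section \<open>Gamma mixtures and the generalised Stieltjes transform\<close>

text \<open>Integrating out the gamma variable first turns \<open>exp (- w * t * x)\<close> into \<open>(1 + w * x) powr (- c)\<close>.\<close>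

lemma laplace_gamma_times:
  fixes M :: "real measure"
  assumes c: "c > 0" and fin: "finite_measure M" and sets: "sets M = sets borel" and AE: "AE x in M. 0 \<le> x" and w: "w \<ge> 0"
  shows "(LINT z|distr (gamma_law c \<Otimes>\<^sub>M M) borel (\<lambda>(t, x). t * x). exp (- w * z)) = (LINT x|M. (1 + w * x) powr (- c))"
proof -
  interpret M: finite_measure M by fact
  interpret g: prob_space "gamma_law c" using c by (intro prob_space_gamma_law) auto
  interpret gM: pair_sigma_finite "gamma_law c" M ..
  note [measurable_cong] = sets
  have AEp: "AE p in gamma_law c \<Otimes>\<^sub>M M. 0 \<le> fst p \<and> 0 \<le> snd p"
  proof (rule gM.AE_pair_measure)
    show "{p \<in> space (gamma_law c \<Otimes>\<^sub>M M). 0 \<le> fst p \<and> 0 \<le> snd p} \<in> sets (gamma_law c \<Otimes>\<^sub>M M)" by measurable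
    show "AE t in gamma_law c. AE x in M. 0 \<le> fst (t, x) \<and> 0 \<le> snd (t, x)"
      using AE_gamma_law_nonneg[of c] AE by auto
  qed
  interpret P: finite_measure "gamma_law c \<Otimes>\<^sub>M M"
    by (rule finite_measure_pair_measure) unfold_locales
  have int: "integrable (gamma_law c \<Otimes>\<^sub>M M) (\<lambda>(t, x). exp (- w * (t * x)))"
  proof (rule P.integrable_const_bound[of _ 1])
    show "AE p in gamma_law c \<Otimes>\<^sub>M M. norm (case p of (t, x) \<Rightarrow> exp (- w * (t * x))) \<le> 1"
      using AEp by eventually_elim (use w in \<open>auto simp: case_prod_beta\<close>)
  qed measurable
  have "(LINT z|distr (gamma_law c \<Otimes>\<^sub>M M) borel (\<lambda>(t, x). t * x). exp (- w * z)) =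
      (LINT p|(gamma_law c \<Otimes>\<^sub>M M). (\<lambda>(t, x). exp (- w * (t * x))) p)"
    by (subst integral_distr) (auto intro!: Bochner_Integration.integral_cong)
  also have "\<dots> = (LINT x|M. LINT t|gamma_law c. exp (- w * (t * x)))"
    using gM.integral_snd[OF int] by simp
  also have "\<dots> = (LINT x|M. (1 + w * x) powr (- c))"
  proof (rule integral_cong_AE)
    show "AE x in M. (LINT t|gamma_law c. exp (- w * (t * x))) = (1 + w * x) powr (- c)"
      using AE
    proof eventually_elim
      case (elim x)
      then have "w * x \<ge> 0" using w by simp
      then show ?case
        using has_bochner_integral_integral_eq[OF has_bochner_integral_gamma_law_exp[of c "w * x"]] c
        by (simp add: mult_ac)
    qed
  qed measurable
  finally show ?thesis .
qed

text \<open>The \<open>k\<close>-th moment of the product is the \<open>k\<close>-th moment of \<open>M\<close> times the nonzero \<open>k\<close>-th moment of the gamma law; the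
moments of \<open>M\<close> can thus be read off, and they determine it.\<close>

lemma gamma_times_cancel:
  fixes M N :: "real measure"
  assumes c: "c > 0" and fin: "finite_measure M" "finite_measure N" and sets: "sets M = sets borel" "sets N = sets borel"
    and AE: "AE x in M. 0 \<le> x \<and> x \<le> 1" "AE x in N. 0 \<le> x \<and> x \<le> 1"
    and eq: "distr (gamma_law c \<Otimes>\<^sub>M M) borel (\<lambda>(t, x). t * x) = distr (gamma_law c \<Otimes>\<^sub>M N) borel (\<lambda>(t, x). t * x)"
  shows "M = N"
proof (rule finite_measure_eqI_moments[OF fin sets AE])
  fix k :: nat
  interpret g: prob_space "gamma_law c" using c by (intro prob_space_gamma_law) auto
  have mom: "(LINT z|(distr (gamma_law c \<Otimes>\<^sub>M L) borel (\<lambda>(t, x). t * x)). z ^ k) = Gamma (c + real k) / Gamma c * (LINT x|L. x ^ k)"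
    if "finite_measure L" "sets L = sets borel" "AE x in L. 0 \<le> x \<and> x \<le> 1" for L :: "real measure"
  proof -
    interpret L: finite_measure L by fact
    interpret gL: pair_sigma_finite "gamma_law c" L ..
    note [measurable_cong] = that(2)
    have int1: "integrable L (\<lambda>x. x ^ k)"
      by (rule L.integrable_const_bound[of _ 1], use that(3) in eventually_elim) (auto simp: power_le_one)
    have int2: "integrable (gamma_law c) (\<lambda>x. x ^ k)"
      using has_bochner_integral_gamma_law_power[OF c, of k] by (rule integrable.intros)
    have int: "integrable (gamma_law c \<Otimes>\<^sub>M L) (\<lambda>p. fst p ^ k * snd p ^ k)"
    proof (rule gL.Fubini_integrable)
      show "integrable (gamma_law c) (\<lambda>t. LINT x|L. norm (fst (t, x) ^ k * snd (t, x) ^ k))"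
        using integrable_norm[OF int2] by (simp add: abs_mult)
    qed (use int1 in auto)
    have "(LINT z|distr (gamma_law c \<Otimes>\<^sub>M L) borel (\<lambda>(t, x). t * x). z ^ k) = (LINT p|(gamma_law c \<Otimes>\<^sub>M L). (\<lambda>(t, x). t ^ k * x ^ k) p)"
      by (subst integral_distr) (auto intro!: Bochner_Integration.integral_cong simp: power_mult_distrib)
    also have "\<dots> = (LINT t|gamma_law c. LINT x|L. t ^ k * x ^ k)"
      using gL.integral_fst'[OF int] by (simp add: case_prod_beta)
    also have "\<dots> = (LINT t|gamma_law c. t ^ k) * (LINT x|L. x ^ k)" by simp
    also have "(LINT t|gamma_law c. t ^ k) = Gamma (c + real k) / Gamma c"
      by (rule has_bochner_integral_integral_eq[OF has_bochner_integral_gamma_law_power[OF c]])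
    finally show ?thesis .
  qed
  have "Gamma (c + real k) / Gamma c > 0" using c by (auto intro!: divide_pos_pos Gamma_real_pos)
  then show "(LINT x|M. x ^ k) = (LINT x|N. x ^ k)"
    using mom[OF fin(1) sets(1) AE(1)] mom[OF fin(2) sets(2) AE(2)] eq by auto
qed

text \<open>The transform is the Laplace transform of the product with an independent gamma variable, which can be cancelled.\<close>

lemma finite_measure_eqI_stieltjes:
  fixes M N :: "real measure"
  assumes c: "c > 0" and fin: "finite_measure M" "finite_measure N" and sets: "sets M = sets borel" "sets N = sets borel"
    and AE: "AE x in M. 0 \<le> x \<and> x \<le> 1" "AE x in N. 0 \<le> x \<and> x \<le> 1"
    and eq: "\<And>w. w \<ge> 0 \<Longrightarrow> (LINT x|M. (1 + w * x) powr (- c)) = (LINT x|N. (1 + w * x) powr (- c))"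
  shows "M = N"
proof (rule gamma_times_cancel[OF c fin sets AE])
  interpret g: prob_space "gamma_law c" using c by (intro prob_space_gamma_law) auto
  interpret M: finite_measure M by fact
  interpret N: finite_measure N by fact
  note [measurable_cong] = sets
  interpret gM: pair_sigma_finite "gamma_law c" M ..
  interpret gN: pair_sigma_finite "gamma_law c" N ..
  interpret P: finite_measure "gamma_law c \<Otimes>\<^sub>M M"
    by (rule finite_measure_pair_measure) unfold_locales
  interpret Q: finite_measure "gamma_law c \<Otimes>\<^sub>M N"
    by (rule finite_measure_pair_measure) unfold_locales
  have AEx: "AE x in M. 0 \<le> x" "AE x in N. 0 \<le> x" using AE by auto
  show "distr (gamma_law c \<Otimes>\<^sub>M M) borel (\<lambda>(t, x). t * x) = distr (gamma_law c \<Otimes>\<^sub>M N) borel (\<lambda>(t, x). t * x)"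
  proof (rule finite_measure_eqI_laplace)
    show "finite_measure (distr (gamma_law c \<Otimes>\<^sub>M M) borel (\<lambda>(t, x). t * x))"
      by (rule P.finite_measure_distr) measurable
    show "finite_measure (distr (gamma_law c \<Otimes>\<^sub>M N) borel (\<lambda>(t, x). t * x))"
      by (rule Q.finite_measure_distr) measurable
    show "AE x in distr (gamma_law c \<Otimes>\<^sub>M M) borel (\<lambda>(t, x). t * x). 0 \<le> x"
    proof (subst AE_distr_iff)
      show "AE p in gamma_law c \<Otimes>\<^sub>M M. 0 \<le> (case p of (t, x) \<Rightarrow> t * x)"
      proof (rule gM.AE_pair_measure)
        show "AE t in gamma_law c. AE x in M. 0 \<le> (case (t, x) of (t, x) \<Rightarrow> t * x)"
          using AE_gamma_law_nonneg[of c]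
        proof eventually_elim
          case (elim t) then show ?case using AEx(1) by auto
        qed
      qed measurable
    qed auto
    show "AE x in distr (gamma_law c \<Otimes>\<^sub>M N) borel (\<lambda>(t, x). t * x). 0 \<le> x"
    proof (subst AE_distr_iff)
      show "AE p in gamma_law c \<Otimes>\<^sub>M N. 0 \<le> (case p of (t, x) \<Rightarrow> t * x)"
      proof (rule gN.AE_pair_measure)
        show "AE t in gamma_law c. AE x in N. 0 \<le> (case (t, x) of (t, x) \<Rightarrow> t * x)"
          using AE_gamma_law_nonneg[of c]
        proof eventually_elim
          case (elim t) then show ?case using AEx(2) by auto
        qed
      qed measurable
    qed auto
  next
    fix k :: nat
    show "(LINT x|distr (gamma_law c \<Otimes>\<^sub>M M) borel (\<lambda>(t, x). t * x). exp (- real k * x)) =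
        (LINT x|distr (gamma_law c \<Otimes>\<^sub>M N) borel (\<lambda>(t, x). t * x). exp (- real k * x))"
      by (subst (1 2) laplace_gamma_times) (use c fin sets AEx eq[of "real k"] in auto)
  qed auto
qed

section \<open>Integrals against gamma random measures\<close>

text \<open>A step function on disjoint cells is a single one of its coefficients at each point, and the choice of the cell does
not depend on the coefficients. Hence functions such as \<open>ln (1 + \<cdot>)\<close> act on the coefficients.\<close>

lemma sum_indicator_disjoint_cases:
  fixes x :: "nat \<Rightarrow> real"
  assumes "disjoint_family_on A {..<k}"
  shows "(\<Sum>i<k. x i * indicator (A i) u) = 0 \<and> (\<forall>i<k. u \<notin> A i) \<or>
    (\<exists>i<k. u \<in> A i \<and> (\<forall>y. (\<Sum>i<k. y i * indicator (A i) u) = (y i :: real)))"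
proof (cases "\<exists>i<k. u \<in> A i")
  case True
  then obtain i where i: "i < k" "u \<in> A i" by blast
  have "(\<Sum>j<k. y j * indicator (A j) u) = y i" for y :: "nat \<Rightarrow> real"
  proof -
    have "(\<Sum>j<k. y j * indicator (A j) u) = (\<Sum>j<k. if j = i then y i else 0)"
    proof (intro sum.cong refl)
      fix j assume "j \<in> {..<k}"
      then show "y j * indicator (A j) u = (if j = i then y i else 0)"
        using assms i by (auto simp: disjoint_family_on_def indicator_def)
    qed
    also have "\<dots> = y i" using i by simp
    finally show ?thesis .
  qed
  with i show ?thesis by blast
qed auto

text \<open>The Laplace functional of a random measure that is gamma distributed on cells. The step functions \<open>fs n\<close> converge
pointwise to \<open>f\<close>, and for them independence gives the formula. To exchange limit and expectation a dominating function
is needed. If the coefficients are nonnegative, the constant 1 dominates; if \<open>f \<le> fs n\<close>, the limit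
\<open>exp (- \<integral> f)\<close> itself does, and Fatou's lemma shows that it is integrable. The second alternative serves
negative \<open>f\<close>, for which \<open>exp (- \<integral> f)\<close> is unbounded.\<close>

lemma laplace_gamma_integral:
  fixes M :: "'a measure" and \<Gamma> :: "'a \<Rightarrow> real measure" and \<mu> :: "real measure"
    and A :: "nat \<Rightarrow> nat \<Rightarrow> real set" and x :: "nat \<Rightarrow> nat \<Rightarrow> real" and k :: "nat \<Rightarrow> nat"
  defines "fs \<equiv> (\<lambda>n u. \<Sum>i<k n. x n i * indicator (A n i) u)"
  assumes "prob_space M"
    and fin: "\<And>w. w \<in> space M \<Longrightarrow> finite_measure (\<Gamma> w)" "\<And>w. w \<in> space M \<Longrightarrow> sets (\<Gamma> w) = sets borel"
    and mu: "finite_measure \<mu>" "sets \<mu> = sets borel"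
    and A: "\<And>n i. i < k n \<Longrightarrow> A n i \<in> sets borel"
    and disj: "\<And>n. disjoint_family_on (A n) {..<k n}"
    and indep: "\<And>n. prob_space.indep_vars M (\<lambda>_. borel) (\<lambda>i w. measure (\<Gamma> w) (A n i)) {..<k n}"
    and law: "\<And>n i. i < k n \<Longrightarrow> distr M borel (\<lambda>w. measure (\<Gamma> w) (A n i)) = gamma_law (measure \<mu> (A n i))"
    and x: "\<And>n i. i < k n \<Longrightarrow> \<beta> \<le> x n i" "\<And>n i. i < k n \<Longrightarrow> x n i \<le> B" "-1 < \<beta>" "\<beta> \<le> 0" "0 \<le> B"
    and lim: "\<And>u. (\<lambda>n. fs n u) \<longlonglongrightarrow> f u"
    and dom: "(\<forall>n. \<forall>i<k n. 0 \<le> x n i) \<or> (\<forall>n u. f u \<le> fs n u)"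
  shows "(\<lambda>w. LINT u|\<Gamma> w. f u) \<in> borel_measurable M \<and>
    has_bochner_integral M (\<lambda>w. exp (- (LINT u|\<Gamma> w. f u))) (exp (- (LINT u|\<mu>. ln (1 + f u))))"
proof -
  interpret prob_space M by fact
  interpret mu: finite_measure \<mu> by fact
  note [measurable_cong] = mu(2)
  note [measurable] = A
  have rv: "random_variable borel (\<lambda>w. measure (\<Gamma> w) (A n i))" if "i < k n" for n i
    using indep[of n] that by (auto simp: indep_vars_def)
  have fs_meas [measurable]: "fs n \<in> borel_measurable borel" for n
    unfolding fs_def by (intro borel_measurable_sum borel_measurable_times borel_measurable_const borel_measurable_indicator A) auto
  have f_meas [measurable]: "f \<in> borel_measurable borel"
    by (rule borel_measurable_LIMSEQ_real[OF lim fs_meas])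
  have fs_cases: "(fs n u = 0 \<and> (\<forall>i<k n. u \<notin> A n i)) \<or> (\<exists>i<k n. u \<in> A n i \<and> (\<forall>y. (\<Sum>i<k n. y i * indicator (A n i) u) = (y i :: real)))" for n u
    unfolding fs_def by (rule sum_indicator_disjoint_cases[OF disj])
  have fs_cases': "fs n u = 0 \<or> (\<exists>i<k n. fs n u = x n i)" for n u
    using fs_cases[of n u] by (auto simp: fs_def)
  have fs_bd: "\<beta> \<le> fs n u" "fs n u \<le> B" for n u
    using fs_cases'[of n u] x by auto
  have f_bd: "\<beta> \<le> f u" "f u \<le> B" for u
    using LIMSEQ_le_const[OF lim[of u]] LIMSEQ_le_const2[OF lim[of u]] fs_bd by blast+
  define K where "K = max \<bar>\<beta>\<bar> B"
  have fs_K: "\<bar>fs n u\<bar> \<le> K" and f_K: "\<bar>f u\<bar> \<le> K" for n u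
    using fs_bd[of n u] f_bd[of u] by (auto simp: K_def)
  define Z where "Z = (\<lambda>w. LINT u|\<Gamma> w. f u)"
  define Zs where "Zs = (\<lambda>n w. \<Sum>i<k n. x n i * measure (\<Gamma> w) (A n i))"
  have Zs_meas [measurable]: "Zs n \<in> borel_measurable M" for n
    unfolding Zs_def by (intro borel_measurable_sum borel_measurable_times borel_measurable_const rv) auto
  have int_fs: "(LINT u|N. fs n u) = (\<Sum>i<k n. x n i * measure N (A n i))"
    if "finite_measure N" "sets N = sets borel" for N n
  proof -
    interpret N: finite_measure N by fact
    have sp: "space N = UNIV" using sets_eq_imp_space_eq[OF that(2)] by simp
    show ?thesis unfolding fs_def
      by (subst Bochner_Integration.integral_sum)
         (auto simp: that(2) A N.emeasure_finite less_top[symmetric] sp intro!: integrable_mult_right integrable_real_indicator)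
  qed
  have Zs_lim: "(\<lambda>n. Zs n w) \<longlonglongrightarrow> Z w" if w: "w \<in> space M" for w
  proof -
    interpret G: finite_measure "\<Gamma> w" using fin w by auto
    have "(\<lambda>n. LINT u|\<Gamma> w. fs n u) \<longlonglongrightarrow> (LINT u|\<Gamma> w. f u)"
    proof (rule integral_dominated_convergence[where w = "\<lambda>_. K"])
      show "f \<in> borel_measurable (\<Gamma> w)" "\<And>n. fs n \<in> borel_measurable (\<Gamma> w)"
        using f_meas fs_meas by (simp_all only: measurable_cong_sets[OF fin(2)[OF w] refl])
      show "integrable (\<Gamma> w) (\<lambda>_. K)" by (rule G.integrable_const)
      show "AE u in \<Gamma> w. (\<lambda>n. fs n u) \<longlonglongrightarrow> f u" by (intro AE_I2 lim)
      show "AE u in \<Gamma> w. norm (fs n u) \<le> K" for n by (intro AE_I2) (simp only: real_norm_def fs_K)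
    qed
    then show ?thesis
      using int_fs[OF fin[OF w]] by (simp add: Zs_def Z_def)
  qed
  have Z_meas: "(\<lambda>w. LINT u|\<Gamma> w. f u) \<in> borel_measurable M"
    unfolding Z_def[symmetric]
    by (rule borel_measurable_LIMSEQ_metric[of Zs, OF Zs_meas Zs_lim])
  then have [measurable]: "Z \<in> borel_measurable M" by (simp add: Z_def)
  have ln_fs: "ln (1 + fs n u) = (\<Sum>i<k n. ln (1 + x n i) * indicator (A n i) u)" for n u
  proof (cases "\<exists>i<k n. u \<in> A n i")
    case True
    then show ?thesis using fs_cases[of n u] by (auto simp: fs_def)
  next
    case False
    then have "(\<Sum>i<k n. y i * indicator (A n i) u) = 0" for y :: "nat \<Rightarrow> real"
      by (intro sum.neutral) auto
    then show ?thesis by (simp add: fs_def)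
  qed
  have int_ln: "(LINT u|\<mu>. ln (1 + fs n u)) = (\<Sum>i<k n. ln (1 + x n i) * measure \<mu> (A n i))" for n
  proof -
    have sp: "space \<mu> = UNIV" using sets_eq_imp_space_eq[OF mu(2)] by simp
    show ?thesis unfolding ln_fs
      by (subst Bochner_Integration.integral_sum)
         (auto simp: mu(2) A mu.emeasure_finite less_top[symmetric] sp intro!: integrable_mult_right integrable_real_indicator)
  qed
  have expZs: "has_bochner_integral M (\<lambda>w. exp (- Zs n w)) (exp (- (LINT u|\<mu>. ln (1 + fs n u))))" for n
  proof -
    let ?X = "\<lambda>i w. exp (- x n i * measure (\<Gamma> w) (A n i))"
    have eqX: "exp (- Zs n w) = (\<Prod>i<k n. ?X i w)" for w
      by (simp add: Zs_def exp_sum sum_negf[symmetric])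
    have ind: "indep_vars (\<lambda>_. borel) ?X {..<k n}"
      by (rule indep_vars_compose2[OF indep[of n]]) measurable
    have hX: "has_bochner_integral M (?X i) ((1 + x n i) powr (- measure \<mu> (A n i)))" if "i < k n" for i
    proof -
      have "has_bochner_integral (distr M borel (\<lambda>w. measure (\<Gamma> w) (A n i))) (\<lambda>y. exp (- x n i * y)) ((1 + x n i) powr (- measure \<mu> (A n i)))"
        unfolding law[OF that] using x that by (intro has_bochner_integral_gamma_law_exp) (auto intro: less_le_trans)
      then show ?thesis
        using rv[OF that] by (simp add: has_bochner_integral_iff integrable_distr_eq integral_distr)
    qed
    have I: "integrable M (?X i)" if "i \<in> {..<k n}" for i
      using hX that by (auto intro: integrable.intros)
    have "(LINT w|M. exp (- Zs n w)) = (\<Prod>i<k n. LINT w|M. ?X i w)"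
      unfolding eqX by (rule indep_vars_lebesgue_integral[OF finite_lessThan ind I])
    also have "\<dots> = (\<Prod>i<k n. exp (- (ln (1 + x n i) * measure \<mu> (A n i))))"
    proof (intro prod.cong refl)
      fix i assume "i \<in> {..<k n}"
      then have i: "i < k n" by simp
      have "1 + x n i > 0" using x(1)[OF i] x(3) by simp
      then show "(LINT w|M. ?X i w) = exp (- (ln (1 + x n i) * measure \<mu> (A n i)))"
        using has_bochner_integral_integral_eq[OF hX[OF i]] by (simp add: powr_def mult.commute)
    qed
    also have "\<dots> = exp (- (LINT u|\<mu>. ln (1 + fs n u)))"
      by (simp add: int_ln exp_sum sum_negf[symmetric])
    finally have "(LINT w|M. exp (- Zs n w)) = exp (- (LINT u|\<mu>. ln (1 + fs n u)))" .
    moreover have "integrable M (\<lambda>w. exp (- Zs n w))"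
      unfolding eqX by (rule indep_vars_integrable[OF finite_lessThan ind I])
    ultimately show ?thesis by (simp add: has_bochner_integral_iff)
  qed
  have lnK: "\<bar>ln (1 + y)\<bar> \<le> max \<bar>ln (1 + \<beta>)\<bar> \<bar>ln (1 + B)\<bar>" if "\<beta> \<le> y" "y \<le> B" for y
  proof -
    have "ln (1 + \<beta>) \<le> ln (1 + y)" "ln (1 + y) \<le> ln (1 + B)" using that x by auto
    then show ?thesis by linarith
  qed
  have lim_int: "(\<lambda>n. LINT u|\<mu>. ln (1 + fs n u)) \<longlonglongrightarrow> (LINT u|\<mu>. ln (1 + f u))"
  proof (rule integral_dominated_convergence[where w = "\<lambda>_. max \<bar>ln (1 + \<beta>)\<bar> \<bar>ln (1 + B)\<bar>"])
    show "AE u in \<mu>. (\<lambda>n. ln (1 + fs n u)) \<longlonglongrightarrow> ln (1 + f u)"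
    proof (rule AE_I2)
      fix u
      have "1 + f u \<noteq> 0" using f_bd(1)[of u] x by linarith
      then show "(\<lambda>n. ln (1 + fs n u)) \<longlonglongrightarrow> ln (1 + f u)" by (intro tendsto_intros lim) 
    qed
    show "AE u in \<mu>. norm (ln (1 + fs n u)) \<le> max \<bar>ln (1 + \<beta>)\<bar> \<bar>ln (1 + B)\<bar>" for n
      using lnK fs_bd by auto
  qed auto
  define L where "L = exp (- (LINT u|\<mu>. ln (1 + f u)))"
  have lim_exp: "(\<lambda>n. exp (- (LINT u|\<mu>. ln (1 + fs n u)))) \<longlonglongrightarrow> L"
    unfolding L_def by (intro tendsto_intros lim_int)
  have expZs_lim: "(\<lambda>n. exp (- Zs n w)) \<longlonglongrightarrow> exp (- Z w)" if "w \<in> space M" for w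
    by (intro tendsto_intros Zs_lim that)
  \<comment> \<open>Fatou's lemma: the limit is integrable in either case.\<close>
  have "(\<integral>\<^sup>+w. ennreal (exp (- Z w)) \<partial>M) = (\<integral>\<^sup>+w. liminf (\<lambda>n. ennreal (exp (- Zs n w))) \<partial>M)"
    by (intro nn_integral_cong sym[OF lim_imp_Liminf[OF trivial_limit_sequentially tendsto_ennrealI[OF expZs_lim]]])
  also have "\<dots> \<le> liminf (\<lambda>n. \<integral>\<^sup>+w. ennreal (exp (- Zs n w)) \<partial>M)"
    by (rule nn_integral_liminf) measurable
  also have "(\<lambda>n. \<integral>\<^sup>+w. ennreal (exp (- Zs n w)) \<partial>M) = (\<lambda>n. ennreal (exp (- (LINT u|\<mu>. ln (1 + fs n u)))))"
    using expZs by (auto simp: has_bochner_integral_iff nn_integral_eq_integral)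
  also have "liminf \<dots> = ennreal L"
    by (rule lim_imp_Liminf[OF trivial_limit_sequentially tendsto_ennrealI[OF lim_exp]])
  finally have le_L: "(\<integral>\<^sup>+w. ennreal (exp (- Z w)) \<partial>M) \<le> ennreal L" .
  have fin_int: "(\<integral>\<^sup>+w. ennreal (exp (- Z w)) \<partial>M) < \<infinity>"
    using order_le_less_trans[OF le_L ennreal_less_top] by simp
  have intZ: "integrable M (\<lambda>w. exp (- Z w))"
    using fin_int by (intro integrableI_nonneg) auto
  have dom': "exp (- Zs n w) \<le> 1 + exp (- Z w)" if w: "w \<in> space M" for n w
    using dom
  proof
    assume "\<forall>n. \<forall>i<k n. 0 \<le> x n i"
    then have "Zs n w \<ge> 0" unfolding Zs_def by (intro sum_nonneg mult_nonneg_nonneg) auto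
    then have "exp (- Zs n w) \<le> 1" by simp
    also have "1 \<le> 1 + exp (- Z w)" by simp
    finally show ?thesis .
  next
    assume *: "\<forall>n u. f u \<le> fs n u"
    interpret G: finite_measure "\<Gamma> w" using fin w by auto
    have "(LINT u|\<Gamma> w. f u) \<le> (LINT u|\<Gamma> w. fs n u)"
    proof (rule integral_mono)
      have m: "f \<in> borel_measurable (\<Gamma> w)" "fs n \<in> borel_measurable (\<Gamma> w)"
        using f_meas fs_meas by (simp_all only: measurable_cong_sets[OF fin(2)[OF w] refl])
      have b: "AE u in \<Gamma> w. norm (f u) \<le> K" "AE u in \<Gamma> w. norm (fs n u) \<le> K"
        unfolding real_norm_def by (intro AE_I2 f_K fs_K)+
      show "integrable (\<Gamma> w) f" by (rule G.integrable_const_bound[OF b(1) m(1)])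
      show "integrable (\<Gamma> w) (fs n)" by (rule G.integrable_const_bound[OF b(2) m(2)])
      show "f u \<le> fs n u" for u using * by blast
    qed
    then have "Z w \<le> Zs n w"
      using int_fs[OF fin[OF w]] by (simp add: Zs_def Z_def)
    then have "exp (- Zs n w) \<le> exp (- Z w)" by simp
    also have "\<dots> \<le> 1 + exp (- Z w)" by simp
    finally show ?thesis .
  qed
  have "(\<lambda>n. LINT w|M. exp (- Zs n w)) \<longlonglongrightarrow> (LINT w|M. exp (- Z w))"
  proof (rule integral_dominated_convergence[where w = "\<lambda>w. 1 + exp (- Z w)"])
    show "integrable M (\<lambda>w. 1 + exp (- Z w))" using intZ by auto
    show "AE w in M. (\<lambda>n. exp (- Zs n w)) \<longlonglongrightarrow> exp (- Z w)"
      by (intro AE_I2 expZs_lim)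
    show "AE w in M. norm (exp (- Zs n w)) \<le> 1 + exp (- Z w)" for n
      by (intro AE_I2) (simp add: dom')
  qed measurable
  moreover have "(\<lambda>n. LINT w|M. exp (- Zs n w)) = (\<lambda>n. exp (- (LINT u|\<mu>. ln (1 + fs n u))))"
    using expZs by (auto simp: has_bochner_integral_iff)
  ultimately have "(LINT w|M. exp (- Z w)) = L"
    using LIMSEQ_unique lim_exp by metis
  with intZ have "has_bochner_integral M (\<lambda>w. exp (- (LINT u|\<Gamma> w. f u))) (exp (- (LINT u|\<mu>. ln (1 + f u))))"
    by (simp add: has_bochner_integral_iff L_def Z_def)
  with Z_meas show ?thesis by blast
qed

section \<open>Integrals against the gamma process\<close>

text \<open>The left-open cells fit the half-open intervals on which an increasing right-continuous path puts its increments.\<close>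

lemma interval_cells_cover:
  fixes r u :: real
  assumes "0 < r" "0 < u" "u \<le> r"
  obtains i where "i < Suc n" "r * real i / real (Suc n) < u" "u \<le> r * real (Suc i) / real (Suc n)"
proof -
  define y where "y = u * real (Suc n) / r"
  have "u * real (Suc n) \<le> r * real (Suc n)" using assms by (intro mult_right_mono) auto
  then have y: "0 < y" "y \<le> real (Suc n)"
    using assms by (simp_all add: y_def pos_divide_le_eq mult.commute del: of_nat_Suc)
  define i where "i = nat \<lceil>y\<rceil> - 1"
  have c: "1 \<le> \<lceil>y\<rceil>" "\<lceil>y\<rceil> \<le> int (Suc n)" using y by linarith+
  then have "int i = \<lceil>y\<rceil> - 1" unfolding i_def by linarith
  then have i: "real i = of_int \<lceil>y\<rceil> - 1" by (metis of_int_1 of_int_diff of_int_of_nat_eq)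
  have "i < Suc n" using c by (auto simp: i_def)
  moreover have "real i < y" "y \<le> real i + 1" unfolding i by linarith+
  then have "r * real i / real (Suc n) < u" "u \<le> r * real (Suc i) / real (Suc n)"
    using assms by (auto simp: y_def field_simps)
  ultimately show ?thesis using that by blast
qed

lemma disjoint_interval_cells:
  fixes r :: real
  assumes "0 < r"
  shows "disjoint_family_on (\<lambda>i. {r * real i / real (Suc n)<..r * real (Suc i) / real (Suc n)}) {..<k}"
proof -
  have *: "{r * real i / real (Suc n)<..r * real (Suc i) / real (Suc n)} \<inter> {r * real j / real (Suc n)<..r * real (Suc j) / real (Suc n)} = {}" if "i < j" for i j
  proof -
    have "real (Suc i) \<le> real j" using that by linarith
    then have "r * real (Suc i) / real (Suc n) \<le> r * real j / real (Suc n)"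
      using assms by (intro divide_right_mono mult_left_mono) auto
    then show ?thesis by auto
  qed
  have "{r * real i / real (Suc n)<..r * real (Suc i) / real (Suc n)} \<inter> {r * real j / real (Suc n)<..r * real (Suc j) / real (Suc n)} = {}" if "i \<noteq> j" for i j
  proof (cases "i < j")
    case True
    then show ?thesis by (rule *)
  next
    case False
    with that have "j < i" by simp
    then show ?thesis using *[of j i] by blast
  qed
  then show ?thesis unfolding disjoint_family_on_def by blast
qed

lemma left_endpoint_sums_tendsto:
  fixes r u :: real and f :: "real \<Rightarrow> real"
  assumes r: "0 < r" and f: "continuous_on {0..r} f" and u: "0 < u" "u \<le> r"
  shows "(\<lambda>n. \<Sum>i<Suc n. f (r * real i / real (Suc n)) * indicator {r * real i / real (Suc n)<..r * real (Suc i) / real (Suc n)} u) \<longlonglongrightarrow> f u"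
proof -
  have "\<exists>i. i < Suc n \<and> r * real i / real (Suc n) < u \<and> u \<le> r * real (Suc i) / real (Suc n)" for n
    using interval_cells_cover[OF r u] by metis
  then obtain i where i: "\<And>n. i n < Suc n" "\<And>n. r * real (i n) / real (Suc n) < u" "\<And>n. u \<le> r * real (Suc (i n)) / real (Suc n)"
    by metis
  define p where "p = (\<lambda>n. r * real (i n) / real (Suc n))"
  have eq: "(\<Sum>j<Suc n. f (r * real j / real (Suc n)) * indicator {r * real j / real (Suc n)<..r * real (Suc j) / real (Suc n)} u) = f (p n)" for n
  proof -
    have "(\<Sum>j<Suc n. f (r * real j / real (Suc n)) * indicator {r * real j / real (Suc n)<..r * real (Suc j) / real (Suc n)} u) = (\<Sum>j<Suc n. if j = i n then f (p n) else 0)"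
    proof (intro sum.cong refl)
      fix j assume "j \<in> {..<Suc n}"
      show "f (r * real j / real (Suc n)) * indicator {r * real j / real (Suc n)<..r * real (Suc j) / real (Suc n)} u = (if j = i n then f (p n) else 0)"
      proof (cases "j = i n")
        case False
        have "u \<in> {r * real (i n) / real (Suc n)<..r * real (Suc (i n)) / real (Suc n)}" using i by auto
        then have "u \<notin> {r * real j / real (Suc n)<..r * real (Suc j) / real (Suc n)}"
          using disjoint_family_onD[OF disjoint_interval_cells[OF r, of n "Suc (max j (i n))"], of j "i n"] False
          by (simp only: lessThan_iff less_Suc_eq_le max.cobounded1 max.cobounded2) blast
        then have "indicator {r * real j / real (Suc n)<..r * real (Suc j) / real (Suc n)} u = (0::real)"
          by (rule indicator_simps(2))
        then show ?thesis using False by (simp only: mult_zero_right if_False)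
      qed (use i in \<open>auto simp: p_def\<close>)
    qed
    also have "\<dots> = f (p n)" using i(1)[of n] by simp
    finally show ?thesis .
  qed
  have close: "u - r / real (Suc n) \<le> p n" "p n \<le> u" "0 \<le> p n" for n
  proof -
    have "r * real (Suc (i n)) / real (Suc n) = p n + r / real (Suc n)"
      by (simp add: p_def add_divide_distrib[symmetric] algebra_simps)
    then show "u - r / real (Suc n) \<le> p n" using i(3)[of n] by linarith
    show "p n \<le> u" using i(2)[of n] by (simp add: p_def)
    show "0 \<le> p n" using r by (simp add: p_def)
  qed
  have "(\<lambda>n. u - r * inverse (real (Suc n))) \<longlonglongrightarrow> u - r * 0"
    by (intro tendsto_intros LIMSEQ_inverse_real_of_nat)
  then have l: "(\<lambda>n. u - r / real (Suc n)) \<longlonglongrightarrow> u" by (simp add: divide_inverse)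
  have "p \<longlonglongrightarrow> u"
    by (rule tendsto_sandwich[OF _ _ l tendsto_const]) (use close in auto)
  moreover have "p n \<in> {0..r}" for n using close[of n] u by auto
  ultimately have "(\<lambda>n. f (p n)) \<longlonglongrightarrow> f u"
    by (intro continuous_on_tendsto_compose[OF f]) (use u in auto)
  then show ?thesis by (simp only: eq)
qed

text \<open>Independence assumptions of the process hold for increments of paths, whereas the random measure is evaluated on cells; the
two families agree only on the space of the probability measure.\<close>

lemma (in prob_space) indep_vars_cong_space:
  assumes "indep_vars M' X I" "\<And>i w. i \<in> I \<Longrightarrow> w \<in> space M \<Longrightarrow> X i w = Y i w"
  shows "indep_vars M' Y I"
proof -
  have eq: "X i -` A \<inter> space M = Y i -` A \<inter> space M" if "i \<in> I" for i A
    using assms(2)[OF that] by auto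
  have "indep_sets (\<lambda>i. {X i -` A \<inter> space M |A. A \<in> sets (M' i)}) I"
    using assms(1) by (simp add: indep_vars_def2)
  also have "?this \<longleftrightarrow> indep_sets (\<lambda>i. {Y i -` A \<inter> space M |A. A \<in> sets (M' i)}) I"
    by (intro indep_sets_cong refl) (simp add: eq)
  finally have "indep_sets (\<lambda>i. {Y i -` A \<inter> space M |A. A \<in> sets (M' i)}) I" .
  moreover have "random_variable (M' i) (Y i)" if "i \<in> I" for i
    using assms that measurable_cong[of M "X i" "Y i" "M' i"] by (auto simp: indep_vars_def2)
  ultimately show ?thesis by (simp add: indep_vars_def2)
qed

lemma gamma_process_marginal:
  assumes G: "gamma_process M G \<theta>" and "0 < \<theta>" "0 \<le> t"
  shows "distr M borel (G t) = gamma_law (\<theta> * t)"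
proof -
  interpret prob_space M using G by (simp add: gamma_process_def subordinator_def)
  have [measurable]: "G t \<in> borel_measurable M"
    using G assms(3) by (simp add: gamma_process_def subordinator_def)
  have nn: "0 \<le> G t w" if "w \<in> space M" for w
    using G assms(3) that unfolding gamma_process_def subordinator_def by (metis order_refl)
  have c: "0 \<le> \<theta> * t" using assms by simp
  interpret g: prob_space "gamma_law (\<theta> * t)" by (rule prob_space_gamma_law[OF c])
  show ?thesis
  proof (rule finite_measure_eqI_laplace)
    show "finite_measure (distr M borel (G t))" by (rule finite_measure_distr) measurable
    show "finite_measure (gamma_law (\<theta> * t))" by unfold_locales
    show "AE x in distr M borel (G t). 0 \<le> x" by (subst AE_distr_iff) (auto intro!: AE_I2 nn)
    show "AE x in gamma_law (\<theta> * t). 0 \<le> x" by (rule AE_gamma_law_nonneg)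
    fix k :: nat
    have "(LINT x|distr M borel (G t). exp (- real k * x)) = (1 + real k) powr (- \<theta> * t)"
      using G assms(3) by (subst integral_distr) (auto simp: gamma_process_def)
    also have "\<dots> = (LINT x|gamma_law (\<theta> * t). exp (- real k * x))"
      using has_bochner_integral_integral_eq[OF has_bochner_integral_gamma_law_exp[OF c, of "real k"]] by simp
    finally show "(LINT x|distr M borel (G t). exp (- real k * x)) = (LINT x|gamma_law (\<theta> * t). exp (- real k * x))" .
  qed auto
qed

text \<open>Cell measures of the random measure \<open>dG\<close> are increments of the gamma process, hence independent gamma variables, and
the general formula applies with \<open>\<mu> = \<theta> ds\<close> on \<open>(0, r]\<close>. Evaluation at left end points dominates a decreasing
integrand, which meets the second alternative of \<open>laplace_gamma_integral\<close>.\<close>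

lemma laplace_gamma_process_integral:
  assumes G: "gamma_process M G \<theta>" and th: "0 < \<theta>" and r: "0 < r"
    and cont: "continuous_on {0..r} f" and f: "\<And>s. s \<in> {0..r} \<Longrightarrow> -1 < f s"
    and dom: "(\<forall>s\<in>{0..r}. 0 \<le> f s) \<or> (\<forall>s\<in>{0..r}. \<forall>t\<in>{0..r}. s \<le> t \<longrightarrow> f t \<le> f s)"
  defines "I \<equiv> (\<lambda>w. LINT s:{0<..r}|interval_measure (\<lambda>s. G (max 0 s) w). f s)"
  shows "I \<in> borel_measurable M"
    and "has_bochner_integral M (\<lambda>w. exp (- I w)) (exp (- \<theta> * (LBINT s:{0<..r}. ln (1 + f s))))"
proof -
  interpret prob_space M using G by (simp add: gamma_process_def subordinator_def)
  have sub: "\<And>t. 0 \<le> t \<Longrightarrow> G t \<in> borel_measurable M" "\<And>w. w \<in> space M \<Longrightarrow> G 0 w = 0"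
    "\<And>w s t. w \<in> space M \<Longrightarrow> 0 \<le> s \<Longrightarrow> s \<le> t \<Longrightarrow> G s w \<le> G t w"
    "\<And>w t. w \<in> space M \<Longrightarrow> 0 \<le> t \<Longrightarrow> continuous (at_right t) (\<lambda>s. G s w)"
    "\<And>(n::nat) t. 0 \<le> t 0 \<Longrightarrow> (\<forall>i<n. t i \<le> t (Suc i)) \<Longrightarrow>
       indep_vars (\<lambda>_. borel) (\<lambda>i w. G (t (Suc i)) w - G (t i) w) {..<n}"
    "\<And>s t. 0 \<le> s \<Longrightarrow> 0 \<le> t \<Longrightarrow> distr M borel (\<lambda>w. G (s + t) w - G s w) = distr M borel (G t)"
    using G unfolding gamma_process_def subordinator_def by auto
  define F where "F = (\<lambda>w s. G (max 0 s) w)"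
  have F_mono: "F w s \<le> F w t" if "w \<in> space M" "s \<le> t" for w s t
    unfolding F_def using that by (intro sub(3)) auto
  have F_rc: "continuous (at_right s) (F w)" if w: "w \<in> space M" for w s
  proof (cases "0 \<le> s")
    case True
    have "((\<lambda>t. G t w) \<longlongrightarrow> G s w) (at_right s)"
      using sub(4)[OF w True] by (simp add: continuous_within)
    moreover have "eventually (\<lambda>t. G t w = F w t) (at_right s)"
      using True by (auto simp: eventually_at_filter F_def intro!: always_eventually)
    ultimately show ?thesis
      using True by (simp add: continuous_within tendsto_cong F_def)
  next
    case False
    have "((\<lambda>t. G 0 w) \<longlongrightarrow> G 0 w) (at_right s)" by simp
    moreover have "eventually (\<lambda>t. t < 0) (at_right s)"
      using False by (intro eventually_at_rightI[of s 0]) auto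
    then have "eventually (\<lambda>t. G 0 w = F w t) (at_right s)"
      by eventually_elim (simp add: F_def)
    ultimately have "(F w \<longlongrightarrow> G 0 w) (at_right s)"
      by (rule Lim_transform_eventually)
    then show ?thesis
      using False by (simp add: continuous_within F_def max_absorb1)
  qed
  have F_em: "emeasure (interval_measure (F w)) {s<..t} = F w t - F w s" if "w \<in> space M" "s \<le> t" for w s t
    using that F_mono F_rc by (intro emeasure_interval_measure_Ioc) auto
  define \<Gamma> where "\<Gamma> = (\<lambda>w. density (interval_measure (F w)) (indicator {0<..r}))"
  define \<mu> where "\<mu> = density lborel (\<lambda>s. ennreal (\<theta> * indicator {0<..r} s))"
  define A where "A = (\<lambda>n i. {r * real i / real (Suc n)<..r * real (Suc i) / real (Suc n)})"
  define x where "x = (\<lambda>n i. f (r * real i / real (Suc n)))"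
  define f' where "f' = (\<lambda>u. if u \<in> {0<..r} then f u else 0)"
  define fs where "fs = (\<lambda>n u. \<Sum>i<Suc n. x n i * indicator (A n i) u)"
  have pt: "r * real i / real (Suc n) \<in> {0..r}" if "i \<le> Suc n" for i n
  proof -
    have "r * real i \<le> r * real (Suc n)" using that r by (intro mult_left_mono) auto
    then show ?thesis using r by (simp add: pos_divide_le_eq)
  qed
  have A_sub: "A n i \<subseteq> {0<..r}" if "i < Suc n" for n i
    using pt[of i n] pt[of "Suc i" n] that by (auto simp: A_def)
  have compact: "compact (f ` {0..r})"
    using cont by (intro compact_continuous_image) auto
  obtain s0 where s0: "s0 \<in> {0..r}" "\<And>s. s \<in> {0..r} \<Longrightarrow> f s0 \<le> f s"
    using continuous_attains_inf[of "{0..r}" f] cont r by (auto simp: compact_Icc)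
  obtain s1 where s1: "s1 \<in> {0..r}" "\<And>s. s \<in> {0..r} \<Longrightarrow> f s \<le> f s1"
    using continuous_attains_sup[of "{0..r}" f] cont r by (auto simp: compact_Icc)
  have fin_G: "finite_measure (\<Gamma> w)" "sets (\<Gamma> w) = sets borel" if "w \<in> space M" for w
    using F_em[OF that, of 0 r] r
    by (auto intro!: finite_measureI simp: \<Gamma>_def emeasure_density)
  have meas_A: "measure (\<Gamma> w) (A n i) = G (r * real (Suc i) / real (Suc n)) w - G (r * real i / real (Suc n)) w"
    if w: "w \<in> space M" and i: "i < Suc n" for w n i
  proof -
    have le: "r * real i / real (Suc n) \<le> r * real (Suc i) / real (Suc n)" using r by (simp add: field_simps)
    have "emeasure (\<Gamma> w) (A n i) = emeasure (interval_measure (F w)) (A n i)"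
    proof -
      have [measurable]: "A n i \<in> sets borel" by (simp add: A_def)
      have "emeasure (\<Gamma> w) (A n i) = (\<integral>\<^sup>+s. indicator {0<..r} s * indicator (A n i) s \<partial>interval_measure (F w))"
        unfolding \<Gamma>_def by (rule emeasure_density) measurable
      also have "\<dots> = (\<integral>\<^sup>+s. indicator (A n i) s \<partial>interval_measure (F w))"
        using A_sub[OF i] by (intro nn_integral_cong) (auto simp: indicator_def)
      finally have "emeasure (\<Gamma> w) (A n i) = (\<integral>\<^sup>+s. indicator (A n i) s \<partial>interval_measure (F w))" .
      then show ?thesis by (simp add: A_def)
    qed
    also have "\<dots> = ennreal (F w (r * real (Suc i) / real (Suc n)) - F w (r * real i / real (Suc n)))"
      unfolding A_def by (rule F_em[OF w le])
    finally show ?thesis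
      using F_mono[OF w le] pt[of i n] pt[of "Suc i" n] i by (simp add: measure_def F_def max_absorb2)
  qed
  have mu_A: "measure \<mu> (A n i) = \<theta> * (r / real (Suc n))" if i: "i < Suc n" for n i
  proof -
    have le: "r * real i / real (Suc n) \<le> r * real (Suc i) / real (Suc n)" using r by (simp add: field_simps)
    have [measurable]: "A n i \<in> sets borel" by (simp add: A_def)
    have "emeasure \<mu> (A n i) = (\<integral>\<^sup>+s. ennreal (\<theta> * indicator {0<..r} s) * indicator (A n i) s \<partial>lborel)"
      unfolding \<mu>_def by (rule emeasure_density) measurable
    also have "\<dots> = (\<integral>\<^sup>+s. ennreal \<theta> * indicator (A n i) s \<partial>lborel)"
      using A_sub[OF i] by (intro nn_integral_cong) (auto simp: indicator_def)
    also have "\<dots> = ennreal \<theta> * emeasure lborel (A n i)"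
      by (subst nn_integral_cmult_indicator) (auto simp: A_def)
    also have "\<dots> = ennreal (\<theta> * (r / real (Suc n)))"
      using le th r by (simp add: A_def ennreal_mult[symmetric] diff_divide_distrib[symmetric] algebra_simps)
    finally show ?thesis using th r by (simp add: measure_def)
  qed
  have res: "(\<lambda>w. LINT u|\<Gamma> w. f' u) \<in> borel_measurable M \<and>
      has_bochner_integral M (\<lambda>w. exp (- (LINT u|\<Gamma> w. f' u))) (exp (- (LINT u|\<mu>. ln (1 + f' u))))"
  proof (rule laplace_gamma_integral[where A = A and x = x and k = Suc and \<mu> = \<mu> and \<beta> = "min 0 (f s0)" and B = "max 0 (f s1)"])
    show "finite_measure \<mu>"
      using th r by (auto intro!: finite_measureI simp: \<mu>_def emeasure_density ennreal_mult nn_integral_cmult ennreal_indicator ennreal_mult_eq_top_iff)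
    show "indep_vars (\<lambda>_. borel) (\<lambda>i w. measure (\<Gamma> w) (A n i)) {..<Suc n}" for n
    proof (rule indep_vars_cong_space)
      show "indep_vars (\<lambda>_. borel) (\<lambda>i w. G (r * real (Suc i) / real (Suc n)) w - G (r * real i / real (Suc n)) w) {..<Suc n}"
        using sub(5)[of "\<lambda>i. r * real i / real (Suc n)" "Suc n"] r by (auto simp: field_simps)
    qed (simp add: meas_A)
    show "distr M borel (\<lambda>w. measure (\<Gamma> w) (A n i)) = gamma_law (measure \<mu> (A n i))" if i: "i < Suc n" for n i
    proof -
      have *: "r * real (Suc i) / real (Suc n) = r * real i / real (Suc n) + r / real (Suc n)"
        by (simp add: add_divide_distrib[symmetric] distrib_left add.commute)
      have "distr M borel (\<lambda>w. measure (\<Gamma> w) (A n i)) = distr M borel (\<lambda>w. G (r * real i / real (Suc n) + r / real (Suc n)) w - G (r * real i / real (Suc n)) w)"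
        using meas_A[OF _ i] by (intro distr_cong refl) (simp only: *)
      also have "\<dots> = gamma_law (\<theta> * (r / real (Suc n)))"
        using sub(6)[of "r * real i / real (Suc n)" "r / real (Suc n)"] gamma_process_marginal[OF G th, of "r / real (Suc n)"] r
        by simp
      finally show ?thesis by (simp add: mu_A[OF i])
    qed
    show "(\<lambda>n. \<Sum>i<Suc n. x n i * indicator (A n i) u) \<longlonglongrightarrow> f' u" for u
    proof (cases "u \<in> {0<..r}")
      case True
      then show ?thesis
        using left_endpoint_sums_tendsto[OF r cont, of u] unfolding x_def A_def f'_def by auto
    next
      case False
      then have "u \<notin> A n i" if "i < Suc n" for n i using A_sub[OF that] by blast
      then have "(\<Sum>i<Suc n. x n i * indicator (A n i) u) = 0" for n
        by (intro sum.neutral) auto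
      then have "(\<lambda>n. \<Sum>i<Suc n. x n i * indicator (A n i) u) = (\<lambda>_. 0)" by (intro ext)
      moreover have "f' u = 0" using False by (simp only: f'_def if_False)
      ultimately show ?thesis by (simp only: tendsto_const)
    qed
    show "(\<forall>n. \<forall>i<Suc n. 0 \<le> x n i) \<or> (\<forall>n u. f' u \<le> (\<Sum>i<Suc n. x n i * indicator (A n i) u))"
      using dom
    proof
      assume "\<forall>s\<in>{0..r}. 0 \<le> f s"
      then have "0 \<le> x n i" if "i < Suc n" for n i using pt[of i n] that unfolding x_def by auto
      then show ?thesis by blast
    next
      assume dec: "\<forall>s\<in>{0..r}. \<forall>t\<in>{0..r}. s \<le> t \<longrightarrow> f t \<le> f s"
      have "f' u \<le> (\<Sum>i<Suc n. x n i * indicator (A n i) u)" for n u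
      proof (cases "u \<in> {0<..r}")
        case True
        then obtain i where i: "i < Suc n" "u \<in> A n i"
          using interval_cells_cover[OF r, of u n] unfolding A_def by auto
        have d: "disjoint_family_on (A n) {..<Suc n}" unfolding A_def by (rule disjoint_interval_cells[OF r])
        obtain j where j: "j < Suc n" "u \<in> A n j" "\<forall>y. (\<Sum>i<Suc n. y i * indicator (A n i) u) = (y j :: real)"
          using sum_indicator_disjoint_cases[OF d, of "\<lambda>_. 0" u] i by auto
        have "f u \<le> x n j"
          unfolding x_def using dec pt[of j n] j True by (auto simp: A_def)
        then show ?thesis using j True by (simp add: f'_def)
      next
        case False
        then have "u \<notin> A n i" if "i < Suc n" for i using A_sub[OF that] by blast
        then have "(\<Sum>i<Suc n. x n i * indicator (A n i) u) = 0"
          by (intro sum.neutral) auto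
        then show ?thesis using False by (simp only: f'_def if_False order_refl)
      qed
      then show ?thesis by blast
    qed
    show "disjoint_family_on (A n) {..<Suc n}" for n unfolding A_def by (rule disjoint_interval_cells[OF r])
    show "min 0 (f s0) \<le> x n i" if "i < Suc n" for n i
      using s0(2)[OF pt[of i n]] that by (auto simp: x_def)
    show "x n i \<le> max 0 (f s1)" if "i < Suc n" for n i
      using s1(2)[OF pt[of i n]] that by (auto simp: x_def)
    show "-1 < min 0 (f s0)" using f[OF s0(1)] by auto
    show "sets \<mu> = sets borel" by (simp add: \<mu>_def)
    show "A n i \<in> sets borel" for n i by (simp add: A_def)
  qed (fact fin_G prob_space_axioms max.cobounded1 min.cobounded1)+
  have I_eq: "I w = (LINT u|\<Gamma> w. f' u)" if "w \<in> space M" for w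
  proof -
    have "continuous_on {0<..r} f" by (rule continuous_on_subset[OF cont]) auto
    then have m: "(\<lambda>u. indicator {0<..r} u *\<^sub>R f u) \<in> borel_measurable borel"
      by (rule borel_measurable_continuous_on_indicator[rotated]) auto
    have eq: "f' = (\<lambda>u. indicator {0<..r} u *\<^sub>R f u)" by (auto simp: f'_def fun_eq_iff)
    have [measurable]: "f' \<in> borel_measurable borel" unfolding eq by (rule m)
    have "(LINT u|\<Gamma> w. f' u) = (LINT u|interval_measure (F w). indicator {0<..r} u *\<^sub>R f' u)"
      unfolding \<Gamma>_def by (subst integral_density[symmetric]) (auto simp: ennreal_indicator)
    also have "\<dots> = I w"
      unfolding I_def set_lebesgue_integral_def F_def
      by (intro Bochner_Integration.integral_cong refl) (auto simp: f'_def)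
    finally show ?thesis by simp
  qed
  show "I \<in> borel_measurable M"
    using res I_eq by (subst measurable_cong[of M I]) auto
  have "(LINT u|\<mu>. ln (1 + f' u)) = \<theta> * (LBINT s:{0<..r}. ln (1 + f s))"
  proof -
    have "continuous_on {0<..r} f" by (rule continuous_on_subset[OF cont]) auto
    then have m: "(\<lambda>u. indicator {0<..r} u *\<^sub>R f u) \<in> borel_measurable borel"
      by (rule borel_measurable_continuous_on_indicator[rotated]) auto
    have eq: "f' = (\<lambda>u. indicator {0<..r} u *\<^sub>R f u)" by (auto simp: f'_def fun_eq_iff)
    have [measurable]: "f' \<in> borel_measurable borel" unfolding eq by (rule m)
    have "(LINT u|\<mu>. ln (1 + f' u)) = (LBINT u. (\<theta> * indicator {0<..r} u) *\<^sub>R ln (1 + f' u))"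
      unfolding \<mu>_def using th by (intro integral_density) (auto intro!: AE_I2)
    also have "\<dots> = (LBINT u. \<theta> * (indicator {0<..r} u *\<^sub>R ln (1 + f u)))"
      by (intro Bochner_Integration.integral_cong refl) (auto simp: f'_def indicator_def)
    finally show ?thesis by (simp add: set_lebesgue_integral_def)
  qed
  moreover have "has_bochner_integral M (\<lambda>w. exp (- I w)) (exp (- (LINT u|\<mu>. ln (1 + f' u))))"
    using res by (subst has_bochner_integral_cong[OF refl _ refl, of _ "\<lambda>w. exp (- I w)" "\<lambda>w. exp (- (LINT u|\<Gamma> w. f' u))"]) (auto simp: I_eq)
  ultimately show "has_bochner_integral M (\<lambda>w. exp (- I w)) (exp (- \<theta> * (LBINT s:{0<..r}. ln (1 + f s))))" by simp
qed

section \<open>Independence of a gamma total and a proportion\<close>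

text \<open>The hypothesis says that under the density proportional to \<open>exp (- s * S)\<close> the variable \<open>Z\<close> is distributed as
\<open>Z / (1 + s)\<close>. Comparing \<open>k\<close>-th moments gives \<open>E (exp (- s S) Z^k) = (1 + s) powr (- c - k) E (Z^k)\<close>, which as a function
of \<open>s\<close> is a multiple of the Laplace transform of \<open>x^k\<close> times the gamma law. So \<open>E ((Z / S)^k; S \<in> A)\<close> factors as
\<open>E ((Z / S)^k) P (S \<in> A)\<close>, and the moments of \<open>Z / S\<close>, which lies in \<open>[0, 1]\<close>, determine its law given \<open>S \<in> A\<close>.\<close>

lemma gamma_sum_ratio_independent:
  fixes M :: "'a measure" and S Z :: "'a \<Rightarrow> real"
  assumes "prob_space M" and S [measurable]: "S \<in> borel_measurable M" and Z [measurable]: "Z \<in> borel_measurable M"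
    and c: "c > 0" and ZS: "AE w in M. 0 \<le> Z w \<and> Z w \<le> S w"
    and lap: "\<And>s \<omega>. 0 \<le> s \<Longrightarrow> 0 \<le> \<omega> \<Longrightarrow>
      (LINT w|M. exp (- s * S w - \<omega> * Z w)) = (1 + s) powr (- c) * (LINT w|M. exp (- (\<omega> / (1 + s)) * Z w))"
  shows "distr M borel S = gamma_law c"
    and "distr M borel Z = distr (gamma_law c \<Otimes>\<^sub>M distr M borel (\<lambda>w. Z w / S w)) borel (\<lambda>(t, x). t * x)"
proof -
  interpret prob_space M by fact
  have c0: "0 \<le> c" using c by simp
  interpret g: prob_space "gamma_law c" by (rule prob_space_gamma_law[OF c0])
  define R where "R = (\<lambda>w. Z w / S w)"
  have [measurable]: "R \<in> borel_measurable M" unfolding R_def by measurable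
  show lawS: "distr M borel S = gamma_law c"
  proof (rule finite_measure_eqI_laplace)
    show "finite_measure (distr M borel S)" by (rule finite_measure_distr) measurable
    show "AE x in distr M borel S. 0 \<le> x" using ZS by (subst AE_distr_iff) auto
    fix k :: nat
    show "(LINT x|distr M borel S. exp (- real k * x)) = (LINT x|gamma_law c. exp (- real k * x))"
      using lap[of "real k" 0] has_bochner_integral_integral_eq[OF has_bochner_integral_gamma_law_exp[OF c0, of "real k"]]
      by (simp add: integral_distr prob_space)
  qed (auto intro: AE_gamma_law_nonneg, unfold_locales)
  have Spos: "AE w in M. S w > 0"
  proof -
    have "AE x in distr M borel S. x > 0" unfolding lawS by (rule AE_gamma_law_pos[OF c])
    then show ?thesis by (subst (asm) AE_distr_iff) auto
  qed
  have Rbd: "AE w in M. 0 \<le> R w \<and> R w \<le> 1"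
    using Spos ZS by eventually_elim (auto simp: R_def field_simps)
  have int_Sk: "integrable M (\<lambda>w. S w ^ k)" for k
  proof -
    have "integrable (distr M borel S) (\<lambda>x. x ^ k)"
      unfolding lawS using has_bochner_integral_gamma_law_power[OF c] by (auto intro: integrable.intros)
    then show ?thesis by (simp add: integrable_distr_eq)
  qed
  have int_Zk: "integrable M (\<lambda>w. Z w ^ k)" for k
    by (rule Bochner_Integration.integrable_bound[OF int_Sk[of k]], measurable, use ZS in eventually_elim) (auto simp: power_mono)
  \<comment> \<open>Moments of \<open>Z\<close> under exponential tilting by \<open>S\<close>.\<close>
  have tilt: "(LINT w|M. exp (- real n * S w) * Z w ^ k) = (1 + real n) powr (- c - real k) * (LINT w|M. Z w ^ k)" for n k :: nat
  proof -
    define D1 where "D1 = distr (density M (\<lambda>w. ennreal (exp (- real n * S w)))) borel Z"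
    define D2 where "D2 = density (distr M borel (\<lambda>w. Z w / (1 + real n))) (\<lambda>_. ennreal ((1 + real n) powr (- c)))"
    have int_e: "integrable M (\<lambda>w. exp (- real n * S w))"
      by (rule integrable_const_bound[of _ 1], use Spos in eventually_elim) auto
    have "D1 = D2"
    proof (rule finite_measure_eqI_laplace)
      have "finite_measure (density M (\<lambda>w. ennreal (exp (- real n * S w))))"
        using int_e by (intro finite_measureI) (simp add: emeasure_density nn_integral_eq_integral cong: nn_integral_cong_simp)
      then show "finite_measure D1" unfolding D1_def by (rule finite_measure.finite_measure_distr) measurable
      interpret Q: prob_space "distr M borel (\<lambda>w. Z w / (1 + real n))" by (rule prob_space_distr) measurable
      show "finite_measure D2" unfolding D2_def
        by (intro finite_measureI) (auto simp: emeasure_density nn_integral_cmult_indicator Q.emeasure_eq_measure ennreal_mult[symmetric])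
      show "AE x in D1. 0 \<le> x" using ZS unfolding D1_def
        by (subst AE_distr_iff, simp, simp) (subst AE_density, auto)
      have "AE x in distr M borel (\<lambda>w. Z w / (1 + real n)). 0 \<le> x"
        using ZS by (subst AE_distr_iff) auto
      then show "AE x in D2. 0 \<le> x" unfolding D2_def
        by (subst AE_density) auto
      fix j :: nat
      have "(LINT x|D1. exp (- real j * x)) = (LINT w|M. exp (- real n * S w - real j * Z w))"
        unfolding D1_def by (subst integral_distr, simp, simp, subst integral_density) (auto simp: exp_add[symmetric] exp_diff exp_minus field_simps)
      also have "\<dots> = (1 + real n) powr (- c) * (LINT w|M. exp (- (real j / (1 + real n)) * Z w))"
        by (rule lap) auto
      also have "\<dots> = (LINT x|D2. exp (- real j * x))"
        unfolding D2_def by (subst integral_density, simp, simp, simp, simp, subst integral_distr) auto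
      finally show "(LINT x|D1. exp (- real j * x)) = (LINT x|D2. exp (- real j * x))" .
    qed (auto simp: D1_def D2_def)
    have "(LINT w|M. exp (- real n * S w) * Z w ^ k) = (LINT x|D1. x ^ k)"
      unfolding D1_def by (subst integral_distr, simp, simp, subst integral_density) auto
    also have "\<dots> = (LINT x|D2. x ^ k)" by (simp only: \<open>D1 = D2\<close>)
    also have "\<dots> = (1 + real n) powr (- c) * (LINT w|M. (Z w / (1 + real n)) ^ k)"
      unfolding D2_def by (subst integral_density, simp, simp, simp, simp, subst integral_distr) auto
    also have "\<dots> = (1 + real n) powr (- c) * ((LINT w|M. Z w ^ k) / (1 + real n) ^ k)"
      by (simp add: power_divide)
    also have "\<dots> = (1 + real n) powr (- c - real k) * (LINT w|M. Z w ^ k)"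
      by (simp add: powr_diff powr_realpow)
    finally show ?thesis .
  qed
  \<comment> \<open>Conversely, \<open>Z^k\<close> tilts the law of \<open>S\<close> by a multiple of \<open>x^k\<close>; dividing by \<open>S^k\<close> removes the tilt.\<close>
  have mixed: "(LINT w|M. indicator A (S w) * R w ^ k) = (LINT w|M. Z w ^ k) * Gamma c / Gamma (c + real k) * measure (gamma_law c) A"
    if A [measurable]: "A \<in> sets borel" for A k
  proof -
    define \<kappa> where "\<kappa> = (LINT w|M. Z w ^ k) * Gamma c / Gamma (c + real k)"
    have G: "Gamma c > 0" "Gamma (c + real k) > 0" using c by (auto intro!: Gamma_real_pos)
    have EZ: "0 \<le> (LINT w|M. Z w ^ k)"
      using ZS by (intro integral_nonneg_AE) (auto elim!: eventually_mono)
    have k0: "0 \<le> \<kappa>" using G EZ by (simp add: \<kappa>_def)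
    define D1 where "D1 = distr (density M (\<lambda>w. ennreal (Z w ^ k))) borel S"
    define D2 where "D2 = density (gamma_law c) (\<lambda>x. ennreal (\<kappa> * x ^ k))"
    have "AE w in M. 0 \<le> Z w ^ k" using ZS by (auto elim!: eventually_mono)
    note nnZ = this
    have "AE x in gamma_law c. 0 \<le> \<kappa> * x ^ k" using AE_gamma_law_nonneg[of c] k0 by (auto elim!: eventually_mono)
    note nnG = this
    have intG: "integrable (gamma_law c) (\<lambda>x. \<kappa> * x ^ k)"
      using has_bochner_integral_gamma_law_power[OF c, of k] by (auto intro: integrable.intros)
    have "D1 = D2"
    proof (rule finite_measure_eqI_laplace)
      have "finite_measure (density M (\<lambda>w. ennreal (Z w ^ k)))"
        using int_Zk[of k] nnZ by (intro finite_measureI) (simp add: emeasure_density nn_integral_eq_integral cong: nn_integral_cong_simp)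
      then show "finite_measure D1" unfolding D1_def by (rule finite_measure.finite_measure_distr) measurable
      show "finite_measure D2" unfolding D2_def
        using intG nnG by (intro finite_measureI) (simp add: emeasure_density nn_integral_eq_integral cong: nn_integral_cong_simp)
      show "AE x in D1. 0 \<le> x" using ZS unfolding D1_def
        by (subst AE_distr_iff, simp, simp) (subst AE_density, auto)
      show "AE x in D2. 0 \<le> x" unfolding D2_def using AE_gamma_law_nonneg[of c]
        by (subst AE_density) auto
      fix n :: nat
      have "(LINT x|D1. exp (- real n * x)) = (LINT w|M. exp (- real n * S w) * Z w ^ k)"
        unfolding D1_def using nnZ by (subst integral_distr, simp, simp, subst integral_density) (auto simp: mult.commute)
      also have "\<dots> = (1 + real n) powr (- c - real k) * (LINT w|M. Z w ^ k)" by (rule tilt)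
      also have "\<dots> = \<kappa> * (Gamma (c + real k) / Gamma c * (1 + real n) powr (- (c + real k)))"
        using G by (simp add: \<kappa>_def)
      also have "\<dots> = \<kappa> * (LINT x|gamma_law c. x ^ k * exp (- real n * x))"
        using has_bochner_integral_integral_eq[OF has_bochner_integral_gamma_law[OF c, of "real n" k]] by simp
      also have "\<dots> = (LINT x|D2. exp (- real n * x))"
        unfolding D2_def using nnG by (subst integral_density) (auto simp: mult.assoc)
      finally show "(LINT x|D1. exp (- real n * x)) = (LINT x|D2. exp (- real n * x))" .
    qed (auto simp: D1_def D2_def)
    have "(LINT w|M. indicator A (S w) * R w ^ k) = (LINT w|M. Z w ^ k * (indicator A (S w) / S w ^ k))"
      by (rule integral_cong_AE) (auto simp: R_def power_divide)
    also have "\<dots> = (LINT x|D1. indicator A x / x ^ k)"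
      unfolding D1_def using nnZ by (subst integral_distr, simp, simp, subst integral_density) auto
    also have "\<dots> = (LINT x|gamma_law c. \<kappa> * x ^ k * (indicator A x / x ^ k))"
      unfolding \<open>D1 = D2\<close> D2_def using nnG by (subst integral_density) auto
    also have "\<dots> = (LINT x|gamma_law c. \<kappa> * indicator A x)"
      by (intro integral_cong_AE, measurable, use AE_gamma_law_pos[OF c] in eventually_elim) auto
    also have "\<dots> = \<kappa> * measure (gamma_law c) A" by simp
    finally show ?thesis by (simp add: \<kappa>_def)
  qed
  have ER: "(LINT w|M. R w ^ k) = (LINT w|M. Z w ^ k) * Gamma c / Gamma (c + real k)" for k
    using mixed[of UNIV k] g.prob_space by simp
  have indep: "measure M {w \<in> space M. S w \<in> A \<and> R w \<in> B} = measure (gamma_law c) A * measure (distr M borel R) B"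
    if A [measurable]: "A \<in> sets borel" and B [measurable]: "B \<in> sets borel" for A B
  proof -
    define D1 where "D1 = distr (density M (\<lambda>w. ennreal (indicator A (S w)))) borel R"
    define D2 where "D2 = density (distr M borel R) (\<lambda>_. ennreal (measure (gamma_law c) A))"
    interpret Q: prob_space "distr M borel R" by (rule prob_space_distr) measurable
    have "D1 = D2"
    proof (rule finite_measure_eqI_moments)
      have "finite_measure (density M (\<lambda>w. ennreal (indicator A (S w))))"
        by (intro finite_measureI) (simp add: emeasure_density nn_integral_eq_integral integrable_const_bound[of _ 1] cong: nn_integral_cong_simp)
      then show "finite_measure D1" unfolding D1_def by (rule finite_measure.finite_measure_distr) measurable
      show "finite_measure D2" unfolding D2_def
        by (intro finite_measureI) (auto simp: emeasure_density nn_integral_cmult_indicator Q.emeasure_eq_measure ennreal_mult[symmetric])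
      show "AE x in D1. 0 \<le> x \<and> x \<le> 1" using Rbd unfolding D1_def
        by (subst AE_distr_iff, simp, simp) (subst AE_density, auto)
      have "AE x in distr M borel R. 0 \<le> x \<and> x \<le> 1"
        using Rbd by (subst AE_distr_iff) auto
      then show "AE x in D2. 0 \<le> x \<and> x \<le> 1" unfolding D2_def
        by (subst AE_density) auto
      fix k :: nat
      have "(LINT x|D1. x ^ k) = (LINT w|M. indicator A (S w) * R w ^ k)"
        unfolding D1_def by (subst integral_distr, simp, simp, subst integral_density) auto
      also have "\<dots> = measure (gamma_law c) A * (LINT w|M. R w ^ k)"
        by (simp add: mixed ER)
      also have "\<dots> = (LINT x|D2. x ^ k)"
        unfolding D2_def by (subst integral_density, simp, simp, simp, simp, subst integral_distr) auto
      finally show "(LINT x|D1. x ^ k) = (LINT x|D2. x ^ k)" .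
    qed (auto simp: D1_def D2_def)
    have "emeasure D1 B = (\<integral>\<^sup>+w. ennreal (indicator A (S w)) * indicator (R -` B \<inter> space M) w \<partial>M)"
      unfolding D1_def by (subst emeasure_distr) (auto simp: emeasure_density)
    also have "\<dots> = (\<integral>\<^sup>+w. indicator {w \<in> space M. S w \<in> A \<and> R w \<in> B} w \<partial>M)"
      by (intro nn_integral_cong) (auto simp: indicator_def)
    also have "\<dots> = emeasure M {w \<in> space M. S w \<in> A \<and> R w \<in> B}" by simp
    finally have 1: "measure D1 B = measure M {w \<in> space M. S w \<in> A \<and> R w \<in> B}" by (simp add: measure_def)
    have "emeasure D2 B = ennreal (measure (gamma_law c) A) * emeasure (distr M borel R) B"
      unfolding D2_def by (simp add: emeasure_density nn_integral_cmult_indicator)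
    then have 2: "measure D2 B = measure (gamma_law c) A * measure (distr M borel R) B"
      by (simp add: measure_def enn2real_mult)
    show ?thesis using 1 2 \<open>D1 = D2\<close> by simp
  qed
  interpret Q: prob_space "distr M borel R" by (rule prob_space_distr) measurable
  have pair: "gamma_law c \<Otimes>\<^sub>M distr M borel R = distr M (borel \<Otimes>\<^sub>M borel) (\<lambda>w. (S w, R w))"
  proof (rule pair_measure_eqI)
    show "sigma_finite_measure (gamma_law c)" "sigma_finite_measure (distr M borel R)" by unfold_locales
    show "sets (gamma_law c \<Otimes>\<^sub>M distr M borel R) = sets (distr M (borel \<Otimes>\<^sub>M borel) (\<lambda>w. (S w, R w)))"
      by (simp cong: sets_pair_measure_cong)
    fix A B assume "A \<in> sets (gamma_law c)" "B \<in> sets (distr M borel R)"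
    then have [measurable]: "A \<in> sets borel" "B \<in> sets borel" by auto
    have "emeasure (distr M (borel \<Otimes>\<^sub>M borel) (\<lambda>w. (S w, R w))) (A \<times> B) = emeasure M {w \<in> space M. S w \<in> A \<and> R w \<in> B}"
      by (subst emeasure_distr) (auto intro!: arg_cong2[where f = emeasure])
    also have "\<dots> = ennreal (measure (gamma_law c) A * measure (distr M borel R) B)"
      by (simp add: emeasure_eq_measure indep)
    finally show "emeasure (gamma_law c) A * emeasure (distr M borel R) B = emeasure (distr M (borel \<Otimes>\<^sub>M borel) (\<lambda>w. (S w, R w))) (A \<times> B)"
      by (simp add: g.emeasure_eq_measure Q.emeasure_eq_measure ennreal_mult)
  qed
  have "distr (gamma_law c \<Otimes>\<^sub>M distr M borel R) borel (\<lambda>(t, x). t * x) = distr M borel (\<lambda>w. S w * R w)"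
    unfolding pair by (subst distr_distr) (auto simp: o_def)
  also have "\<dots> = distr M borel Z"
    by (rule distr_cong_AE) (use Spos in \<open>auto simp: R_def elim!: eventually_mono\<close>)
  finally show "distr M borel Z = distr (gamma_law c \<Otimes>\<^sub>M distr M borel (\<lambda>w. Z w / S w)) borel (\<lambda>(t, x). t * x)"
    by (simp add: R_def)
qed

section \<open>The shape measure and its gamma random measures\<close>

text \<open>The measure \<open>du / u\<close> on \<open>[exp (- a), 1]\<close> is the image of Lebesgue measure on \<open>[0, a]\<close> under \<open>s \<mapsto> exp (s - a)\<close>.\<close>

lemma exp_substitution:
  fixes g :: "real \<Rightarrow> real"
  assumes a: "0 \<le> a" and g: "continuous_on {exp (- a)..1} g"
  shows "set_integrable lborel {exp (- a)..1} (\<lambda>u. g u / u)"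
    and "(LBINT u:{exp (- a)..1}. g u / u) = (LBINT s:{0<..a}. g (exp (s - a)))"
proof -
  have cont: "continuous_on {exp (- a)..1} (\<lambda>u. g u / u)"
    using g by (intro continuous_intros) (auto simp: less_le_trans[OF exp_gt_zero] dest: less_le_trans[OF exp_gt_zero])
  show i: "set_integrable lborel {exp (- a)..1} (\<lambda>u. g u / u)"
    by (rule borel_integrable_atLeastAtMost'[OF cont])
  have "(LBINT u. (g u / u) * indicator {exp (0 - a)..exp (a - a)} u) = (LBINT s. g (exp (s - a)) / exp (s - a) * exp (s - a) * indicator {0..a} s)"
    by (rule integral_substitution(2)) (use i a in \<open>auto intro!: derivative_eq_intros continuous_intros\<close>)
  also have "\<dots> = (LBINT s:{0..a}. g (exp (s - a)))"
    by (simp add: set_lebesgue_integral_def mult.commute)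
  also have "\<dots> = (LBINT s:{0<..a}. g (exp (s - a)))"
  proof (rule set_integral_cong_set[symmetric])
    have g': "continuous_on {0..a} (\<lambda>s. g (exp (s - a)))"
      by (rule continuous_on_compose2[OF g]) (auto intro!: continuous_intros)
    then show "set_borel_measurable lborel {0..a} (\<lambda>s. g (exp (s - a)))"
      using borel_integrable_atLeastAtMost'[OF g'] by (simp add: set_borel_measurable_def set_integrable_def)
    have "set_integrable lborel {0<..a} (\<lambda>s. g (exp (s - a)))"
      by (rule set_integrable_subset[OF borel_integrable_atLeastAtMost'[OF g']]) auto
    then show "set_borel_measurable lborel {0<..a} (\<lambda>s. g (exp (s - a)))"
      by (simp add: set_borel_measurable_def set_integrable_def)
    have "AE s in lborel. s \<noteq> (0::real)" by (rule AE_lborel_singleton)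
    then show "AE s in lborel. (s \<in> {0..a}) = (s \<in> {0<..a})" by eventually_elim auto
  qed
  finally show "(LBINT u:{exp (- a)..1}. g u / u) = (LBINT s:{0<..a}. g (exp (s - a)))"
    by (simp add: set_lebesgue_integral_def mult.commute)
qed

lemma sets_F_law [simp, measurable_cong]: "sets (F_law a) = sets borel"
  by (simp add: F_law_def)

lemma F_density_nonneg: "0 < a \<Longrightarrow> 0 \<le> indicator {exp (- a)..1} u / (a * u)" for u :: real
  using less_le_trans[OF exp_gt_zero, of "- a" u] by (auto simp: indicator_def)

lemma nn_integral_F_law_1:
  assumes a: "0 < a" shows "(\<integral>\<^sup>+u. 1 \<partial>F_law a) = 1"
proof -
  note nn = F_density_nonneg[OF a]
  have i: "set_integrable lborel {exp (- a)..1} (\<lambda>u. 1 / u)" "(LBINT u:{exp (- a)..1}. 1 / u) = a"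
    using exp_substitution[of a "\<lambda>_. 1"] a by (auto simp: set_lebesgue_integral_def)
  have eq: "indicator {exp (- a)..1} u / (a * u) = (indicator {exp (- a)..1} u *\<^sub>R (1 / u)) / a" for u :: real
    by simp
  have i2: "integrable lborel (\<lambda>u. indicator {exp (- a)..1} u / (a * u))"
    unfolding eq by (rule integrable_divide_zero) (use i(1) in \<open>simp only: set_integrable_def\<close>)
  have "(\<integral>\<^sup>+u. 1 \<partial>F_law a) = (\<integral>\<^sup>+u. ennreal (indicator {exp (- a)..1} u / (a * u)) \<partial>lborel)"
    unfolding F_law_def by (subst nn_integral_density) auto
  also have "\<dots> = ennreal (LBINT u. indicator {exp (- a)..1} u / (a * u))"
    by (rule nn_integral_eq_integral[OF i2 AE_I2[OF nn]])
  also have "(LBINT u. indicator {exp (- a)..1} u / (a * u)) = 1"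
    unfolding eq integral_divide_zero using i(2) a by (simp only: set_lebesgue_integral_def) simp
  finally show ?thesis by simp
qed

lemma prob_space_F_law: "0 < a \<Longrightarrow> prob_space (F_law a)"
  using nn_integral_F_law_1 by (intro prob_spaceI) simp

lemma AE_F_law: "AE u in F_law a. exp (- a) \<le> u \<and> u \<le> 1"
  unfolding F_law_def by (subst AE_density) (auto simp: indicator_def)

lemma integral_F_law:
  fixes g :: "real \<Rightarrow> real"
  assumes a: "0 < a" and g: "continuous_on {exp (- a)..1} g" and [measurable]: "g \<in> borel_measurable borel"
  shows "(LINT u|F_law a. g u) = (LBINT u:{exp (- a)..1}. g u / u) / a"
proof -
  note nn = F_density_nonneg[OF a]
  have "(LINT u|F_law a. g u) = (LBINT u. (indicator {exp (- a)..1} u / (a * u)) *\<^sub>R g u)"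
    unfolding F_law_def by (intro integral_density) (auto intro!: AE_I2 nn)
  also have "\<dots> = (LBINT u. (indicator {exp (- a)..1} u *\<^sub>R (g u / u)) / a)"
    by (intro Bochner_Integration.integral_cong refl) simp
  also have "\<dots> = (LBINT u:{exp (- a)..1}. g u / u) / a"
    by (simp only: integral_divide_zero set_lebesgue_integral_def)
  finally show ?thesis .
qed

lemma scale_measure_eq_density: "scale_measure r M = density M (\<lambda>_. r)"
  by (rule measure_eqI) (auto simp: emeasure_density nn_integral_cmult_indicator)

text \<open>Apply the Laplace functional to \<open>f u = s + \<omega> u\<close> on the support of the shape measure. Off the support \<open>f\<close> is \<open>s\<close>, so that
\<open>\<integral> f d\<Gamma>\<close> contains the mass of the whole line and not only that of the support.\<close>

lemma laplace_gamma_random_measure: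
  fixes N :: "'w measure"
  assumes gam: "gamma_random_measure N \<Gamma> (scale_measure (ennreal c) (F_law a))" and a: "0 < a" and c: "0 < c"
    and s: "0 \<le> s" and \<omega>: "0 \<le> \<omega>"
  defines "S \<equiv> (\<lambda>w. measure (\<Gamma> w) UNIV)" and "Z \<equiv> (\<lambda>w. LINT x:{exp (- a)..1}|\<Gamma> w. x)"
  shows "(\<lambda>w. s * S w + \<omega> * Z w) \<in> borel_measurable N"
    and "(LINT w|N. exp (- (s * S w + \<omega> * Z w))) = exp (- c * (LINT u|F_law a. ln (1 + s + \<omega> * u)))"
proof -
  define \<mu> where "\<mu> = scale_measure (ennreal c) (F_law a)"
  define I where "I = {exp (- a)..1::real}"
  interpret F: prob_space "F_law a" by (rule prob_space_F_law[OF a])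
  have N: "prob_space N" and G: "\<And>w. w \<in> space N \<Longrightarrow> finite_measure (\<Gamma> w)" "\<And>w. w \<in> space N \<Longrightarrow> sets (\<Gamma> w) = sets borel"
    and mu: "finite_measure \<mu>" "sets \<mu> = sets borel"
    and law: "\<And>A. A \<in> sets borel \<Longrightarrow> distr N borel (\<lambda>w. measure (\<Gamma> w) A) = gamma_law (measure \<mu> A)"
    and ind: "\<And>(n::nat) A. (\<forall>i<n. A i \<in> sets borel) \<Longrightarrow> disjoint_family_on A {..<n} \<Longrightarrow>
       prob_space.indep_vars N (\<lambda>_. borel) (\<lambda>i w. measure (\<Gamma> w) (A i)) {..<n}"
    using gam unfolding gamma_random_measure_def \<mu>_def by auto
  \<comment> \<open>The last cell collects the complement of the support, where the integrand is the constant \<open>s\<close>.\<close>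
  define A where "A = (\<lambda>n i. if i < Suc n then {1 * real i / real (Suc n)<..1 * real (Suc i) / real (Suc n)} \<inter> I else - I)"
  define x where "x = (\<lambda>n i. if i < Suc n then s + \<omega> * (1 * real i / real (Suc n)) else s)"
  define f where "f = (\<lambda>u. s + \<omega> * (indicator I u * u))"
  have I_sub: "I \<subseteq> {0<..1}" by (auto simp: I_def intro: less_le_trans[OF exp_gt_zero])
  have [measurable]: "I \<in> sets borel" by (simp add: I_def)
  have A_meas: "A n i \<in> sets borel" for n i by (auto simp: A_def)
  have disj: "disjoint_family_on (A n) {..<Suc (Suc n)}" for n
    unfolding disjoint_family_on_def
  proof (intro ballI impI)
    fix i j assume "i \<noteq> j" "i \<in> {..<Suc (Suc n)}" "j \<in> {..<Suc (Suc n)}"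
    then show "A n i \<inter> A n j = {}"
      using disjoint_family_onD[OF disjoint_interval_cells[of 1 n "Suc n"], of i j]
      by (cases "i < Suc n"; cases "j < Suc n") (auto simp: A_def)
  qed
  have "(\<lambda>w. LINT u|\<Gamma> w. f u) \<in> borel_measurable N \<and>
      has_bochner_integral N (\<lambda>w. exp (- (LINT u|\<Gamma> w. f u))) (exp (- (LINT u|\<mu>. ln (1 + f u))))"
  proof (rule laplace_gamma_integral[where A = A and x = x and k = "\<lambda>n. Suc (Suc n)" and \<beta> = 0 and B = "s + \<omega>"])
    show "prob_space.indep_vars N (\<lambda>_. borel) (\<lambda>i w. measure (\<Gamma> w) (A n i)) {..<Suc (Suc n)}" for n
      by (rule ind) (auto simp: A_meas disj)
    show "distr N borel (\<lambda>w. measure (\<Gamma> w) (A n i)) = gamma_law (measure \<mu> (A n i))" for n i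
      by (rule law[OF A_meas])
    show "0 \<le> x n i" for n i using s \<omega> by (simp add: x_def)
    show "x n i \<le> s + \<omega>" if "i < Suc (Suc n)" for n i
    proof -
      have "\<omega> * (real i / real (Suc n)) \<le> \<omega>" if "i < Suc n" using \<omega> that by (intro mult_left_le) auto
      then show ?thesis using s \<omega> by (auto simp: x_def)
    qed
    show "(\<lambda>n. \<Sum>i<Suc (Suc n). x n i * indicator (A n i) u) \<longlonglongrightarrow> f u" for u
    proof (cases "u \<in> I")
      case True
      have c: "continuous_on {0..1} (\<lambda>v. s + \<omega> * v)" by (intro continuous_intros)
      have "(\<lambda>n. \<Sum>i<Suc n. (s + \<omega> * (1 * real i / real (Suc n))) * indicator {1 * real i / real (Suc n)<..1 * real (Suc i) / real (Suc n)} u) \<longlonglongrightarrow> s + \<omega> * u"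
        using True I_sub by (intro left_endpoint_sums_tendsto[OF _ c]) auto
      also have "(\<lambda>n. \<Sum>i<Suc n. (s + \<omega> * (1 * real i / real (Suc n))) * indicator {1 * real i / real (Suc n)<..1 * real (Suc i) / real (Suc n)} u)
          = (\<lambda>n. \<Sum>i<Suc (Suc n). x n i * indicator (A n i) u)"
      proof
        fix n
        have "(\<Sum>i<Suc (Suc n). x n i * indicator (A n i) u) = (\<Sum>i<Suc n. x n i * indicator (A n i) u) + x n (Suc n) * indicator (A n (Suc n)) u"
          by (rule sum.lessThan_Suc)
        also have "x n (Suc n) * indicator (A n (Suc n)) u = 0" using True by (simp add: A_def)
        also have "(\<Sum>i<Suc n. x n i * indicator (A n i) u) = (\<Sum>i<Suc n. (s + \<omega> * (1 * real i / real (Suc n))) * indicator {1 * real i / real (Suc n)<..1 * real (Suc i) / real (Suc n)} u)"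
          using True by (intro sum.cong refl) (auto simp: x_def A_def indicator_def)
        finally show "(\<Sum>i<Suc n. (s + \<omega> * (1 * real i / real (Suc n))) * indicator {1 * real i / real (Suc n)<..1 * real (Suc i) / real (Suc n)} u) = (\<Sum>i<Suc (Suc n). x n i * indicator (A n i) u)"
          by simp
      qed
      finally show ?thesis using True by (simp add: f_def)
    next
      case False
      have "(\<Sum>i<Suc (Suc n). x n i * indicator (A n i) u) = s" for n
      proof -
        have "(\<Sum>i<Suc (Suc n). x n i * indicator (A n i) u) = (\<Sum>i<Suc n. x n i * indicator (A n i) u) + x n (Suc n) * indicator (A n (Suc n)) u"
          by (rule sum.lessThan_Suc)
        also have "(\<Sum>i<Suc n. x n i * indicator (A n i) u) = 0"
          using False by (intro sum.neutral) (auto simp: A_def)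
        also have "x n (Suc n) * indicator (A n (Suc n)) u = s" using False by (simp add: A_def x_def)
        finally show ?thesis by simp
      qed
      then have "(\<lambda>n. \<Sum>i<Suc (Suc n). x n i * indicator (A n i) u) = (\<lambda>_. s)" by (intro ext)
      moreover have "f u = s" using False by (simp add: f_def)
      ultimately show ?thesis by (simp only: tendsto_const)
    qed
    show "(\<forall>n. \<forall>i<Suc (Suc n). 0 \<le> x n i) \<or> (\<forall>n u. f u \<le> (\<Sum>i<Suc (Suc n). x n i * indicator (A n i) u))"
      using s \<omega> by (simp add: x_def)
    show "0 \<le> s + \<omega>" using s \<omega> by simp
  qed (use N G mu A_meas disj in auto)
  moreover have Z: "(LINT u|\<Gamma> w. f u) = s * S w + \<omega> * Z w" if w: "w \<in> space N" for w
  proof -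
    interpret g: finite_measure "\<Gamma> w" by (rule G(1)[OF w])
    note [measurable_cong] = G(2)[OF w]
    have sp: "space (\<Gamma> w) = UNIV" using sets_eq_imp_space_eq[OF G(2)[OF w]] by simp
    have i: "integrable (\<Gamma> w) (\<lambda>u. indicator I u * u)"
    proof (rule g.integrable_const_bound[of _ 1])
      show "AE u in \<Gamma> w. norm (indicator I u * u) \<le> 1"
        by (intro AE_I2) (use I_sub in \<open>auto simp: indicator_def\<close>)
    qed measurable
    have "(LINT u|\<Gamma> w. f u) = (LINT u|\<Gamma> w. s) + (LINT u|\<Gamma> w. \<omega> * (indicator I u * u))"
      unfolding f_def using i by (intro Bochner_Integration.integral_add) auto
    then show ?thesis by (simp add: S_def Z_def sp set_lebesgue_integral_def I_def mult.commute)
  qed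
  ultimately have m: "(\<lambda>w. s * S w + \<omega> * Z w) \<in> borel_measurable N" and
    h: "has_bochner_integral N (\<lambda>w. exp (- (s * S w + \<omega> * Z w))) (exp (- (LINT u|\<mu>. ln (1 + f u))))"
    by (simp_all cong: measurable_cong has_bochner_integral_cong)
  show "(\<lambda>w. s * S w + \<omega> * Z w) \<in> borel_measurable N" by (rule m)
  have [measurable]: "f \<in> borel_measurable borel" unfolding f_def by measurable
  have "(LINT u|\<mu>. ln (1 + f u)) = (LINT u|F_law a. c *\<^sub>R ln (1 + f u))"
    unfolding \<mu>_def scale_measure_eq_density using c by (intro integral_density) auto
  also have "\<dots> = c * (LINT u|F_law a. ln (1 + f u))" by simp
  also have "(LINT u|F_law a. ln (1 + f u)) = (LINT u|F_law a. ln (1 + s + \<omega> * u))"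
    by (rule integral_cong_AE, measurable, use AE_F_law[of a] in eventually_elim) (auto simp: f_def I_def add.assoc)
  finally show "(LINT w|N. exp (- (s * S w + \<omega> * Z w))) = exp (- c * (LINT u|F_law a. ln (1 + s + \<omega> * u)))"
    using has_bochner_integral_integral_eq[OF h] by simp
qed

section \<open>The Ornstein--Uhlenbeck increment and the mean functional\<close>

text \<open>The Levy exponent of the increment for \<open>\<theta> = 1\<close>.\<close>

definition log_transform :: "real \<Rightarrow> real \<Rightarrow> real" where
  "log_transform a \<omega> = (LBINT u:{exp (- a)..1}. ln (1 + \<omega> * u) / u)"

text \<open>Negative \<open>\<omega>\<close> are kept down to \<open>- 1\<close>: the cumulants need the exponent in a neighbourhood of 0.\<close>

lemma one_plus_mult_pos: "-1 < \<omega> \<Longrightarrow> 0 \<le> u \<Longrightarrow> u \<le> 1 \<Longrightarrow> 0 < 1 + \<omega> * u" for \<omega> u :: real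
proof (cases "0 \<le> \<omega>")
  case True
  assume "0 \<le> u"
  with True have "0 \<le> \<omega> * u" by simp
  then show ?thesis by simp
next
  case False
  assume "-1 < \<omega>" "0 \<le> u" "u \<le> 1"
  then have "- \<omega> * u \<le> - \<omega> * 1" using False by (intro mult_left_mono) auto
  then show ?thesis using \<open>-1 < \<omega>\<close> by simp
qed

lemma continuous_on_ln_one_plus:
  assumes "-1 < \<omega>" shows "continuous_on {exp (- a)..1::real} (\<lambda>u. ln (1 + \<omega> * u))"
proof -
  have "1 + \<omega> * u \<noteq> 0" if "u \<in> {exp (- a)..1}" for u
  proof -
    have "0 \<le> u" using that less_le_trans[OF exp_gt_zero, of "- a" u] by simp
    then show ?thesis using one_plus_mult_pos[OF assms, of u] that by simp
  qed
  then show ?thesis by (intro continuous_intros) auto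
qed

lemma log_transform_process:
  assumes "0 \<le> a" "-1 < \<omega>"
  shows "log_transform a \<omega> = (LBINT s:{0<..a}. ln (1 + \<omega> * exp (s - a)))"
  unfolding log_transform_def by (rule exp_substitution(2)[OF assms(1) continuous_on_ln_one_plus[OF assms(2)]])

lemma integral_F_law_ln:
  assumes "0 < a" "-1 < \<omega>"
  shows "(LINT u|F_law a. ln (1 + \<omega> * u)) = log_transform a \<omega> / a"
  unfolding log_transform_def by (rule integral_F_law[OF assms(1) continuous_on_ln_one_plus[OF assms(2)]]) measurable

lemma ou_increment_eq:
  assumes "0 < lam"
  shows "ou_increment G lam t w = (LINT s:{0<..lam * t}|interval_measure (\<lambda>s. G (max 0 s) w). exp (s - lam * t))"
proof -
  have "ou_increment G lam t w = (LINT s:{0<..lam * t}|interval_measure (\<lambda>s. G (max 0 s) w). exp (- lam * t) * exp (lam * (s / lam)))"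
    unfolding ou_increment_def gamma_integral_def by (rule set_integral_mult_right[symmetric])
  also have "(\<lambda>s. exp (- lam * t) * exp (lam * (s / lam))) = (\<lambda>s. exp (s - lam * t))"
    using assms by (simp add: exp_add[symmetric])
  finally show ?thesis .
qed

text \<open>For negative \<open>\<omega>\<close> the integrand \<open>\<omega> * exp (k * s - b)\<close> is decreasing, and \<open>k * r \<le> b\<close> keeps it above \<open>- 1\<close>. The factor
\<open>k\<close> is the speed used for infinite divisibility.\<close>

lemma gamma_process_exp_integral:
  assumes G: "gamma_process M G \<theta>" and th: "0 < \<theta>" and r: "0 < r" and k: "0 < k"
    and \<omega>: "0 \<le> \<omega> \<or> (-1 < \<omega> \<and> k * r \<le> b)"
  defines "I \<equiv> (\<lambda>w. LINT s:{0<..r}|interval_measure (\<lambda>s. G (max 0 s) w). exp (k * s - b))"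
  shows "I \<in> borel_measurable M"
    and "has_bochner_integral M (\<lambda>w. exp (- \<omega> * I w)) (exp (- \<theta> * (LBINT s:{0<..r}. ln (1 + \<omega> * exp (k * s - b)))))"
proof -
  have eq: "(LINT s:{0<..r}|interval_measure (\<lambda>s. G (max 0 s) w). y * exp (k * s - b)) = y * I w" for y w
    unfolding I_def by (rule set_integral_mult_right)
  have *: "(\<lambda>w. y * I w) \<in> borel_measurable M \<and>
    has_bochner_integral M (\<lambda>w. exp (- (y * I w))) (exp (- \<theta> * (LBINT s:{0<..r}. ln (1 + y * exp (k * s - b)))))"
    if y: "0 \<le> y \<or> (-1 < y \<and> k * r \<le> b)" for y
  proof -
    have gt: "-1 < y * exp (k * s - b)" if "s \<in> {0..r}" for s
      using y
    proof
      assume "0 \<le> y"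
      then have "0 \<le> y * exp (k * s - b)" by simp
      then show ?thesis by linarith
    next
      assume *: "-1 < y \<and> k * r \<le> b"
      have "k * s \<le> k * r" using that k by simp
      then have "exp (k * s - b) \<le> 1" using * by simp
      then show ?thesis using one_plus_mult_pos[of y "exp (k * s - b)"] * by simp
    qed
    have dom: "(\<forall>s\<in>{0..r}. 0 \<le> y * exp (k * s - b)) \<or> (\<forall>s\<in>{0..r}. \<forall>t\<in>{0..r}. s \<le> t \<longrightarrow> y * exp (k * t - b) \<le> y * exp (k * s - b))"
    proof (cases "0 \<le> y")
      case False
      then have "y * exp (k * t - b) \<le> y * exp (k * s - b)" if "s \<le> t" for s t
        using that k by (intro mult_left_mono_neg) auto
      then show ?thesis by blast
    qed simp
    have cont: "continuous_on {0..r} (\<lambda>s. y * exp (k * s - b))" by (intro continuous_intros)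
    show ?thesis
      using laplace_gamma_process_integral[OF G th r cont gt dom] unfolding eq by blast
  qed
  show "I \<in> borel_measurable M" using *[of 1] by simp
  show "has_bochner_integral M (\<lambda>w. exp (- \<omega> * I w)) (exp (- \<theta> * (LBINT s:{0<..r}. ln (1 + \<omega> * exp (k * s - b)))))"
    using *[OF \<omega>] by simp
qed

lemma
  assumes G: "gamma_process M G \<theta>" and th: "0 < \<theta>" and lam: "0 < lam" and Del: "0 < Del" and a: "a = lam * Del"
  shows borel_measurable_ou_increment: "ou_increment G lam Del \<in> borel_measurable M"
    and laplace_ou_increment: "-1 < \<omega> \<Longrightarrow> has_bochner_integral M (\<lambda>w. exp (- \<omega> * ou_increment G lam Del w)) (exp (- \<theta> * log_transform a \<omega>))"
    and ou_increment_nonneg: "0 \<le> ou_increment G lam Del w"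
proof -
  have a0: "0 < a" using lam Del a by simp
  have eq: "ou_increment G lam Del = (\<lambda>w. LINT s:{0<..a}|interval_measure (\<lambda>s. G (max 0 s) w). exp (1 * s - a))"
    by (intro ext) (simp only: ou_increment_eq[OF lam] a mult_1)
  have *: "(\<lambda>w. LINT s:{0<..a}|interval_measure (\<lambda>s. G (max 0 s) w). exp (1 * s - a)) \<in> borel_measurable M"
    by (rule gamma_process_exp_integral(1)[OF G th a0, of 1 0]) auto
  show "ou_increment G lam Del \<in> borel_measurable M" unfolding eq by (rule *)
  show "0 \<le> ou_increment G lam Del w" unfolding eq set_lebesgue_integral_def by (intro Bochner_Integration.integral_nonneg) auto
  assume \<omega>: "-1 < \<omega>"
  have "has_bochner_integral M (\<lambda>w. exp (- \<omega> * ou_increment G lam Del w)) (exp (- \<theta> * (LBINT s:{0<..a}. ln (1 + \<omega> * exp (1 * s - a)))))"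
    unfolding eq by (rule gamma_process_exp_integral(2)[OF G th a0]) (use \<omega> in auto)
  then show "has_bochner_integral M (\<lambda>w. exp (- \<omega> * ou_increment G lam Del w)) (exp (- \<theta> * log_transform a \<omega>))"
    using log_transform_process[of a \<omega>] a0 \<omega> by simp
qed

lemma laplace_sum_PiM:
  fixes \<nu> :: "real measure"
  assumes "prob_space \<nu>" and [measurable_cong]: "sets \<nu> = sets borel" and i: "integrable \<nu> (\<lambda>x. exp (- \<omega> * x))"
  shows "(LINT y|distr (PiM {..<n::nat} (\<lambda>_. \<nu>)) borel (\<lambda>x. \<Sum>i<n. x i). exp (- \<omega> * y)) = (LINT x|\<nu>. exp (- \<omega> * x)) ^ n"
proof -
  interpret prob_space \<nu> by fact
  interpret product_sigma_finite "\<lambda>_::nat. \<nu>" by unfold_locales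
  have "(LINT y|distr (PiM {..<n} (\<lambda>_. \<nu>)) borel (\<lambda>x. \<Sum>i<n. x i). exp (- \<omega> * y)) = (LINT x|PiM {..<n} (\<lambda>_. \<nu>). (\<Prod>i<n. exp (- \<omega> * x i)))"
    by (subst integral_distr) (auto simp: exp_sum sum_distrib_left)
  also have "\<dots> = (\<Prod>i<n. LINT x|\<nu>. exp (- \<omega> * x))"
    by (rule product_integral_prod) (use i in auto)
  finally show ?thesis by simp
qed

text \<open>The \<open>n\<close>-th convolution root is again an integral against the gamma process: running through the same integrand at
speed \<open>n\<close> on \<open>(0, a / n]\<close> divides the exponent by \<open>n\<close>.\<close>

lemma infinitely_divisible_ou:
  assumes G: "gamma_process M G \<theta>" and th: "0 < \<theta>" and lam: "0 < lam" and Del: "0 < Del"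
  shows "infinitely_divisible (distr M borel (ou_increment G lam Del))"
proof -
  define a where "a = lam * Del"
  have a0: "0 < a" using lam Del by (simp add: a_def)
  interpret prob_space M using G by (simp add: gamma_process_def subordinator_def)
  note m [measurable] = borel_measurable_ou_increment[OF G th lam Del a_def]
  have "\<exists>\<nu>. prob_space \<nu> \<and> sets \<nu> = sets borel \<and> distr M borel (ou_increment G lam Del) = distr (PiM {..<n} (\<lambda>_. \<nu>)) borel (\<lambda>x. \<Sum>i<n. x i)"
    if n: "1 \<le> n" for n :: nat
  proof -
    define I where "I = (\<lambda>w. LINT s:{0<..a / real n}|interval_measure (\<lambda>s. G (max 0 s) w). exp (real n * s - a))"
    have r: "0 < a / real n" "0 < real n" using a0 n by auto
    have [measurable]: "I \<in> borel_measurable M" unfolding I_def by (rule gamma_process_exp_integral(1)[OF G th r, of 0]) simp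
    define \<nu> where "\<nu> = distr M borel I"
    interpret \<nu>: prob_space \<nu> unfolding \<nu>_def by (rule prob_space_distr) measurable
    have [measurable_cong, simp]: "sets \<nu> = sets borel" by (simp add: \<nu>_def)
    have I0: "0 \<le> I w" for w unfolding I_def set_lebesgue_integral_def by (intro Bochner_Integration.integral_nonneg) auto
    have nu0: "AE x in \<nu>. 0 \<le> x" unfolding \<nu>_def by (subst AE_distr_iff) (auto simp: I0)
    have lapI: "has_bochner_integral \<nu> (\<lambda>x. exp (- \<omega> * x)) (exp (- \<theta> / real n * log_transform a \<omega>))" if \<omega>: "0 \<le> \<omega>" for \<omega>
    proof -
      have "has_bochner_integral M (\<lambda>w. exp (- \<omega> * I w)) (exp (- \<theta> * (LBINT s:{0<..a / real n}. ln (1 + \<omega> * exp (real n * s - a)))))"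
        unfolding I_def by (rule gamma_process_exp_integral(2)[OF G th r]) (use \<omega> in auto)
      moreover have "(LBINT s:{0<..a / real n}. ln (1 + \<omega> * exp (real n * s - a))) = log_transform a \<omega> / real n"
      proof -
        have "log_transform a \<omega> = (LBINT s. indicator {0<..a} s *\<^sub>R ln (1 + \<omega> * exp (s - a)))"
          using log_transform_process[of a \<omega>] a0 \<omega> by (simp add: set_lebesgue_integral_def)
        also have "\<dots> = \<bar>real n\<bar> *\<^sub>R (LBINT s. indicator {0<..a} (0 + real n * s) *\<^sub>R ln (1 + \<omega> * exp (0 + real n * s - a)))"
          using n by (intro lborel_integral_real_affine) simp
        also have "(LBINT s. indicator {0<..a} (0 + real n * s) *\<^sub>R ln (1 + \<omega> * exp (0 + real n * s - a))) = (LBINT s:{0<..a / real n}. ln (1 + \<omega> * exp (real n * s - a)))"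
          unfolding set_lebesgue_integral_def using n
          by (intro Bochner_Integration.integral_cong refl) (auto simp: indicator_def field_simps zero_less_mult_iff)
        finally show ?thesis using n by simp
      qed
      ultimately have "has_bochner_integral M (\<lambda>w. exp (- \<omega> * I w)) (exp (- \<theta> / real n * log_transform a \<omega>))" by simp
      then show ?thesis unfolding \<nu>_def by (simp add: has_bochner_integral_iff integrable_distr_eq integral_distr)
    qed
    have "distr M borel (ou_increment G lam Del) = distr (PiM {..<n} (\<lambda>_. \<nu>)) borel (\<lambda>x. \<Sum>i<n. x i)"
    proof (rule finite_measure_eqI_laplace)
      interpret PP: product_prob_space "\<lambda>_::nat. \<nu>" "{..<n}" by unfold_locales

      show "finite_measure (distr M borel (ou_increment G lam Del))" by (rule finite_measure_distr) measurable
      show "finite_measure (distr (PiM {..<n} (\<lambda>_. \<nu>)) borel (\<lambda>x. \<Sum>i<n. x i))"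
        by (rule PP.P.finite_measure_distr) measurable
      show "AE x in distr M borel (ou_increment G lam Del). 0 \<le> x"
        by (subst AE_distr_iff) (auto simp: ou_increment_nonneg[OF G th lam Del a_def])
      have "AE x in PiM {..<n} (\<lambda>_. \<nu>). \<forall>i\<in>{..<n}. 0 \<le> x i"
      proof (intro AE_finite_allI finite_lessThan)
        fix i assume "i \<in> {..<n}"
        then show "AE x in PiM {..<n} (\<lambda>_. \<nu>). 0 \<le> x i"
          using nu0 by (intro AE_PiM_component) (auto intro: \<nu>.prob_space_axioms)
      qed
      then show "AE x in distr (PiM {..<n} (\<lambda>_. \<nu>)) borel (\<lambda>x. \<Sum>i<n. x i). 0 \<le> x"
        by (subst AE_distr_iff) (auto elim!: eventually_mono intro!: sum_nonneg)
      fix k :: nat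
      have k: "-1 < real k" "0 \<le> real k" by auto
      have "(LINT x|distr (PiM {..<n} (\<lambda>_. \<nu>)) borel (\<lambda>x. \<Sum>i<n. x i). exp (- real k * x)) = (exp (- \<theta> / real n * log_transform a (real k))) ^ n"
        using lapI[OF k(2)] by (subst laplace_sum_PiM) (auto simp: \<nu>.prob_space_axioms has_bochner_integral_iff)
      also have "\<dots> = exp (- \<theta> * log_transform a (real k))"
        using n by (simp add: exp_of_nat_mult[symmetric])
      also have "\<dots> = (LINT x|distr M borel (ou_increment G lam Del). exp (- real k * x))"
        using has_bochner_integral_integral_eq[OF laplace_ou_increment[OF G th lam Del a_def k(1)]] by (subst integral_distr) auto
      finally show "(LINT x|distr M borel (ou_increment G lam Del). exp (- real k * x)) = (LINT x|distr (PiM {..<n} (\<lambda>_. \<nu>)) borel (\<lambda>x. \<Sum>i<n. x i). exp (- real k * x))" by simp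
    qed auto
    then show ?thesis using \<nu>.prob_space_axioms by auto
  qed
  then show ?thesis unfolding infinitely_divisible_def by (auto intro: prob_space_distr)
qed

text \<open>The Markov--Krein identity. Total mass \<open>S\<close> and unnormalised mean \<open>Z\<close> satisfy the scaling hypothesis of
\<open>gamma_sum_ratio_independent\<close> because \<open>1 + s + \<omega> u = (1 + s) (1 + \<omega> / (1 + s) u)\<close>. Hence \<open>Z\<close> is distributed as a gamma
variable times an independent copy of \<open>Z / S\<close>, and its Laplace transform can be computed in two ways.\<close>

lemma mean_functional_gamma_mixture:
  assumes dir: "dirichlet_process N P (scale_measure (ennreal c) (F_law a))" and a: "0 < a" and c: "0 < c"
    and D: "D = mean_functional_law N P a"
  shows "prob_space D" and "sets D = sets borel" and "AE x in D. 0 \<le> x \<and> x \<le> 1"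
    and "\<And>\<omega>. 0 \<le> \<omega> \<Longrightarrow> (LINT x|D. (1 + \<omega> * x) powr (- c)) = exp (- (c / a) * log_transform a \<omega>)"
proof -
  obtain \<Gamma> where gam: "gamma_random_measure N \<Gamma> (scale_measure (ennreal c) (F_law a))"
    and P: "\<And>w. w \<in> space N \<Longrightarrow> P w = scale_measure (1 / emeasure (\<Gamma> w) (space (\<Gamma> w))) (\<Gamma> w)"
    using dir unfolding dirichlet_process_def by blast
  define S where "S = (\<lambda>w. measure (\<Gamma> w) UNIV)"
  define Z where "Z = (\<lambda>w. LINT x:{exp (- a)..1}|\<Gamma> w. x)"
  have N: "prob_space N" and G: "\<And>w. w \<in> space N \<Longrightarrow> finite_measure (\<Gamma> w)" "\<And>w. w \<in> space N \<Longrightarrow> sets (\<Gamma> w) = sets borel"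
    using gam unfolding gamma_random_measure_def by auto
  interpret prob_space N by (rule N)
  interpret F: prob_space "F_law a" by (rule prob_space_F_law[OF a])
  have lap: "(\<lambda>w. s * S w + \<omega> * Z w) \<in> borel_measurable N"
    "(LINT w|N. exp (- (s * S w + \<omega> * Z w))) = exp (- c * (LINT u|F_law a. ln (1 + s + \<omega> * u)))"
    if "0 \<le> s" "0 \<le> \<omega>" for s \<omega>
    unfolding S_def Z_def using that by (rule laplace_gamma_random_measure[OF gam a c])+
  have Sm [measurable]: "S \<in> borel_measurable N" using lap(1)[of 1 0] by simp
  have Zm [measurable]: "Z \<in> borel_measurable N" using lap(1)[of 0 1] by simp
  have sp: "space (\<Gamma> w) = UNIV" if "w \<in> space N" for w using sets_eq_imp_space_eq[OF G(2)[OF that]] by simp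
  have ZS: "0 \<le> Z w \<and> Z w \<le> S w" if w: "w \<in> space N" for w
  proof -
    interpret g: finite_measure "\<Gamma> w" by (rule G(1)[OF w])
    note [measurable_cong] = G(2)[OF w]
    have b: "0 \<le> indicator {exp (- a)..1} u * u" "indicator {exp (- a)..1} u * u \<le> 1" for u :: real
      using less_le_trans[OF exp_gt_zero, of "- a" u] by (auto simp: indicator_def)
    have i: "integrable (\<Gamma> w) (\<lambda>u. indicator {exp (- a)..1} u * u)"
      by (rule g.integrable_const_bound[of _ 1]) (use b in \<open>auto simp: abs_le_iff intro: order_trans[OF _ b(1)]\<close>)
    have "Z w \<le> (LINT u|\<Gamma> w. 1)"
      unfolding Z_def set_lebesgue_integral_def real_scaleR_def by (intro integral_mono i) (use b in auto)
    then show ?thesis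
      using b by (auto simp: Z_def set_lebesgue_integral_def S_def sp[OF w] intro!: Bochner_Integration.integral_nonneg)
  qed
  have joint: "(LINT w|N. exp (- s * S w - \<omega> * Z w)) = (1 + s) powr (- c) * (LINT w|N. exp (- (\<omega> / (1 + s)) * Z w))"
    if s: "0 \<le> s" and \<omega>: "0 \<le> \<omega>" for s \<omega>
  proof -
    have "(LINT u|F_law a. ln (1 + s + \<omega> * u)) = (LINT u|F_law a. ln (1 + s) + ln (1 + \<omega> / (1 + s) * u))"
    proof (rule integral_cong_AE)
      show "AE u in F_law a. ln (1 + s + \<omega> * u) = ln (1 + s) + ln (1 + \<omega> / (1 + s) * u)"
        using AE_F_law[of a]
      proof eventually_elim
        case (elim u)
        then have "0 \<le> u" using less_le_trans[OF exp_gt_zero, of "- a" u] by simp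
        then have "0 \<le> \<omega> / (1 + s) * u" using s \<omega> by simp
        then have "ln ((1 + s) * (1 + \<omega> / (1 + s) * u)) = ln (1 + s) + ln (1 + \<omega> / (1 + s) * u)"
          using s by (intro ln_mult_pos) linarith+
        moreover have "(1 + s) * (1 + \<omega> / (1 + s) * u) = 1 + s + \<omega> * u" using s by (simp add: field_simps)
        ultimately show ?case by simp
      qed
    qed measurable
    also have "\<dots> = ln (1 + s) + (LINT u|F_law a. ln (1 + \<omega> / (1 + s) * u))"
    proof -
      have "integrable (F_law a) (\<lambda>u. ln (1 + \<omega> / (1 + s) * u))"
      proof (rule F.integrable_const_bound[of _ "\<omega> / (1 + s)"])
        show "AE u in F_law a. norm (ln (1 + \<omega> / (1 + s) * u)) \<le> \<omega> / (1 + s)"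
          using AE_F_law[of a]
        proof eventually_elim
          case (elim u)
          then have u: "0 \<le> u" "u \<le> 1" using less_le_trans[OF exp_gt_zero, of "- a" u] by auto
          then have "0 \<le> \<omega> / (1 + s) * u" using s \<omega> by simp
          moreover have "\<omega> / (1 + s) * u \<le> \<omega> / (1 + s)" using u s \<omega> by (intro mult_left_le) auto
          moreover have "ln (1 + \<omega> / (1 + s) * u) \<le> \<omega> / (1 + s) * u" by (rule ln_add_one_self_le_self) fact
          ultimately show ?case by simp
        qed
      qed measurable
      then show ?thesis by (simp add: F.prob_space)
    qed
    finally have eq: "exp (- c * (LINT u|F_law a. ln (1 + s + \<omega> * u))) = (1 + s) powr (- c) * exp (- c * (LINT u|F_law a. ln (1 + \<omega> / (1 + s) * u)))"
      using s by (simp add: powr_def exp_add[symmetric] algebra_simps)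
    have "(LINT w|N. exp (- s * S w - \<omega> * Z w)) = (LINT w|N. exp (- (s * S w + \<omega> * Z w)))"
      by (intro Bochner_Integration.integral_cong refl) simp
    also have "\<dots> = (1 + s) powr (- c) * exp (- c * (LINT u|F_law a. ln (1 + \<omega> / (1 + s) * u)))"
      using lap(2)[OF s \<omega>] eq by simp
    also have "exp (- c * (LINT u|F_law a. ln (1 + \<omega> / (1 + s) * u))) = (LINT w|N. exp (- (\<omega> / (1 + s)) * Z w))"
      using lap(2)[of 0 "\<omega> / (1 + s)"] s \<omega> by simp
    finally show ?thesis .
  qed
  have law_Z: "distr N borel Z = distr (gamma_law c \<Otimes>\<^sub>M distr N borel (\<lambda>w. Z w / S w)) borel (\<lambda>(t, x). t * x)"
    by (rule gamma_sum_ratio_independent(2)[OF N Sm Zm c _ joint]) (use ZS in auto)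
  have D_eq: "D = distr N borel (\<lambda>w. Z w / S w)"
    unfolding D mean_functional_law_def
  proof (rule distr_cong[OF refl refl])
    fix w assume w: "w \<in> space N"
    interpret g: finite_measure "\<Gamma> w" by (rule G(1)[OF w])
    note [measurable_cong] = G(2)[OF w]
    have Pw: "P w = density (\<Gamma> w) (\<lambda>_. 1 / ennreal (S w))"
      using P[OF w] by (simp add: scale_measure_eq_density S_def sp[OF w] g.emeasure_eq_measure)
    show "(LINT x:{exp (- a)..1}|P w. x) = Z w / S w"
    \<comment> \<open>A null measure has no normalisation: scaling it by \<open>1 / 0 = \<infinity>\<close> leaves it null, and both sides are 0.\<close>
    proof (cases "S w = 0")
      case True
      have "emeasure (\<Gamma> w) (space (\<Gamma> w)) = 0" using True by (simp add: S_def sp[OF w] g.emeasure_eq_measure)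
      then have "AE u in \<Gamma> w. False" by (intro AE_I[of _ _ "space (\<Gamma> w)"]) auto
      then have "AE u in P w. False" unfolding Pw by (subst AE_density) auto
      then have "(LINT x:{exp (- a)..1}|P w. x) = (LINT x|P w. 0)"
        unfolding set_lebesgue_integral_def by (intro integral_cong_AE) (auto simp: Pw)
      then show ?thesis using True by simp
    next
      case False
      then have S: "0 < S w" using ZS[OF w] by linarith
      then have Pw': "P w = density (\<Gamma> w) (\<lambda>_. ennreal (1 / S w))"
        using Pw by (simp add: divide_ennreal[symmetric])
      have "(LINT x:{exp (- a)..1}|P w. x) = (LINT x|\<Gamma> w. (1 / S w) *\<^sub>R (indicator {exp (- a)..1} x *\<^sub>R x))"
        unfolding set_lebesgue_integral_def Pw' using S by (intro integral_density) auto
      then show ?thesis by (simp add: Z_def set_lebesgue_integral_def)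
    qed
  qed
  show "prob_space D" unfolding D_eq by (rule prob_space_distr) measurable
  show sets: "sets D = sets borel" by (simp add: D_eq)
  show AE: "AE x in D. 0 \<le> x \<and> x \<le> 1"
    unfolding D_eq
  proof (subst AE_distr_iff)
    show "AE w in N. 0 \<le> Z w / S w \<and> Z w / S w \<le> 1"
    proof (rule AE_I2)
      fix w assume "w \<in> space N"
      then show "0 \<le> Z w / S w \<and> Z w / S w \<le> 1"
        using ZS[of w] by (cases "S w = 0") (auto simp: divide_le_eq_1)
    qed
  qed auto
  fix \<omega> :: real assume \<omega>: "0 \<le> \<omega>"
  have "(LINT x|D. (1 + \<omega> * x) powr (- c)) = (LINT z|distr N borel Z. exp (- \<omega> * z))"
    unfolding law_Z D_eq[symmetric]
    using laplace_gamma_times[OF c, of D \<omega>] \<open>prob_space D\<close> sets AE \<omega> by (auto simp: prob_space.finite_measure)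
  also have "\<dots> = exp (- c * (LINT u|F_law a. ln (1 + \<omega> * u)))"
    using lap(2)[of 0 \<omega>] \<omega> by (subst integral_distr) auto
  also have "\<dots> = exp (- (c / a) * log_transform a \<omega>)"
    using \<omega> a by (simp add: integral_F_law_ln)
  finally show "(LINT x|D. (1 + \<omega> * x) powr (- c)) = exp (- (c / a) * log_transform a \<omega>)" .
qed

text \<open>Both sides have the Laplace transform \<open>exp (- \<theta> * log_transform a \<omega>)\<close>, the right-hand side by the Markov--Krein
identity.\<close>

lemma ou_law_eq_gamma_times_mean:
  assumes G: "gamma_process M G \<theta>" and th: "0 < \<theta>" and lam: "0 < lam" and Del: "0 < Del" and a: "a = lam * Del"
    and dir: "dirichlet_process N P (scale_measure (ennreal (\<theta> * a)) (F_law a))" and D: "D = mean_functional_law N P a"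
  shows "distr M borel (ou_increment G lam Del) = distr (gamma_law (\<theta> * a) \<Otimes>\<^sub>M D) borel (\<lambda>(t, x). t * x)"
proof (rule finite_measure_eqI_laplace)
  have a0: "0 < a" using lam Del a by simp
  have c: "0 < \<theta> * a" using th a0 by simp
  note mf = mean_functional_gamma_mixture[OF dir a0 c D]
  interpret prob_space M using G by (simp add: gamma_process_def subordinator_def)
  note m [measurable] = borel_measurable_ou_increment[OF G th lam Del a]
  interpret D: prob_space D by (rule mf(1))
  interpret g: prob_space "gamma_law (\<theta> * a)" using c by (intro prob_space_gamma_law) simp
  note [measurable_cong] = mf(2)
  interpret gD: pair_prob_space "gamma_law (\<theta> * a)" D ..
  show "finite_measure (distr M borel (ou_increment G lam Del))" by (rule finite_measure_distr) measurable
  show "finite_measure (distr (gamma_law (\<theta> * a) \<Otimes>\<^sub>M D) borel (\<lambda>(t, x). t * x))"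
    by (rule gD.finite_measure_distr) measurable
  show "AE x in distr M borel (ou_increment G lam Del). 0 \<le> x"
    by (subst AE_distr_iff) (auto simp: ou_increment_nonneg[OF G th lam Del a])
  show "AE x in distr (gamma_law (\<theta> * a) \<Otimes>\<^sub>M D) borel (\<lambda>(t, x). t * x). 0 \<le> x"
  proof (subst AE_distr_iff)
    show "AE p in gamma_law (\<theta> * a) \<Otimes>\<^sub>M D. 0 \<le> (case p of (t, x) \<Rightarrow> t * x)"
    proof (rule gD.AE_pair_measure)
      show "AE t in gamma_law (\<theta> * a). AE x in D. 0 \<le> (case (t, x) of (t, x) \<Rightarrow> t * x)"
        using AE_gamma_law_nonneg[of "\<theta> * a"]
      proof eventually_elim
        case (elim t) then show ?case using mf(3) by (auto elim!: eventually_mono)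
      qed
    qed measurable
  qed auto
  fix k :: nat
  have "(LINT x|distr M borel (ou_increment G lam Del). exp (- real k * x)) = exp (- \<theta> * log_transform a (real k))"
    using has_bochner_integral_integral_eq[OF laplace_ou_increment[OF G th lam Del a, of "real k"]] by (subst integral_distr) auto
  also have "\<dots> = (LINT x|D. (1 + real k * x) powr (- (\<theta> * a)))"
    using mf(4)[of "real k"] a0 by simp
  also have "\<dots> = (LINT x|distr (gamma_law (\<theta> * a) \<Otimes>\<^sub>M D) borel (\<lambda>(t, x). t * x). exp (- real k * x))"
    using mf(2,3) D.finite_measure_axioms by (subst laplace_gamma_times[OF c]) auto
  finally show "(LINT x|distr M borel (ou_increment G lam Del). exp (- real k * x)) = (LINT x|distr (gamma_law (\<theta> * a) \<Otimes>\<^sub>M D) borel (\<lambda>(t, x). t * x). exp (- real k * x))" .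
qed auto

section \<open>The exponent in terms of the dilogarithm\<close>

lemma set_integrable_ln_over:
  fixes \<omega> b :: real
  assumes "0 \<le> \<omega>"
  shows "set_integrable lborel {0<..b} (\<lambda>u. ln (1 + \<omega> * u) / u)"
  unfolding set_integrable_def
proof (rule Bochner_Integration.integrable_bound[where f = "\<lambda>u. indicator {0<..b} u *\<^sub>R \<omega>"])
  show "integrable lborel (\<lambda>u::real. indicator {0<..b} u *\<^sub>R \<omega>)"
    by (cases "0 \<le> b") (auto simp: integrable_real_indicator)
  show "AE u in lborel. norm (indicator {0<..b} u *\<^sub>R (ln (1 + \<omega> * u) / u)) \<le> norm (indicator {0<..b} u *\<^sub>R \<omega>)"
  proof (rule AE_I2)
    fix u :: real
    show "norm (indicator {0<..b} u *\<^sub>R (ln (1 + \<omega> * u) / u)) \<le> norm (indicator {0<..b} u *\<^sub>R \<omega>)"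
    proof (cases "u \<in> {0<..b}")
      case True
      then have u: "0 < u" by simp
      have "0 \<le> \<omega> * u" using assms u by simp
      then have "0 \<le> ln (1 + \<omega> * u)" "ln (1 + \<omega> * u) \<le> \<omega> * u" using ln_add_one_self_le_self by auto
      then have "0 \<le> ln (1 + \<omega> * u) / u" "ln (1 + \<omega> * u) / u \<le> \<omega>" using u by (auto simp: pos_divide_le_eq)
      then show ?thesis using True assms by simp
    qed simp
  qed
qed measurable

text \<open>The definition of \<open>Li2\<close> integrates over the negative axis with orientation; reflecting and rescaling yields an integral over
\<open>(0, b]\<close>.\<close>

lemma Li2_neg:
  assumes w: "0 \<le> \<omega>" and b: "0 \<le> b"
  shows "Li2 (- \<omega> * b) = - (LBINT u:{0<..b}. ln (1 + \<omega> * u) / u)"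
proof (cases "\<omega> = 0 \<or> b = 0")
  case True
  then show ?thesis by (auto simp: Li2_def zero_ereal_def[symmetric] set_lebesgue_integral_def)
next
  case False
  then have pos: "0 < \<omega>" "0 < b" using w b by auto
  have "(LBINT u=0..ereal (- \<omega> * b). ln (1 - u) / u) = (LBINT u=ereal (\<omega> * b)..0. ln (1 + u) / (- u))"
    by (subst interval_integral_reflect) (simp add: zero_ereal_def)
  also have "\<dots> = - (LBINT u=0..ereal (\<omega> * b). ln (1 + u) / (- u))"
    by (rule interval_integral_endpoints_reverse)
  also have "\<dots> = (LBINT u=0..ereal (\<omega> * b). ln (1 + u) / u)"
    by (simp add: interval_lebesgue_integral_uminus[symmetric])
  also have "\<dots> = (LBINT u:{0<..\<omega> * b}. ln (1 + u) / u)"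
    using interval_integral_Ioc[of 0 "\<omega> * b" "\<lambda>u. ln (1 + u) / u"] pos by (simp add: zero_ereal_def)
  also have "\<dots> = \<bar>\<omega>\<bar> *\<^sub>R (LBINT u. indicator {0<..\<omega> * b} (0 + \<omega> * u) *\<^sub>R (ln (1 + (0 + \<omega> * u)) / (0 + \<omega> * u)))"
    unfolding set_lebesgue_integral_def using pos by (intro lborel_integral_real_affine) simp
  also have "\<dots> = (LBINT u. \<omega> * (indicator {0<..\<omega> * b} (0 + \<omega> * u) *\<^sub>R (ln (1 + (0 + \<omega> * u)) / (0 + \<omega> * u))))"
    using pos by (subst integral_mult_right_zero) simp
  also have "\<dots> = (LBINT u:{0<..b}. ln (1 + \<omega> * u) / u)"
    unfolding set_lebesgue_integral_def
    by (intro Bochner_Integration.integral_cong refl) (use pos in \<open>auto simp: indicator_def zero_less_mult_iff\<close>)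
  finally show ?thesis by (simp add: Li2_def)
qed

lemma log_transform_split:
  assumes a: "0 < a" and w: "0 \<le> \<omega>"
  shows "log_transform a \<omega> = (LBINT u:{0<..1}. ln (1 + \<omega> * u) / u) - (LBINT u:{0<..exp (- a)}. ln (1 + \<omega> * u) / u)"
proof -
  have e: "0 < exp (- a)" "exp (- a) < 1" using a by auto
  have "(LBINT u:{0<..1}. ln (1 + \<omega> * u) / u) = (LBINT u:{0<..exp (- a)} \<union> {exp (- a)<..1}. ln (1 + \<omega> * u) / u)"
    by (intro arg_cong[where f = "\<lambda>A. LBINT u:A. ln (1 + \<omega> * u) / u"])
       (auto intro: order_trans[OF _ less_imp_le[OF e(2)]] less_trans[OF e(1)])
  also have "\<dots> = (LBINT u:{0<..exp (- a)}. ln (1 + \<omega> * u) / u) + (LBINT u:{exp (- a)<..1}. ln (1 + \<omega> * u) / u)"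
  proof (rule set_integral_Un)
    show "set_integrable lborel {exp (- a)<..1} (\<lambda>u. ln (1 + \<omega> * u) / u)"
      by (rule set_integrable_subset[OF set_integrable_ln_over[OF w, of 1]]) (auto intro: less_trans[OF e(1)])
  qed (auto intro: set_integrable_ln_over[OF w])
  also have "(LBINT u:{exp (- a)<..1}. ln (1 + \<omega> * u) / u) = log_transform a \<omega>"
    unfolding log_transform_def set_lebesgue_integral_def
  proof (rule integral_cong_AE)
    have "AE u in lborel. u \<noteq> exp (- a)" by (rule AE_lborel_singleton)
    then show "AE u in lborel. indicator {exp (- a)<..1} u *\<^sub>R (ln (1 + \<omega> * u) / u) = indicator {exp (- a)..1} u *\<^sub>R (ln (1 + \<omega> * u) / u)"
      by eventually_elim (auto simp: indicator_def)
  qed measurable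
  finally show ?thesis by simp
qed

lemma log_transform_Li2:
  assumes a: "0 < a" and w: "0 \<le> \<omega>"
  shows "log_transform a \<omega> = - (Li2 (- \<omega>) - Li2 (- \<omega> * exp (- a)))"
  using log_transform_split[OF a w] Li2_neg[OF w, of 1] Li2_neg[OF w, of "exp (- a)"] by simp

lemma log_transform_tendsto:
  assumes w: "0 \<le> \<omega>" and a: "\<And>n. 0 < a n" and lim: "(\<lambda>n. exp (- a n)) \<longlonglongrightarrow> 0"
  shows "(\<lambda>n. log_transform (a n) \<omega>) \<longlonglongrightarrow> (LBINT u:{0<..1}. ln (1 + \<omega> * u) / u)"
proof -
  have b: "0 \<le> (LBINT u:{0<..exp (- a n)}. ln (1 + \<omega> * u) / u)" "(LBINT u:{0<..exp (- a n)}. ln (1 + \<omega> * u) / u) \<le> \<omega> * exp (- a n)" for n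
  proof -
    have i: "set_integrable lborel {0<..exp (- a n)} (\<lambda>u::real. \<omega>)"
      by (auto simp: set_integrable_def integrable_real_indicator)
    have *: "0 \<le> ln (1 + \<omega> * u) / u" "ln (1 + \<omega> * u) / u \<le> \<omega>" if "0 < u" for u
    proof -
      have "0 \<le> \<omega> * u" using w that by simp
      then have "0 \<le> ln (1 + \<omega> * u)" "ln (1 + \<omega> * u) \<le> \<omega> * u" using ln_add_one_self_le_self by auto
      then show "0 \<le> ln (1 + \<omega> * u) / u" "ln (1 + \<omega> * u) / u \<le> \<omega>" using that by (auto simp: pos_divide_le_eq)
    qed
    show "0 \<le> (LBINT u:{0<..exp (- a n)}. ln (1 + \<omega> * u) / u)"
      unfolding set_lebesgue_integral_def by (intro Bochner_Integration.integral_nonneg) (use * in \<open>auto simp: indicator_def\<close>)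
    have "(LBINT u:{0<..exp (- a n)}. ln (1 + \<omega> * u) / u) \<le> (LBINT u:{0<..exp (- a n)}. \<omega>)"
      by (rule set_integral_mono[OF set_integrable_ln_over[OF w] i]) (use * in auto)
    also have "\<dots> = \<omega> * exp (- a n)"
      by (simp add: set_lebesgue_integral_def)
    finally show "(LBINT u:{0<..exp (- a n)}. ln (1 + \<omega> * u) / u) \<le> \<omega> * exp (- a n)" .
  qed
  have "(\<lambda>n. \<omega> * exp (- a n)) \<longlonglongrightarrow> \<omega> * 0" by (intro tendsto_intros lim)
  then have l0: "(\<lambda>n. \<omega> * exp (- a n)) \<longlonglongrightarrow> 0" by simp
  have "(\<lambda>n. LBINT u:{0<..exp (- a n)}. ln (1 + \<omega> * u) / u) \<longlonglongrightarrow> 0"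
    by (rule tendsto_sandwich[OF _ _ tendsto_const l0]) (use b in auto)
  then have "(\<lambda>n. (LBINT u:{0<..1}. ln (1 + \<omega> * u) / u) - (LBINT u:{0<..exp (- a n)}. ln (1 + \<omega> * u) / u)) \<longlonglongrightarrow> (LBINT u:{0<..1}. ln (1 + \<omega> * u) / u) - 0"
    by (intro tendsto_intros)
  then show ?thesis using log_transform_split[OF a w] by simp
qed

text \<open>The form that suits power series and the Levy density: the integration variable enters only through \<open>exp (- s)\<close>.\<close>

lemma log_transform_exp:
  assumes a: "0 \<le> a" and w: "-1 < \<omega>"
  shows "log_transform a \<omega> = (LBINT s:{0..a}. ln (1 + \<omega> * exp (- s)))"
proof -
  have "log_transform a \<omega> = (LBINT s. indicator {0<..a} s *\<^sub>R ln (1 + \<omega> * exp (s - a)))"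
    using log_transform_process[OF a w] by (simp add: set_lebesgue_integral_def)
  also have "\<dots> = \<bar>-1\<bar> *\<^sub>R (LBINT s. indicator {0<..a} (a + -1 * s) *\<^sub>R ln (1 + \<omega> * exp (a + -1 * s - a)))"
    by (rule lborel_integral_real_affine) simp
  also have "\<dots> = (LBINT s. indicator {0<..a} (a + -1 * s) *\<^sub>R ln (1 + \<omega> * exp (a + -1 * s - a)))" by simp
  also have "\<dots> = (LBINT s. indicator {0..a} s *\<^sub>R ln (1 + \<omega> * exp (- s)))"
  proof (rule integral_cong_AE)
    have "AE s in lborel. s \<noteq> a" by (rule AE_lborel_singleton)
    then show "AE s in lborel. indicator {0<..a} (a + -1 * s) *\<^sub>R ln (1 + \<omega> * exp (a + -1 * s - a)) = indicator {0..a} s *\<^sub>R ln (1 + \<omega> * exp (- s))"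
      by eventually_elim (auto simp: indicator_def)
  qed measurable
  finally show ?thesis by (simp add: set_lebesgue_integral_def)
qed

lemma set_integrable_exp_over:
  fixes y :: real
  assumes y: "0 < y" shows "set_integrable lborel {y..} (\<lambda>u. exp (- u) / u)"
  unfolding set_integrable_def
proof (rule Bochner_Integration.integrable_bound)
  show "integrable lborel (\<lambda>x::real. (indicator {0<..} x *\<^sub>R exp (- (x * 1))) / y)"
    using integrable_I0i_exp_mscale[of 1] unfolding set_integrable_def by (intro integrable_divide_zero) simp
  show "AE u in lborel. norm (indicator {y..} u *\<^sub>R (exp (- u) / u)) \<le> norm ((indicator {0<..} u *\<^sub>R exp (- (u * 1))) / y)"
  proof (rule AE_I2)
    fix u :: real
    show "norm (indicator {y..} u *\<^sub>R (exp (- u) / u)) \<le> norm ((indicator {0<..} u *\<^sub>R exp (- (u * 1))) / y)"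
    proof (cases "u \<in> {y..}")
      case True
      then have "0 < u" "y \<le> u" using y by auto
      moreover have "exp (- u) / u \<le> exp (- u) / y" using True y by (intro divide_left_mono) auto
      ultimately show ?thesis using y by simp
    qed (use y in auto)
  qed
qed measurable

section \<open>The Levy density\<close>

definition E_diff :: "real \<Rightarrow> real \<Rightarrow> real" where
  "E_diff a y = E1 y - E1 (y * exp a)"

text \<open>Substituting \<open>u = y * exp s\<close> in the difference of the two tails. The result is a mixture of exponential functions of \<open>y\<close>,
so integrals of the Levy density become integrals over \<open>s\<close> of elementary ones.\<close>

lemma E_diff_eq:
  assumes a: "0 < a" and y: "0 < y"
  shows "E_diff a y = (LBINT s:{0..a}. exp (- y * exp s))"
proof -
  have ye: "y \<le> y * exp a" using a y by simp
  have "E1 y = (LBINT u:{y..<y * exp a} \<union> {y * exp a..}. exp (- u) / u)"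
    unfolding E1_def using ye by (intro arg_cong[where f = "\<lambda>A. LBINT u:A. exp (- u) / u"]) (auto intro: order_trans)
  also have "\<dots> = (LBINT u:{y..<y * exp a}. exp (- u) / u) + (LBINT u:{y * exp a..}. exp (- u) / u)"
    using y ye by (intro set_integral_Un set_integrable_exp_over set_integrable_subset[OF set_integrable_exp_over[OF y]]) auto
  finally have "E_diff a y = (LBINT u:{y..<y * exp a}. exp (- u) / u)" by (simp add: E_diff_def E1_def)
  also have "\<dots> = (LBINT u. (exp (- u) / u) * indicator {y * exp 0..y * exp a} u)"
    unfolding set_lebesgue_integral_def
  proof (rule integral_cong_AE)
    have "AE u in lborel. u \<noteq> y * exp a" by (rule AE_lborel_singleton)
    then show "AE u in lborel. indicator {y..<y * exp a} u *\<^sub>R (exp (- u) / u) = (exp (- u) / u) * indicator {y * exp 0..y * exp a} u"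
      by eventually_elim (auto simp: indicator_def)
  qed measurable
  also have "\<dots> = (LBINT s. (exp (- (y * exp s)) / (y * exp s)) * (y * exp s) * indicator {0..a} s)"
  proof (rule integral_substitution(2))
    show "set_integrable lborel {y * exp 0..y * exp a} (\<lambda>u. exp (- u) / u)"
      by (rule set_integrable_subset[OF set_integrable_exp_over[OF y]]) auto
  qed (use a y in \<open>auto intro!: derivative_eq_intros continuous_intros\<close>)
  also have "\<dots> = (LBINT s:{0..a}. exp (- y * exp s))"
    unfolding set_lebesgue_integral_def using y by (intro Bochner_Integration.integral_cong refl) auto
  finally show ?thesis .
qed

lemma E_diff_nonneg: "0 < a \<Longrightarrow> 0 < y \<Longrightarrow> 0 \<le> E_diff a y"
  unfolding E_diff_eq set_lebesgue_integral_def by (intro Bochner_Integration.integral_nonneg) auto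

lemma ennreal_E_diff:
  assumes a: "0 < a" and y: "0 < y"
  shows "ennreal (E_diff a y) = (\<integral>\<^sup>+s. ennreal (indicator {0..a} s * exp (- y * exp s)) \<partial>lborel)"
proof -
  have "set_integrable lborel {0..a} (\<lambda>s. exp (- y * exp s))"
    by (intro borel_integrable_atLeastAtMost' continuous_intros)
  then show ?thesis
    unfolding E_diff_eq[OF a y] set_lebesgue_integral_def set_integrable_def
    by (subst nn_integral_eq_integral) auto
qed

lemma nn_integral_E_diff:
  fixes \<phi> :: "real \<Rightarrow> real"
  assumes a: "0 < a" and [measurable]: "\<phi> \<in> borel_measurable borel" and nn: "\<And>y. 0 < y \<Longrightarrow> 0 \<le> \<phi> y"
  shows "(\<integral>\<^sup>+y. ennreal (indicator {0<..} y * (\<phi> y * E_diff a y)) \<partial>lborel) =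
    (\<integral>\<^sup>+s. ennreal (indicator {0..a} s) * (\<integral>\<^sup>+y. ennreal (indicator {0<..} y * (\<phi> y * exp (- y * exp s))) \<partial>lborel) \<partial>lborel)"
proof -
  have "(\<integral>\<^sup>+y. ennreal (indicator {0<..} y * (\<phi> y * E_diff a y)) \<partial>lborel) =
      (\<integral>\<^sup>+y. (\<integral>\<^sup>+s. ennreal (indicator {0<..} y * \<phi> y) * ennreal (indicator {0..a} s * exp (- y * exp s)) \<partial>lborel) \<partial>lborel)"
  proof (intro nn_integral_cong)
    fix y :: real
    show "ennreal (indicator {0<..} y * (\<phi> y * E_diff a y)) = (\<integral>\<^sup>+s. ennreal (indicator {0<..} y * \<phi> y) * ennreal (indicator {0..a} s * exp (- y * exp s)) \<partial>lborel)"
    proof (cases "0 < y")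
      case True
      then have "ennreal (indicator {0<..} y * (\<phi> y * E_diff a y)) = ennreal (indicator {0<..} y * \<phi> y) * ennreal (E_diff a y)"
        using nn[OF True] E_diff_nonneg[OF a True] by (simp add: ennreal_mult)
      also have "\<dots> = ennreal (indicator {0<..} y * \<phi> y) * (\<integral>\<^sup>+s. ennreal (indicator {0..a} s * exp (- y * exp s)) \<partial>lborel)"
        by (simp only: ennreal_E_diff[OF a True])
      also have "\<dots> = (\<integral>\<^sup>+s. ennreal (indicator {0<..} y * \<phi> y) * ennreal (indicator {0..a} s * exp (- y * exp s)) \<partial>lborel)"
        by (rule nn_integral_cmult[symmetric]) measurable
      finally show ?thesis .
    qed simp
  qed
  also have "\<dots> = (\<integral>\<^sup>+s. (\<integral>\<^sup>+y. ennreal (indicator {0<..} y * \<phi> y) * ennreal (indicator {0..a} s * exp (- y * exp s)) \<partial>lborel) \<partial>lborel)"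
    by (rule lborel_pair.Fubini') measurable
  also have "\<dots> = (\<integral>\<^sup>+s. ennreal (indicator {0..a} s) * (\<integral>\<^sup>+y. ennreal (indicator {0<..} y * (\<phi> y * exp (- y * exp s))) \<partial>lborel) \<partial>lborel)"
  proof (intro nn_integral_cong)
    fix s :: real
    have "(\<integral>\<^sup>+y. ennreal (indicator {0<..} y * \<phi> y) * ennreal (indicator {0..a} s * exp (- y * exp s)) \<partial>lborel) =
      (\<integral>\<^sup>+y. ennreal (indicator {0..a} s) * ennreal (indicator {0<..} y * (\<phi> y * exp (- y * exp s))) \<partial>lborel)"
    proof (intro nn_integral_cong)
      fix y :: real
      show "ennreal (indicator {0<..} y * \<phi> y) * ennreal (indicator {0..a} s * exp (- y * exp s)) = ennreal (indicator {0..a} s) * ennreal (indicator {0<..} y * (\<phi> y * exp (- y * exp s)))"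
        using nn[of y] by (cases "0 < y") (auto simp: ennreal_mult[symmetric] indicator_def)
    qed
    also have "\<dots> = ennreal (indicator {0..a} s) * (\<integral>\<^sup>+y. ennreal (indicator {0<..} y * (\<phi> y * exp (- y * exp s))) \<partial>lborel)"
      by (rule nn_integral_cmult) measurable
    finally show "(\<integral>\<^sup>+y. ennreal (indicator {0<..} y * \<phi> y) * ennreal (indicator {0..a} s * exp (- y * exp s)) \<partial>lborel) =
      ennreal (indicator {0..a} s) * (\<integral>\<^sup>+y. ennreal (indicator {0<..} y * (\<phi> y * exp (- y * exp s))) \<partial>lborel)" .
  qed
  finally show ?thesis .
qed

text \<open>Frullani's integral, from \<open>(1 - exp (- \<omega> * y)) / y = \<integral> exp (- x * y) dx\<close> over \<open>[0, \<omega>]\<close> and Tonelli.\<close>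

lemma nn_integral_exp_diff_over:
  fixes b \<omega> :: real
  assumes b: "0 < b" and w: "0 \<le> \<omega>"
  shows "(\<integral>\<^sup>+y. ennreal (indicator {0<..} y * ((1 - exp (- \<omega> * y)) / y * exp (- y * b))) \<partial>lborel) = ennreal (ln (1 + \<omega> / b))"
proof -
  have frul: "ennreal ((1 - exp (- \<omega> * y)) / y) = (\<integral>\<^sup>+x. ennreal (exp (- x * y)) * indicator {0..\<omega>} x \<partial>lborel)" if y: "0 < y" for y
  proof -
    have "(\<integral>\<^sup>+x. ennreal (exp (- x * y)) * indicator {0..\<omega>} x \<partial>lborel) = ennreal (- exp (- \<omega> * y) / y - (- exp (- 0 * y) / y))"
      using y w by (intro nn_integral_FTC_Icc) (auto intro!: derivative_eq_intros)
    then show ?thesis using y by (simp add: diff_divide_distrib)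
  qed
  have "(\<integral>\<^sup>+y. ennreal (indicator {0<..} y * ((1 - exp (- \<omega> * y)) / y * exp (- y * b))) \<partial>lborel) =
    (\<integral>\<^sup>+y. (\<integral>\<^sup>+x. ennreal (indicator {0<..} y * exp (- y * b)) * (ennreal (exp (- x * y)) * indicator {0..\<omega>} x) \<partial>lborel) \<partial>lborel)"
  proof (intro nn_integral_cong)
    fix y :: real
    show "ennreal (indicator {0<..} y * ((1 - exp (- \<omega> * y)) / y * exp (- y * b))) = (\<integral>\<^sup>+x. ennreal (indicator {0<..} y * exp (- y * b)) * (ennreal (exp (- x * y)) * indicator {0..\<omega>} x) \<partial>lborel)"
    proof (cases "0 < y")
      case True
      have "0 \<le> (1 - exp (- \<omega> * y)) / y" using True w by simp
      then have "ennreal (indicator {0<..} y * ((1 - exp (- \<omega> * y)) / y * exp (- y * b))) = ennreal (indicator {0<..} y * exp (- y * b)) * ennreal ((1 - exp (- \<omega> * y)) / y)"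
        using True by (simp add: ennreal_mult[symmetric] mult.commute)
      also have "\<dots> = ennreal (indicator {0<..} y * exp (- y * b)) * (\<integral>\<^sup>+x. ennreal (exp (- x * y)) * indicator {0..\<omega>} x \<partial>lborel)"
        by (simp only: frul[OF True])
      also have "\<dots> = (\<integral>\<^sup>+x. ennreal (indicator {0<..} y * exp (- y * b)) * (ennreal (exp (- x * y)) * indicator {0..\<omega>} x) \<partial>lborel)"
        by (rule nn_integral_cmult[symmetric]) measurable
      finally show ?thesis .
    qed simp
  qed
  also have "\<dots> = (\<integral>\<^sup>+x. (\<integral>\<^sup>+y. ennreal (indicator {0<..} y * exp (- y * b)) * (ennreal (exp (- x * y)) * indicator {0..\<omega>} x) \<partial>lborel) \<partial>lborel)"
    by (rule lborel_pair.Fubini') measurable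
  also have "\<dots> = (\<integral>\<^sup>+x. ennreal (1 / (b + x)) * indicator {0..\<omega>} x \<partial>lborel)"
  proof (intro nn_integral_cong)
    fix x :: real
    show "(\<integral>\<^sup>+y. ennreal (indicator {0<..} y * exp (- y * b)) * (ennreal (exp (- x * y)) * indicator {0..\<omega>} x) \<partial>lborel) = ennreal (1 / (b + x)) * indicator {0..\<omega>} x"
    proof (cases "x \<in> {0..\<omega>}")
      case True
      then have bx: "0 < b + x" using b by simp
      have "(\<integral>\<^sup>+y. ennreal (indicator {0<..} y * exp (- y * b)) * (ennreal (exp (- x * y)) * indicator {0..\<omega>} x) \<partial>lborel) =
         (\<integral>\<^sup>+y. ennreal (if 0 < y then y powr (1 - 1) * exp (- (b + x) * y) else 0) \<partial>lborel)"
        using True by (intro nn_integral_cong) (auto simp: ennreal_mult[symmetric] exp_add[symmetric] algebra_simps)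
      also have "\<dots> = ennreal (Gamma 1 * (b + x) powr (- 1))"
        by (rule nn_integral_gamma_kernel) (use bx in auto)
      finally show ?thesis using True bx by (simp add: powr_minus divide_inverse)
    qed simp
  qed
  also have "\<dots> = ennreal (ln (b + \<omega>) - ln (b + 0))"
    using b w by (intro nn_integral_FTC_Icc) (auto intro!: derivative_eq_intros simp: divide_simps)
  also have "ln (b + \<omega>) - ln (b + 0) = ln (1 + \<omega> / b)"
  proof -
    have "(b + \<omega>) / b = 1 + \<omega> / b" using b by (simp add: field_simps)
    moreover have "ln ((b + \<omega>) / b) = ln (b + \<omega>) - ln b" using b w by (intro ln_divide_pos) auto
    ultimately show ?thesis by simp
  qed
  finally show ?thesis .
qed

lemma integral_exp_diff_E_diff:
  assumes a: "0 < a" and w: "0 \<le> \<omega>"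
  shows "set_integrable lborel {0<..} (\<lambda>y. (1 - exp (- \<omega> * y)) / y * E_diff a y)"
    and "(LBINT y:{0<..}. (1 - exp (- \<omega> * y)) / y * E_diff a y) = log_transform a \<omega>"
proof -
  have cont: "continuous_on {0..a} (\<lambda>s. ln (1 + \<omega> * exp (- s)))"
    using w by (intro continuous_intros) (auto intro!: less_imp_neq[symmetric] add_pos_nonneg)
  have i: "set_integrable lborel {0..a} (\<lambda>s. ln (1 + \<omega> * exp (- s)))"
    by (rule borel_integrable_atLeastAtMost'[OF cont])
  have nn: "(\<integral>\<^sup>+y. ennreal (indicator {0<..} y * ((1 - exp (- \<omega> * y)) / y * E_diff a y)) \<partial>lborel) = ennreal (log_transform a \<omega>)"
  proof (subst nn_integral_E_diff[OF a])
    show "0 \<le> (1 - exp (- \<omega> * y)) / y" if "0 < y" for y using that w by simp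
    have "(\<integral>\<^sup>+s. ennreal (indicator {0..a} s) * (\<integral>\<^sup>+y. ennreal (indicator {0<..} y * ((1 - exp (- \<omega> * y)) / y * exp (- y * exp s))) \<partial>lborel) \<partial>lborel) =
      (\<integral>\<^sup>+s. ennreal (indicator {0..a} s * ln (1 + \<omega> * exp (- s))) \<partial>lborel)"
      using w by (intro nn_integral_cong, subst nn_integral_exp_diff_over) (auto simp: ennreal_mult[symmetric] exp_minus divide_inverse)
    also have "\<dots> = ennreal (log_transform a \<omega>)"
      using i w a unfolding log_transform_exp[OF less_imp_le[OF a] less_le_trans[OF neg_less_0_iff_less[THEN iffD2, OF zero_less_one] w]] set_lebesgue_integral_def set_integrable_def
      by (subst nn_integral_eq_integral) (auto simp: indicator_def)
    finally show "(\<integral>\<^sup>+s. ennreal (indicator {0..a} s) * (\<integral>\<^sup>+y. ennreal (indicator {0<..} y * ((1 - exp (- \<omega> * y)) / y * exp (- y * exp s))) \<partial>lborel) \<partial>lborel) = ennreal (log_transform a \<omega>)" .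
  qed measurable
  have m: "(\<lambda>y. indicator {0<..} y *\<^sub>R ((1 - exp (- \<omega> * y)) / y * E_diff a y)) \<in> borel_measurable lborel"
  proof -
    have "(\<lambda>y. indicator {0<..} y *\<^sub>R ((1 - exp (- \<omega> * y)) / y * (LBINT s. indicator {0..a} s *\<^sub>R exp (- y * exp s)))) \<in> borel_measurable lborel"
      by measurable
    also have "(\<lambda>y. indicator {0<..} y *\<^sub>R ((1 - exp (- \<omega> * y)) / y * (LBINT s. indicator {0..a} s *\<^sub>R exp (- y * exp s)))) = (\<lambda>y. indicator {0<..} y *\<^sub>R ((1 - exp (- \<omega> * y)) / y * E_diff a y))"
      using E_diff_eq[OF a] by (auto simp: fun_eq_iff indicator_def set_lebesgue_integral_def)
    finally show ?thesis .
  qed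
  have pos: "0 \<le> indicator {0<..} y *\<^sub>R ((1 - exp (- \<omega> * y)) / y * E_diff a y)" for y
    using E_diff_nonneg[OF a, of y] w by (auto simp: indicator_def)
  have L0: "0 \<le> log_transform a \<omega>"
    unfolding log_transform_exp[OF less_imp_le[OF a] less_le_trans[OF neg_less_0_iff_less[THEN iffD2, OF zero_less_one] w]] set_lebesgue_integral_def
    using w by (intro Bochner_Integration.integral_nonneg) auto
  have "has_bochner_integral lborel (\<lambda>y. indicator {0<..} y *\<^sub>R ((1 - exp (- \<omega> * y)) / y * E_diff a y)) (log_transform a \<omega>)"
    by (rule has_bochner_integral_nn_integral[OF m AE_I2[OF pos] L0]) (use nn in simp)
  then show "set_integrable lborel {0<..} (\<lambda>y. (1 - exp (- \<omega> * y)) / y * E_diff a y)"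
    "(LBINT y:{0<..}. (1 - exp (- \<omega> * y)) / y * E_diff a y) = log_transform a \<omega>"
    by (simp_all add: has_bochner_integral_iff set_integrable_def set_lebesgue_integral_def)
qed

lemma integral_power_E_diff:
  assumes a: "0 < a" and j: "1 \<le> j"
  shows "set_integrable lborel {0<..} (\<lambda>y. y ^ (j - 1) * E_diff a y)"
    and "(LBINT y:{0<..}. y ^ (j - 1) * E_diff a y) = Gamma (real j) / real j * (1 - exp (- a * real j))"
proof -
  have G: "0 < Gamma (real j)" using j by (intro Gamma_real_pos) simp
  have nn: "(\<integral>\<^sup>+y. ennreal (indicator {0<..} y * (y ^ (j - 1) * E_diff a y)) \<partial>lborel) = ennreal (Gamma (real j) / real j * (1 - exp (- a * real j)))"
  proof (subst nn_integral_E_diff[OF a])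
    have inner: "(\<integral>\<^sup>+y. ennreal (indicator {0<..} y * (y ^ (j - 1) * exp (- y * exp s))) \<partial>lborel) = ennreal (Gamma (real j) * exp (- real j * s))" for s
    proof -
      have "(\<integral>\<^sup>+y. ennreal (indicator {0<..} y * (y ^ (j - 1) * exp (- y * exp s))) \<partial>lborel) =
        (\<integral>\<^sup>+y. ennreal (if 0 < y then y powr (real j - 1) * exp (- exp s * y) else 0) \<partial>lborel)"
        using j by (intro nn_integral_cong) (auto simp: powr_realpow[symmetric] of_nat_diff mult.commute)
      also have "\<dots> = ennreal (Gamma (real j) * exp s powr (- real j))"
        by (rule nn_integral_gamma_kernel) (use j in auto)
      finally show ?thesis by (simp add: powr_def mult.commute)
    qed
    have "(\<integral>\<^sup>+s. ennreal (indicator {0..a} s) * (\<integral>\<^sup>+y. ennreal (indicator {0<..} y * (y ^ (j - 1) * exp (- y * exp s))) \<partial>lborel) \<partial>lborel) =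
      (\<integral>\<^sup>+s. ennreal (Gamma (real j) * exp (- real j * s)) * indicator {0..a} s \<partial>lborel)"
      unfolding inner by (intro nn_integral_cong) (auto simp: indicator_def)
    also have "\<dots> = ennreal (- Gamma (real j) / real j * exp (- real j * a) - (- Gamma (real j) / real j * exp (- real j * 0)))"
      using a j G by (intro nn_integral_FTC_Icc) (auto intro!: derivative_eq_intros)
    also have "- Gamma (real j) / real j * exp (- real j * a) - (- Gamma (real j) / real j * exp (- real j * 0)) = Gamma (real j) / real j * (1 - exp (- a * real j))"
      by (simp add: algebra_simps)
    finally show "(\<integral>\<^sup>+s. ennreal (indicator {0..a} s) * (\<integral>\<^sup>+y. ennreal (indicator {0<..} y * (y ^ (j - 1) * exp (- y * exp s))) \<partial>lborel) \<partial>lborel) = ennreal (Gamma (real j) / real j * (1 - exp (- a * real j)))" .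
  qed auto
  have m: "(\<lambda>y. indicator {0<..} y *\<^sub>R (y ^ (j - 1) * E_diff a y)) \<in> borel_measurable lborel"
  proof -
    have "(\<lambda>y. indicator {0<..} y *\<^sub>R (y ^ (j - 1) * (LBINT s. indicator {0..a} s *\<^sub>R exp (- y * exp s)))) \<in> borel_measurable lborel"
      by measurable
    also have "(\<lambda>y. indicator {0<..} y *\<^sub>R (y ^ (j - 1) * (LBINT s. indicator {0..a} s *\<^sub>R exp (- y * exp s)))) = (\<lambda>y. indicator {0<..} y *\<^sub>R (y ^ (j - 1) * E_diff a y))"
      using E_diff_eq[OF a] by (auto simp: fun_eq_iff indicator_def set_lebesgue_integral_def)
    finally show ?thesis .
  qed
  have pos: "0 \<le> indicator {0<..} y *\<^sub>R (y ^ (j - 1) * E_diff a y)" for y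
    using E_diff_nonneg[OF a, of y] by (auto simp: indicator_def)
  have L0: "0 \<le> Gamma (real j) / real j * (1 - exp (- a * real j))" using G a by simp
  have "has_bochner_integral lborel (\<lambda>y. indicator {0<..} y *\<^sub>R (y ^ (j - 1) * E_diff a y)) (Gamma (real j) / real j * (1 - exp (- a * real j)))"
    by (rule has_bochner_integral_nn_integral[OF m AE_I2[OF pos] L0]) (use nn in simp)
  then show "set_integrable lborel {0<..} (\<lambda>y. y ^ (j - 1) * E_diff a y)"
    "(LBINT y:{0<..}. y ^ (j - 1) * E_diff a y) = Gamma (real j) / real j * (1 - exp (- a * real j))"
    by (simp_all add: has_bochner_integral_iff set_integrable_def set_lebesgue_integral_def)
qed

section \<open>Cumulants\<close>

lemma funpow_diffs: "(diffs ^^ j) c n = fact (n + j) / fact n * (c (n + j) :: real)"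
proof (induction j arbitrary: n)
  case (Suc j)
  have "(diffs ^^ Suc j) c n = real (Suc n) * (fact (Suc n + j) / fact (Suc n) * c (Suc n + j))"
    by (simp add: diffs_def Suc)
  also have "\<dots> = fact (n + Suc j) / fact n * c (n + Suc j)"
  proof -
    have "real (Suc n) * (F / fact (Suc n) * C) = F / fact n * C" for F C :: real
      by (simp add: fact_Suc del: of_nat_Suc)
    then show ?thesis by (simp only: add_Suc add_Suc_right)
  qed
  finally show ?case .
qed simp

text \<open>Termwise differentiation; the statement is about all points of the disc so that the induction on \<open>j\<close> goes through.\<close>

lemma funpow_deriv_power_series:
  fixes f :: "real \<Rightarrow> real"
  assumes summ: "\<And>t. \<bar>t\<bar> < r \<Longrightarrow> summable (\<lambda>n. c n * t ^ n)"
    and f: "\<And>t. \<bar>t\<bar> < r \<Longrightarrow> f t = (\<Sum>n. c n * t ^ n)"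
  shows "\<forall>t. \<bar>t\<bar> < r \<longrightarrow> summable (\<lambda>n. (diffs ^^ j) c n * t ^ n) \<and> (deriv ^^ j) f t = (\<Sum>n. (diffs ^^ j) c n * t ^ n)"
proof (induction j)
  case 0
  then show ?case using summ f by simp
next
  case (Suc j)
  show ?case
  proof (intro allI impI conjI)
    fix t :: real assume t: "\<bar>t\<bar> < r"
    have s: "summable (\<lambda>n. (diffs ^^ j) c n * x ^ n)" if "norm x < r" for x using Suc that by simp
    show "summable (\<lambda>n. (diffs ^^ Suc j) c n * t ^ n)"
      using termdiff_converges[of t r "(diffs ^^ j) c"] s t by simp
    have "((\<lambda>z. \<Sum>n. (diffs ^^ j) c n * z ^ n) has_field_derivative (\<Sum>n. diffs ((diffs ^^ j) c) n * t ^ n)) (at t)"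
      by (rule termdiffs_strong'[of r]) (use s t in auto)
    then have "((deriv ^^ j) f has_field_derivative (\<Sum>n. diffs ((diffs ^^ j) c) n * t ^ n)) (at t)"
      by (rule has_field_derivative_transform_within_open[where S = "{- r<..<r}"]) (use Suc t in \<open>auto simp: abs_less_iff\<close>)
    then show "(deriv ^^ Suc j) f t = (\<Sum>n. (diffs ^^ Suc j) c n * t ^ n)"
      by (simp add: DERIV_imp_deriv)
  qed
qed

lemma funpow_deriv_power_series_0:
  fixes f :: "real \<Rightarrow> real"
  assumes "0 < r" "\<And>t. \<bar>t\<bar> < r \<Longrightarrow> (\<lambda>n. c n * t ^ n) sums f t"
  shows "(deriv ^^ j) f 0 = fact j * c j"
proof -
  have "(deriv ^^ j) f 0 = (\<Sum>n. (diffs ^^ j) c n * 0 ^ n)"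
    using funpow_deriv_power_series[of r c f j] assms by (auto simp: sums_iff)
  also have "\<dots> = (diffs ^^ j) c 0" by (rule powser_zero)
  finally show ?thesis by (simp add: funpow_diffs)
qed

lemma integral_exp_nat:
  assumes a: "0 < a"
  shows "(LBINT s:{0..a}. exp (- s) ^ n / real n) = (1 - exp (- a * real n)) / (real n)\<^sup>2"
proof (cases "n = 0")
  case False
  then have n: "0 < real n" by simp
  have "(LBINT s. (exp (- s) ^ n / real n) * indicator {0..a} s) = - (exp (- a) ^ n) / (real n)\<^sup>2 - (- (exp (- 0) ^ n) / (real n)\<^sup>2)"
  proof (rule integral_FTC_Icc_real)
    fix s :: real
    have "((\<lambda>s. - exp (- real n * s) / (real n)\<^sup>2) has_real_derivative exp (- real n * s) / real n) (at s)"
      using n by (auto intro!: derivative_eq_intros simp: power2_eq_square)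
    then show "((\<lambda>s. - (exp (- s) ^ n) / (real n)\<^sup>2) has_real_derivative exp (- s) ^ n / real n) (at s)"
      by (simp add: exp_of_nat_mult[symmetric])
    show "isCont (\<lambda>s. exp (- s) ^ n / real n) s" using n by (intro continuous_intros) auto
  qed (use a in auto)
  then show ?thesis
    by (simp add: set_lebesgue_integral_def mult.commute diff_divide_distrib exp_of_nat_mult[symmetric])
qed (simp add: set_lebesgue_integral_def)

text \<open>Expand \<open>ln (1 - t * exp (- s))\<close> and integrate termwise over \<open>[0, a]\<close>. The coefficient at \<open>n = 0\<close> is 0 because division by 0
is 0.\<close>

lemma log_transform_power_series:
  assumes a: "0 < a" and t: "\<bar>t\<bar> < 1"
  shows "(\<lambda>n. (1 - exp (- a * real n)) / (real n)\<^sup>2 * t ^ n) sums (- log_transform a (- t))"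
proof -
  define f where "f = (\<lambda>n s. indicator {0..a} s * (t ^ n * (exp (- s) ^ n / real n)))"
  have int_e: "integrable lborel (\<lambda>s. indicator {0..a} s * (exp (- s) ^ n / real n))" for n
  proof -
    have "continuous_on {0..a} (\<lambda>s. exp (- s) ^ n / real n)" by (cases "n = 0") (auto intro!: continuous_intros)
    from borel_integrable_atLeastAtMost'[OF this] show ?thesis by (simp add: set_integrable_def)
  qed
  have int_f: "integrable lborel (f n)" for n
    using integrable_mult_right[OF int_e[of n], of "t ^ n"] by (simp add: f_def mult_ac)
  have val: "(LBINT s. f n s) = (1 - exp (- a * real n)) / (real n)\<^sup>2 * t ^ n" for n
  proof -
    have "(LBINT s. f n s) = (LBINT s. t ^ n * (indicator {0..a} s * (exp (- s) ^ n / real n)))"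
      by (simp add: f_def mult_ac)
    also have "\<dots> = t ^ n * (LBINT s:{0..a}. exp (- s) ^ n / real n)"
      by (simp add: set_lebesgue_integral_def)
    finally show ?thesis by (simp only: integral_exp_nat[OF a] mult.commute[of "t ^ n"])
  qed
  have bound: "norm (f n s) \<le> indicator {0..a} s * \<bar>t\<bar> ^ n" for n s
  proof (cases "s \<in> {0..a}")
    case True
    then have "exp (- s) ^ n \<le> 1" by (simp add: power_le_one)
    moreover have "exp (- s) ^ n / real n \<le> exp (- s) ^ n"
      by (cases "n = 0") (auto simp: divide_le_eq mult_le_cancel_left1)
    ultimately have "exp (- s) ^ n / real n \<le> 1" by linarith
    then have "\<bar>t\<bar> ^ n * (exp (- s) ^ n / real n) \<le> \<bar>t\<bar> ^ n * 1" by (intro mult_left_mono) auto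
    then show ?thesis using True by (simp add: f_def abs_mult power_abs)
  qed (simp add: f_def)
  have geo: "summable (\<lambda>n. \<bar>t\<bar> ^ n)" using t by (simp add: summable_geometric)
  have suminf: "(LBINT s. (\<Sum>n. f n s)) = (\<Sum>n. LBINT s. f n s)" and summ: "summable (\<lambda>n. LBINT s. f n s)"
  proof -
    have s1: "AE s in lborel. summable (\<lambda>n. norm (f n s))"
    proof (rule AE_I2)
      fix s
      show "summable (\<lambda>n. norm (f n s))"
        by (rule summable_comparison_test'[OF summable_mult[OF geo, of "indicator {0..a} s"], of 0]) (use bound in auto)
    qed
    have s2: "summable (\<lambda>n. LBINT s. norm (f n s))"
    proof (rule summable_comparison_test'[OF summable_mult[OF geo, of a], of 0])
      fix n
      have i: "integrable lborel (\<lambda>s. indicator {0..a} s * \<bar>t\<bar> ^ n)" using a by (auto intro!: integrable_mult_left integrable_real_indicator)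
      have "(LBINT s. norm (f n s)) \<le> (LBINT s. indicator {0..a} s * \<bar>t\<bar> ^ n)"
        by (intro integral_mono integrable_norm int_f i bound)
      also have "\<dots> = a * \<bar>t\<bar> ^ n" using a by simp
      finally show "norm (LBINT s. norm (f n s)) \<le> a * \<bar>t\<bar> ^ n" by simp
    qed
    show "(LBINT s. (\<Sum>n. f n s)) = (\<Sum>n. LBINT s. f n s)" by (rule integral_suminf[OF int_f s1 s2])
    show "summable (\<lambda>n. LBINT s. f n s)"
      by (rule summable_comparison_test'[OF s2, of 0]) (auto intro: integral_norm_bound[THEN order_trans])
  qed
  have "(\<Sum>n. f n s) = - (indicator {0..a} s * ln (1 + (- t) * exp (- s)))" for s
  proof (cases "s \<in> {0..a}")
    case True
    have "\<bar>t * exp (- s)\<bar> \<le> \<bar>t\<bar> * 1" using True by (simp add: abs_mult mult_left_le)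
    then have "\<bar>- (t * exp (- s))\<bar> < 1" using t by simp
    from ln_series'[OF this] have "(\<lambda>n. - ((t * exp (- s)) ^ n) / real n) sums ln (1 + - (t * exp (- s)))" by simp
    from sums_minus[OF this] have "(\<lambda>n. f n s) sums (- ln (1 + (- t) * exp (- s)))"
      using True by (simp add: f_def power_mult_distrib)
    then show ?thesis using True by (simp add: sums_iff)
  qed (simp add: f_def)
  then have "(LBINT s. (\<Sum>n. f n s)) = - (LBINT s:{0..a}. ln (1 + (- t) * exp (- s)))"
    by (simp add: set_lebesgue_integral_def)
  also have "\<dots> = - log_transform a (- t)"
    using log_transform_exp[of a "- t"] a t by simp
  finally show ?thesis
    using suminf summ by (simp add: sums_iff val)
qed

text \<open>The cumulant generating function is \<open>- \<theta> * log_transform a (- t)\<close> for \<open>\<bar>t\<bar> < 1\<close>, so the \<open>j\<close>-th cumulant is \<open>fact j\<close> times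
a coefficient of its power series.\<close>

lemma has_cumulant_ou:
  assumes G: "gamma_process M G \<theta>" and th: "0 < \<theta>" and lam: "0 < lam" and Del: "0 < Del" and a: "a = lam * Del" and j: "1 \<le> j"
  shows "has_cumulant (distr M borel (ou_increment G lam Del)) j (\<theta> * (Gamma (real j) / real j * (1 - exp (- a * real j))))"
proof -
  have a0: "0 < a" using lam Del a by simp
  note m [measurable] = borel_measurable_ou_increment[OF G th lam Del a]
  define L where "L = distr M borel (ou_increment G lam Del)"
  have mgf: "has_bochner_integral L (\<lambda>x. exp (t * x)) (exp (- \<theta> * log_transform a (- t)))" if "\<bar>t\<bar> < 1" for t
    using laplace_ou_increment[OF G th lam Del a, of "- t"] that
    by (simp add: L_def has_bochner_integral_iff integrable_distr_eq integral_distr)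
  have ser: "(\<lambda>n. \<theta> * ((1 - exp (- a * real n)) / (real n)\<^sup>2) * t ^ n) sums ln (LINT x|L. exp (t * x))" if "\<bar>t\<bar> < 1" for t
    using sums_mult[OF log_transform_power_series[OF a0 that], of \<theta>] has_bochner_integral_integral_eq[OF mgf[OF that]]
    by (simp add: mult.assoc)
  have "(deriv ^^ j) (\<lambda>t. ln (LINT x|L. exp (t * x))) 0 = fact j * (\<theta> * ((1 - exp (- a * real j)) / (real j)\<^sup>2))"
    by (rule funpow_deriv_power_series_0[of 1]) (use ser in auto)
  also have "\<dots> = \<theta> * (Gamma (real j) / real j * (1 - exp (- a * real j)))"
  proof -
    obtain k where k: "j = Suc k" using j by (cases j) auto
    have "Gamma (real j) = fact k" using Gamma_fact[of k, where 'a = real] by (simp add: k add.commute)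
    moreover have "fact j = real j * fact k" by (simp add: k)
    ultimately show ?thesis using j by (simp add: power2_eq_square)
  qed
  finally have "(deriv ^^ j) (\<lambda>t. ln (LINT x|L. exp (t * x))) 0 = \<theta> * (Gamma (real j) / real j * (1 - exp (- a * real j)))" .
  moreover have "\<exists>\<epsilon>>0. \<forall>t. \<bar>t\<bar> < \<epsilon> \<longrightarrow> integrable L (\<lambda>x. exp (t * x))"
    using mgf by (intro exI[of _ 1]) (auto intro: integrable.intros)
  ultimately show ?thesis unfolding has_cumulant_def L_def[symmetric] by blast
qed

section \<open>A logarithm on the closed upper half plane\<close>

text \<open>The branch of the logarithm with cut along the negative imaginary axis. It is continuous on the closed upper half plane
without 0, and its imaginary part is 0 on the positive and \<open>pi\<close> on the negative half line: these are the boundary values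
approached from above. The value at 0 is chosen such that \<open>Re (Lg w) = ln (norm w)\<close> holds there too.\<close>

definition Lg :: "complex \<Rightarrow> complex" where
  "Lg w = (if w = 0 then 0 else Ln (- \<i> * w) + \<i> * (pi / 2))"

lemma Re_Lg: "Re (Lg w) = ln (norm w)"
  by (cases "w = 0") (auto simp: Lg_def norm_mult)

lemma abs_Im_Lg: "\<bar>Im (Lg w)\<bar> \<le> 2 * pi"
proof (cases "w = 0")
  case False
  then have "- \<i> * w \<noteq> 0" by simp
  then have "- pi < Im (Ln (- \<i> * w))" "Im (Ln (- \<i> * w)) \<le> pi"
    using mpi_less_Im_Ln Im_Ln_le_pi by blast+
  then have "\<bar>Im (Ln (- \<i> * w)) + pi / 2\<bar> \<le> 2 * pi" by linarith
  then show ?thesis using False unfolding Lg_def by simp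
qed (simp add: Lg_def)

lemma norm_Lg: "norm (Lg w) \<le> \<bar>ln (norm w)\<bar> + 2 * pi"
  using cmod_le[of "Lg w"] abs_Im_Lg[of w] by (simp add: Re_Lg)

lemma Lg_pos: "x > 0 \<Longrightarrow> Lg (complex_of_real x) = of_real (ln x)"
proof -
  assume x: "x > 0"
  have "Lg (complex_of_real x) = Ln (of_real x * (- \<i>)) + \<i> * (pi / 2)"
    using x by (simp add: Lg_def mult.commute)
  also have "\<dots> = complex_of_real (ln x)"
    using x by (subst Ln_times_of_real) (auto simp: Ln_of_real)
  finally show ?thesis .
qed

lemma Lg_neg: "x < 0 \<Longrightarrow> Lg (complex_of_real x) = of_real (ln (- x)) + \<i> * pi"
proof -
  assume x: "x < 0"
  have "Lg (complex_of_real x) = Ln (of_real (- x) * \<i>) + \<i> * (pi / 2)"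
    using x by (simp add: Lg_def mult.commute)
  also have "\<dots> = complex_of_real (ln (- x)) + \<i> * pi"
    using x Ln_of_real[of "- x"] by (subst Ln_times_of_real) auto
  finally show ?thesis .
qed

lemma eventually_Lg_eq: "w \<noteq> 0 \<Longrightarrow> eventually (\<lambda>z. Lg z = Ln (- \<i> * z) + \<i> * (pi / 2)) (nhds w)"
  by (rule eventually_mono[OF eventually_nhds_in_open[of "- {0}" w]]) (auto simp: Lg_def)

lemma not_nonpos_half_plane: "0 \<le> Im w \<Longrightarrow> w \<noteq> 0 \<Longrightarrow> - \<i> * w \<notin> \<real>\<^sub>\<le>\<^sub>0"
  by (auto simp: complex_nonpos_Reals_iff complex_eq_iff)

lemma isCont_Lg: "0 \<le> Im w \<Longrightarrow> w \<noteq> 0 \<Longrightarrow> isCont Lg w"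
  using not_nonpos_half_plane[of w] by (subst isCont_cong[OF eventually_Lg_eq]) (auto intro!: continuous_intros)

lemma has_field_derivative_Lg:
  assumes "0 < Im w" shows "(Lg has_field_derivative inverse w) (at w within A)"
proof -
  have "w \<noteq> 0" using assms by auto
  then have "- \<i> * w \<notin> \<real>\<^sub>\<le>\<^sub>0" using assms by (intro not_nonpos_half_plane) auto
  then have "((\<lambda>z. Ln (- \<i> * z) + \<i> * (pi / 2)) has_field_derivative inverse w) (at w)"
    by (auto intro!: derivative_eq_intros simp: field_simps \<open>w \<noteq> 0\<close>)
  then have "(Lg has_field_derivative inverse w) (at w)"
    by (subst DERIV_cong_ev[OF refl eventually_Lg_eq[OF \<open>w \<noteq> 0\<close>] refl])
  then show ?thesis by (rule has_field_derivative_at_within)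
qed

lemma borel_measurable_Lg [measurable]: "Lg \<in> borel_measurable borel"
  unfolding Lg_def by measurable

section \<open>An integrable logarithmic singularity\<close>

text \<open>For every real \<open>x\<close> there is a point \<open>s\<close> of \<open>[0, 1]\<close>, namely the parameter of the nearest point of the curve
\<open>v \<mapsto> exp (- a * v)\<close>, such that the distance from \<open>x\<close> grows at least linearly in \<open>\<bar>v - s\<bar>\<close>. Thus \<open>ln \<bar>x - exp (- a * v)\<bar>\<close> is
bounded below by a constant plus a translate of \<open>ln \<bar>v\<bar>\<close>, with a constant that does not depend on \<open>x\<close>.\<close>

lemma exp_gap_lower_bound:
  fixes a x :: real
  assumes a: "0 < a"
  obtains s where "0 \<le> s" "s \<le> 1" "\<And>v. 0 \<le> v \<Longrightarrow> v \<le> 1 \<Longrightarrow> a * exp (- a) * \<bar>v - s\<bar> \<le> \<bar>x - exp (- a * v)\<bar>"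
proof -
  have gap: "a * exp (- a) * (t - s) \<le> exp (- a * s) - exp (- a * t)" if "s \<le> t" "t \<le> 1" for s t :: real
  proof -
    have "1 + a * (t - s) \<le> exp (a * (t - s))" by (rule exp_ge_add_one_self)
    then have "exp (- a * t) * (a * (t - s)) \<le> exp (- a * t) * (exp (a * (t - s)) - 1)"
      by (intro mult_left_mono) (linarith, simp)
    also have "\<dots> = exp (- a * s) - exp (- a * t)"
      by (simp add: algebra_simps exp_add[symmetric])
    also have "exp (- a) * (a * (t - s)) \<le> exp (- a * t) * (a * (t - s))"
      using a that by (intro mult_right_mono mult_nonneg_nonneg) auto
    finally (xtrans) show ?thesis by (simp add: mult_ac)
  qed
  consider "x \<le> exp (- a)" | "1 \<le> x" | "exp (- a) < x" "x < 1" by linarith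
  then show ?thesis
  proof cases
    case 1
    show ?thesis
    proof (rule that[of 1])
      fix v :: real assume "0 \<le> v" "v \<le> 1"
      then show "a * exp (- a) * \<bar>v - 1\<bar> \<le> \<bar>x - exp (- a * v)\<bar>"
        using gap[of v 1] 1 by (simp add: abs_if algebra_simps)
    qed auto
  next
    case 2
    show ?thesis
    proof (rule that[of 0])
      fix v :: real assume "0 \<le> v" "v \<le> 1"
      then show "a * exp (- a) * \<bar>v - 0\<bar> \<le> \<bar>x - exp (- a * v)\<bar>"
        using gap[of 0 v] 2 by (simp add: abs_if algebra_simps)
    qed auto
  next
    case 3
    have x0: "0 < x" using 3 less_trans[OF exp_gt_zero] by blast
    define s where "s = - ln x / a"
    have xs: "x = exp (- a * s)" using a x0 by (simp add: s_def)
    have "ln x < 0" using 3 x0 by simp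
    moreover have "- a < ln x" using 3 x0 by (metis exp_less_cancel_iff exp_ln)
    ultimately
    have s: "0 \<le> s" "s \<le> 1" using a by (auto simp: s_def field_simps)
    show ?thesis
    proof (rule that[OF s])
      fix v :: real assume "0 \<le> v" "v \<le> 1"
      then show "a * exp (- a) * \<bar>v - s\<bar> \<le> \<bar>x - exp (- a * v)\<bar>"
        using gap[of s v] gap[of v s] s a unfolding xs by (cases "s \<le> v") (auto simp: abs_if algebra_simps)
    qed
  qed
qed

text \<open>The function \<open>\<bar>v - s\<bar> powr (- 1 / 2)\<close> majorises the logarithmic singularity and has an integral with a bound independent of
\<open>s\<close>.\<close>

lemma nn_integral_inverse_sqrt_shift:
  fixes s :: real
  assumes "0 \<le> s" "s \<le> 1"
  shows "(\<integral>\<^sup>+v. ennreal (indicator {0..1} v * \<bar>v - s\<bar> powr (- 1 / 2)) \<partial>lborel) \<le> 4"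
proof -
  have base: "(\<integral>\<^sup>+t. ennreal (indicator {0..1} t * t powr (- 1 / 2)) \<partial>lborel) = 2"
    using nn_integral_has_integral_lebesgue[OF _ has_integral_powr_from_0[of "- 1 / 2" 1]] by simp
  have "(\<integral>\<^sup>+v. ennreal (indicator {0..1} v * \<bar>v - s\<bar> powr (- 1 / 2)) \<partial>lborel) \<le>
    (\<integral>\<^sup>+v. ennreal (indicator {0..1} (s - v) * (s - v) powr (- 1 / 2)) + ennreal (indicator {0..1} (v - s) * (v - s) powr (- 1 / 2)) \<partial>lborel)"
    using assms by (intro nn_integral_mono) (auto simp: indicator_def abs_if)
  also have "\<dots> = (\<integral>\<^sup>+v. ennreal (indicator {0..1} (s - v) * (s - v) powr (- 1 / 2)) \<partial>lborel) + (\<integral>\<^sup>+v. ennreal (indicator {0..1} (v - s) * (v - s) powr (- 1 / 2)) \<partial>lborel)"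
    by (rule nn_integral_add) auto
  also have "(\<integral>\<^sup>+v. ennreal (indicator {0..1} (s - v) * (s - v) powr (- 1 / 2)) \<partial>lborel) = (\<integral>\<^sup>+t. ennreal (indicator {0..1} t * t powr (- 1 / 2)) \<partial>lborel)"
    using nn_integral_real_affine[of "\<lambda>t. ennreal (indicator {0..1} t * t powr (- 1 / 2))" "-1" s] by simp
  also have "(\<integral>\<^sup>+v. ennreal (indicator {0..1} (v - s) * (v - s) powr (- 1 / 2)) \<partial>lborel) = (\<integral>\<^sup>+t. ennreal (indicator {0..1} t * t powr (- 1 / 2)) \<partial>lborel)"
    using nn_integral_real_affine[of "\<lambda>t. ennreal (indicator {0..1} t * t powr (- 1 / 2))" "1" "-s"] by simp
  finally show ?thesis unfolding base by simp
qed

lemma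
  fixes s :: real
  assumes "0 \<le> s" "s \<le> 1"
  shows set_integrable_inverse_sqrt_shift: "set_integrable lborel {0..1} (\<lambda>v. \<bar>v - s\<bar> powr (- 1 / 2))"
    and set_integral_inverse_sqrt_shift_le: "(LBINT v:{0..1}. \<bar>v - s\<bar> powr (- 1 / 2)) \<le> 4"
proof -
  have lt: "(\<integral>\<^sup>+v. ennreal (indicator {0..1} v * \<bar>v - s\<bar> powr (- 1 / 2)) \<partial>lborel) < \<infinity>"
    using nn_integral_inverse_sqrt_shift[OF assms] by (rule order_le_less_trans) simp
  show i: "set_integrable lborel {0..1} (\<lambda>v. \<bar>v - s\<bar> powr (- 1 / 2))"
    unfolding set_integrable_def using lt by (intro integrableI_nonneg) auto
  have "ennreal (LBINT v:{0..1}. \<bar>v - s\<bar> powr (- 1 / 2)) = (\<integral>\<^sup>+v. ennreal (indicator {0..1} v * \<bar>v - s\<bar> powr (- 1 / 2)) \<partial>lborel)"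
    using i unfolding set_lebesgue_integral_def set_integrable_def
    by (subst nn_integral_eq_integral) auto
  also have "\<dots> \<le> ennreal 4" using nn_integral_inverse_sqrt_shift[OF assms] by simp
  finally show "(LBINT v:{0..1}. \<bar>v - s\<bar> powr (- 1 / 2)) \<le> 4" by (subst (asm) ennreal_le_iff) auto
qed

lemma neg_ln_le_inverse_sqrt:
  fixes t :: real assumes "0 \<le> t" shows "- ln t \<le> 2 * t powr (- 1 / 2)"
proof (cases "t = 0")
  case False
  then have t: "0 < t" using assms by simp
  have "ln (t powr (- 1 / 2)) \<le> t powr (- 1 / 2) - 1" using t by (intro ln_le_minus_one) auto
  moreover have "ln (t powr (- 1 / 2)) = - ln t / 2" using t by (simp add: ln_powr)
  ultimately show ?thesis by simp
qed simp

section \<open>Contour integrals along the real line\<close>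

lemma integrable_inverse_1_plus_square': "integrable lborel (\<lambda>x::real. inverse (1 + x^2))"
  and integral_inverse_1_plus_square': "(LBINT x::real. inverse (1 + x^2)) = pi"
  using integrable_inverse_1_plus_square LBINT_inverse_1_plus_square
  by (simp_all add: set_integrable_def interval_lebesgue_integral_def set_lebesgue_integral_def)

text \<open>Translates contour integrals along real segments into Lebesgue integrals.\<close>

lemma contour_integral_horizontal_segment:
  assumes "(f has_contour_integral I) (linepath (of_real (- R)) (of_real R))" "0 < R"
    and cont: "continuous_on {- R..R} (\<lambda>x. f (of_real x))"
  shows "(LBINT x:{- R..R}. f (of_real x)) = I"
proof -
  have "((\<lambda>x. f (of_real x)) has_integral I) {Re (of_real (- R))..Re (of_real R)}"
    using assms by (subst has_contour_integral_linepath_Reals_iff[symmetric]) auto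
  then have "integral {- R..R} (\<lambda>x. f (of_real x)) = I" by (simp add: integral_unique)
  then show ?thesis
    using set_borel_integral_eq_integral(2)[OF borel_integrable_atLeastAtMost'[OF cont]] by simp
qed

lemma triangle_side_far_from_origin:
  assumes "0 \<le> R" "z \<in> closed_segment (of_real R) (\<i> * of_real R) \<or> z \<in> closed_segment (\<i> * of_real R) (of_real (- R))"
  shows "0 \<le> Im z" "R / 2 \<le> norm z"
proof -
  obtain t where t: "0 \<le> t" "t \<le> 1" "\<bar>Re z\<bar> = R * (1 - t)" "Im z = R * t"
  proof (cases "z \<in> closed_segment (of_real R) (\<i> * of_real R)")
    case True
    then obtain t where "0 \<le> t" "t \<le> 1" "z = (1 - t) *\<^sub>R of_real R + t *\<^sub>R (\<i> * of_real R)"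
      by (auto simp: in_segment)
    then show ?thesis using assms(1) by (intro that[of t]) (auto simp: scaleR_conv_of_real abs_mult)
  next
    case False
    then have "z \<in> closed_segment (\<i> * of_real R) (of_real (- R))" using assms by auto
    then obtain t where "0 \<le> t" "t \<le> 1" "z = (1 - t) *\<^sub>R (\<i> * of_real R) + t *\<^sub>R of_real (- R)"
      by (auto simp: in_segment)
    then show ?thesis using assms(1) by (intro that[of "1 - t"]) (auto simp: scaleR_conv_of_real abs_mult)
  qed
  show "0 \<le> Im z" using t assms by simp
  have "R = \<bar>Re z\<bar> + \<bar>Im z\<bar>" using t assms by (simp add: algebra_simps)
  also have "\<dots> \<le> norm z + norm z" by (intro add_mono abs_Re_le_cmod abs_Im_le_cmod)
  finally show "R / 2 \<le> norm z" by simp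
qed

text \<open>Close the segment \<open>[- R, R]\<close> at height \<open>\<epsilon>\<close> by the two sides of an isosceles triangle with apex at height \<open>R\<close> above it. On
them the integrand is of order \<open>1 / R^2\<close> and their length is of order \<open>R\<close>, so Cauchy's theorem leaves the integral over the line.\<close>

lemma holomorphic_upper_half_plane_line_integral:
  fixes f :: "complex \<Rightarrow> complex"
  assumes holo: "f holomorphic_on {z. 0 < Im z}" and B: "\<And>z. 0 < Im z \<Longrightarrow> norm (f z) \<le> B / (1 + norm z)\<^sup>2"
    and eps: "0 < \<epsilon>"
  shows "integrable lborel (\<lambda>x. f (of_real x + \<i> * of_real \<epsilon>))"
    and "(LBINT x. f (of_real x + \<i> * of_real \<epsilon>)) = 0"
proof -
  have B0: "0 \<le> B"
  proof -
    have "0 \<le> norm (f \<i>)" by simp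
    also have "\<dots> \<le> B / 4" using B[of \<i>] by (simp add: power2_eq_square)
    finally show ?thesis by simp
  qed
  define g where "g = (\<lambda>z. f (z + \<i> * of_real \<epsilon>))"
  have gholo: "g holomorphic_on {z. - \<epsilon> < Im z}"
    unfolding g_def by (rule holomorphic_on_compose_gen[OF _ holo, unfolded o_def]) (auto intro!: holomorphic_intros)
  have gB: "norm (g z) \<le> B / (1 + norm z)\<^sup>2 * (1 + \<epsilon>)\<^sup>2" if "0 \<le> Im z" for z
  proof -
    have "norm z \<le> norm (z + \<i> * of_real \<epsilon>) + norm (\<i> * of_real \<epsilon>)"
      by (metis add_diff_cancel_right' norm_triangle_ineq4)
    then have "norm z \<le> norm (z + \<i> * of_real \<epsilon>) + \<epsilon>" using eps by (simp add: norm_mult)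
    moreover have "0 \<le> \<epsilon> * norm (z + \<i> * of_real \<epsilon>)" using eps by simp
    ultimately have "1 + norm z \<le> 1 + norm (z + \<i> * of_real \<epsilon>) + \<epsilon> + \<epsilon> * norm (z + \<i> * of_real \<epsilon>)" by linarith
    then have "1 + norm z \<le> (1 + norm (z + \<i> * of_real \<epsilon>)) * (1 + \<epsilon>)" by (simp add: algebra_simps)
    then have "(1 + norm z)\<^sup>2 \<le> ((1 + norm (z + \<i> * of_real \<epsilon>)) * (1 + \<epsilon>))\<^sup>2"
      by (intro power_mono) auto
    then have le: "(1 + norm z)\<^sup>2 \<le> (1 + norm (z + \<i> * of_real \<epsilon>))\<^sup>2 * (1 + \<epsilon>)\<^sup>2" by (simp add: power_mult_distrib)
    have "norm (g z) \<le> B / (1 + norm (z + \<i> * of_real \<epsilon>))\<^sup>2"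
      unfolding g_def using that eps by (intro B) simp
    also have "\<dots> \<le> B / (1 + norm z)\<^sup>2 * (1 + \<epsilon>)\<^sup>2"
    proof -
      have p: "0 < (1 + norm z)\<^sup>2" "0 < (1 + norm (z + \<i> * of_real \<epsilon>))\<^sup>2"
        by (intro zero_less_power add_pos_nonneg; simp)+
      have "B * (1 + norm z)\<^sup>2 \<le> B * ((1 + norm (z + \<i> * of_real \<epsilon>))\<^sup>2 * (1 + \<epsilon>)\<^sup>2)"
        using le B0 by (rule mult_left_mono)
      then show ?thesis using p by (simp add: field_simps)
    qed
    finally show ?thesis .
  qed
  define C where "C = B * (1 + \<epsilon>)\<^sup>2"
  have C0: "0 \<le> C" using B0 by (simp add: C_def)
  have gC: "norm (g z) \<le> C / (1 + norm z)\<^sup>2" if "0 \<le> Im z" for z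
    using gB[OF that] by (simp add: C_def)
  have gcont: "continuous_on UNIV (\<lambda>x::real. g (of_real x))"
    by (rule continuous_on_compose2[OF holomorphic_on_imp_continuous_on[OF gholo]])
       (use eps in \<open>auto intro!: continuous_intros\<close>)
  have dom: "norm (g (of_real x)) \<le> C * inverse (1 + x\<^sup>2)" for x :: real
  proof -
    have "1 + x\<^sup>2 \<le> (1 + \<bar>x\<bar>)\<^sup>2" by (simp add: power2_sum)
    then have "C / (1 + \<bar>x\<bar>)\<^sup>2 \<le> C / (1 + x\<^sup>2)"
      using C0 by (intro divide_left_mono) (auto intro!: mult_pos_pos zero_less_power add_pos_nonneg)
    then show ?thesis using gC[of "of_real x"] by (simp add: divide_inverse)
  qed
  have gm [measurable]: "(\<lambda>x. g (of_real x)) \<in> borel_measurable borel"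
    by (rule borel_measurable_continuous_onI[OF gcont])
  have gint: "integrable lborel (\<lambda>x. g (of_real x))"
    by (rule Bochner_Integration.integrable_bound[where f = "\<lambda>x. C * inverse (1 + x\<^sup>2)"])
       (use dom C0 in \<open>auto simp: integrable_inverse_1_plus_square' intro!: order_trans[OF dom abs_ge_self]\<close>)
  have geq: "g (of_real x) = f (of_real x + \<i> * of_real \<epsilon>)" for x by (simp add: g_def)
  show "integrable lborel (\<lambda>x. f (of_real x + \<i> * of_real \<epsilon>))" using gint by (simp add: geq)
  have bound: "norm (LBINT x:{- real (Suc n)..real (Suc n)}. g (of_real x)) \<le> 16 * C / real (Suc n)" for n
  proof -
    define R where "R = real (Suc n)"
    have R: "0 < R" by (simp add: R_def)
    let ?a = "complex_of_real (- R)" and ?b = "complex_of_real R" and ?c = "\<i> * complex_of_real R"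
    have hull: "convex hull {?a, ?b, ?c} \<subseteq> {z. - \<epsilon> < Im z}"
      by (rule hull_minimal) (use eps R in \<open>auto simp: convex_halfspace_Im_gt\<close>)
    have gh: "g holomorphic_on (convex hull {?a, ?b, ?c})" by (rule holomorphic_on_subset[OF gholo hull])
    have seg: "closed_segment ?a ?b \<subseteq> convex hull {?a, ?b, ?c}" "closed_segment ?b ?c \<subseteq> convex hull {?a, ?b, ?c}" "closed_segment ?c ?a \<subseteq> convex hull {?a, ?b, ?c}"
      unfolding segment_convex_hull by (intro hull_mono; auto)+
    have ci: "g contour_integrable_on linepath ?a ?b" "g contour_integrable_on linepath ?b ?c" "g contour_integrable_on linepath ?c ?a"
      by (intro contour_integrable_continuous_linepath continuous_on_subset[OF holomorphic_on_imp_continuous_on[OF gh]] seg)+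
    have "(g has_contour_integral 0) (linepath ?a ?b +++ linepath ?b ?c +++ linepath ?c ?a)"
      by (rule Cauchy_theorem_triangle_interior[OF holomorphic_on_imp_continuous_on[OF gh]])
         (rule holomorphic_on_subset[OF gh interior_subset])
    then have "contour_integral (linepath ?a ?b +++ linepath ?b ?c +++ linepath ?c ?a) g = 0"
      by (rule contour_integral_unique)
    then have sum0: "contour_integral (linepath ?a ?b) g + (contour_integral (linepath ?b ?c) g + contour_integral (linepath ?c ?a) g) = 0"
      using ci by (simp add: contour_integrable_joinI)
    have side: "norm (contour_integral (linepath u w) g) \<le> 4 * C / R\<^sup>2 * (2 * R)"
      if "g contour_integrable_on linepath u w" "u = ?b \<and> w = ?c \<or> u = ?c \<and> w = ?a" for u w
    proof -
      have "norm (contour_integral (linepath u w) g) \<le> 4 * C / R\<^sup>2 * norm (w - u)"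
      proof (rule contour_integral_bound_linepath[OF that(1)])
        show "0 \<le> 4 * C / R\<^sup>2" using C0 by simp
        fix z assume "z \<in> closed_segment u w"
        then have z: "0 \<le> Im z" "R / 2 \<le> norm z"
          using triangle_side_far_from_origin[of R z] that(2) R by auto
        have "norm (g z) \<le> C / (1 + norm z)\<^sup>2" by (rule gC[OF z(1)])
        also have "\<dots> \<le> C / (R / 2)\<^sup>2"
          using z(2) R C0 by (intro divide_left_mono power_mono) (auto intro!: mult_pos_pos zero_less_power add_pos_nonneg)
        finally show "norm (g z) \<le> 4 * C / R\<^sup>2" by (simp add: power_divide mult.commute)
      qed
      also have "\<dots> \<le> 4 * C / R\<^sup>2 * (2 * R)"
      proof (intro mult_left_mono)
        have "norm (w - u) \<le> norm w + norm u" by (rule norm_triangle_ineq4)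
        also have "\<dots> = 2 * R" using that(2) R by (auto simp: norm_mult)
        finally show "norm (w - u) \<le> 2 * R" .
      qed (use C0 in auto)
      finally show ?thesis .
    qed
    have "(LBINT x:{- R..R}. g (of_real x)) = contour_integral (linepath ?a ?b) g"
      using has_contour_integral_integral[OF ci(1)] R
      by (intro contour_integral_horizontal_segment continuous_on_subset[OF gcont]) auto
    also have "\<dots> = - (contour_integral (linepath ?b ?c) g + contour_integral (linepath ?c ?a) g)"
      using sum0 by (simp only: eq_neg_iff_add_eq_0)
    finally have "norm (LBINT x:{- R..R}. g (of_real x)) = norm (contour_integral (linepath ?b ?c) g + contour_integral (linepath ?c ?a) g)"
      by (simp only: norm_minus_cancel)
    also have "\<dots> \<le> norm (contour_integral (linepath ?b ?c) g) + norm (contour_integral (linepath ?c ?a) g)"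
      by (rule norm_triangle_ineq)
    also have "\<dots> \<le> 4 * C / R\<^sup>2 * (2 * R) + 4 * C / R\<^sup>2 * (2 * R)"
      by (intro add_mono side ci) auto
    also have "\<dots> = 16 * C / R" using R by (simp add: power2_eq_square)
    finally show ?thesis by (simp add: R_def)
  qed
  have lim1: "(\<lambda>n. LBINT x:{- real (Suc n)..real (Suc n)}. g (of_real x)) \<longlonglongrightarrow> (LBINT x. g (of_real x))"
    unfolding set_lebesgue_integral_def
  proof (rule integral_dominated_convergence[where w = "\<lambda>x. norm (g (of_real x))"])
    show "integrable lborel (\<lambda>x. norm (g (of_real x)))" using gint by (rule integrable_norm)
    show "AE x in lborel. (\<lambda>n. indicator {- real (Suc n)..real (Suc n)} x *\<^sub>R g (of_real x)) \<longlonglongrightarrow> g (of_real x)"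
    proof (rule AE_I2)
      fix x :: real
      have "eventually (\<lambda>n. \<bar>x\<bar> \<le> real (Suc n)) sequentially"
        using eventually_ge_at_top[of "nat \<lceil>\<bar>x\<bar>\<rceil>"] by eventually_elim linarith
      then have "eventually (\<lambda>n. indicator {- real (Suc n)..real (Suc n)} x *\<^sub>R g (of_real x) = g (of_real x)) sequentially"
        by eventually_elim (auto simp: abs_le_iff)
      then show "(\<lambda>n. indicator {- real (Suc n)..real (Suc n)} x *\<^sub>R g (of_real x)) \<longlonglongrightarrow> g (of_real x)"
        by (rule tendsto_eventually)
    qed
  qed (auto simp: indicator_def)
  have lim2: "(\<lambda>n. LBINT x:{- real (Suc n)..real (Suc n)}. g (of_real x)) \<longlonglongrightarrow> 0"
  proof (rule Lim_null_comparison)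
    show "eventually (\<lambda>n. norm (LBINT x:{- real (Suc n)..real (Suc n)}. g (of_real x)) \<le> 16 * C / real (Suc n)) sequentially"
      using bound by simp
    have "(\<lambda>n. 16 * C * inverse (real (Suc n))) \<longlonglongrightarrow> 16 * C * 0"
      by (intro tendsto_intros LIMSEQ_inverse_real_of_nat)
    then show "(\<lambda>n. 16 * C / real (Suc n)) \<longlonglongrightarrow> 0" by (simp add: divide_inverse)
  qed
  show "(LBINT x. f (of_real x + \<i> * of_real \<epsilon>)) = 0"
    using LIMSEQ_unique[OF lim1 lim2] by (simp add: geq)
qed

text \<open>Moving the line down to the real axis is an instance of dominated convergence, with the majorant \<open>B / (1 + x^2)\<close>.\<close>

lemma boundary_integral_zero:
  fixes f :: "complex \<Rightarrow> complex" and F :: "real \<Rightarrow> complex"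
  assumes holo: "f holomorphic_on {z. 0 < Im z}" and B: "\<And>z. 0 < Im z \<Longrightarrow> norm (f z) \<le> B / (1 + norm z)\<^sup>2"
    and [measurable]: "F \<in> borel_measurable borel"
    and lim: "AE x in lborel. (\<lambda>n. f (of_real x + \<i> * of_real (inverse (real (Suc n))))) \<longlonglongrightarrow> F x"
  shows "(LBINT x. F x) = 0"
proof -
  have pos: "0 < inverse (real (Suc n))" for n by simp
  have fm: "(\<lambda>x. f (of_real x + \<i> * of_real (inverse (real (Suc n))))) \<in> borel_measurable lborel" for n
    using holomorphic_upper_half_plane_line_integral(1)[OF holo B pos[of n]] by (simp add: integrable_iff_bounded)
  have B0: "0 \<le> B"
  proof -
    have "0 \<le> norm (f \<i>)" by simp
    also have "\<dots> \<le> B / 4" using B[of \<i>] by (simp add: power2_eq_square)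
    finally show ?thesis by simp
  qed
  have "(\<lambda>n. LBINT x. f (of_real x + \<i> * of_real (inverse (real (Suc n))))) \<longlonglongrightarrow> (LBINT x. F x)"
  proof (rule integral_dominated_convergence[where w = "\<lambda>x. B * inverse (1 + x\<^sup>2)"])
    show "integrable lborel (\<lambda>x. B * inverse (1 + x\<^sup>2))" using integrable_inverse_1_plus_square' by simp
    show "AE x in lborel. norm (f (of_real x + \<i> * of_real (inverse (real (Suc n))))) \<le> B * inverse (1 + x\<^sup>2)" for n
    proof (rule AE_I2)
      fix x :: real
      let ?z = "of_real x + \<i> * of_real (inverse (real (Suc n)))"
      have "\<bar>Re ?z\<bar> \<le> norm ?z" by (rule abs_Re_le_cmod)
      then have "(1 + \<bar>x\<bar>)\<^sup>2 \<le> (1 + norm ?z)\<^sup>2" by (intro power_mono) auto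
      moreover have "1 + x\<^sup>2 \<le> (1 + \<bar>x\<bar>)\<^sup>2" by (simp add: power2_sum)
      ultimately have "1 + x\<^sup>2 \<le> (1 + norm ?z)\<^sup>2" by linarith
      then have "B / (1 + norm ?z)\<^sup>2 \<le> B / (1 + x\<^sup>2)"
        using B0 by (intro divide_left_mono) (auto intro!: mult_pos_pos zero_less_power add_pos_nonneg)
      then show "norm (f ?z) \<le> B * inverse (1 + x\<^sup>2)"
        using B[of ?z] by (simp add: divide_inverse)
    qed
    show "F \<in> borel_measurable lborel" using assms(3) by simp
  qed (fact lim fm)+
  then have "(\<lambda>n. 0) \<longlonglongrightarrow> (LBINT x. F x)"
    using holomorphic_upper_half_plane_line_integral(2)[OF holo B pos] by simp
  then show ?thesis by (simp add: LIMSEQ_const_iff)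
qed

section \<open>The logarithmic potential of the shape measure\<close>

text \<open>The logarithmic potential of the law of \<open>exp (- a * V)\<close> with \<open>V\<close> uniform on \<open>[0, 1]\<close>, which is \<open>F_law a\<close>.\<close>

definition logpot :: "real \<Rightarrow> complex \<Rightarrow> complex" where
  "logpot a z = (LBINT v:{0..1}. Lg (z - of_real (exp (- a * v))))"

text \<open>The exceptional point \<open>s\<close> depends on the real part only, so that one majorant serves all points above the same boundary
point; this is what the passage to the boundary needs.\<close>

lemma Lg_diff_exp_bound:
  fixes z :: complex
  assumes a: "0 < a"
  obtains s where "0 \<le> s" "s \<le> 1"
    "\<And>\<zeta> v. Re \<zeta> = Re z \<Longrightarrow> 0 \<le> v \<Longrightarrow> v \<le> 1 \<Longrightarrow> v \<noteq> s \<Longrightarrow>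
       - (\<bar>ln (a * exp (- a))\<bar> + 2 * \<bar>v - s\<bar> powr (- 1 / 2)) \<le> ln (norm (\<zeta> - of_real (exp (- a * v)))) \<and>
       norm (Lg (\<zeta> - of_real (exp (- a * v)))) \<le> \<bar>ln (a * exp (- a))\<bar> + 2 * \<bar>v - s\<bar> powr (- 1 / 2) + (norm \<zeta> + 1 + 2 * pi)"
proof -
  obtain s where s: "0 \<le> s" "s \<le> 1" "\<And>v. 0 \<le> v \<Longrightarrow> v \<le> 1 \<Longrightarrow> a * exp (- a) * \<bar>v - s\<bar> \<le> \<bar>Re z - exp (- a * v)\<bar>"
    using exp_gap_lower_bound[OF a, of "Re z"] by blast
  show ?thesis
  proof (rule that[OF s(1,2)])
    fix \<zeta> v assume \<zeta>: "Re \<zeta> = Re z" and v: "0 \<le> v" "v \<le> (1::real)" "v \<noteq> s"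
    define w where "w = \<zeta> - of_real (exp (- a * v))"
    have pos: "0 < a * exp (- a) * \<bar>v - s\<bar>" using a v by simp
    have "a * exp (- a) * \<bar>v - s\<bar> \<le> \<bar>Re w\<bar>" using s(3)[OF v(1,2)] \<zeta> by (simp add: w_def)
    also have "\<dots> \<le> norm w" by (rule abs_Re_le_cmod)
    finally have le: "a * exp (- a) * \<bar>v - s\<bar> \<le> norm w" .
    then have w0: "0 < norm w" using pos by linarith
    have "ln (a * exp (- a) * \<bar>v - s\<bar>) \<le> ln (norm w)" using le pos w0 by simp
    moreover have "ln (a * exp (- a) * \<bar>v - s\<bar>) = ln (a * exp (- a)) + ln \<bar>v - s\<bar>"
      using a v by (intro ln_mult_pos) auto
    moreover have "- ln \<bar>v - s\<bar> \<le> 2 * \<bar>v - s\<bar> powr (- 1 / 2)" by (rule neg_ln_le_inverse_sqrt) simp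
    ultimately have lower: "- (\<bar>ln (a * exp (- a))\<bar> + 2 * \<bar>v - s\<bar> powr (- 1 / 2)) \<le> ln (norm w)" by linarith
    have "ln (norm w) \<le> norm w" using ln_le_minus_one[OF w0] by simp
    also have "\<dots> \<le> norm \<zeta> + norm (complex_of_real (exp (- a * v)))" unfolding w_def by (rule norm_triangle_ineq4)
    also have "\<dots> \<le> norm \<zeta> + 1" using a v by simp
    finally have upper: "ln (norm w) \<le> norm \<zeta> + 1" .
    have "0 \<le> \<bar>v - s\<bar> powr (- 1 / 2)" by simp
    then have "norm (Lg w) \<le> \<bar>ln (a * exp (- a))\<bar> + 2 * \<bar>v - s\<bar> powr (- 1 / 2) + (norm \<zeta> + 1 + 2 * pi)"
      using lower upper norm_Lg[of w] norm_ge_zero[of \<zeta>] by linarith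
    with lower show "- (\<bar>ln (a * exp (- a))\<bar> + 2 * \<bar>v - s\<bar> powr (- 1 / 2)) \<le> ln (norm (\<zeta> - of_real (exp (- a * v)))) \<and>
       norm (Lg (\<zeta> - of_real (exp (- a * v)))) \<le> \<bar>ln (a * exp (- a))\<bar> + 2 * \<bar>v - s\<bar> powr (- 1 / 2) + (norm \<zeta> + 1 + 2 * pi)"
      by (simp add: w_def)
  qed
qed

lemma LBINT_const_unit_interval: "(LBINT v:{0..1::real}. A) = (A::real)"
  by (simp add: set_lebesgue_integral_def)

lemma set_integrable_Lg_bound:
  assumes "0 \<le> s" "s \<le> 1"
  shows "set_integrable lborel {0..1} (\<lambda>v. A + 2 * \<bar>v - s\<bar> powr (- 1 / 2) + (B :: real))"
proof -
  have c: "set_integrable lborel {0..1::real} (\<lambda>v. D :: real)" for D by (simp add: set_integrable_def)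
  show ?thesis
    by (intro set_integral_add set_integrable_mult_right c set_integrable_inverse_sqrt_shift assms)
qed

lemma set_integrable_Lg:
  assumes a: "0 < a"
  shows "set_integrable lborel {0..1} (\<lambda>v. Lg (z - of_real (exp (- a * v))))"
proof -
  obtain s where s: "0 \<le> s" "s \<le> 1" and b: "\<And>\<zeta> v. Re \<zeta> = Re z \<Longrightarrow> 0 \<le> v \<Longrightarrow> v \<le> 1 \<Longrightarrow> v \<noteq> s \<Longrightarrow>
       norm (Lg (\<zeta> - of_real (exp (- a * v)))) \<le> \<bar>ln (a * exp (- a))\<bar> + 2 * \<bar>v - s\<bar> powr (- 1 / 2) + (norm \<zeta> + 1 + 2 * pi)"
    using Lg_diff_exp_bound[OF a, of z] by metis
  show ?thesis
    unfolding set_integrable_def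
  proof (rule Bochner_Integration.integrable_bound[OF set_integrable_Lg_bound[OF s, of "\<bar>ln (a * exp (- a))\<bar>" "norm z + 1 + 2 * pi", unfolded set_integrable_def]])
    have "AE v in lborel. v \<noteq> s" by (rule AE_lborel_singleton)
    then show "AE v in lborel. norm (indicator {0..1} v *\<^sub>R Lg (z - of_real (exp (- a * v)))) \<le> norm (indicator {0..1} v *\<^sub>R (\<bar>ln (a * exp (- a))\<bar> + 2 * \<bar>v - s\<bar> powr (- 1 / 2) + (norm z + 1 + 2 * pi)))"
    proof eventually_elim
      case (elim v)
      then show ?case using b[of z v] by (auto simp: indicator_def intro: order_trans[OF _ abs_ge_self])
    qed
  qed measurable
qed

lemma Re_logpot: "0 < a \<Longrightarrow> Re (logpot a z) = (LBINT v:{0..1}. ln (norm (z - of_real (exp (- a * v)))))"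
  unfolding logpot_def set_lebesgue_integral_def
  by (subst integral_Re[symmetric], use set_integrable_Lg in \<open>simp add: set_integrable_def\<close>) (simp add: Re_Lg)

lemma set_integrable_ln_norm:
  fixes z :: complex
  assumes a: "0 < a" shows "set_integrable lborel {0..1} (\<lambda>v. ln (norm (z - of_real (exp (- a * v)))))"
proof -
  have "integrable lborel (\<lambda>v. Re (indicator {0..1} v *\<^sub>R Lg (z - of_real (exp (- a * v)))))"
    using set_integrable_Lg[OF a, of z] unfolding set_integrable_def by (rule integrable_Re)
  then show ?thesis by (simp add: set_integrable_def Re_Lg)
qed

text \<open>A lower bound that is uniform in \<open>z\<close>. It bounds \<open>exp (- c * logpot a z)\<close> near the support.\<close>

lemma Re_logpot_lower:
  assumes a: "0 < a"
  shows "- (\<bar>ln (a * exp (- a))\<bar> + 8) \<le> Re (logpot a z)"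
proof -
  define A where "A = \<bar>ln (a * exp (- a))\<bar>"
  obtain s where s: "0 \<le> s" "s \<le> 1" and b: "\<And>\<zeta> v. Re \<zeta> = Re z \<Longrightarrow> 0 \<le> v \<Longrightarrow> v \<le> 1 \<Longrightarrow> v \<noteq> s \<Longrightarrow>
       - (A + 2 * \<bar>v - s\<bar> powr (- 1 / 2)) \<le> ln (norm (\<zeta> - of_real (exp (- a * v))))"
    using Lg_diff_exp_bound[OF a, of z] unfolding A_def by metis
  have i: "set_integrable lborel {0..1} (\<lambda>v. \<bar>v - s\<bar> powr (- 1 / 2))" by (rule set_integrable_inverse_sqrt_shift[OF s])
  have c: "set_integrable lborel {0..1::real} (\<lambda>v. A)" by (simp add: set_integrable_def)
  have i2: "set_integrable lborel {0..1} (\<lambda>v. A + 2 * \<bar>v - s\<bar> powr (- 1 / 2))"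
    by (intro set_integral_add set_integrable_mult_right c i)
  have "(LBINT v:{0..1}. A + 2 * \<bar>v - s\<bar> powr (- 1 / 2)) = A + 2 * (LBINT v:{0..1}. \<bar>v - s\<bar> powr (- 1 / 2))"
    using c i by (simp add: set_integral_add(2) LBINT_const_unit_interval)
  also have "\<dots> \<le> A + 8" using set_integral_inverse_sqrt_shift_le[OF s] by simp
  finally have "- (A + 8) \<le> - (LBINT v:{0..1}. A + 2 * \<bar>v - s\<bar> powr (- 1 / 2))" by simp
  also have "\<dots> = (LBINT v:{0..1}. - (A + 2 * \<bar>v - s\<bar> powr (- 1 / 2)))"
    using set_integral_uminus[OF i2] by simp
  also have "\<dots> \<le> (LBINT v:{0..1}. ln (norm (z - of_real (exp (- a * v)))))"
    unfolding set_lebesgue_integral_def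
  proof (rule integral_mono_AE)
    show "integrable lborel (\<lambda>v. indicator {0..1} v *\<^sub>R - (A + 2 * \<bar>v - s\<bar> powr (- 1 / 2)))"
      using Bochner_Integration.integrable_minus[OF i2[unfolded set_integrable_def]] by (simp only: scaleR_minus_right)
    show "integrable lborel (\<lambda>v. indicator {0..1} v *\<^sub>R ln (norm (z - of_real (exp (- a * v)))))"
      using set_integrable_ln_norm[OF a] by (simp add: set_integrable_def)
    have "AE v in lborel. v \<noteq> s" by (rule AE_lborel_singleton)
    then show "AE v in lborel. indicator {0..1} v *\<^sub>R - (A + 2 * \<bar>v - s\<bar> powr (- 1 / 2)) \<le> indicator {0..1} v *\<^sub>R ln (norm (z - of_real (exp (- a * v))))"
    proof eventually_elim
      case (elim v)
      then show ?case using b[of z v] by (auto simp: indicator_def)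
    qed
  qed
  finally show ?thesis using Re_logpot[OF a] by (simp add: A_def)
qed

lemma Re_logpot_large:
  assumes a: "0 < a" and z: "2 \<le> norm z"
  shows "ln (norm z / 2) \<le> Re (logpot a z)"
proof -
  have "ln (norm z / 2) = (LBINT v:{0..1::real}. ln (norm z / 2))" by (rule LBINT_const_unit_interval[symmetric])
  also have "\<dots> \<le> (LBINT v:{0..1}. ln (norm (z - of_real (exp (- a * v)))))"
  proof (rule set_integral_mono)
    show "set_integrable lborel {0..1::real} (\<lambda>v. ln (norm z / 2))" by (simp add: set_integrable_def)
    fix v :: real assume v: "v \<in> {0..1}"
    have "norm z \<le> norm (z - of_real (exp (- a * v))) + norm (complex_of_real (exp (- a * v)))"
      by (metis diff_add_cancel norm_triangle_ineq)
    also have "norm (complex_of_real (exp (- a * v))) \<le> 1" using a v by simp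
    finally have "norm z / 2 \<le> norm (z - of_real (exp (- a * v)))" using z by linarith
    then show "ln (norm z / 2) \<le> ln (norm (z - of_real (exp (- a * v))))" using z by (subst ln_le_cancel_iff) linarith+
  qed (rule set_integrable_ln_norm[OF a])
  finally show ?thesis using Re_logpot[OF a] by simp
qed

lemma logpot_holomorphic:
  assumes a: "0 < a"
  shows "logpot a holomorphic_on {z. 0 < Im z}"
proof -
  have "(\<lambda>z. integral (cbox 0 1) (\<lambda>v. Lg (z - of_real (exp (- a * v))))) holomorphic_on {z. 0 < Im z}"
  proof (rule leibniz_rule_holomorphic[where fx = "\<lambda>z v. inverse (z - of_real (exp (- a * v)))"])
    fix z :: complex and v :: real assume z: "z \<in> {z. 0 < Im z}"
    have "(Lg has_field_derivative inverse (z - of_real (exp (- a * v)))) (at (z - of_real (exp (- a * v))))"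
      using z by (intro has_field_derivative_Lg) simp
    then have "((\<lambda>z. Lg (z - of_real (exp (- a * v)))) has_field_derivative inverse (z - of_real (exp (- a * v))) * 1) (at z)"
      by (rule DERIV_chain2) (auto intro!: derivative_eq_intros)
    then show "((\<lambda>z. Lg (z - of_real (exp (- a * v)))) has_field_derivative inverse (z - of_real (exp (- a * v)))) (at z within {z. 0 < Im z})"
      by (simp add: has_field_derivative_at_within)
  next
    fix z :: complex assume z: "z \<in> {z. 0 < Im z}"
    show "(\<lambda>v. Lg (z - of_real (exp (- a * v)))) integrable_on cbox 0 1"
      using set_borel_integral_eq_integral(1)[OF set_integrable_Lg[OF a, of z]] by simp
  next
    have "z \<noteq> of_real (exp (- a * v))" if "0 < Im z" for z :: complex and v :: real
      using that by auto
    then show "continuous_on ({z. 0 < Im z} \<times> cbox 0 1) (\<lambda>(z, v). inverse (z - of_real (exp (- a * v))))"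
      by (auto simp: case_prod_beta intro!: continuous_intros)
  next
    show "convex {z. 0 < Im z}" by (simp add: convex_halfspace_Im_gt)
  qed
  also have "(\<lambda>z. integral (cbox 0 1) (\<lambda>v. Lg (z - of_real (exp (- a * v))))) = logpot a"
    using set_borel_integral_eq_integral(2)[OF set_integrable_Lg[OF a]] by (auto simp: logpot_def)
  finally show ?thesis .
qed

text \<open>Vertical approach to a boundary point. The integrand may fail to converge only at the single \<open>v\<close> with \<open>exp (- a * v) = x\<close>.\<close>

lemma logpot_tendsto:
  fixes x :: real
  assumes a: "0 < a" and re: "\<And>n. Re (\<zeta> n) = x" and im: "\<And>n. 0 \<le> Im (\<zeta> n)" and lim: "\<zeta> \<longlonglongrightarrow> of_real x"
    and bd: "\<And>n. norm (\<zeta> n) \<le> C"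
  shows "(\<lambda>n. logpot a (\<zeta> n)) \<longlonglongrightarrow> logpot a (of_real x)"
proof -
  define A where "A = \<bar>ln (a * exp (- a))\<bar>"
  obtain s where s: "0 \<le> s" "s \<le> 1" and b: "\<And>\<zeta> v. Re \<zeta> = Re (of_real x) \<Longrightarrow> 0 \<le> v \<Longrightarrow> v \<le> 1 \<Longrightarrow> v \<noteq> s \<Longrightarrow>
       norm (Lg (\<zeta> - of_real (exp (- a * v)))) \<le> A + 2 * \<bar>v - s\<bar> powr (- 1 / 2) + (norm \<zeta> + 1 + 2 * pi)"
    using Lg_diff_exp_bound[OF a, of "of_real x"] unfolding A_def by metis
  show ?thesis
    unfolding logpot_def set_lebesgue_integral_def
  proof (rule integral_dominated_convergence[OF _ _ set_integrable_Lg_bound[OF s, of A "C + 1 + 2 * pi", unfolded set_integrable_def]])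
    have ne: "AE v in lborel. v \<noteq> s" by (rule AE_lborel_singleton)
    show "AE v in lborel. norm (indicator {0..1} v *\<^sub>R Lg (\<zeta> n - of_real (exp (- a * v)))) \<le> indicator {0..1} v *\<^sub>R (A + 2 * \<bar>v - s\<bar> powr (- 1 / 2) + (C + 1 + 2 * pi))" for n
      using ne
    proof eventually_elim
      case (elim v)
      then show ?case using b[of "\<zeta> n" v] re bd[of n] by (auto simp: indicator_def)
    qed
    have "AE v in lborel. v \<noteq> - ln x / a" by (rule AE_lborel_singleton)
    then show "AE v in lborel. (\<lambda>n. indicator {0..1} v *\<^sub>R Lg (\<zeta> n - of_real (exp (- a * v)))) \<longlonglongrightarrow> indicator {0..1} v *\<^sub>R Lg (of_real x - of_real (exp (- a * v)))"
    proof eventually_elim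
      case (elim v)
      have "x \<noteq> exp (- a * v)"
      proof
        assume "x = exp (- a * v)"
        then have "ln x = - a * v" by simp
        then have "v = - ln x / a" using a by simp
        with elim show False by simp
      qed
      then have "isCont Lg (of_real x - of_real (exp (- a * v)))" by (intro isCont_Lg) auto
      then show ?case by (intro tendsto_intros isCont_tendsto_compose[where g = Lg] lim)
    qed
  qed measurable
qed

lemma Lg_of_real: "Lg (of_real y) = of_real (ln \<bar>y\<bar>) + \<i> * (pi * of_bool (y < 0))"
  using Lg_pos[of y] Lg_neg[of y] by (cases y "0::real" rule: linorder_cases) (auto simp: Lg_def)

definition rlogpot :: "real \<Rightarrow> real \<Rightarrow> real" where
  "rlogpot a x = (LBINT v:{0..1}. ln \<bar>x - exp (- a * v)\<bar>)"

lemma set_integrable_ln_abs: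
  fixes a x :: real
  assumes "0 < a" shows "set_integrable lborel {0..1} (\<lambda>v. ln \<bar>x - exp (- a * v)\<bar>)"
proof -
  have "norm (complex_of_real x - of_real (exp (- a * v))) = \<bar>x - exp (- a * v)\<bar>" for v
    by (metis norm_of_real of_real_diff real_norm_def)
  then show ?thesis using set_integrable_ln_norm[OF assms, of "of_real x"] by simp
qed

text \<open>On the real line the imaginary part is \<open>pi\<close> times the mass of the shape measure to the right of \<open>x\<close>, since \<open>Lg\<close> adds \<open>\<i> * pi\<close>
for negative arguments.\<close>

lemma logpot_of_real:
  assumes a: "0 < a"
  shows "logpot a (of_real x) = of_real (rlogpot a x) + \<i> * (pi * measure lborel ({0..1} \<inter> {v. x < exp (- a * v)}))"
proof -
  let ?N = "{0..1} \<inter> {v. x < exp (- a * v)}"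
  have eq: "indicator {0..1} v *\<^sub>R Lg (of_real x - of_real (exp (- a * v))) =
      complex_of_real (indicator {0..1} v *\<^sub>R ln \<bar>x - exp (- a * v)\<bar>) + \<i> * pi * of_real (indicator ?N v)" for v :: real
    using Lg_of_real[of "x - exp (- a * v)"] by (auto simp: indicator_def)
  have "?N \<in> sets borel" by measurable
  moreover have "emeasure lborel ?N \<le> emeasure lborel {0..1::real}" by (intro emeasure_mono) auto
  ultimately have i: "integrable lborel (indicator ?N :: real \<Rightarrow> real)"
    by (intro integrable_real_indicator) (auto intro: order_le_less_trans)
  have "logpot a (of_real x) = (LBINT v. complex_of_real (indicator {0..1} v *\<^sub>R ln \<bar>x - exp (- a * v)\<bar>)) + (LBINT v. \<i> * pi * complex_of_real (indicator ?N v))"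
    unfolding logpot_def set_lebesgue_integral_def eq
    using set_integrable_ln_abs[OF a, of x] i
    by (intro Bochner_Integration.integral_add) (auto simp: set_integrable_def simp del: of_real_mult real_scaleR_def)
  also have "\<dots> = of_real (rlogpot a x) + \<i> * pi * of_real (LBINT v. indicator ?N v)"
    by (simp only: integral_complex_of_real integral_mult_right_zero rlogpot_def set_lebesgue_integral_def)
  finally show ?thesis by simp
qed

section \<open>Inversion of the Stieltjes transform\<close>

text \<open>This is \<open>(z - 1) powr (c - 1) * exp (- c * logpot a z)\<close> with the branch \<open>Lg\<close>. The first factor makes it decay like \<open>1 / z\<close>
instead of \<open>z powr (- c)\<close>, and its boundary argument combines with that of the potential to the same constant
\<open>- pi\<close> to the left of the support for every \<open>c\<close>.\<close>

definition cauchy_fn :: "real \<Rightarrow> real \<Rightarrow> complex \<Rightarrow> complex" where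
  "cauchy_fn c a z = exp (of_real (c - 1) * Lg (z - 1) - of_real c * logpot a z)"

lemma norm_cauchy_fn: "norm (cauchy_fn c a z) = exp ((c - 1) * ln (norm (z - 1)) - c * Re (logpot a z))"
  by (simp add: cauchy_fn_def norm_exp_eq_Re Re_Lg)

lemma cauchy_fn_bound:
  assumes a: "0 < a" and c: "1 \<le> c"
  obtains K where "0 < K" "\<And>z. norm (cauchy_fn c a z) \<le> K / (1 + norm z)"
proof -
  define m where "m = \<bar>ln (a * exp (- a))\<bar> + 8"
  define K1 where "K1 = exp ((c - 1) * ln 3 + c * m)"
  define K2 where "K2 = exp ((2 * c - 1) * ln 2)"
  have small: "norm (cauchy_fn c a z) \<le> K1" if z: "norm z \<le> 2" for z
  proof -
    have "norm (z - 1) \<le> 3" using norm_triangle_ineq4[of z 1] z by simp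
    then have "ln (norm (z - 1)) \<le> ln 3"
      by (cases "z = 1") (auto simp: ln_le_cancel_iff)
    then have "(c - 1) * ln (norm (z - 1)) \<le> (c - 1) * ln 3" using c by (intro mult_left_mono) auto
    moreover have "- (c * Re (logpot a z)) \<le> c * m"
      using mult_left_mono[OF Re_logpot_lower[OF a, of z], of c] c by (simp add: m_def algebra_simps)
    ultimately show ?thesis by (simp add: norm_cauchy_fn K1_def)
  qed
  have large: "norm (cauchy_fn c a z) \<le> K2 / norm z" if z: "2 \<le> norm z" for z
  proof -
    have z0: "0 < norm z" using z by linarith
    have ne: "0 < norm (z - 1)" using z by auto
    have "norm (z - 1) \<le> 2 * norm z" using norm_triangle_ineq4[of z 1] z by simp
    then have "ln (norm (z - 1)) \<le> ln (2 * norm z)" using ne z0 by simp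
    then have "(c - 1) * ln (norm (z - 1)) \<le> (c - 1) * ln (2 * norm z)" using c by (intro mult_left_mono) auto
    moreover have "c * ln (norm z / 2) \<le> c * Re (logpot a z)"
      using Re_logpot_large[OF a z] c by (intro mult_left_mono) auto
    moreover have "(c - 1) * ln (2 * norm z) - c * ln (norm z / 2) = (2 * c - 1) * ln 2 - ln (norm z)"
      using z0 by (simp add: ln_mult_pos ln_div algebra_simps)
    ultimately have "(c - 1) * ln (norm (z - 1)) - c * Re (logpot a z) \<le> (2 * c - 1) * ln 2 - ln (norm z)" by linarith
    then have "norm (cauchy_fn c a z) \<le> exp ((2 * c - 1) * ln 2 - ln (norm z))" by (simp add: norm_cauchy_fn)
    also have "\<dots> = K2 / norm z" using z0 by (simp add: K2_def exp_diff)
    finally show ?thesis .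
  qed
  have pos: "0 < K1" "0 < K2" by (auto simp: K1_def K2_def)
  show ?thesis
  proof (rule that[of "3 * (K1 + K2)"])
    show "0 < 3 * (K1 + K2)" using pos by simp
    fix z :: complex
    show "norm (cauchy_fn c a z) \<le> 3 * (K1 + K2) / (1 + norm z)"
    proof (cases "norm z \<le> 2")
      case True
      have "K1 * (1 + norm z) \<le> K1 * 3" using True pos by (intro mult_left_mono) auto
      also have "\<dots> \<le> 3 * (K1 + K2)" using pos by simp
      finally have "K1 \<le> 3 * (K1 + K2) / (1 + norm z)" by (subst pos_le_divide_eq) (auto intro: add_pos_nonneg)
      then show ?thesis using small[OF True] by linarith
    next
      case False
      then have z: "2 \<le> norm z" "0 < norm z" by auto
      have "K2 * (1 + norm z) \<le> K2 * (3 * norm z)" using z pos by (intro mult_left_mono) auto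
      also have "\<dots> \<le> 3 * (K1 + K2) * norm z" using z pos by (simp add: algebra_simps)
      finally have "K2 / norm z \<le> 3 * (K1 + K2) / (1 + norm z)"
        using z by (subst frac_le_eq) (auto simp: divide_le_0_iff algebra_simps)
      then show ?thesis using large[OF z(1)] by linarith
    qed
  qed
qed

lemma cauchy_fn_holomorphic:
  assumes a: "0 < a" shows "cauchy_fn c a holomorphic_on {z. 0 < Im z}"
proof -
  have "(\<lambda>z. Lg (z - 1)) holomorphic_on {z. 0 < Im z}"
  proof (rule holomorphic_onI)
    fix z :: complex assume z: "z \<in> {z. 0 < Im z}"
    have "(Lg has_field_derivative inverse (z - 1)) (at (z - 1))" using z by (intro has_field_derivative_Lg) simp
    then have "((\<lambda>z. Lg (z - 1)) has_field_derivative inverse (z - 1) * 1) (at z)"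
      by (rule DERIV_chain2) (auto intro!: derivative_eq_intros)
    then show "(\<lambda>z. Lg (z - 1)) field_differentiable at z within {z. 0 < Im z}"
      using field_differentiable_at_within field_differentiable_def by blast
  qed
  then show ?thesis
    unfolding cauchy_fn_def by (intro holomorphic_intros logpot_holomorphic[OF a])
qed

lemma cauchy_fn_boundary_tendsto:
  assumes a: "0 < a" and x: "x \<noteq> 1"
  shows "(\<lambda>n. cauchy_fn c a (of_real x + \<i> * of_real (inverse (real (Suc n))))) \<longlonglongrightarrow> cauchy_fn c a (of_real x)"
proof -
  define \<zeta> where "\<zeta> = (\<lambda>n. of_real x + \<i> * complex_of_real (inverse (real (Suc n))))"
  have "(\<lambda>n. complex_of_real (inverse (real (Suc n)))) \<longlonglongrightarrow> of_real 0"
    by (intro tendsto_of_real LIMSEQ_inverse_real_of_nat)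
  then have "\<zeta> \<longlonglongrightarrow> of_real x + \<i> * of_real 0"
    unfolding \<zeta>_def by (rule tendsto_add[OF tendsto_const tendsto_mult[OF tendsto_const]])
  then have lim: "\<zeta> \<longlonglongrightarrow> of_real x" by simp
  have bd: "norm (\<zeta> n) \<le> \<bar>x\<bar> + 1" for n
  proof -
    have "norm (\<zeta> n) \<le> norm (complex_of_real x) + norm (\<i> * complex_of_real (inverse (real (Suc n))))"
      unfolding \<zeta>_def by (rule norm_triangle_ineq)
    also have "norm (\<i> * complex_of_real (inverse (real (Suc n)))) \<le> 1"
      by (simp only: norm_mult norm_ii norm_of_real) (simp add: inverse_eq_divide)
    finally show ?thesis by simp
  qed
  have L: "(\<lambda>n. logpot a (\<zeta> n)) \<longlonglongrightarrow> logpot a (of_real x)"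
    by (rule logpot_tendsto[OF a _ _ lim bd]) (auto simp: \<zeta>_def simp del: of_real_inverse)
  have "isCont Lg (of_real x - 1)" using x by (intro isCont_Lg) (auto simp: complex_eq_iff)
  then have "(\<lambda>n. Lg (\<zeta> n - 1)) \<longlonglongrightarrow> Lg (of_real x - 1)"
    by (rule isCont_tendsto_compose) (intro tendsto_intros lim)
  moreover have "of_real x + \<i> * complex_of_real (inverse (real (Suc n))) = \<zeta> n" for n by (simp only: \<zeta>_def)
  ultimately show ?thesis unfolding cauchy_fn_def
    by (simp only:) (intro tendsto_intros L)
qed

lemma borel_measurable_logpot [measurable]: "(\<lambda>x. logpot a (of_real x)) \<in> borel_measurable borel"
  unfolding logpot_def set_lebesgue_integral_def by measurable

lemma borel_measurable_rlogpot [measurable]: "rlogpot a \<in> borel_measurable borel"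
  unfolding rlogpot_def set_lebesgue_integral_def by measurable

lemma borel_measurable_cauchy_fn [measurable]: "(\<lambda>x. cauchy_fn c a (of_real x)) \<in> borel_measurable borel"
  unfolding cauchy_fn_def by measurable

lemma cauchy_fn_of_real:
  assumes a: "0 < a" and x: "x \<noteq> 1"
  shows "cauchy_fn c a (of_real x) = of_real (\<bar>x - 1\<bar> powr (c - 1) * exp (- c * rlogpot a x)) *
    cis (pi * ((c - 1) * of_bool (x < 1) - c * measure lborel ({0..1} \<inter> {v. x < exp (- a * v)})))"
proof -
  let ?N = "measure lborel ({0..1} \<inter> {v. x < exp (- a * v)})"
  have "Lg (of_real x - 1) = of_real (ln \<bar>x - 1\<bar>) + \<i> * (pi * of_bool (x < 1))"
    using Lg_of_real[of "x - 1"] by simp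
  then have "of_real (c - 1) * Lg (of_real x - 1) - of_real c * logpot a (of_real x) =
    of_real ((c - 1) * ln \<bar>x - 1\<bar> + (- c * rlogpot a x)) + \<i> * of_real (pi * ((c - 1) * of_bool (x < 1) - c * ?N))"
    unfolding logpot_of_real[OF a] by (simp add: algebra_simps)
  then have "cauchy_fn c a (of_real x) = exp (of_real ((c - 1) * ln \<bar>x - 1\<bar> + (- c * rlogpot a x))) * cis (pi * ((c - 1) * of_bool (x < 1) - c * ?N))"
    by (simp only: cauchy_fn_def exp_add cis_conv_exp)
  also have "exp (complex_of_real ((c - 1) * ln \<bar>x - 1\<bar> + (- c * rlogpot a x))) = of_real (\<bar>x - 1\<bar> powr (c - 1) * exp (- c * rlogpot a x))"
    using x by (simp only: exp_of_real exp_add powr_def) auto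
  finally show ?thesis .
qed

lemma measure_exceed_exp:
  assumes a: "0 < a"
  shows "x < exp (- a) \<Longrightarrow> measure lborel ({0..1} \<inter> {v. x < exp (- a * v)}) = 1"
    and "1 \<le> x \<Longrightarrow> measure lborel ({0..1} \<inter> {v. x < exp (- a * v)}) = 0"
    and "exp (- a) \<le> x \<Longrightarrow> x \<le> 1 \<Longrightarrow> measure lborel ({0..1} \<inter> {v. x < exp (- a * v)}) = - ln x / a"
proof -
  have lt: "x < exp (- a * v)" if "x < exp (- a)" "v \<le> 1" for v
  proof -
    have "exp (- a) \<le> exp (- a * v)" using that a by simp
    then show ?thesis using that by linarith
  qed
  show "measure lborel ({0..1} \<inter> {v. x < exp (- a * v)}) = 1" if "x < exp (- a)"
  proof -
    have "{0..1} \<inter> {v. x < exp (- a * v)} = {0..1}" using lt[OF that] by auto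
    then show ?thesis by simp
  qed
  show "measure lborel ({0..1} \<inter> {v. x < exp (- a * v)}) = 0" if "1 \<le> x"
  proof -
    have "\<not> x < exp (- a * v)" if "0 \<le> v" for v
    proof -
      have "exp (- a * v) \<le> 1" using that a by simp
      then show ?thesis using \<open>1 \<le> x\<close> by linarith
    qed
    then have "{0..1} \<inter> {v. x < exp (- a * v)} = {}" by auto
    then show ?thesis by simp
  qed
  show "measure lborel ({0..1} \<inter> {v. x < exp (- a * v)}) = - ln x / a" if x: "exp (- a) \<le> x" "x \<le> 1"
  proof -
    have x0: "0 < x" using x less_le_trans[OF exp_gt_zero] by blast
    have l: "- a \<le> ln x" "ln x \<le> 0" using x x0 by (simp_all add: ln_ge_iff)
    have "{0..1} \<inter> {v. x < exp (- a * v)} = {0..<- ln x / a}"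
    proof -
      have "x < exp (- a * v) \<longleftrightarrow> v < - ln x / a" for v
      proof -
        have "x < exp (- a * v) \<longleftrightarrow> exp (ln x) < exp (- a * v)" using x0 by simp
        also have "\<dots> \<longleftrightarrow> v < - ln x / a"
        proof -
          have e: "- a * v = - (v * a)" by simp
          show ?thesis unfolding exp_less_cancel_iff pos_less_divide_eq[OF a] e by (rule less_minus_iff)
        qed
        finally show ?thesis .
      qed
      then have "{v. x < exp (- a * v)} = {v. v < - ln x / a}" by (intro Collect_cong)
      moreover have "- ln x / a \<le> 1" using l a by (simp add: field_simps)
      then have "{0..1} \<inter> {v. v < - ln x / a} = {0..<- ln x / a}" by fastforce
      ultimately show ?thesis by (simp only:)
    qed
    then show ?thesis using l a by (simp add: divide_nonpos_pos)
  qed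
qed

text \<open>To the left of the support the arguments of the factors add up to \<open>pi * (c - 1) - pi * c = - pi\<close>, so the boundary value is real
although \<open>c\<close> need not be an integer.\<close>

lemma cauchy_fn_left:
  assumes a: "0 < a" and x: "x < exp (- a)"
  shows "cauchy_fn c a (of_real x) = of_real (- ((1 - x) powr (c - 1) * exp (- c * rlogpot a x)))"
proof -
  have x1: "x < 1" using x less_le_trans[OF x, of 1] a by simp
  have "pi * ((c - 1) * of_bool (x < 1) - c * 1) = - pi" using x1 by (simp add: algebra_simps)
  then have "cis (pi * ((c - 1) * of_bool (x < 1) - c * 1)) = cis (- pi)" by (rule arg_cong)
  also have "\<dots> = - 1" by (simp add: complex_eq_iff)
  finally have cis: "cis (pi * ((c - 1) * of_bool (x < 1) - c * 1)) = - 1" .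
  have "x \<noteq> 1" using x1 by simp
  show ?thesis
    unfolding cauchy_fn_of_real[OF a \<open>x \<noteq> 1\<close>] measure_exceed_exp(1)[OF a x] cis using x1 by simp
qed

text \<open>The boundary argument is \<open>pi * (c - 1)\<close> minus \<open>pi * c\<close> times the mass to the right of \<open>x\<close>, that is,
\<open>pi * c * F x - pi\<close> with \<open>F x = 1 + ln x / a\<close> the distribution function of the shape measure.\<close>

lemma Im_cauchy_fn:
  assumes a: "0 < a" and x: "x \<noteq> 1"
  shows "Im (cauchy_fn c a (of_real x)) =
    - (indicator {exp (- a)..1} x * ((1 - x) powr (c - 1) * exp (- c * rlogpot a x) * sin (pi * c * (1 + ln x / a))))"
proof -
  consider "x < exp (- a)" | "1 < x" | "exp (- a) \<le> x" "x < 1" using x by linarith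
  then show ?thesis
  proof cases
    case 1
    then show ?thesis by (simp add: cauchy_fn_left[OF a 1])
  next
    case 2
    then have N: "measure lborel ({0..1} \<inter> {v. x < exp (- a * v)}) = 0" by (intro measure_exceed_exp(2)[OF a]) simp
    show ?thesis using 2 unfolding cauchy_fn_of_real[OF a x] N by simp
  next
    case 3
    have "pi * ((c - 1) * of_bool (x < 1) - c * (- ln x / a)) = pi * c * (1 + ln x / a) - pi"
      using 3 a by (simp add: field_simps)
    then have "cis (pi * ((c - 1) * of_bool (x < 1) - c * (- ln x / a))) = cis (pi * c * (1 + ln x / a) - pi)"
      by (rule arg_cong)
    then show ?thesis
      using 3 by (subst cauchy_fn_of_real[OF a x], subst measure_exceed_exp(3)[OF a]) (simp_all add: sin_diff)
  qed
qed

lemma continuous_on_rlogpot: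
  assumes a: "0 < a" shows "continuous_on {..<0} (rlogpot a)"
proof -
  have "continuous_on {..<0} (\<lambda>x. integral (cbox 0 1) (\<lambda>v. ln \<bar>x - exp (- a * v)\<bar>))"
  proof (rule integral_continuous_on_param)
    have "x - exp (- a * v) \<noteq> 0" if "x < 0" for x v using that exp_gt_zero[of "- a * v"] by linarith
    then show "continuous_on ({..<0} \<times> cbox 0 1) (\<lambda>(x, v). ln \<bar>x - exp (- a * v)\<bar>)"
      by (auto simp: case_prod_beta intro!: continuous_intros)
  qed
  also have "(\<lambda>x. integral (cbox 0 1) (\<lambda>v. ln \<bar>x - exp (- a * v)\<bar>)) = rlogpot a"
    using set_borel_integral_eq_integral(2)[OF set_integrable_ln_abs[OF a]] by (auto simp: rlogpot_def)
  finally show ?thesis .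
qed

lemma rlogpot_lower: "0 < a \<Longrightarrow> - (\<bar>ln (a * exp (- a))\<bar> + 8) \<le> rlogpot a x"
  using Re_logpot_lower[of a "of_real x"] by (simp add: logpot_of_real)

text \<open>Cauchy's theorem is applied to \<open>cauchy_fn c a z / (z - w)\<close> for \<open>w = p - \<i> * q\<close> below the real line, where the integral
over the real line vanishes. The imaginary part of that identity equates a Poisson average of the real part of the boundary
function around \<open>p\<close> with a smoothed Stieltjes integral of its imaginary part; let \<open>q\<close> tend to 0. Keeping \<open>w\<close> off the
closed upper half plane avoids an indented contour.\<close>

lemma stieltjes_inversion:
  assumes a: "0 < a" and c: "1 \<le> c" and p: "p < 0"
  shows "(LBINT x:{exp (- a)..1}. (1 - x) powr (c - 1) * exp (- c * rlogpot a x) * sin (pi * c * (1 + ln x / a)) / (x - p)) =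
    pi * ((1 - p) powr (c - 1) * exp (- c * rlogpot a p))"
proof -
  define \<Phi> where "\<Phi> = (\<lambda>x. cauchy_fn c a (of_real x))"
  have [measurable]: "\<Phi> \<in> borel_measurable borel" unfolding \<Phi>_def by measurable
  obtain K where K: "0 < K" "\<And>z. norm (cauchy_fn c a z) \<le> K / (1 + norm z)"
    using cauchy_fn_bound[OF a c] by blast
  have \<Phi>K: "norm (\<Phi> x) \<le> K" for x
  proof -
    have "K / (1 + norm (complex_of_real x)) \<le> K / 1" using K(1) by (intro divide_left_mono) auto
    then show ?thesis using K(2)[of "of_real x"] by (simp add: \<Phi>_def)
  qed
  have balance: "(LBINT y. Re (\<Phi> (p + q * y)) * inverse (1 + y\<^sup>2)) = (LBINT x. Im (\<Phi> x) * ((x - p) / ((x - p)\<^sup>2 + q\<^sup>2)))"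
    if q: "0 < q" for q
  proof -
    define w where "w = of_real p - \<i> * of_real q"
    define f where "f = (\<lambda>z. cauchy_fn c a z / (z - w))"
    define F where "F = (\<lambda>x. \<Phi> x / (of_real x - w))"
    define Cw where "Cw = (1 + norm w) / q + 1"
    have Cw: "0 < Cw" using q by (simp add: Cw_def add_nonneg_pos)
    have [measurable]: "F \<in> borel_measurable borel" unfolding F_def by measurable
    have far: "1 + norm z \<le> Cw * norm (z - w)" if z: "0 \<le> Im z" for z
    proof -
      have "q \<le> \<bar>Im (z - w)\<bar>" using z q by (simp add: w_def)
      also have "\<dots> \<le> norm (z - w)" by (rule abs_Im_le_cmod)
      finally have "q \<le> norm (z - w)" .
      then have A: "1 + norm w \<le> (1 + norm w) * (norm (z - w) / q)"
        using q mult_left_mono[of 1 "norm (z - w) / q" "1 + norm w"] by simp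
      have "norm z \<le> norm (z - w) + norm w" by (metis diff_add_cancel norm_triangle_ineq)
      then have "1 + norm z \<le> (1 + norm w) + norm (z - w)" by linarith
      also have "\<dots> \<le> (1 + norm w) * (norm (z - w) / q) + norm (z - w)" by (rule add_right_mono[OF A])
      also have "\<dots> = Cw * norm (z - w)" by (simp add: Cw_def algebra_simps)
      finally show ?thesis .
    qed
    have fB: "norm (cauchy_fn c a z / (z - w)) \<le> K * Cw / (1 + norm z)\<^sup>2" if z: "0 \<le> Im z" for z
    proof -
      have p1: "0 < 1 + norm z" by (rule add_pos_nonneg) auto
      then have d: "0 < norm (z - w)" using far[OF z] Cw by (smt (verit) mult_nonneg_nonpos)
      have "inverse (norm (z - w)) \<le> Cw / (1 + norm z)"
        using far[OF z] p1 d by (simp add: field_simps)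
      then have "norm (cauchy_fn c a z) * inverse (norm (z - w)) \<le> K / (1 + norm z) * (Cw / (1 + norm z))"
        using K p1 by (intro mult_mono) auto
      then show ?thesis by (simp add: norm_divide norm_mult norm_inverse divide_inverse power2_eq_square mult_ac)
    qed
    have w_notin: "z \<noteq> w" if "0 \<le> Im z" for z using that q by (auto simp: w_def)
    have F0: "(LBINT x. F x) = 0"
    proof (rule boundary_integral_zero[where f = f and B = "K * Cw"])
      show "f holomorphic_on {z. 0 < Im z}" unfolding f_def
        by (intro holomorphic_intros cauchy_fn_holomorphic[OF a]) (use w_notin in auto)
      show "norm (f z) \<le> K * Cw / (1 + norm z)\<^sup>2" if "0 < Im z" for z
        unfolding f_def using that by (intro fB) simp
      have "AE x in lborel. x \<noteq> (1::real)" by (rule AE_lborel_singleton)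
      then show "AE x in lborel. (\<lambda>n. f (of_real x + \<i> * of_real (inverse (real (Suc n))))) \<longlonglongrightarrow> F x"
      proof eventually_elim
        case (elim x)
        have "(\<lambda>n. complex_of_real (inverse (real (Suc n)))) \<longlonglongrightarrow> of_real 0"
          by (intro tendsto_of_real LIMSEQ_inverse_real_of_nat)
        then have "(\<lambda>n. of_real x + \<i> * complex_of_real (inverse (real (Suc n)))) \<longlonglongrightarrow> of_real x + \<i> * of_real 0"
          by (rule tendsto_add[OF tendsto_const tendsto_mult[OF tendsto_const]])
        then have l: "(\<lambda>n. of_real x + \<i> * complex_of_real (inverse (real (Suc n)))) \<longlonglongrightarrow> of_real x" by simp
        show ?case unfolding f_def F_def \<Phi>_def
          by (intro tendsto_divide cauchy_fn_boundary_tendsto[OF a elim] tendsto_diff l tendsto_const)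
             (use w_notin in auto)
      qed
    qed measurable
    have Fint: "integrable lborel F"
    proof (rule Bochner_Integration.integrable_bound[where f = "\<lambda>x. K * Cw * inverse (1 + x\<^sup>2)"])
      show "integrable lborel (\<lambda>x. K * Cw * inverse (1 + x\<^sup>2))"
        by (intro integrable_mult_right integrable_inverse_1_plus_square')
      show "AE x in lborel. norm (F x) \<le> norm (K * Cw * inverse (1 + x\<^sup>2))"
      proof (rule AE_I2)
        fix x :: real
        have "norm (F x) \<le> K * Cw / (1 + \<bar>x\<bar>)\<^sup>2" using fB[of "of_real x"] by (simp add: F_def \<Phi>_def)
        also have "\<dots> \<le> K * Cw / (1 + x\<^sup>2)"
          using K Cw by (intro divide_left_mono) (auto simp: power2_sum intro!: mult_pos_pos add_pos_nonneg zero_less_power)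
        finally show "norm (F x) \<le> norm (K * Cw * inverse (1 + x\<^sup>2))" using K Cw by (simp add: divide_inverse abs_mult)
      qed
    qed measurable
    have ImF: "Im (F x) = Im (\<Phi> x) * ((x - p) / ((x - p)\<^sup>2 + q\<^sup>2)) - Re (\<Phi> x) * (q / ((x - p)\<^sup>2 + q\<^sup>2))" for x
    proof -
      have "Im (F x) = (Im (\<Phi> x) * (x - p) - Re (\<Phi> x) * q) / ((x - p)\<^sup>2 + q\<^sup>2)"
        by (simp add: F_def w_def Im_divide)
      then show ?thesis
        by (simp only: diff_divide_distrib[of "Im (\<Phi> x) * (x - p)" "Re (\<Phi> x) * q"] times_divide_eq_right)
    qed
    define k where "k = (\<lambda>x. q / ((x - p)\<^sup>2 + q\<^sup>2))"
    have k_eq: "q * k (p + q * y) = inverse (1 + y\<^sup>2)" for y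
    proof -
      have "(p + q * y - p)\<^sup>2 + q\<^sup>2 = q\<^sup>2 * (1 + y\<^sup>2)" by (simp add: algebra_simps power_mult_distrib)
      then have "q * k (p + q * y) = (q\<^sup>2 * 1) / (q\<^sup>2 * (1 + y\<^sup>2))" by (simp only: k_def) (simp add: power2_eq_square)
      also have "\<dots> = 1 / (1 + y\<^sup>2)" by (rule mult_divide_mult_cancel_left) (use q in simp)
      finally show ?thesis by (simp add: divide_inverse)
    qed
    have kint: "integrable lborel k"
    proof -
      have "k (p + q * y) = inverse q * inverse (1 + y\<^sup>2)" for y
      proof -
        have "k (p + q * y) = inverse q * (q * k (p + q * y))" using q by simp
        then show ?thesis by (simp only: k_eq)
      qed
      then have "integrable lborel (\<lambda>y. k (p + q * y))"
        by (simp only:) (intro integrable_mult_right integrable_inverse_1_plus_square')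
      then show ?thesis using q by (subst (asm) lborel_integrable_real_affine_iff) auto
    qed
    have Rint: "integrable lborel (\<lambda>x. Re (\<Phi> x) * k x)"
    proof (rule Bochner_Integration.integrable_bound[OF integrable_mult_right[OF kint, of K]])
      show "(\<lambda>x. Re (\<Phi> x) * k x) \<in> borel_measurable lborel" unfolding k_def by measurable
      show "AE x in lborel. norm (Re (\<Phi> x) * k x) \<le> norm (K * k x)"
        by (intro AE_I2) (use K(1) in \<open>auto simp: abs_mult intro!: mult_right_mono order_trans[OF abs_Re_le_cmod \<Phi>K]\<close>)
    qed
    have "0 = Im (LBINT x. F x)" by (simp add: F0)
    also have "\<dots> = (LBINT x. Im (F x))" by (rule integral_Im[OF Fint, symmetric])
    finally have ImF0: "(LBINT x. Im (F x)) = 0" by simp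
    have "(LBINT x. Im (\<Phi> x) * ((x - p) / ((x - p)\<^sup>2 + q\<^sup>2))) = (LBINT x. Im (F x) + Re (\<Phi> x) * k x)"
      by (simp add: ImF k_def)
    also have "\<dots> = (LBINT x. Re (\<Phi> x) * k x)"
      using Rint integrable_Im[OF Fint] by (simp add: ImF0)
    also have "\<dots> = \<bar>q\<bar> *\<^sub>R (LBINT y. Re (\<Phi> (p + q * y)) * k (p + q * y))"
      using q by (intro lborel_integral_real_affine) simp
    also have "\<dots> = (LBINT y. q * (Re (\<Phi> (p + q * y)) * k (p + q * y)))"
      using q by simp
    also have "\<dots> = (LBINT y. Re (\<Phi> (p + q * y)) * (q * k (p + q * y)))"
      by (simp only: mult.left_commute[of q])
    finally show ?thesis by (simp only: k_eq)
  qed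
  define r where "r = (\<lambda>n. inverse (real (Suc n)))"
  have r: "0 < r n" "r n \<le> 1" "r \<longlonglongrightarrow> 0" for n
    using LIMSEQ_inverse_real_of_nat by (auto simp: r_def inverse_eq_divide)
  \<comment> \<open>The Poisson average tends to the value at \<open>p\<close>, where the boundary function is real and continuous.\<close>
  have lhs: "(\<lambda>n. LBINT y. Re (\<Phi> (p + r n * y)) * inverse (1 + y\<^sup>2)) \<longlonglongrightarrow> (LBINT y. Re (\<Phi> p) * inverse (1 + y\<^sup>2))"
  proof (rule integral_dominated_convergence[where w = "\<lambda>y. K * inverse (1 + y\<^sup>2)"])
    show "integrable lborel (\<lambda>y. K * inverse (1 + y\<^sup>2))" by (intro integrable_mult_right integrable_inverse_1_plus_square')
    show "AE y in lborel. norm (Re (\<Phi> (p + r n * y)) * inverse (1 + y\<^sup>2)) \<le> K * inverse (1 + y\<^sup>2)" for n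
      by (intro AE_I2) (auto simp: abs_mult intro!: mult_right_mono order_trans[OF abs_Re_le_cmod \<Phi>K])
    show "AE y in lborel. (\<lambda>n. Re (\<Phi> (p + r n * y)) * inverse (1 + y\<^sup>2)) \<longlonglongrightarrow> Re (\<Phi> p) * inverse (1 + y\<^sup>2)"
    proof (rule AE_I2)
      fix y :: real
      define g where "g = (\<lambda>x. - ((1 - x) powr (c - 1) * exp (- c * rlogpot a x)))"
      have "(\<lambda>n. p + r n * y) \<longlonglongrightarrow> p + 0 * y" by (intro tendsto_intros r)
      then have l: "(\<lambda>n. p + r n * y) \<longlonglongrightarrow> p" by simp
      have ev: "eventually (\<lambda>n. p + r n * y < 0) sequentially" using order_tendstoD(2)[OF l p] .
      have gc: "continuous_on {..<0} g"
        unfolding g_def by (intro continuous_intros continuous_on_rlogpot[OF a]) auto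
      have gR: "Re (\<Phi> x) = g x" if "x < 0" for x
        using cauchy_fn_left[OF a, of x c] that less_trans[OF that exp_gt_zero] by (simp add: \<Phi>_def g_def)
      have "(\<lambda>n. g (p + r n * y)) \<longlonglongrightarrow> g p"
        by (rule continuous_on_tendsto_compose[OF gc l]) (use p ev in auto)
      moreover have "eventually (\<lambda>n. g (p + r n * y) = Re (\<Phi> (p + r n * y))) sequentially"
        using ev by eventually_elim (simp add: gR)
      ultimately have "(\<lambda>n. Re (\<Phi> (p + r n * y))) \<longlonglongrightarrow> Re (\<Phi> p)"
        using gR[OF p] by (simp add: Lim_transform_eventually)
      then show "(\<lambda>n. Re (\<Phi> (p + r n * y)) * inverse (1 + y\<^sup>2)) \<longlonglongrightarrow> Re (\<Phi> p) * inverse (1 + y\<^sup>2)"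
        by (rule tendsto_mult[OF _ tendsto_const])
    qed
  qed measurable
  have supp: "Im (\<Phi> x) = 0" if "x \<noteq> 1" "x \<notin> {exp (- a)..1}" for x
    using Im_cauchy_fn[OF a that(1), of c] that(2) by (simp add: \<Phi>_def)
  \<comment> \<open>The singularity at \<open>p < 0\<close> is at a positive distance from the support of the imaginary part.\<close>
  have rhs: "(\<lambda>n. LBINT x. Im (\<Phi> x) * ((x - p) / ((x - p)\<^sup>2 + (r n)\<^sup>2))) \<longlonglongrightarrow> (LBINT x. Im (\<Phi> x) / (x - p))"
  proof (rule integral_dominated_convergence[where w = "\<lambda>x. indicator {0..1} x *\<^sub>R (K / - p)"])
    show "integrable lborel (\<lambda>x::real. indicator {0..1} x *\<^sub>R (K / - p))" by simp
    have ne: "AE x in lborel. x \<noteq> (1::real)" by (rule AE_lborel_singleton)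
    have e0: "0 < exp (- a)" by simp
    show "AE x in lborel. norm (Im (\<Phi> x) * ((x - p) / ((x - p)\<^sup>2 + (r n)\<^sup>2))) \<le> indicator {0..1} x *\<^sub>R (K / - p)" for n
      using ne
    proof eventually_elim
      case (elim x)
      show ?case
      proof (cases "x \<in> {exp (- a)..1}")
        case True
        then have x: "0 < x" "x \<le> 1" using less_le_trans[OF e0, of x] by auto
        then have d: "0 < x - p" "- p \<le> x - p" using p by auto
        have "(x - p) / ((x - p)\<^sup>2 + (r n)\<^sup>2) \<le> (x - p) / (x - p)\<^sup>2"
          using d by (intro divide_left_mono) (auto intro!: mult_pos_pos add_pos_nonneg)
        also have "\<dots> = 1 / (x - p)" using d by (simp add: power2_eq_square)
        also have "\<dots> \<le> 1 / - p" using d p by (intro divide_left_mono) (auto intro: mult_pos_neg mult_neg_pos simp: mult_less_0_iff)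
        finally have "(x - p) / ((x - p)\<^sup>2 + (r n)\<^sup>2) \<le> 1 / - p" .
        moreover have "0 \<le> (x - p) / ((x - p)\<^sup>2 + (r n)\<^sup>2)" using d by (intro divide_nonneg_nonneg) auto
        moreover have "\<bar>Im (\<Phi> x)\<bar> \<le> K" using abs_Im_le_cmod \<Phi>K order_trans by blast
        ultimately have "\<bar>Im (\<Phi> x)\<bar> * ((x - p) / ((x - p)\<^sup>2 + (r n)\<^sup>2)) \<le> K * (1 / - p)"
          using K(1) by (intro mult_mono) auto
        then show ?thesis using x \<open>0 \<le> (x - p) / _\<close> by (simp add: abs_mult abs_of_pos[OF d(1)])
      next
        case False
        then show ?thesis using supp[OF elim False] K(1) p by (simp add: divide_nonneg_neg mult_nonneg_nonneg)
      qed
    qed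
    show "AE x in lborel. (\<lambda>n. Im (\<Phi> x) * ((x - p) / ((x - p)\<^sup>2 + (r n)\<^sup>2))) \<longlonglongrightarrow> Im (\<Phi> x) / (x - p)"
      using ne
    proof eventually_elim
      case (elim x)
      show ?case
      proof (cases "x \<in> {exp (- a)..1}")
        case True
        then have "0 < x" using less_le_trans[OF e0, of x] by auto
        then have d: "0 < x - p" using p by simp
        have "(\<lambda>n. Im (\<Phi> x) * ((x - p) / ((x - p)\<^sup>2 + (r n)\<^sup>2))) \<longlonglongrightarrow> Im (\<Phi> x) * ((x - p) / ((x - p)\<^sup>2 + 0\<^sup>2))"
          using d by (intro tendsto_intros r) auto
        then show ?thesis using d by (simp add: power2_eq_square)
      next
        case False
        then show ?thesis using supp[OF elim False] by simp
      qed
    qed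
  qed measurable
  have "(LBINT y. Re (\<Phi> p) * inverse (1 + y\<^sup>2)) = (LBINT x. Im (\<Phi> x) / (x - p))"
    using lhs rhs balance[OF r(1)] by (intro LIMSEQ_unique[OF lhs]) simp
  then have eq: "Re (\<Phi> p) * pi = (LBINT x. Im (\<Phi> x) / (x - p))"
    by (simp add: integral_inverse_1_plus_square')
  have "(LBINT x. Im (\<Phi> x) / (x - p)) = (LBINT x. - (indicator {exp (- a)..1} x *\<^sub>R ((1 - x) powr (c - 1) * exp (- c * rlogpot a x) * sin (pi * c * (1 + ln x / a)) / (x - p))))"
  proof (rule integral_cong_AE)
    have "AE x in lborel. x \<noteq> (1::real)" by (rule AE_lborel_singleton)
    then show "AE x in lborel. Im (\<Phi> x) / (x - p) = - (indicator {exp (- a)..1} x *\<^sub>R ((1 - x) powr (c - 1) * exp (- c * rlogpot a x) * sin (pi * c * (1 + ln x / a)) / (x - p)))"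
      by eventually_elim (simp add: \<Phi>_def Im_cauchy_fn[OF a])
  qed measurable
  also have "\<dots> = - (LBINT x:{exp (- a)..1}. (1 - x) powr (c - 1) * exp (- c * rlogpot a x) * sin (pi * c * (1 + ln x / a)) / (x - p))"
    by (simp add: set_lebesgue_integral_def)
  finally have "(LBINT x:{exp (- a)..1}. (1 - x) powr (c - 1) * exp (- c * rlogpot a x) * sin (pi * c * (1 + ln x / a)) / (x - p)) = - (Re (\<Phi> p) * pi)"
    using eq by simp
  also have "Re (\<Phi> p) = - ((1 - p) powr (c - 1) * exp (- c * rlogpot a p))"
    using cauchy_fn_left[OF a, of p c] less_trans[OF p exp_gt_zero] by (simp add: \<Phi>_def)
  finally show ?thesis by simp
qed

section \<open>Closed form of the potential\<close>

lemma log_transform_unit: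
  assumes a: "0 < a" and w: "-1 < \<omega>"
  shows "log_transform a \<omega> = a * (LBINT v:{0..1}. ln (1 + \<omega> * exp (- a * v)))"
proof -
  have "log_transform a \<omega> = (LBINT s. indicator {0..a} s *\<^sub>R ln (1 + \<omega> * exp (- s)))"
    using log_transform_exp[of a \<omega>] a w by (simp add: set_lebesgue_integral_def)
  also have "\<dots> = \<bar>a\<bar> *\<^sub>R (LBINT s. indicator {0..a} (0 + a * s) *\<^sub>R ln (1 + \<omega> * exp (- (0 + a * s))))"
    using a by (intro lborel_integral_real_affine) simp
  also have "(LBINT s. indicator {0..a} (0 + a * s) *\<^sub>R ln (1 + \<omega> * exp (- (0 + a * s)))) = (LBINT v:{0..1}. ln (1 + \<omega> * exp (- a * v)))"
    unfolding set_lebesgue_integral_def using a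
    by (intro Bochner_Integration.integral_cong refl) (auto simp: indicator_def zero_le_mult_iff)
  finally show ?thesis using a by simp
qed

text \<open>For \<open>x = - 1 / \<omega>\<close> one has \<open>\<bar>x - exp (- a * v)\<bar> = (1 + \<omega> * exp (- a * v)) / \<omega>\<close>, which relates the potential to the exponent
of the increment.\<close>

lemma rlogpot_neg:
  assumes a: "0 < a" and w: "0 < \<omega>"
  shows "rlogpot a (- (1 / \<omega>)) = log_transform a \<omega> / a - ln \<omega>"
proof -
  have eq: "ln \<bar>- (1 / \<omega>) - exp (- a * v)\<bar> = ln (1 + \<omega> * exp (- a * v)) + - ln \<omega>" for v
  proof -
    have p: "0 < 1 + \<omega> * exp (- a * v)" using w by (intro add_pos_pos mult_pos_pos) auto
    have "0 < 1 / \<omega> + exp (- a * v)" using w by (intro add_pos_pos) auto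
    then have "\<bar>- (1 / \<omega>) - exp (- a * v)\<bar> = 1 / \<omega> + exp (- a * v)" by linarith
    also have "\<dots> = (1 + \<omega> * exp (- a * v)) / \<omega>" using w by (simp add: field_simps)
    finally show ?thesis using p w by (simp add: ln_divide_pos)
  qed
  have "continuous_on {0..1} (\<lambda>v. ln (1 + \<omega> * exp (- a * v)))"
    using w by (intro continuous_intros) (auto intro!: less_imp_neq[symmetric] add_pos_pos)
  then have i: "set_integrable lborel {0..1} (\<lambda>v. ln (1 + \<omega> * exp (- a * v)))"
    by (rule borel_integrable_atLeastAtMost')
  have c: "set_integrable lborel {0..1::real} (\<lambda>v. - ln \<omega>)" by (simp add: set_integrable_def)
  have "rlogpot a (- (1 / \<omega>)) = (LBINT v:{0..1}. ln (1 + \<omega> * exp (- a * v)) + - ln \<omega>)"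
    unfolding rlogpot_def eq ..
  also have "\<dots> = (LBINT v:{0..1}. ln (1 + \<omega> * exp (- a * v))) + (LBINT v:{0..1::real}. - ln \<omega>)"
    by (rule set_integral_add(2)[OF i c])
  also have "(LBINT v:{0..1::real}. - ln \<omega>) = - ln \<omega>" by (rule LBINT_const_unit_interval)
  finally show ?thesis using log_transform_unit[of a \<omega>] a w by simp
qed

definition dilog_kernel :: "real \<Rightarrow> real" where
  "dilog_kernel u = - ln (1 - u) / u"

lemma borel_measurable_dilog_kernel [measurable]: "dilog_kernel \<in> borel_measurable borel"
  unfolding dilog_kernel_def by measurable

text \<open>Termwise integration of the power series of \<open>- ln (1 - u) / u\<close> leads to the sum of the inverse squares.\<close>

lemma nn_integral_dilog:
  "(\<integral>\<^sup>+u. ennreal (indicator {0<..1} u * dilog_kernel u) \<partial>lborel) = ennreal (pi\<^sup>2 / 6)"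
proof -
  have nn: "0 \<le> indicator {0..1} u * (u ^ k / real (Suc k))" for u :: real and k
    by (auto simp: indicator_def)
  have ser: "ennreal (indicator {0<..1} u * dilog_kernel u) = (\<Sum>k. ennreal (indicator {0..1} u * (u ^ k / real (Suc k))))"
    if "u \<noteq> 0" "u \<noteq> 1" for u :: real
  proof (cases "u \<in> {0<..1}")
    case True
    then have u: "0 < u" "u < 1" using that by auto
    have "(\<lambda>n. - ((- (- u)) ^ n) / real n) sums ln (1 + (- u))" using u by (intro ln_series') auto
    then have "(\<lambda>n. - (u ^ n / real n)) sums ln (1 - u)" by simp
    from sums_minus[OF this] have "(\<lambda>n. u ^ n / real n) sums (- ln (1 - u))" by simp
    then have "(\<lambda>n. u ^ Suc n / real (Suc n)) sums (- ln (1 - u))"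
      by (subst sums_Suc_iff) simp
    from sums_divide[OF this, of u] have "(\<lambda>n. u ^ n / real (Suc n)) sums dilog_kernel u"
      using u by (simp add: dilog_kernel_def del: of_nat_Suc)
    then have s: "(\<lambda>n. indicator {0..1} u * (u ^ n / real (Suc n))) sums (indicator {0<..1} u * dilog_kernel u)"
      using u by simp
    have "(\<Sum>k. ennreal (indicator {0..1} u * (u ^ k / real (Suc k)))) = ennreal (\<Sum>k. indicator {0..1} u * (u ^ k / real (Suc k)))"
      by (rule suminf_ennreal2[OF nn sums_summable[OF s]])
    then show ?thesis by (simp only: sums_unique[OF s, symmetric])
  next
    case False
    then have "indicator {0..1} u = (0::real)" "indicator {0<..1} u = (0::real)" using that by auto
    then show ?thesis by simp
  qed
  have term_eq: "(\<integral>\<^sup>+u. ennreal (indicator {0..1} u * (u ^ k / real (Suc k))) \<partial>lborel) = ennreal (1 / (real (Suc k))\<^sup>2)" for k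
  proof -
    have "(\<integral>\<^sup>+u. ennreal (indicator {0..1} u * (u ^ k / real (Suc k))) \<partial>lborel) = (\<integral>\<^sup>+u. ennreal (u ^ k / real (Suc k)) * indicator {0..1} u \<partial>lborel)"
      by (intro nn_integral_cong) (auto simp: indicator_def)
    also have "\<dots> = ennreal (1 ^ Suc k / (real (Suc k))\<^sup>2 - 0 ^ Suc k / (real (Suc k))\<^sup>2)"
    proof (rule nn_integral_FTC_Icc)
      fix x :: real
      have "((\<lambda>x. x ^ Suc k / (real (Suc k))\<^sup>2) has_real_derivative real (Suc k) * x ^ k / (real (Suc k))\<^sup>2) (at x)"
        using DERIV_cdivide[OF DERIV_pow[of "Suc k" x UNIV], of "(real (Suc k))\<^sup>2"] by simp
      then show "((\<lambda>x. x ^ Suc k / (real (Suc k))\<^sup>2) has_real_derivative x ^ k / real (Suc k)) (at x)"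
        by (simp add: power2_eq_square del: of_nat_Suc power_Suc)
    qed (auto simp del: of_nat_Suc)
    finally show ?thesis by simp
  qed
  have "(\<integral>\<^sup>+u. ennreal (indicator {0<..1} u * dilog_kernel u) \<partial>lborel) = (\<integral>\<^sup>+u. (\<Sum>k. ennreal (indicator {0..1} u * (u ^ k / real (Suc k)))) \<partial>lborel)"
  proof (rule nn_integral_cong_AE)
    have "AE u in lborel. u \<noteq> (0::real)" "AE u in lborel. u \<noteq> (1::real)" by (rule AE_lborel_singleton)+
    then show "AE u in lborel. ennreal (indicator {0<..1} u * dilog_kernel u) = (\<Sum>k. ennreal (indicator {0..1} u * (u ^ k / real (Suc k))))"
      by eventually_elim (rule ser)
  qed
  also have "\<dots> = (\<Sum>k. \<integral>\<^sup>+u. ennreal (indicator {0..1} u * (u ^ k / real (Suc k))) \<partial>lborel)"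
    by (rule nn_integral_suminf) measurable
  also have "\<dots> = (\<Sum>k. ennreal (1 / (real (Suc k))\<^sup>2))" by (simp only: term_eq)
  also have "\<dots> = ennreal (pi\<^sup>2 / 6)"
  proof -
    have s: "(\<lambda>k. 1 / (real (Suc k))\<^sup>2) sums (pi\<^sup>2 / 6)"
      using inverse_squares_sums by (simp add: add.commute)
    have "(\<Sum>k. ennreal (1 / (real (Suc k))\<^sup>2)) = ennreal (\<Sum>k. 1 / (real (Suc k))\<^sup>2)"
      by (rule suminf_ennreal2[OF _ sums_summable[OF s]]) simp
    then show ?thesis by (simp only: sums_unique[OF s, symmetric])
  qed
  finally show ?thesis .
qed

lemma dilog_kernel_nonneg: "0 < u \<Longrightarrow> u \<le> 1 \<Longrightarrow> 0 \<le> dilog_kernel u"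
proof (cases "u = 1")
  case False
  assume "0 < u" "u \<le> 1"
  with False have "ln (1 - u) \<le> 0" by (intro ln_le_zero_iff[THEN iffD2]) auto
  then show ?thesis using \<open>0 < u\<close> unfolding dilog_kernel_def by (intro divide_nonneg_pos) auto
qed (simp add: dilog_kernel_def)

lemma set_integrable_dilog: "set_integrable lborel {0<..1} (\<lambda>u. dilog_kernel u)"
  unfolding set_integrable_def
proof (rule integrableI_nonneg)
  show "AE u in lborel. 0 \<le> indicator {0<..1} u *\<^sub>R dilog_kernel u"
    using dilog_kernel_nonneg by (intro AE_I2) (auto simp: indicator_def)
  show "(\<integral>\<^sup>+u. ennreal (indicator {0<..1} u *\<^sub>R dilog_kernel u) \<partial>lborel) < \<infinity>"
    using nn_integral_dilog by simp
qed measurable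

lemma Li2_pos:
  assumes "0 \<le> y" shows "Li2 y = (LBINT u:{0<..y}. dilog_kernel u)"
proof -
  have "Li2 y = - (LBINT u:{0<..y}. ln (1 - u) / u)"
    using interval_integral_Ioc[of 0 y "\<lambda>u. ln (1 - u) / u"] assms by (simp add: Li2_def zero_ereal_def)
  also have "\<dots> = (LBINT u:{0<..y}. dilog_kernel u)"
    by (simp add: set_lebesgue_integral_def dilog_kernel_def)
  finally show ?thesis .
qed

lemma Li2_1: "Li2 1 = pi\<^sup>2 / 6"
proof -
  have "ennreal (Li2 1) = ennreal (pi\<^sup>2 / 6)"
    unfolding Li2_pos[OF zero_le_one] set_lebesgue_integral_def
    using set_integrable_dilog nn_integral_dilog dilog_kernel_nonneg
    by (subst nn_integral_eq_integral[symmetric]) (auto simp: set_integrable_def indicator_def intro!: AE_I2)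
  moreover have "0 \<le> Li2 1"
    unfolding Li2_pos[OF zero_le_one] set_lebesgue_integral_def
    using dilog_kernel_nonneg by (intro Bochner_Integration.integral_nonneg) (auto simp: indicator_def)
  ultimately show ?thesis by (simp add: ennreal_inj)
qed

text \<open>Substituting \<open>u = exp (- t)\<close> in \<open>Li2 1 - Li2 (exp (- \<tau>))\<close>.\<close>

lemma nn_integral_ln_one_minus_exp:
  assumes t: "0 \<le> \<tau>"
  shows "(\<integral>\<^sup>+t. ennreal (indicator {0..\<tau>} t * - ln (1 - exp (- t))) \<partial>lborel) = ennreal (pi\<^sup>2 / 6 - Li2 (exp (- \<tau>)))"
proof -
  have e: "0 < exp (- \<tau>)" "exp (- \<tau>) \<le> 1" using t by auto
  have i1: "set_integrable lborel {0<..exp (- \<tau>)} (\<lambda>u. dilog_kernel u)"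
    by (rule set_integrable_subset[OF set_integrable_dilog]) (auto intro: order_trans[OF _ e(2)])
  have i2: "set_integrable lborel {exp (- \<tau>)<..1} (\<lambda>u. dilog_kernel u)"
    by (rule set_integrable_subset[OF set_integrable_dilog]) (auto intro: less_trans[OF e(1)])
  have "Li2 1 = (LBINT u:{0<..exp (- \<tau>)} \<union> {exp (- \<tau>)<..1}. dilog_kernel u)"
    unfolding Li2_pos[OF zero_le_one]
    by (intro arg_cong[where f = "\<lambda>A. LBINT u:A. dilog_kernel u"]) (auto intro: order_trans[OF _ e(2)] less_trans[OF e(1)])
  also have "\<dots> = Li2 (exp (- \<tau>)) + (LBINT u:{exp (- \<tau>)<..1}. dilog_kernel u)"
    unfolding Li2_pos[OF less_imp_le[OF e(1)]] by (rule set_integral_Un[OF _ i1 i2]) auto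
  finally have diff: "(LBINT u:{exp (- \<tau>)<..1}. dilog_kernel u) = pi\<^sup>2 / 6 - Li2 (exp (- \<tau>))"
    unfolding Li2_1 by linarith
  have "ennreal (pi\<^sup>2 / 6 - Li2 (exp (- \<tau>))) = (\<integral>\<^sup>+u. ennreal (indicator {exp (- \<tau>)<..1} u *\<^sub>R dilog_kernel u) \<partial>lborel)"
    unfolding diff[symmetric] set_lebesgue_integral_def using i2 dilog_kernel_nonneg e
    by (subst nn_integral_eq_integral) (auto simp: set_integrable_def indicator_def intro!: AE_I2 dest: less_trans[OF e(1)])
  also have "\<dots> = (\<integral>\<^sup>+u. ennreal (dilog_kernel u) * indicator {exp (0 - \<tau>)..exp (\<tau> - \<tau>)} u \<partial>lborel)"
  proof (rule nn_integral_cong_AE)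
    have "AE u in lborel. u \<noteq> exp (- \<tau>)" by (rule AE_lborel_singleton)
    then show "AE u in lborel. ennreal (indicator {exp (- \<tau>)<..1} u *\<^sub>R dilog_kernel u) = ennreal (dilog_kernel u) * indicator {exp (0 - \<tau>)..exp (\<tau> - \<tau>)} u"
      by eventually_elim (auto simp: indicator_def)
  qed
  also have "\<dots> = (\<integral>\<^sup>+s. ennreal (dilog_kernel (exp (s - \<tau>)) * exp (s - \<tau>)) * indicator {0..\<tau>} s \<partial>lborel)"
  proof -
    have sb: "set_borel_measurable borel {exp (0 - \<tau>)..exp (\<tau> - \<tau>)} (\<lambda>u. dilog_kernel u)"
      unfolding set_borel_measurable_def by measurable
    have "(\<integral>\<^sup>+u. ennreal (dilog_kernel u * indicator {exp (0 - \<tau>)..exp (\<tau> - \<tau>)} u) \<partial>lborel) = (\<integral>\<^sup>+s. ennreal (dilog_kernel (exp (s - \<tau>)) * exp (s - \<tau>) * indicator {0..\<tau>} s) \<partial>lborel)"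
      by (rule nn_integral_substitution[where f = dilog_kernel and g = "\<lambda>s. exp (s - \<tau>)" and a = 0 and b = \<tau>, OF sb]) (use t in \<open>auto intro!: derivative_eq_intros continuous_intros\<close>)
    moreover have "ennreal (x * indicator A u) = ennreal x * indicator A u" for x and A :: "real set" and u
      by (auto simp: indicator_def)
    ultimately show ?thesis by simp
  qed
  also have "\<dots> = (\<integral>\<^sup>+s. ennreal (indicator {0..\<tau>} s * - ln (1 - exp (s - \<tau>))) \<partial>lborel)"
    by (intro nn_integral_cong) (auto simp: indicator_def dilog_kernel_def)
  also have "\<dots> = ennreal \<bar>-1\<bar> * (\<integral>\<^sup>+t. ennreal (indicator {0..\<tau>} (\<tau> + -1 * t) * - ln (1 - exp (\<tau> + -1 * t - \<tau>))) \<partial>lborel)"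
    by (rule nn_integral_real_affine) auto
  also have "\<dots> = (\<integral>\<^sup>+t. ennreal (indicator {0..\<tau>} (\<tau> + -1 * t) * - ln (1 - exp (\<tau> + -1 * t - \<tau>))) \<partial>lborel)" by simp
  also have "\<dots> = (\<integral>\<^sup>+t. ennreal (indicator {0..\<tau>} t * - ln (1 - exp (- t))) \<partial>lborel)"
    by (intro nn_integral_cong) (auto simp: indicator_def)
  finally show ?thesis by simp
qed

lemma nn_integral_ln_one_minus_exp_scaled:
  assumes a: "0 < a" and s: "0 \<le> s"
  shows "(\<integral>\<^sup>+t. ennreal (indicator {0..s} t * - ln (1 - exp (- a * t))) \<partial>lborel) = ennreal ((pi\<^sup>2 / 6 - Li2 (exp (- a * s))) / a)"
proof -
  have as: "0 \<le> a * s" using a s by simp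
  have "ennreal (pi\<^sup>2 / 6 - Li2 (exp (- (a * s)))) = (\<integral>\<^sup>+t. ennreal (indicator {0..a * s} t * - ln (1 - exp (- t))) \<partial>lborel)"
    by (rule nn_integral_ln_one_minus_exp[OF as, symmetric])
  also have "\<dots> = ennreal \<bar>a\<bar> * (\<integral>\<^sup>+t. ennreal (indicator {0..a * s} (0 + a * t) * - ln (1 - exp (- (0 + a * t)))) \<partial>lborel)"
    using a by (intro nn_integral_real_affine) auto
  also have "(\<integral>\<^sup>+t. ennreal (indicator {0..a * s} (0 + a * t) * - ln (1 - exp (- (0 + a * t)))) \<partial>lborel) = (\<integral>\<^sup>+t. ennreal (indicator {0..s} t * - ln (1 - exp (- a * t))) \<partial>lborel)"
    using a by (intro nn_integral_cong) (auto simp: indicator_def zero_le_mult_iff)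
  finally have eq: "ennreal (pi\<^sup>2 / 6 - Li2 (exp (- (a * s)))) = ennreal a * (\<integral>\<^sup>+t. ennreal (indicator {0..s} t * - ln (1 - exp (- a * t))) \<partial>lborel)" (is "_ = _ * ?I")
    using a by simp
  have "?I = ennreal (1 / a) * (ennreal a * ?I)"
    using a by (simp add: mult.assoc[symmetric] ennreal_mult[symmetric])
  also have "\<dots> = ennreal (1 / a) * ennreal (pi\<^sup>2 / 6 - Li2 (exp (- (a * s))))" by (simp only: eq)
  also have "\<dots> = ennreal (1 / a * (pi\<^sup>2 / 6 - Li2 (exp (- (a * s)))))"
    using a by (intro ennreal_mult'[symmetric]) simp
  finally show ?thesis by simp
qed

lemma Li2_exp_le: "0 \<le> \<tau> \<Longrightarrow> Li2 (exp (- \<tau>)) \<le> pi\<^sup>2 / 6"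
proof -
  assume t: "0 \<le> \<tau>"
  have e: "0 < exp (- \<tau>)" "exp (- \<tau>) \<le> 1" using t by auto
  have "Li2 (exp (- \<tau>)) \<le> Li2 1"
    unfolding Li2_pos[OF zero_le_one] Li2_pos[OF less_imp_le[OF e(1)]] set_lebesgue_integral_def
  proof (rule integral_mono)
    show "integrable lborel (\<lambda>u. indicator {0<..exp (- \<tau>)} u *\<^sub>R dilog_kernel u)"
    proof -
      have sub: "{0<..exp (- \<tau>)} \<subseteq> {0<..1}" by (auto intro: order_trans[OF _ e(2)])
      show ?thesis using set_integrable_subset[OF set_integrable_dilog _ sub] by (simp add: set_integrable_def)
    qed
    show "integrable lborel (\<lambda>u. indicator {0<..1} u *\<^sub>R dilog_kernel u)"
      using set_integrable_dilog by (simp add: set_integrable_def)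
    fix u :: real
    show "indicator {0<..exp (- \<tau>)} u *\<^sub>R dilog_kernel u \<le> indicator {0<..1} u *\<^sub>R dilog_kernel u"
      using dilog_kernel_nonneg[of u] order_trans[OF _ e(2), of u] by (auto simp: indicator_def)
  qed
  then show ?thesis by (simp add: Li2_1)
qed

text \<open>For \<open>v \<noteq> s\<close>, \<open>\<bar>exp (- a * s) - exp (- a * v)\<bar> = exp (- a * min v s) * (1 - exp (- a * \<bar>s - v\<bar>))\<close>. The logarithm of the first factor
integrates to the quadratic part, and that of the second one to a dilogarithm from each side of \<open>s\<close>.\<close>

lemma rlogpot_exp:
  assumes a: "0 < a" and s: "0 \<le> s" "s \<le> 1"
  shows "rlogpot a (exp (- a * s)) = - a * (s - s\<^sup>2 / 2) - (pi\<^sup>2 / 3 - Li2 (exp (- a * s)) - Li2 (exp (- a * (1 - s)))) / a"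
proof -
  define h where "h = (\<lambda>t. - ln (1 - exp (- a * t)))"
  have [measurable]: "h \<in> borel_measurable borel" unfolding h_def by measurable
  have h0: "0 \<le> h t" if "0 \<le> t" for t
    using that a by (cases "t = 0") (auto simp: h_def)
  define B where "B = (pi\<^sup>2 / 6 - Li2 (exp (- a * s))) / a + (pi\<^sup>2 / 6 - Li2 (exp (- a * (1 - s)))) / a"
  have parts: "0 \<le> (pi\<^sup>2 / 6 - Li2 (exp (- a * s))) / a" "0 \<le> (pi\<^sup>2 / 6 - Li2 (exp (- a * (1 - s)))) / a"
    using Li2_exp_le[of "a * s"] Li2_exp_le[of "a * (1 - s)"] a s by auto
  have nn: "(\<integral>\<^sup>+v. ennreal (indicator {0..1} v * h \<bar>s - v\<bar>) \<partial>lborel) = ennreal B"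
  proof -
    have "(\<integral>\<^sup>+v. ennreal (indicator {0..1} v * h \<bar>s - v\<bar>) \<partial>lborel) =
      (\<integral>\<^sup>+v. ennreal (indicator {0..s} (s - v) * h (s - v)) + ennreal (indicator {0..1 - s} (v - s) * h (v - s)) \<partial>lborel)"
    proof (rule nn_integral_cong_AE)
      have "AE v in lborel. v \<noteq> s" by (rule AE_lborel_singleton)
      then show "AE v in lborel. ennreal (indicator {0..1} v * h \<bar>s - v\<bar>) = ennreal (indicator {0..s} (s - v) * h (s - v)) + ennreal (indicator {0..1 - s} (v - s) * h (v - s))"
        by eventually_elim (use s in \<open>auto simp: indicator_def abs_if\<close>)
    qed
    also have "\<dots> = (\<integral>\<^sup>+v. ennreal (indicator {0..s} (s - v) * h (s - v)) \<partial>lborel) + (\<integral>\<^sup>+v. ennreal (indicator {0..1 - s} (v - s) * h (v - s)) \<partial>lborel)"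
      by (rule nn_integral_add) auto
    also have "(\<integral>\<^sup>+v. ennreal (indicator {0..s} (s - v) * h (s - v)) \<partial>lborel) = (\<integral>\<^sup>+t. ennreal (indicator {0..s} t * h t) \<partial>lborel)"
      using nn_integral_real_affine[of "\<lambda>t. ennreal (indicator {0..s} t * h t)" "-1" s] by simp
    also have "(\<integral>\<^sup>+v. ennreal (indicator {0..1 - s} (v - s) * h (v - s)) \<partial>lborel) = (\<integral>\<^sup>+t. ennreal (indicator {0..1 - s} t * h t) \<partial>lborel)"
      using nn_integral_real_affine[of "\<lambda>t. ennreal (indicator {0..1 - s} t * h t)" "1" "-s"] by simp
    finally show ?thesis
      unfolding h_def B_def using s parts
      by (simp only: nn_integral_ln_one_minus_exp_scaled[OF a s(1)] nn_integral_ln_one_minus_exp_scaled[OF a, of "1 - s"] diff_ge_0_iff_ge ennreal_plus)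
  qed
  have hb: "has_bochner_integral lborel (\<lambda>v. indicator {0..1} v * h \<bar>s - v\<bar>) B"
    by (rule has_bochner_integral_nn_integral[OF _ _ _ nn]) (use parts h0 in \<open>auto simp: B_def indicator_def intro!: AE_I2\<close>)
  have mn: "has_bochner_integral lborel (\<lambda>v. indicator {0..1} v * min v s) (s - s\<^sup>2 / 2)"
  proof -
    have i: "integrable lborel (\<lambda>v. indicator {0..1} v * min v s)"
    proof -
      have "continuous_on {0..1} (\<lambda>v. min v s)" by (intro continuous_intros)
      from borel_integrable_atLeastAtMost'[OF this] show ?thesis by (simp add: set_integrable_def)
    qed
    have "(LBINT v. indicator {0..1} v * min v s) = (LBINT v. v * indicator {0..s} v + s * indicator {s..1} v)"
    proof (rule integral_cong_AE)
      have "AE v in lborel. v \<noteq> s" by (rule AE_lborel_singleton)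
      then show "AE v in lborel. indicator {0..1} v * min v s = v * indicator {0..s} v + s * indicator {s..1} v"
        by eventually_elim (use s in \<open>auto simp: indicator_def min_def\<close>)
    qed measurable
    also have "\<dots> = (LBINT v. v * indicator {0..s} v) + (LBINT v. s * indicator {s..1} v)"
    proof (rule Bochner_Integration.integral_add)
      show "integrable lborel (\<lambda>v. v * indicator {0..s} v)"
        using borel_integrable_atLeastAtMost'[of 0 s "\<lambda>v. v"] by (auto simp: set_integrable_def mult.commute)
      show "integrable lborel (\<lambda>v. s * indicator {s..1} v)"
        using s by (auto intro!: integrable_mult_right integrable_real_indicator)
    qed
    also have "(LBINT v. v * indicator {0..s} v) = s\<^sup>2 / 2 - 0\<^sup>2 / 2"
      using s by (intro integral_FTC_Icc_real) (auto intro!: derivative_eq_intros)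
    also have "(LBINT v. s * indicator {s..1} v) = s * (1 - s)" using s by simp
    finally show ?thesis using i by (simp add: has_bochner_integral_iff power2_eq_square algebra_simps)
  qed
  have pt: "ln \<bar>exp (- a * s) - exp (- a * v)\<bar> = - a * min v s - h \<bar>s - v\<bar>" if "v \<noteq> s" for v
  proof -
    have *: "ln \<bar>exp (- a * x) - exp (- a * y)\<bar> = - a * x + ln (1 - exp (- a * (y - x)))" if "x < y" for x y
    proof -
      have "exp (- a * (y - x)) < 1" using that a by simp
      moreover have "exp (- a * x) - exp (- a * y) = exp (- a * x) * (1 - exp (- a * (y - x)))"
        by (simp add: algebra_simps exp_add[symmetric])
      moreover have "exp (- a * y) < exp (- a * x)" using that a by simp
      ultimately show ?thesis by (simp add: ln_mult_pos)
    qed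
    show ?thesis
      using *[of s v] *[of v s] that by (cases "s < v") (auto simp: h_def min_def abs_minus_commute)
  qed
  have "rlogpot a (exp (- a * s)) = (LBINT v. - a * (indicator {0..1} v * min v s) - indicator {0..1} v * h \<bar>s - v\<bar>)"
    unfolding rlogpot_def set_lebesgue_integral_def
  proof (rule integral_cong_AE)
    have "AE v in lborel. v \<noteq> s" by (rule AE_lborel_singleton)
    then show "AE v in lborel. indicator {0..1} v *\<^sub>R ln \<bar>exp (- a * s) - exp (- a * v)\<bar> = - a * (indicator {0..1} v * min v s) - indicator {0..1} v * h \<bar>s - v\<bar>"
    proof eventually_elim
      case (elim v)
      show ?case unfolding pt[OF elim] by (auto simp: indicator_def)
    qed
  qed measurable
  also have "\<dots> = - a * (s - s\<^sup>2 / 2) - B"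
    using hb mn by (simp add: has_bochner_integral_iff)
  finally show ?thesis by (simp add: B_def diff_divide_distrib add_divide_distrib)
qed

section \<open>Recovering a density from its Stieltjes transform\<close>

text \<open>Needed to rewrite an identity between signed densities as one between positive measures.\<close>

definition measure_plus :: "'a measure \<Rightarrow> 'a measure \<Rightarrow> 'a measure" where
  "measure_plus M N = measure_of (space M) (sets M) (\<lambda>A. emeasure M A + emeasure N A)"

lemma sets_measure_plus [simp, measurable_cong]: "sets (measure_plus M N) = sets M"
  by (simp add: measure_plus_def)

lemma space_measure_plus [simp]: "space (measure_plus M N) = space M"
  by (simp add: measure_plus_def)

lemma emeasure_measure_plus:
  assumes "sets N = sets M" "A \<in> sets M"
  shows "emeasure (measure_plus M N) A = emeasure M A + emeasure N A"
  unfolding measure_plus_def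
proof (rule emeasure_measure_of_sigma[OF sets.sigma_algebra_axioms])
  show "positive (sets M) (\<lambda>A. emeasure M A + emeasure N A)" by (simp add: positive_def)
  show "countably_additive (sets M) (\<lambda>A. emeasure M A + emeasure N A)"
    unfolding countably_additive_def
  proof (intro allI impI)
    fix A :: "nat \<Rightarrow> 'a set" assume A: "range A \<subseteq> sets M" "disjoint_family A"
    have "(\<Sum>i. emeasure M (A i) + emeasure N (A i)) = (\<Sum>i. emeasure M (A i)) + (\<Sum>i. emeasure N (A i))"
      by (rule suminf_add[symmetric]) auto
    then show "(\<Sum>i. emeasure M (A i) + emeasure N (A i)) = emeasure M (\<Union>i. A i) + emeasure N (\<Union>i. A i)"
      using A assms(1) by (simp add: suminf_emeasure)
  qed
qed (use assms in auto)

lemma nn_integral_measure_plus: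
  assumes sets: "sets N = sets M" and f: "f \<in> borel_measurable M"
  shows "(\<integral>\<^sup>+x. f x \<partial>measure_plus M N) = (\<integral>\<^sup>+x. f x \<partial>M) + (\<integral>\<^sup>+x. f x \<partial>N)"
  using f
proof (induction rule: borel_measurable_induct)
  case (cong f g)
  moreover have "space N = space M" by (rule sets_eq_imp_space_eq[OF sets])
  ultimately have eqs: "(\<integral>\<^sup>+x. f x \<partial>measure_plus M N) = (\<integral>\<^sup>+x. g x \<partial>measure_plus M N)" "(\<integral>\<^sup>+x. f x \<partial>M) = (\<integral>\<^sup>+x. g x \<partial>M)" "(\<integral>\<^sup>+x. f x \<partial>N) = (\<integral>\<^sup>+x. g x \<partial>N)"
    by - (rule nn_integral_cong; simp)+
  show ?case unfolding eqs by (rule cong)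
next
  case (set A)
  then show ?case using sets by (simp add: emeasure_measure_plus)
next
  case (mult u c)
  then have "u \<in> borel_measurable N" "u \<in> borel_measurable (measure_plus M N)" using sets by (auto cong: measurable_cong_sets)
  with mult show ?case by (simp add: nn_integral_cmult distrib_left)
next
  case (add u v)
  then have "u \<in> borel_measurable N" "v \<in> borel_measurable N" "u \<in> borel_measurable (measure_plus M N)" "v \<in> borel_measurable (measure_plus M N)"
    using sets by (auto cong: measurable_cong_sets)
  with add show ?case by (simp add: nn_integral_add ac_simps)
next
  case (seq U)
  then have m: "\<And>i. U i \<in> borel_measurable N" "\<And>i. U i \<in> borel_measurable (measure_plus M N)" using sets by (auto cong: measurable_cong_sets)
  have inc: "incseq (\<lambda>i. integral\<^sup>N M (U i))" "incseq (\<lambda>i. integral\<^sup>N N (U i))"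
    using seq by (auto simp: incseq_def le_fun_def intro!: nn_integral_mono)
  have s: "(\<integral>\<^sup>+x. (SUP i. U i) x \<partial>L) = (SUP i. integral\<^sup>N L (U i))" if "\<And>i. U i \<in> borel_measurable L" for L
    unfolding SUP_apply using that seq by (intro nn_integral_monotone_convergence_SUP) auto
  show ?case
    unfolding s[OF seq(1)] s[OF m(1)] s[OF m(2)] using seq by (simp add: ennreal_SUP_add[OF inc])
qed

text \<open>Continuity at 0 supplies the total mass of a measure whose transform is known at positive arguments only.\<close>

lemma stieltjes_at_zero:
  fixes N :: "real measure"
  assumes "finite_measure N" "sets N = sets borel" "AE x in N. 0 \<le> x \<and> x \<le> 1" and c: "0 < c"
  shows "(\<lambda>n. LINT x|N. (1 + inverse (real (Suc n)) * x) powr (- c)) \<longlonglongrightarrow> (LINT x|N. (1 + 0 * x) powr (- c))"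
proof -
  interpret finite_measure N by fact
  note [measurable_cong] = assms(2)
  show ?thesis
  proof (rule integral_dominated_convergence[where w = "\<lambda>_. 1"])
    show "AE x in N. norm ((1 + inverse (real (Suc n)) * x) powr (- c)) \<le> 1" for n
      using assms(3)
    proof eventually_elim
      case (elim x)
      then have "0 \<le> inverse (real (Suc n)) * x" by simp
      then have "(1 + inverse (real (Suc n)) * x) powr (- c) \<le> 1 powr (- c)"
        using c by (intro powr_mono2') auto
      then show ?case by simp
    qed
    show "AE x in N. (\<lambda>n. (1 + inverse (real (Suc n)) * x) powr (- c)) \<longlonglongrightarrow> (1 + 0 * x) powr (- c)"
      by (intro AE_I2 tendsto_intros LIMSEQ_inverse_real_of_nat) auto
  qed auto
qed

lemma finite_measure_eqI_stieltjes_pos: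
  fixes M N :: "real measure"
  assumes c: "c > 0" and fin: "finite_measure M" "finite_measure N" and sets: "sets M = sets borel" "sets N = sets borel"
    and AE: "AE x in M. 0 \<le> x \<and> x \<le> 1" "AE x in N. 0 \<le> x \<and> x \<le> 1"
    and eq: "\<And>w. w > 0 \<Longrightarrow> (LINT x|M. (1 + w * x) powr (- c)) = (LINT x|N. (1 + w * x) powr (- c))"
  shows "M = N"
proof (rule finite_measure_eqI_stieltjes[OF c fin sets AE])
  fix w :: real assume "0 \<le> w"
  have "(\<lambda>n. LINT x|M. (1 + inverse (real (Suc n)) * x) powr (- c)) \<longlonglongrightarrow> (LINT x|N. (1 + 0 * x) powr (- c))"
    using stieltjes_at_zero[OF fin(2) sets(2) AE(2) c] by (subst eq) auto
  then have "(LINT x|M. (1 + 0 * x) powr (- c)) = (LINT x|N. (1 + 0 * x) powr (- c))"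
    using stieltjes_at_zero[OF fin(1) sets(1) AE(1) c] by (rule LIMSEQ_unique[rotated])
  then show "(LINT x|M. (1 + w * x) powr (- c)) = (LINT x|N. (1 + w * x) powr (- c))"
    using eq[of w] \<open>0 \<le> w\<close> by (cases "w = 0") auto
qed

text \<open>The candidate density is not known to be nonnegative. Moving its negative part to the other side gives two
positive measures with the same transform, so \<open>D\<close> plus the negative part equals the positive part. Evaluating on
\<open>{x. q x < 0}\<close>, where the positive part has no mass, shows that the negative part is null.\<close>

lemma prob_eq_density_signed:
  fixes D :: "real measure" and q :: "real \<Rightarrow> real"
  assumes D: "prob_space D" "sets D = sets borel" "AE x in D. 0 \<le> x \<and> x \<le> 1" and c: "0 < c"
    and q: "integrable lborel q" and supp: "\<And>x. \<not> (0 \<le> x \<and> x \<le> 1) \<Longrightarrow> q x = 0"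
    and eq: "\<And>w. 0 < w \<Longrightarrow> (LINT x|D. (1 + w * x) powr (- c)) = (LBINT x. q x * (1 + w * x) powr (- c))"
  shows "D = density lborel (\<lambda>x. ennreal (q x))"
proof -
  interpret D: prob_space D by fact
  note [measurable_cong] = D(2)
  have [measurable]: "q \<in> borel_measurable borel" using q by auto
  define Np where "Np = density lborel (\<lambda>x. ennreal (q x))"
  define Nm where "Nm = density lborel (\<lambda>x. ennreal (- q x))"
  have sN [simp, measurable_cong]: "sets Np = sets borel" "sets Nm = sets borel" by (simp_all add: Np_def Nm_def)
  have fin: "(\<integral>\<^sup>+x. ennreal (q x) \<partial>lborel) < \<infinity>" "(\<integral>\<^sup>+x. ennreal (- q x) \<partial>lborel) < \<infinity>"
    using q by (auto simp: real_integrable_def less_top)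
  have finp: "finite_measure Np" and finm: "finite_measure Nm"
    using fin by (auto intro!: finite_measureI simp: Np_def Nm_def emeasure_density)
  have spD: "space D = UNIV" using sets_eq_imp_space_eq[OF D(2)] by simp
  have finD: "finite_measure (measure_plus D Nm)"
  proof (rule finite_measureI)
    have "emeasure D UNIV + emeasure Nm UNIV \<noteq> \<infinity>"
      using finm by (simp add: D.emeasure_eq_measure finite_measure.emeasure_eq_measure)
    then show "emeasure (measure_plus D Nm) (space (measure_plus D Nm)) \<noteq> \<infinity>"
      by (simp add: emeasure_measure_plus D(2) spD)
  qed
  have supp': "0 \<le> x" "x \<le> 1" if "q x \<noteq> 0" for x using supp[of x] that by auto
  have AEp: "AE x in Np. 0 \<le> x \<and> x \<le> 1" and AEm: "AE x in Nm. 0 \<le> x \<and> x \<le> 1"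
    unfolding Np_def Nm_def by (auto simp: AE_density intro!: AE_I2 supp')
  have AED: "AE x in measure_plus D Nm. 0 \<le> x \<and> x \<le> 1"
  proof (rule AE_I)
    have "emeasure D {x \<in> space D. \<not> (0 \<le> x \<and> x \<le> 1)} = 0" using D(3) by (subst (asm) AE_iff_measurable[OF _ refl]) auto
    moreover have "emeasure Nm {x \<in> space D. \<not> (0 \<le> x \<and> x \<le> 1)} = 0"
      using AEm sets_eq_imp_space_eq[OF D(2)] by (subst (asm) AE_iff_measurable[OF _ refl]) (auto simp: Nm_def)
    ultimately show "emeasure (measure_plus D Nm) {x \<in> space D. \<not> (0 \<le> x \<and> x \<le> 1)} = 0"
      by (subst emeasure_measure_plus) (auto simp: D(2))
    show "{x \<in> space D. \<not> (0 \<le> x \<and> x \<le> 1)} \<in> sets (measure_plus D Nm)" by simp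
    show "{x \<in> space (measure_plus D Nm). \<not> (0 \<le> x \<and> x \<le> 1)} \<subseteq> {x \<in> space D. \<not> (0 \<le> x \<and> x \<le> 1)}" by simp
  qed
  have main: "measure_plus D Nm = Np"
  proof (rule finite_measure_eqI_stieltjes_pos[OF c finD finp _ _ AED AEp])
    show "sets (measure_plus D Nm) = sets borel" "sets Np = sets borel" by (simp_all add: D(2))
    fix w :: real assume w: "0 < w"
    define g where "g = (\<lambda>x. (1 + w * x) powr (- c))"
    have [measurable]: "g \<in> borel_measurable borel" unfolding g_def by measurable
    have g0: "0 \<le> g x" for x by (simp add: g_def)
    have g1: "g x \<le> 1" if "0 \<le> x" for x
    proof -
      have "(1 + w * x) powr (- c) \<le> 1 powr (- c)" using that w c by (intro powr_mono2') auto
      then show ?thesis by (simp add: g_def)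
    qed
    have qg: "integrable lborel (\<lambda>x. q x * g x)"
    proof (rule Bochner_Integration.integrable_bound[OF q])
      show "AE x in lborel. norm (q x * g x) \<le> norm (q x)"
      proof (rule AE_I2)
        fix x show "norm (q x * g x) \<le> norm (q x)"
          using g1[of x] g0[of x] supp[of x] by (cases "0 \<le> x \<and> x \<le> 1") (auto simp: abs_mult mult_left_le)
      qed
    qed measurable
    have iD: "integrable D g" using D(3) g0 g1 by (intro D.integrable_const_bound[of _ 1]) auto
    have parts: "(\<integral>\<^sup>+x. ennreal (g x) \<partial>Np) = (\<integral>\<^sup>+x. ennreal (q x * g x) \<partial>lborel)" "(\<integral>\<^sup>+x. ennreal (g x) \<partial>Nm) = (\<integral>\<^sup>+x. ennreal (- (q x * g x)) \<partial>lborel)"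
      unfolding Np_def Nm_def using g0 by (subst nn_integral_density; simp add: ennreal_mult''[symmetric])+
    have finqg: "(\<integral>\<^sup>+x. ennreal (q x * g x) \<partial>lborel) \<noteq> \<infinity>" "(\<integral>\<^sup>+x. ennreal (- (q x * g x)) \<partial>lborel) \<noteq> \<infinity>"
      using qg by (auto simp: real_integrable_def)
    have "(LINT x|measure_plus D Nm. g x) = enn2real (\<integral>\<^sup>+x. ennreal (g x) \<partial>measure_plus D Nm)"
      by (rule integral_eq_nn_integral) (auto simp: g0 D(2) cong: measurable_cong_sets)
    also have "(\<integral>\<^sup>+x. ennreal (g x) \<partial>measure_plus D Nm) = (\<integral>\<^sup>+x. ennreal (g x) \<partial>D) + (\<integral>\<^sup>+x. ennreal (- (q x * g x)) \<partial>lborel)"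
      using parts by (subst nn_integral_measure_plus) (auto simp: D(2))
    also have "(\<integral>\<^sup>+x. ennreal (g x) \<partial>D) = ennreal (LINT x|D. g x)" using iD g0 by (intro nn_integral_eq_integral) auto
    also have "(LINT x|D. g x) = (LBINT x. q x * g x)" using eq[OF w] by (simp add: g_def)
    also have "\<dots> = enn2real (\<integral>\<^sup>+x. ennreal (q x * g x) \<partial>lborel) - enn2real (\<integral>\<^sup>+x. ennreal (- (q x * g x)) \<partial>lborel)"
      by (rule real_lebesgue_integral_def[OF qg])
    also have "enn2real (ennreal (enn2real (\<integral>\<^sup>+x. ennreal (q x * g x) \<partial>lborel) - enn2real (\<integral>\<^sup>+x. ennreal (- (q x * g x)) \<partial>lborel)) + (\<integral>\<^sup>+x. ennreal (- (q x * g x)) \<partial>lborel)) = enn2real (\<integral>\<^sup>+x. ennreal (q x * g x) \<partial>lborel)"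
    proof -
      obtain A where A: "(\<integral>\<^sup>+x. ennreal (q x * g x) \<partial>lborel) = ennreal A" "0 \<le> A"
        using finqg(1) by (cases "\<integral>\<^sup>+x. ennreal (q x * g x) \<partial>lborel") auto
      obtain B where B: "(\<integral>\<^sup>+x. ennreal (- (q x * g x)) \<partial>lborel) = ennreal B" "0 \<le> B"
        using finqg(2) by (cases "\<integral>\<^sup>+x. ennreal (- (q x * g x)) \<partial>lborel") auto
      note AB = A B
      have "A - B = (LINT x|D. g x)" using AB eq[OF w] real_lebesgue_integral_def[OF qg] by (simp add: g_def)
      moreover have "0 \<le> (LINT x|D. g x)" using g0 by (intro Bochner_Integration.integral_nonneg) auto
      ultimately have "0 \<le> A - B" by simp
      then show ?thesis using AB by (simp add: ennreal_plus[symmetric] del: ennreal_plus)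
    qed
    also have "\<dots> = (LINT x|Np. g x)"
      unfolding parts(1)[symmetric] by (rule integral_eq_nn_integral[symmetric]) (auto simp: g0)
    finally show "(LINT x|measure_plus D Nm. (1 + w * x) powr (- c)) = (LINT x|Np. (1 + w * x) powr (- c))" by (simp add: g_def)
  qed
  have null: "emeasure Nm B = 0" if "B \<in> sets borel" for B
  proof -
    define E where "E = {x. q x < 0}"
    have [measurable]: "E \<in> sets borel" "B \<in> sets borel" using that by (auto simp: E_def)
    have "emeasure D E + emeasure Nm E = emeasure Np E"
      using emeasure_measure_plus[of Nm D E] main by (simp add: D(2))
    also have "emeasure Np E = 0"
      unfolding Np_def by (subst emeasure_density) (auto simp: nn_integral_0_iff_AE E_def indicator_def ennreal_neg intro!: AE_I2)
    finally have "emeasure Nm E = 0" by (simp add: add_eq_0_iff_both_eq_0)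
    moreover have "emeasure Nm B \<le> emeasure Nm E"
      unfolding Nm_def by (subst (1 2) emeasure_density) (auto intro!: nn_integral_mono simp: E_def indicator_def ennreal_neg)
    ultimately show ?thesis by simp
  qed
  show ?thesis
    unfolding Np_def[symmetric]
  proof (rule measure_eqI)
    fix A assume "A \<in> sets D"
    then show "emeasure D A = emeasure Np A"
      using emeasure_measure_plus[of Nm D A] main null[of A] by (simp add: D(2))
  qed (simp add: D(2))
qed

section \<open>The law of the mean functional for shape one\<close>

text \<open>With \<open>F x = 1 + ln x / a\<close> the distribution function of the shape measure, this is
\<open>sin (pi * c * F x) / pi\<close> times \<open>exp\<close> of minus \<open>c\<close> times the logarithmic potential. On the support of the shape measure,
\<open>(1 - x) powr (c - 1) * cr_fn a c x\<close> is \<open>- 1 / pi\<close> times the imaginary part of \<open>cauchy_fn c a\<close>; for \<open>c = 1\<close> it is the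
density found by Cifarelli and Regazzini.\<close>

definition cr_fn :: "real \<Rightarrow> real \<Rightarrow> real \<Rightarrow> real" where
  "cr_fn a c x = sin (pi * c * (1 + ln x / a)) / pi * exp (- c * rlogpot a x)"

lemma borel_measurable_cr_fn [measurable]: "cr_fn a c \<in> borel_measurable borel"
  unfolding cr_fn_def by measurable

lemma cr_fn_bound:
  assumes "0 < a" "0 < c"
  shows "\<bar>cr_fn a c x\<bar> \<le> exp (c * (\<bar>ln (a * exp (- a))\<bar> + 8))"
proof -
  have "- c * rlogpot a x \<le> c * (\<bar>ln (a * exp (- a))\<bar> + 8)"
    using mult_left_mono[OF rlogpot_lower[OF assms(1), of x], of c] assms by (simp add: algebra_simps)
  then have e: "exp (- c * rlogpot a x) \<le> exp (c * (\<bar>ln (a * exp (- a))\<bar> + 8))" by simp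
  have "\<bar>sin (pi * c * (1 + ln x / a))\<bar> \<le> pi" using abs_sin_le_one[of "pi * c * (1 + ln x / a)"] pi_ge_two by linarith
  then have "\<bar>sin (pi * c * (1 + ln x / a))\<bar> / pi \<le> 1" by simp
  then have "\<bar>cr_fn a c x\<bar> \<le> 1 * exp (- c * rlogpot a x)"
    unfolding cr_fn_def abs_mult abs_divide by (intro mult_mono) auto
  also have "\<dots> \<le> exp (c * (\<bar>ln (a * exp (- a))\<bar> + 8))" using e by simp
  finally show ?thesis .
qed

text \<open>The inversion formula at \<open>p = - 1 / \<omega>\<close>, in the variables of the Markov--Krein identity.\<close>

lemma cr_fn_stieltjes:
  assumes a: "0 < a" and c: "1 \<le> c" and w: "0 < \<omega>"
  shows "(LBINT x:{exp (- a)..1}. (1 - x) powr (c - 1) * cr_fn a c x / (1 + \<omega> * x)) = (1 + \<omega>) powr (c - 1) * exp (- (c / a) * log_transform a \<omega>)"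
proof -
  define p where "p = - (1 / \<omega>)"
  have p: "p < 0" using w by (simp add: p_def)
  have pt: "indicator {exp (- a)..1} x *\<^sub>R ((1 - x) powr (c - 1) * exp (- c * rlogpot a x) * sin (pi * c * (1 + ln x / a)) / (x - p))
      = pi * \<omega> * (indicator {exp (- a)..1} x *\<^sub>R ((1 - x) powr (c - 1) * cr_fn a c x / (1 + \<omega> * x)))" for x
  proof (cases "x \<in> {exp (- a)..1}")
    case True
    then have "0 < x" using less_le_trans[OF exp_gt_zero, of "- a" x] by simp
    then have "0 < 1 + \<omega> * x" using w by (simp add: add_pos_pos)
    moreover have "x - p = (1 + \<omega> * x) / \<omega>" using w by (simp add: p_def field_simps)
    ultimately show ?thesis using w by (simp add: cr_fn_def)
  qed simp
  have "pi * \<omega> * (LBINT x:{exp (- a)..1}. (1 - x) powr (c - 1) * cr_fn a c x / (1 + \<omega> * x)) = pi * ((1 - p) powr (c - 1) * exp (- c * rlogpot a p))"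
    using stieltjes_inversion[OF a c p] unfolding set_lebesgue_integral_def pt by (simp only: integral_mult_right_zero)
  also have "exp (- c * rlogpot a p) = \<omega> powr c * exp (- (c / a) * log_transform a \<omega>)"
    unfolding p_def rlogpot_neg[OF a w] using w by (simp add: powr_def exp_add[symmetric] algebra_simps)
  also have "(1 - p) powr (c - 1) = (1 + \<omega>) powr (c - 1) / \<omega> powr (c - 1)"
  proof -
    have "1 - p = (1 + \<omega>) / \<omega>" using w by (simp add: p_def field_simps)
    then show ?thesis using w by (simp add: powr_divide)
  qed
  also have "pi * ((1 + \<omega>) powr (c - 1) / \<omega> powr (c - 1) * (\<omega> powr c * exp (- (c / a) * log_transform a \<omega>))) = pi * \<omega> * ((1 + \<omega>) powr (c - 1) * exp (- (c / a) * log_transform a \<omega>))"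
  proof -
    have "\<omega> powr c = \<omega> * \<omega> powr (c - 1)" using w powr_add[of \<omega> 1 "c - 1"] by simp
    moreover have "0 < \<omega> powr (c - 1)" using w by simp
    ultimately show ?thesis by simp
  qed
  finally show ?thesis using w by simp
qed

lemma exp_rlogpot:
  assumes a: "0 < a" and s: "0 \<le> s" "s \<le> 1"
  shows "exp (- c * rlogpot a (exp (- a * s))) =
    exp (c * (a * s - a * s\<^sup>2 / 2)) * exp (c / a * pi\<^sup>2 / 3) * exp (- (c / a) * (Li2 (exp (- a * s)) + Li2 (exp (- a * (1 - s)))))"
  unfolding rlogpot_exp[OF a s] exp_add[symmetric] using a
  by (intro arg_cong[where f = exp]) (simp add: field_simps)

lemma exp_coordinate:
  fixes a x :: real
  assumes a: "0 < a" and x: "exp (- a) \<le> x" "x \<le> 1"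
  shows "0 < x" and "0 \<le> - ln x / a" and "- ln x / a \<le> 1" and "exp (- a * (- ln x / a)) = x" and "exp (- a * (1 - (- ln x / a))) = exp (- a) / x"
proof -
  show x0: "0 < x" by (rule less_le_trans[OF exp_gt_zero x(1)])
  have "- a \<le> ln x" "ln x \<le> 0" using x x0 by (simp_all add: ln_ge_iff)
  then show "0 \<le> - ln x / a" "- ln x / a \<le> 1" using a by (auto simp: field_simps)
  show e: "exp (- a * (- ln x / a)) = x" using a x0 by simp
  have "exp (- a * (1 - (- ln x / a))) = exp (- a) / exp (- a * (- ln x / a))"
    by (simp add: exp_diff[symmetric] algebra_simps)
  then show "exp (- a * (1 - (- ln x / a))) = exp (- a) / x" by (simp only: e)
qed

lemma density_M1_eq_cr_fn:
  assumes a: "0 < a"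
  shows "density_M1 a x = indicator {exp (- a)..1} x * cr_fn a 1 x"
proof (cases "exp (- a) \<le> x \<and> x \<le> 1")
  case True
  define s where "s = - ln x / a"
  note ec = exp_coordinate[OF a, of x, folded s_def]
  have x0: "0 < x" and s: "0 \<le> s" "s \<le> 1" and xs: "exp (- a * s) = x" "exp (- a * (1 - s)) = exp (- a) / x"
    using ec True by auto
  have lnx: "ln x = - a * s" using a by (simp add: s_def)
  have "exp (- 1 * rlogpot a x) = exp (1 * (a * s - a * s\<^sup>2 / 2)) * exp (1 / a * pi\<^sup>2 / 3) * exp (- (1 / a) * (Li2 x + Li2 (exp (- a) / x)))"
    using exp_rlogpot[OF a s, of 1] unfolding xs .
  also have "exp (1 * (a * s - a * s\<^sup>2 / 2)) = x powr (- ln x / (2 * a) - 1)"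
    using x0 a by (simp add: powr_def lnx power2_eq_square field_simps)
  finally have e: "exp (- 1 * rlogpot a x) = x powr (- ln x / (2 * a) - 1) * exp (pi\<^sup>2 / (3 * a)) * exp (- (1 / a) * (Li2 x + Li2 (exp (- a) / x)))"
    by (simp add: mult.commute)
  have "sin (pi * 1 * (1 + ln x / a)) = sin (- pi * ln x / a)" by (simp add: distrib_left sin_add)
  then show ?thesis using True e by (simp add: density_M1_def cr_fn_def)
qed (auto simp: density_M1_def)

lemma cr_fn_nonneg:
  assumes a: "0 < a" and x: "exp (- a) \<le> x" "x \<le> 1"
  shows "0 \<le> cr_fn a 1 x"
proof -
  have "0 \<le> 1 + ln x / a" "1 + ln x / a \<le> 1" using exp_coordinate(2,3)[OF a x] by auto
  then have "0 \<le> sin (pi * 1 * (1 + ln x / a))" by (intro sin_ge_zero) (auto intro: mult_left_le)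
  then show ?thesis by (simp add: cr_fn_def)
qed

lemma log_transform_bounds:
  assumes a: "0 < a" and w: "0 \<le> \<omega>"
  shows "0 \<le> log_transform a \<omega>" "log_transform a \<omega> \<le> \<omega> * a"
proof -
  have eq: "log_transform a \<omega> = (LBINT s:{0..a}. ln (1 + \<omega> * exp (- s)))" using log_transform_exp[of a \<omega>] a w by simp
  have b: "0 \<le> ln (1 + \<omega> * exp (- s))" "ln (1 + \<omega> * exp (- s)) \<le> \<omega>" if "0 \<le> s" for s
  proof -
    have p: "0 \<le> \<omega> * exp (- s)" using w by simp
    then show "0 \<le> ln (1 + \<omega> * exp (- s))" by simp
    have "ln (1 + \<omega> * exp (- s)) \<le> \<omega> * exp (- s)" by (rule ln_add_one_self_le_self[OF p])
    also have "\<dots> \<le> \<omega>" using that w by (intro mult_left_le) auto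
    finally show "ln (1 + \<omega> * exp (- s)) \<le> \<omega>" .
  qed
  show "0 \<le> log_transform a \<omega>" unfolding eq set_lebesgue_integral_def
    by (intro Bochner_Integration.integral_nonneg) (use b in \<open>auto simp: indicator_def\<close>)
  have "continuous_on {0..a} (\<lambda>s. ln (1 + \<omega> * exp (- s)))"
    using w by (intro continuous_intros) (auto intro!: less_imp_neq[symmetric] add_pos_nonneg)
  then have "log_transform a \<omega> \<le> (LBINT s:{0..a}. \<omega>)"
    unfolding eq using b by (intro set_integral_mono borel_integrable_atLeastAtMost') auto
  also have "\<dots> = \<omega> * a" using a by (simp add: set_lebesgue_integral_def)
  finally show "log_transform a \<omega> \<le> \<omega> * a" .
qed

text \<open>For \<open>c = 1\<close> the Stieltjes transform of \<open>cr_fn\<close> is the one required. That the total mass is 1 follows by letting \<open>\<omega>\<close> tend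
to 0.\<close>

lemma density_M1_law:
  assumes a: "0 < a"
  defines "\<kappa> \<equiv> density lborel (\<lambda>x. ennreal (density_M1 a x))"
  shows "prob_space \<kappa>" and "sets \<kappa> = sets borel" and "AE x in \<kappa>. 0 \<le> x \<and> x \<le> 1"
    and "\<And>\<omega>. 0 \<le> \<omega> \<Longrightarrow> (LINT x|\<kappa>. (1 + \<omega> * x) powr (- 1)) = exp (- (1 / a) * log_transform a \<omega>)"
proof -
  have nn: "0 \<le> density_M1 a x" for x using cr_fn_nonneg[OF a, of x] by (auto simp: density_M1_eq_cr_fn[OF a] indicator_def)
  have m [measurable]: "density_M1 a \<in> borel_measurable borel"
    unfolding density_M1_eq_cr_fn[OF a, abs_def] by measurable
  have int: "integrable lborel (density_M1 a)"
  proof (rule Bochner_Integration.integrable_bound[where f = "\<lambda>x. indicator {exp (- a)..1} x * exp (1 * (\<bar>ln (a * exp (- a))\<bar> + 8))"])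
    show "integrable lborel (\<lambda>x. indicator {exp (- a)..1} x * exp (1 * (\<bar>ln (a * exp (- a))\<bar> + 8)))"
      using a by (intro integrable_mult_left integrable_real_indicator) auto
    show "AE x in lborel. norm (density_M1 a x) \<le> norm (indicator {exp (- a)..1} x * exp (1 * (\<bar>ln (a * exp (- a))\<bar> + 8)))"
      using cr_fn_bound[OF a, of 1] by (intro AE_I2) (auto simp: density_M1_eq_cr_fn[OF a] abs_mult intro!: mult_left_mono)
  qed measurable
  show sets [measurable_cong]: "sets \<kappa> = sets borel" by (simp add: \<kappa>_def)
  have "(\<integral>\<^sup>+x. ennreal (density_M1 a x) \<partial>lborel) < \<infinity>" using int nn by (simp add: nn_integral_eq_integral)
  then interpret \<kappa>: finite_measure \<kappa> by (intro finite_measureI) (auto simp: \<kappa>_def emeasure_density)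
  show AE: "AE x in \<kappa>. 0 \<le> x \<and> x \<le> 1"
    unfolding \<kappa>_def using exp_coordinate(1)[OF a] by (subst AE_density) (auto simp: density_M1_eq_cr_fn[OF a] indicator_def less_imp_le)
  have pos: "(LINT x|\<kappa>. (1 + \<omega> * x) powr (- 1)) = exp (- (1 / a) * log_transform a \<omega>)" if w: "0 < \<omega>" for \<omega>
  proof -
    have "(LINT x|\<kappa>. (1 + \<omega> * x) powr (- 1)) = (LBINT x. density_M1 a x *\<^sub>R (1 + \<omega> * x) powr (- 1))"
      unfolding \<kappa>_def using nn by (intro integral_density) auto
    also have "\<dots> = (LBINT x:{exp (- a)..1}. (1 - x) powr (1 - 1) * cr_fn a 1 x / (1 + \<omega> * x))"
      unfolding set_lebesgue_integral_def
    proof (rule integral_cong_AE)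
      have "AE x in lborel. x \<noteq> (1::real)" by (rule AE_lborel_singleton)
      then show "AE x in lborel. density_M1 a x *\<^sub>R (1 + \<omega> * x) powr (- 1) = indicator {exp (- a)..1} x *\<^sub>R ((1 - x) powr (1 - 1) * cr_fn a 1 x / (1 + \<omega> * x))"
      proof eventually_elim
        case (elim x)
        show ?case
        proof (cases "x \<in> {exp (- a)..1}")
          case True
          then have "0 < x" using exp_coordinate(1)[OF a, of x] by auto
          then have "0 < 1 + \<omega> * x" using w by (simp add: add_pos_pos)
          then show ?thesis using True elim by (simp add: density_M1_eq_cr_fn[OF a] powr_minus powr_one divide_inverse)
        qed (simp add: density_M1_eq_cr_fn[OF a])
      qed
    qed measurable
    also have "\<dots> = exp (- (1 / a) * log_transform a \<omega>)"
      using cr_fn_stieltjes[OF a order_refl w] w by simp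
    finally show ?thesis .
  qed
  have one: "(LINT x|\<kappa>. (1 + 0 * x) powr (- 1)) = 1"
  proof (rule LIMSEQ_unique[OF stieltjes_at_zero[OF \<kappa>.finite_measure_axioms sets AE zero_less_one]])
    have "(\<lambda>n. log_transform a (inverse (real (Suc n)))) \<longlonglongrightarrow> 0"
    proof (rule tendsto_sandwich[OF _ _ tendsto_const])
      have "(\<lambda>n. inverse (real (Suc n)) * a) \<longlonglongrightarrow> 0 * a" by (intro tendsto_intros LIMSEQ_inverse_real_of_nat)
      then show "(\<lambda>n. inverse (real (Suc n)) * a) \<longlonglongrightarrow> 0" by simp
    qed (use log_transform_bounds[OF a] in auto)
    then have "(\<lambda>n. exp (- (1 / a) * log_transform a (inverse (real (Suc n))))) \<longlonglongrightarrow> exp (- (1 / a) * 0)" by (intro tendsto_intros)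
    then show "(\<lambda>n. LINT x|\<kappa>. (1 + inverse (real (Suc n)) * x) powr (- 1)) \<longlonglongrightarrow> 1" by (subst pos) auto
  qed
  then have "measure \<kappa> (space \<kappa>) = 1" by simp
  then show "prob_space \<kappa>" by (intro prob_spaceI) (simp add: \<kappa>.emeasure_eq_measure)
  fix \<omega> :: real assume "0 \<le> \<omega>"
  moreover have "log_transform a 0 = 0" by (simp add: log_transform_def)
  ultimately show "(LINT x|\<kappa>. (1 + \<omega> * x) powr (- 1)) = exp (- (1 / a) * log_transform a \<omega>)"
    using pos[of \<omega>] one by (cases "\<omega> = 0") auto
qed

section \<open>Exponential coordinates\<close>

text \<open>Stated as an identity of measures, the change of variables \<open>x = exp (- a * v)\<close> applies to integrals and to densities
alike.\<close>

lemma exp_coordinate_measure: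
  fixes a :: real
  assumes a: "0 < a"
  shows "density lborel (\<lambda>x. ennreal (indicator {exp (- a)..1} x)) =
    distr (density lborel (\<lambda>v. ennreal (indicator {0..1} v * (a * exp (- a * v))))) borel (\<lambda>v. exp (- a * v))"
proof (rule measure_eqI)
  fix A :: "real set" assume "A \<in> sets (density lborel (\<lambda>x. ennreal (indicator {exp (- a)..1} x)))"
  then have [measurable]: "A \<in> sets borel" by simp
  have "emeasure (density lborel (\<lambda>x. ennreal (indicator {exp (- a)..1} x))) A = (\<integral>\<^sup>+x. indicator A x * indicator {exp (a * (0 - 1))..exp (a * (1 - 1))} x \<partial>lborel)"
    by (subst emeasure_density) (auto intro!: nn_integral_cong simp: indicator_def)
  \<comment> \<open>The substitution rule requires an increasing map, hence the detour over \<open>w = 1 - v\<close>.\<close>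
  also have "\<dots> = (\<integral>\<^sup>+w. indicator A (exp (a * (w - 1))) * ennreal (a * exp (a * (w - 1))) * indicator {0..1} w \<partial>lborel)"
    by (rule nn_integral_substitution_aux) (use a in \<open>auto intro!: derivative_eq_intros continuous_intros\<close>)
  also have "\<dots> = ennreal \<bar>- 1\<bar> * (\<integral>\<^sup>+v. indicator A (exp (a * (1 + - 1 * v - 1))) * ennreal (a * exp (a * (1 + - 1 * v - 1))) * indicator {0..1} (1 + - 1 * v) \<partial>lborel)"
    by (rule nn_integral_real_affine) auto
  also have "\<dots> = (\<integral>\<^sup>+v. ennreal (indicator {0..1} v * (a * exp (- a * v))) * indicator A (exp (- a * v)) \<partial>lborel)"
    by (auto intro!: nn_integral_cong simp: indicator_def)
  also have "\<dots> = (\<integral>\<^sup>+v. indicator A (exp (- a * v)) \<partial>density lborel (\<lambda>v. ennreal (indicator {0..1} v * (a * exp (- a * v)))))"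
    by (rule nn_integral_density[symmetric]) measurable
  also have "\<dots> = (\<integral>\<^sup>+x. indicator A x \<partial>distr (density lborel (\<lambda>v. ennreal (indicator {0..1} v * (a * exp (- a * v))))) borel (\<lambda>v. exp (- a * v)))"
    by (rule nn_integral_distr[symmetric]) measurable
  also have "\<dots> = emeasure (distr (density lborel (\<lambda>v. ennreal (indicator {0..1} v * (a * exp (- a * v))))) borel (\<lambda>v. exp (- a * v))) A"
    by (rule nn_integral_indicator) simp
  finally show "emeasure (density lborel (\<lambda>x. ennreal (indicator {exp (- a)..1} x))) A =
    emeasure (distr (density lborel (\<lambda>v. ennreal (indicator {0..1} v * (a * exp (- a * v))))) borel (\<lambda>v. exp (- a * v))) A" .
qed simp

lemma exp_coordinate_integral:
  fixes f :: "real \<Rightarrow> real"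
  assumes a: "0 < a" and [measurable]: "f \<in> borel_measurable borel"
  shows "(LBINT x. indicator {exp (- a)..1} x * f x) = (LBINT v. indicator {0..1} v * (a * exp (- a * v)) * f (exp (- a * v)))"
proof -
  have "(LBINT x. indicator {exp (- a)..1} x * f x) = (LINT x|density lborel (\<lambda>x. ennreal (indicator {exp (- a)..1} x)). f x)"
    by (subst integral_density) auto
  also have "\<dots> = (LINT v|density lborel (\<lambda>v. ennreal (indicator {0..1} v * (a * exp (- a * v)))). f (exp (- a * v)))"
    unfolding exp_coordinate_measure[OF a] by (rule integral_distr) measurable
  also have "\<dots> = (LBINT v. indicator {0..1} v * (a * exp (- a * v)) * f (exp (- a * v)))"
    using a by (subst integral_density) auto
  finally show ?thesis .
qed

lemma density_V_eq:
  assumes a: "0 < a" and v: "0 \<le> v" "v \<le> 1"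
  shows "a * exp (- a * v) * density_M1 a (exp (- a * v)) = density_V a v"
proof -
  have x: "exp (- a) \<le> exp (- a * v)" "exp (- a * v) \<le> 1" using a v by (auto simp: mult_left_le)
  have e: "exp (- a) / exp (- a * v) = exp (- a * (1 - v))" by (simp add: exp_diff[symmetric] algebra_simps)
  have s: "- pi * ln (exp (- a * v)) / a = pi * v" using a by simp
  have p: "exp (- a * v) powr (- ln (exp (- a * v)) / (2 * a) - 1) = exp (a * v) * exp (- a * v\<^sup>2 / 2)"
  proof -
    have "exp (- a * v) powr (- ln (exp (- a * v)) / (2 * a) - 1) = exp ((v / 2 - 1) * (- a * v))"
      using a by (simp add: powr_def)
    also have "(v / 2 - 1) * (- a * v) = a * v + - a * v\<^sup>2 / 2" by (simp add: algebra_simps power2_eq_square)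
    finally show ?thesis by (simp only: exp_add)
  qed
  have alg: "a * E * (1 / pi * S * (G * Q) * C * L) = (E * G) * (a / pi * S * Q * C * L)" for E S G Q C L :: real by simp
  have c: "exp (- a * v) * exp (a * v) = 1" by (simp add: exp_add[symmetric])
  have "a * exp (- a * v) * density_M1 a (exp (- a * v)) = (exp (- a * v) * exp (a * v)) * (a / pi * sin (pi * v) * exp (- a * v\<^sup>2 / 2) * exp (pi\<^sup>2 / (3 * a)) *
       exp (- (1 / a) * (Li2 (exp (- a * v)) + Li2 (exp (- a * (1 - v))))))"
    unfolding density_M1_def e s p if_P[OF conjI[OF x]] by (rule alg)
  also have "\<dots> = density_V a v" unfolding c using v by (simp add: density_V_def)
  finally show ?thesis .
qed

lemma distr_density_M1:
  assumes a: "0 < a"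
  shows "distr (density lborel (\<lambda>x. ennreal (density_M1 a x))) borel (\<lambda>x. - ln x / a) = density lborel (\<lambda>v. ennreal (density_V a v))"
proof -
  let ?h = "\<lambda>v. ennreal (indicator {0..1} v * (a * exp (- a * v)))"
  have [measurable]: "density_M1 a \<in> borel_measurable borel"
    unfolding density_M1_eq_cr_fn[OF a, abs_def] by measurable
  have "density lborel (\<lambda>x. ennreal (density_M1 a x)) = density (density lborel (\<lambda>x. ennreal (indicator {exp (- a)..1} x))) (\<lambda>x. ennreal (density_M1 a x))"
  proof -
    have "ennreal (density_M1 a x) = ennreal (indicator {exp (- a)..1} x) * ennreal (density_M1 a x)" for x
      by (cases "x \<in> {exp (- a)..1}") (auto simp: density_M1_eq_cr_fn[OF a])
    then have "density lborel (\<lambda>x. ennreal (density_M1 a x)) = density lborel (\<lambda>x. ennreal (indicator {exp (- a)..1} x) * ennreal (density_M1 a x))" by (intro arg_cong[where f = "density lborel"] ext)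
    also have "\<dots> = density (density lborel (\<lambda>x. ennreal (indicator {exp (- a)..1} x))) (\<lambda>x. ennreal (density_M1 a x))"
      by (rule density_density_eq[symmetric]) measurable
    finally show ?thesis .
  qed
  also have "\<dots> = distr (density (density lborel ?h) (\<lambda>v. ennreal (density_M1 a (exp (- a * v))))) borel (\<lambda>v. exp (- a * v))"
    unfolding exp_coordinate_measure[OF a] by (rule density_distr) measurable
  finally have "distr (density lborel (\<lambda>x. ennreal (density_M1 a x))) borel (\<lambda>x. - ln x / a)
      = distr (density (density lborel ?h) (\<lambda>v. ennreal (density_M1 a (exp (- a * v))))) borel (\<lambda>v. v)"
    using a by (simp add: distr_distr comp_def)
  also have "\<dots> = density (density lborel ?h) (\<lambda>v. ennreal (density_M1 a (exp (- a * v))))"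
    by (rule distr_id2) simp
  also have "\<dots> = density lborel (\<lambda>v. ?h v * ennreal (density_M1 a (exp (- a * v))))"
    by (rule density_density_eq) measurable
  also have "\<dots> = density lborel (\<lambda>v. ennreal (density_V a v))"
  proof (rule density_cong)
    show "(\<lambda>v. ennreal (density_V a v)) \<in> borel_measurable lborel"
    proof -
      have "(\<lambda>v. ennreal (indicator {0..1} v * (a * exp (- a * v) * density_M1 a (exp (- a * v))))) \<in> borel_measurable lborel" by measurable
      also have "(\<lambda>v. ennreal (indicator {0..1} v * (a * exp (- a * v) * density_M1 a (exp (- a * v))))) = (\<lambda>v. ennreal (density_V a v))"
        using density_V_eq[OF a] by (intro ext) (auto simp: indicator_def density_V_def)
      finally show ?thesis .
    qed
    show "AE v in lborel. ?h v * ennreal (density_M1 a (exp (- a * v))) = ennreal (density_V a v)"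
    proof (rule AE_I2)
      fix v :: real
      show "?h v * ennreal (density_M1 a (exp (- a * v))) = ennreal (density_V a v)"
      proof (cases "0 \<le> v \<and> v \<le> 1")
        case True
        have "?h v * ennreal (density_M1 a (exp (- a * v))) = ennreal (a * exp (- a * v) * density_M1 a (exp (- a * v)))"
          using True a by (subst ennreal_mult'[symmetric]) auto
        then show ?thesis using density_V_eq[OF a] True by simp
      qed (auto simp: density_V_def)
    qed
  qed measurable
  finally show ?thesis .
qed

section \<open>The law of the mean functional for shape larger than one\<close>

text \<open>The ratio \<open>r = (x - u) / (1 + w * x)\<close> has derivative \<open>(1 + w * u) / (1 + w * x)^2\<close>, so the integrand is the derivative of
\<open>r powr (c - 1) / (1 + w * u)\<close>. For \<open>c < 2\<close> it is unbounded at \<open>u\<close>, which calls for a fundamental theorem on open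
intervals.\<close>

lemma beta_kernel_integral:
  fixes c w u :: real
  assumes c: "1 < c" and w: "0 \<le> w" and u: "0 \<le> u" "u \<le> 1"
  shows "integrable lborel (\<lambda>x. indicator {u<..1} x * ((c - 1) * (x - u) powr (c - 2) * (1 + w * x) powr (- c)))"
    and "(LBINT x. indicator {u<..1} x * ((c - 1) * (x - u) powr (c - 2) * (1 + w * x) powr (- c))) = (1 - u) powr (c - 1) * (1 + w) powr (1 - c) / (1 + w * u)"
proof -
  define f where "f = (\<lambda>x. (c - 1) * (x - u) powr (c - 2) * (1 + w * x) powr (- c))"
  have [measurable]: "f \<in> borel_measurable borel" unfolding f_def by measurable
  have fnn: "0 \<le> f x" for x using c by (simp add: f_def)
  have wu: "0 < 1 + w * u" using w u by (simp add: add_pos_nonneg)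
  have ae: "AE x in lborel. indicator {u<..1} x * f x = indicator {u<..<1} x * f x"
    using AE_lborel_singleton[of 1] by eventually_elim (auto simp: indicator_def)
  have main: "set_integrable lborel {u<..<1} f \<and> (LBINT x:{u<..<1}. f x) = (1 - u) powr (c - 1) * (1 + w) powr (1 - c) / (1 + w * u)"
  proof (cases "u < 1")
    case True
    define F where "F = (\<lambda>x. ((x - u) / (1 + w * x)) powr (c - 1) / (1 + w * u))"
    have pos: "0 < 1 + w * x" if "u < x" for x using that u w by (simp add: add_pos_nonneg)
    have lim: "(F \<longlongrightarrow> F y) (at y within S)" if "u \<le> y" and S: "\<forall>\<^sub>F x in at y within S. u \<le> x" for y S
    proof -
      have py: "0 < 1 + w * y" using that u w by (simp add: add_pos_nonneg)
      have t: "((\<lambda>x. (x - u) / (1 + w * x)) \<longlongrightarrow> (y - u) / (1 + w * y)) (at y within S)"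
        using py by (intro tendsto_intros) auto
      have ev: "\<forall>\<^sub>F x in at y within S. 0 \<le> (x - u) / (1 + w * x)"
        using S
      proof eventually_elim
        case (elim x)
        then have "0 \<le> 1 + w * x" using u w by simp
        then show ?case using elim by simp
      qed
      show ?thesis unfolding F_def
        by (rule tendsto_divide[OF tendsto_powr'[OF t tendsto_const] tendsto_const]) (use ev c wu in auto)
    qed
    have d: "DERIV F x :> f x" if x: "u < x" for x
    proof -
      have px: "0 < 1 + w * x" by (rule pos[OF x])
      define r where "r = (x - u) / (1 + w * x)"
      have r: "0 < r" using px x by (simp add: r_def)
      have dr: "DERIV (\<lambda>x. (x - u) / (1 + w * x)) x :> (1 + w * u) / (1 + w * x)\<^sup>2"
        using px by (auto intro!: derivative_eq_intros simp: power2_eq_square field_simps)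
      have "DERIV (\<lambda>x. ((x - u) / (1 + w * x)) powr (c - 1)) x :> (c - 1) * r powr (c - 1 - 1) * ((1 + w * u) / (1 + w * x)\<^sup>2)"
        using DERIV_fun_powr[OF dr, of "c - 1"] r unfolding r_def by simp
      then have "DERIV F x :> (c - 1) * r powr (c - 1 - 1) * ((1 + w * u) / (1 + w * x)\<^sup>2) / (1 + w * u)"
        unfolding F_def by (rule DERIV_cdivide)
      moreover have "(c - 1) * r powr (c - 1 - 1) * ((1 + w * u) / (1 + w * x)\<^sup>2) / (1 + w * u) = f x"
      proof -
        have "r powr (c - 1 - 1) = (x - u) powr (c - 2) / (1 + w * x) powr (c - 2)" using x px by (simp add: r_def powr_divide)
        moreover have "(1 + w * x) powr (- c) = 1 / ((1 + w * x) powr (c - 2) * (1 + w * x)\<^sup>2)"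
        proof -
          have "(1 + w * x) powr (c - 2) * (1 + w * x)\<^sup>2 = (1 + w * x) powr (c - 2) * (1 + w * x) powr 2" using px by (simp add: powr_numeral)
          also have "\<dots> = (1 + w * x) powr c" by (simp add: powr_add[symmetric])
          finally show ?thesis by (simp add: powr_minus_divide)
        qed
        ultimately show ?thesis using wu by (simp add: f_def)
      qed
      ultimately show ?thesis by simp
    qed
    have cont: "isCont f x" if "u < x" for x
      unfolding f_def using pos[OF that] that by (intro continuous_intros) auto
    have A: "((F \<circ> real_of_ereal) \<longlongrightarrow> F u) (at_right (ereal u))"
      unfolding ereal_tendsto_simps by (rule lim) (auto simp: eventually_at_filter)
    have B: "((F \<circ> real_of_ereal) \<longlongrightarrow> F 1) (at_left (ereal 1))"
      unfolding ereal_tendsto_simps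
    proof (rule lim)
      show "\<forall>\<^sub>F x in at_left 1. u \<le> x" using eventually_at_left_real[OF True] by eventually_elim auto
    qed (use True in auto)
    have lt: "ereal u < ereal 1" using True by simp
    have 1: "set_integrable lborel (einterval (ereal u) (ereal 1)) f" "(LBINT x=ereal u..ereal 1. f x) = F 1 - F u"
      using interval_integral_FTC_nonneg[OF lt _ _ _ A B, of f] d cont fnn by auto
    have "F 1 - F u = (1 - u) powr (c - 1) * (1 + w) powr (1 - c) / (1 + w * u)"
    proof -
      have "(1 + w) powr (1 - c) = 1 / (1 + w) powr (c - 1)" using powr_minus_divide[of "1 + w" "c - 1"] by simp
      then show ?thesis using True w by (simp add: F_def powr_divide)
    qed
    then show ?thesis using 1 True by (simp add: interval_lebesgue_integral_def)
  next
    case False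
    then have "u = 1" using u by simp
    then show ?thesis by (simp add: set_integrable_def set_lebesgue_integral_def)
  qed
  have i: "integrable lborel (\<lambda>x. indicator {u<..<1} x * f x)" using main by (simp add: set_integrable_def)
  have "integrable lborel (\<lambda>x. indicator {u<..1} x * f x)"
  proof (rule integrable_cong_AE_imp[OF i])
    show "AE x in lborel. indicator {u<..<1} x * f x = indicator {u<..1} x * f x" using ae by eventually_elim (rule sym)
  qed measurable
  then show "integrable lborel (\<lambda>x. indicator {u<..1} x * ((c - 1) * (x - u) powr (c - 2) * (1 + w * x) powr (- c)))" by (simp add: f_def)
  have "(LBINT x. indicator {u<..1} x * f x) = (LBINT x. indicator {u<..<1} x * f x)"
    by (rule integral_cong_AE[OF _ _ ae]) auto
  then show "(LBINT x. indicator {u<..1} x * ((c - 1) * (x - u) powr (c - 2) * (1 + w * x) powr (- c))) = (1 - u) powr (c - 1) * (1 + w) powr (1 - c) / (1 + w * u)"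
    using main by (simp add: f_def set_lebesgue_integral_def)
qed

text \<open>In the variable \<open>u = exp (- a * v)\<close> the density is the fractional integral of order \<open>c - 1\<close> of \<open>cr_fn\<close>, up to the factor
\<open>Gamma c\<close>. The end point \<open>u = x\<close> may be dropped from the domain since \<open>0 powr (c - 2) = 0\<close>.\<close>

lemma density_M_eq_cr_fn:
  assumes a: "0 < a" and c: "1 < \<theta> * a"
  shows "density_M \<theta> a x = (LBINT u. indicator {exp (- a)..1} u * (indicator {u<..1} x * ((\<theta> * a - 1) * (x - u) powr (\<theta> * a - 2)) * cr_fn a (\<theta> * a) u))"
proof -
  define c where "c = \<theta> * a"
  have ca: "c / a = \<theta>" using a by (simp add: c_def)
  define k where "k = (\<lambda>u. indicator {u<..1} x * ((c - 1) * (x - u) powr (c - 2)) * cr_fn a c u)"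
  have k_eq: "k = (\<lambda>u. (if u < x \<and> x \<le> 1 then 1 else 0) * ((c - 1) * (x - u) powr (c - 2)) * cr_fn a c u)"
    by (auto simp: k_def fun_eq_iff)
  have [measurable]: "k \<in> borel_measurable borel" unfolding k_eq by measurable
  have "(LBINT u. indicator {exp (- a)..1} u * k u) = (LBINT v. indicator {0..1} v * (a * exp (- a * v)) * k (exp (- a * v)))"
    by (rule exp_coordinate_integral[OF a]) measurable
  also have "\<dots> = density_M \<theta> a x"
  proof (cases "exp (- a) \<le> x \<and> x \<le> 1")
    case True
    note ec = exp_coordinate[OF a conjunct1[OF True] conjunct2[OF True]]
    have "indicator {0..1} v * (a * exp (- a * v)) * k (exp (- a * v)) = (c - 1) / pi * (indicator {- ln x / a..1} v *\<^sub>R ((x - exp (- v * a)) powr (c - 2) * sin (pi * \<theta> * a * (1 - v)) *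
         (a * exp (- a * v)) * exp (\<theta> * a * (a * v - a * v\<^sup>2 / 2)) * exp (\<theta> * pi\<^sup>2 / 3) *
         exp (- \<theta> * (Li2 (exp (- a * v)) + Li2 (exp (- a * (1 - v)))))))" for v
    proof (cases "v \<in> {- ln x / a..1}")
      case v: True
      then have v01: "0 \<le> v" "v \<le> 1" using ec(2) by auto
      have le: "exp (- a * v) \<le> x"
      proof -
        have "- ln x \<le> v * a" using v a by (simp add: pos_divide_le_eq[symmetric])
        then have "exp (- a * v) \<le> exp (- a * (- ln x / a))" using a by (simp add: mult.commute)
        then show ?thesis unfolding ec(4) .
      qed
      have crv: "cr_fn a c (exp (- a * v)) = sin (pi * \<theta> * a * (1 - v)) / pi * (exp (\<theta> * a * (a * v - a * v\<^sup>2 / 2)) * exp (\<theta> * pi\<^sup>2 / 3) *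
         exp (- \<theta> * (Li2 (exp (- a * v)) + Li2 (exp (- a * (1 - v))))))"
      proof -
        have "pi * c * (1 + ln (exp (- a * v)) / a) = pi * \<theta> * a * (1 - v)" using a by (simp add: c_def)
        then have sv: "sin (pi * c * (1 + ln (exp (- a * v)) / a)) = sin (pi * \<theta> * a * (1 - v))" by (rule arg_cong)
        show ?thesis unfolding cr_fn_def exp_rlogpot[OF a v01] ca sv by (simp add: c_def)
      qed
      have comm: "exp (- v * a) = exp (- a * v)" by (simp add: mult.commute)
      show ?thesis
      proof (cases "exp (- a * v) < x")
        case True
        then show ?thesis using v v01 \<open>exp (- a) \<le> x \<and> x \<le> 1\<close> unfolding k_def crv comm by simp
      next
        case False
        then have "exp (- a * v) = x" using le by simp
        then show ?thesis unfolding k_def comm by simp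
      qed
    next
      case v: False
      have "indicator {0..1} v * k (exp (- a * v)) = 0"
      proof (cases "v \<in> {0..1}")
        case v01: True
        then have "v < - ln x / a" using v by auto
        then have "v * a < - ln x" using a by (simp add: pos_less_divide_eq[symmetric])
        then have "exp (- a * (- ln x / a)) < exp (- a * v)" using a by (simp add: mult.commute)
        then have "x < exp (- a * v)" unfolding ec(4) .
        then show ?thesis by (simp add: k_def)
      qed simp
      then show ?thesis using v by auto
    qed
    then show ?thesis using True unfolding density_M_def set_lebesgue_integral_def by (simp add: c_def)
  next
    case False
    have "indicator {0..1} v * (a * exp (- a * v)) * k (exp (- a * v)) = 0" for v :: real
    proof (cases "v \<in> {0..1}")
      case True
      then have "exp (- a) \<le> exp (- a * v)" using a by (simp add: mult_left_le)
      then have "x \<notin> {exp (- a * v)<..1}" using False by (auto simp del: exp_le_cancel_iff)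
      then have "k (exp (- a * v)) = 0" by (simp add: k_def)
      then show ?thesis by (simp only: mult_zero_right)
    qed simp
    then have "(LBINT v. indicator {0..1} v * (a * exp (- a * v)) * k (exp (- a * v))) = 0" by (simp only: integral_zero)
    then show ?thesis using False by (auto simp: density_M_def)
  qed
  finally show ?thesis by (simp add: k_def c_def)
qed

text \<open>By Fubini the transform of the density is the integral of \<open>cr_fn\<close> against the transforms of the kernels, which is
the Stieltjes transform evaluated by \<open>cr_fn_stieltjes\<close>. Joint integrability uses that \<open>cr_fn\<close> is bounded and that the
kernels have transforms at most 1.\<close>

lemma density_M_stieltjes:
  assumes a: "0 < a" and c: "1 < \<theta> * a" and w: "0 \<le> w"
  shows "integrable lborel (\<lambda>x. density_M \<theta> a x * (1 + w * x) powr (- (\<theta> * a)))"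
    and "0 < w \<Longrightarrow> (LBINT x. density_M \<theta> a x * (1 + w * x) powr (- (\<theta> * a))) = exp (- (\<theta> * a / a) * log_transform a w)"
proof -
  define c where "c = \<theta> * a"
  have c1: "1 < c" using c by (simp add: c_def)
  define g where "g = (\<lambda>u x. indicator {u<..1} x * ((c - 1) * (x - u) powr (c - 2) * (1 + w * x) powr (- c)))"
  define W where "W = (\<lambda>u. (1 - u) powr (c - 1) * (1 + w) powr (1 - c) / (1 + w * u))"
  define f where "f = (\<lambda>u x. indicator {exp (- a)..1} u * cr_fn a c u * g u x)"
  have gnn: "0 \<le> g u x" for u x using c1 by (simp add: g_def)
  have u01: "0 < u" "u \<le> 1" if "u \<in> {exp (- a)..1}" for u using exp_coordinate(1)[OF a, of u] that by auto
  have g: "integrable lborel (g u)" "(LBINT x. g u x) = W u" if "u \<in> {exp (- a)..1}" for u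
    using beta_kernel_integral[OF c1 w, of u] u01[OF that] unfolding g_def W_def by auto
  have Wb: "0 \<le> W u" "W u \<le> 1" if "u \<in> {exp (- a)..1}" for u
  proof -
    have "1 \<le> 1 + w * u" using w u01[OF that] by simp
    moreover have "(1 - u) powr (c - 1) \<le> 1 powr (c - 1)" using u01[OF that] c1 by (intro powr_mono2) auto
    moreover have "(1 + w) powr (1 - c) \<le> 1"
      using powr_mono2'[of "1 - c" 1 "1 + w"] w c1 by simp
    ultimately show "0 \<le> W u" "W u \<le> 1" unfolding W_def
      by (auto simp: divide_le_eq_1 intro: order_trans[OF mult_le_one])
  qed
  have fmeas: "case_prod f \<in> borel_measurable (lborel \<Otimes>\<^sub>M lborel)"
  proof -
    have "case_prod f = (\<lambda>p. indicator {exp (- a)..1} (fst p) * cr_fn a c (fst p) * ((if fst p < snd p \<and> snd p \<le> 1 then 1 else 0) * ((c - 1) * (snd p - fst p) powr (c - 2) * (1 + w * snd p) powr (- c))))"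
      by (auto simp: fun_eq_iff f_def g_def)
    then show ?thesis by simp
  qed
  have fint: "integrable (lborel \<Otimes>\<^sub>M lborel) (case_prod f)"
  proof (rule lborel_pair.Fubini_integrable[OF fmeas])
    have eq: "(LBINT x. norm (case (u, x) of (u, x) \<Rightarrow> f u x)) = indicator {exp (- a)..1} u * \<bar>cr_fn a c u\<bar> * W u" for u
    proof (cases "u \<in> {exp (- a)..1}")
      case True
      have "(LBINT x. norm (case (u, x) of (u, x) \<Rightarrow> f u x)) = (LBINT x. \<bar>cr_fn a c u\<bar> * g u x)"
        using True gnn by (intro Bochner_Integration.integral_cong) (auto simp: f_def abs_mult)
      then show ?thesis using g(2)[OF True] True by simp
    qed (simp add: f_def)
    have [measurable]: "W \<in> borel_measurable borel" unfolding W_def by measurable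
    show "integrable lborel (\<lambda>u. LBINT x. norm (case (u, x) of (u, x) \<Rightarrow> f u x))"
      unfolding eq
    proof (rule Bochner_Integration.integrable_bound[where f = "\<lambda>u. indicator {exp (- a)..1} u * exp (c * (\<bar>ln (a * exp (- a))\<bar> + 8))"])
      show "integrable lborel (\<lambda>u. indicator {exp (- a)..1} u * exp (c * (\<bar>ln (a * exp (- a))\<bar> + 8)))"
        using a by (intro integrable_mult_left integrable_real_indicator) auto
      show "AE u in lborel. norm (indicator {exp (- a)..1} u * \<bar>cr_fn a c u\<bar> * W u) \<le> norm (indicator {exp (- a)..1} u * exp (c * (\<bar>ln (a * exp (- a))\<bar> + 8)))"
      proof (rule AE_I2)
        fix u :: real
        show "norm (indicator {exp (- a)..1} u * \<bar>cr_fn a c u\<bar> * W u) \<le> norm (indicator {exp (- a)..1} u * exp (c * (\<bar>ln (a * exp (- a))\<bar> + 8)))"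
        proof (cases "u \<in> {exp (- a)..1}")
          case True
          have "\<bar>cr_fn a c u\<bar> * W u \<le> exp (c * (\<bar>ln (a * exp (- a))\<bar> + 8)) * 1"
            using cr_fn_bound[OF a, of c u] Wb[OF True] c1 by (intro mult_mono) auto
          then show ?thesis using True Wb[OF True] by (simp add: abs_mult)
        qed simp
      qed
    qed measurable
    show "AE u in lborel. integrable lborel (\<lambda>x. case (u, x) of (u, x) \<Rightarrow> f u x)"
    proof (rule AE_I2)
      fix u :: real
      show "integrable lborel (\<lambda>x. case (u, x) of (u, x) \<Rightarrow> f u x)"
        using g(1)[of u] by (cases "u \<in> {exp (- a)..1}") (auto simp: f_def)
    qed
  qed
  have q: "(LBINT u. f u x) = density_M \<theta> a x * (1 + w * x) powr (- (\<theta> * a))" for x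
  proof -
    have "density_M \<theta> a x * (1 + w * x) powr (- c) = (LBINT u. indicator {exp (- a)..1} u * (indicator {u<..1} x * ((c - 1) * (x - u) powr (c - 2)) * cr_fn a c u) * (1 + w * x) powr (- c))"
      unfolding density_M_eq_cr_fn[OF a c] c_def by (rule integral_mult_left_zero[symmetric])
    also have "\<dots> = (LBINT u. f u x)"
      by (intro Bochner_Integration.integral_cong refl) (simp add: f_def g_def)
    finally show ?thesis by (simp add: c_def)
  qed
  show "integrable lborel (\<lambda>x. density_M \<theta> a x * (1 + w * x) powr (- (\<theta> * a)))"
    using lborel_pair.integrable_snd[OF fint] unfolding q .
  assume w0: "0 < w"
  have "(LBINT x. density_M \<theta> a x * (1 + w * x) powr (- (\<theta> * a))) = (LBINT u. LBINT x. f u x)"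
    unfolding q[symmetric] by (rule lborel_pair.Fubini_integral[OF fint])
  also have "\<dots> = (LBINT u. (1 + w) powr (1 - c) * (indicator {exp (- a)..1} u *\<^sub>R ((1 - u) powr (c - 1) * cr_fn a c u / (1 + w * u))))"
  proof (rule Bochner_Integration.integral_cong[OF refl])
    fix u :: real
    show "(LBINT x. f u x) = (1 + w) powr (1 - c) * (indicator {exp (- a)..1} u *\<^sub>R ((1 - u) powr (c - 1) * cr_fn a c u / (1 + w * u)))"
    proof (cases "u \<in> {exp (- a)..1}")
      case True
      then have "(LBINT x. f u x) = cr_fn a c u * W u" using g(2)[OF True] by (simp add: f_def)
      then show ?thesis using True by (simp add: W_def)
    qed (simp add: f_def)
  qed
  also have "\<dots> = (1 + w) powr (1 - c) * ((1 + w) powr (c - 1) * exp (- (c / a) * log_transform a w))"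
    using cr_fn_stieltjes[OF a less_imp_le[OF c1] w0] unfolding integral_mult_right_zero set_lebesgue_integral_def by simp
  also have "\<dots> = exp (- (c / a) * log_transform a w)"
    using w powr_add[of "1 + w" "1 - c" "c - 1"] by simp
  finally show "(LBINT x. density_M \<theta> a x * (1 + w * x) powr (- (\<theta> * a))) = exp (- (\<theta> * a / a) * log_transform a w)" by (simp add: c_def)
qed

lemma mean_law_eq_density_M:
  assumes dir: "dirichlet_process N P (scale_measure (ennreal (\<theta> * a)) (F_law a))" and a: "0 < a" and c: "1 < \<theta> * a"
    and D: "D = mean_functional_law N P a"
  shows "D = density lborel (\<lambda>x. ennreal (density_M \<theta> a x))"
proof -
  have c0: "0 < \<theta> * a" using c by simp
  note mix = mean_functional_gamma_mixture[OF dir a c0 D]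
  show ?thesis
  proof (rule prob_eq_density_signed[OF mix(1-3) c0])
    show "integrable lborel (density_M \<theta> a)" using density_M_stieltjes(1)[OF a c, of 0] by simp
    show "density_M \<theta> a x = 0" if "\<not> (0 \<le> x \<and> x \<le> 1)" for x
      using that exp_coordinate(1)[OF a, of x] by (auto simp: density_M_def)
    show "(LINT x|D. (1 + w * x) powr (- (\<theta> * a))) = (LBINT x. density_M \<theta> a x * (1 + w * x) powr (- (\<theta> * a)))" if "0 < w" for w
      using mix(4)[of w] density_M_stieltjes(2)[OF a c, of w] that by simp
  qed
qed

lemma distr_density_divide:
  fixes q :: "real \<Rightarrow> real"
  assumes a: "0 < a" and [measurable]: "q \<in> borel_measurable borel"
  shows "distr (density lborel (\<lambda>x. ennreal (q x))) borel (\<lambda>x. x / a) = density lborel (\<lambda>y. ennreal (a * q (a * y)))"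
proof (rule measure_eqI)
  fix A assume "A \<in> sets (distr (density lborel (\<lambda>x. ennreal (q x))) borel (\<lambda>x. x / a))"
  then have [measurable]: "A \<in> sets borel" by simp
  have "emeasure (distr (density lborel (\<lambda>x. ennreal (q x))) borel (\<lambda>x. x / a)) A = (\<integral>\<^sup>+x. indicator A x \<partial>distr (density lborel (\<lambda>x. ennreal (q x))) borel (\<lambda>x. x / a))"
    by (rule nn_integral_indicator[symmetric]) simp
  also have "\<dots> = (\<integral>\<^sup>+x. indicator A (x / a) \<partial>density lborel (\<lambda>x. ennreal (q x)))"
    by (rule nn_integral_distr) measurable
  also have "\<dots> = (\<integral>\<^sup>+x. ennreal (q x) * indicator A (x / a) \<partial>lborel)"
    by (rule nn_integral_density) measurable
  also have "\<dots> = ennreal \<bar>a\<bar> * (\<integral>\<^sup>+y. ennreal (q (0 + a * y)) * indicator A ((0 + a * y) / a) \<partial>lborel)"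
    using a by (intro nn_integral_real_affine) auto
  also have "\<dots> = (\<integral>\<^sup>+y. ennreal (a * q (a * y)) * indicator A y \<partial>lborel)"
    using a by (subst nn_integral_cmult[symmetric]) (auto intro!: nn_integral_cong simp: ennreal_mult' mult.assoc)
  also have "\<dots> = emeasure (density lborel (\<lambda>y. ennreal (a * q (a * y)))) A"
    by (rule emeasure_density[symmetric]) auto
  finally show "emeasure (distr (density lborel (\<lambda>x. ennreal (q x))) borel (\<lambda>x. x / a)) A = emeasure (density lborel (\<lambda>y. ennreal (a * q (a * y)))) A" .
qed simp

lemma mean_law_eq_density_M1:
  assumes dir: "dirichlet_process N P (scale_measure (ennreal 1) (F_law a))" and a: "0 < a"
    and D: "D = mean_functional_law N P a"
  shows "D = density lborel (\<lambda>x. ennreal (density_M1 a x))"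
proof -
  note mix = mean_functional_gamma_mixture[OF dir a zero_less_one D]
  note law = density_M1_law[OF a]
  show ?thesis
    by (rule finite_measure_eqI_stieltjes[OF zero_less_one prob_space.finite_measure[OF mix(1)] prob_space.finite_measure[OF law(1)] mix(2) law(2) mix(3) law(3)])
       (simp only: mix(4) law(4))
qed

section \<open>Stationary law of the Ornstein--Uhlenbeck process\<close>

text \<open>Over a time \<open>t\<close> the stationary variable is contracted by \<open>exp (- lam * t)\<close> and an independent increment is added.\<close>

lemma char_ou_stationary:
  assumes G: "gamma_process M G \<theta>" and th: "0 < \<theta>" and lam: "0 < lam" and L: "ou_stationary_law M G lam L" and t: "0 < t"
  shows "char L u = char L (u * exp (- lam * t)) * char (distr M borel (ou_increment G lam t)) u"
proof -
  interpret M: prob_space M using G by (simp add: gamma_process_def subordinator_def)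
  have L': "prob_space L" and sets [measurable_cong]: "sets L = sets borel"
    and st: "distr (L \<Otimes>\<^sub>M M) borel (\<lambda>(x, w). exp (- lam * t) * x + ou_increment G lam t w) = L"
    using L t unfolding ou_stationary_law_def by auto
  interpret L: prob_space L by (rule L')
  interpret LM: pair_prob_space L M ..
  have [measurable]: "ou_increment G lam t \<in> borel_measurable M"
    by (rule borel_measurable_ou_increment[OF G th lam t refl])
  let ?f = "\<lambda>x. iexp (u * exp (- lam * t) * x)" and ?g = "\<lambda>w. iexp (u * ou_increment G lam t w)"
  have int: "integrable (L \<Otimes>\<^sub>M M) (\<lambda>p. ?f (fst p) * ?g (snd p))"
    by (rule LM.P.integrable_const_bound[of _ 1]) (auto simp: norm_mult)
  have "char L u = (CLINT y|distr (L \<Otimes>\<^sub>M M) borel (\<lambda>(x, w). exp (- lam * t) * x + ou_increment G lam t w). iexp (u * y))"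
    unfolding st char_def ..
  also have "\<dots> = (LINT p|(L \<Otimes>\<^sub>M M). ?f (fst p) * ?g (snd p))"
  proof (subst integral_distr)
    show "(LINT p|(L \<Otimes>\<^sub>M M). iexp (u * (case p of (x, w) \<Rightarrow> exp (- lam * t) * x + ou_increment G lam t w))) = (LINT p|(L \<Otimes>\<^sub>M M). ?f (fst p) * ?g (snd p))"
      by (intro Bochner_Integration.integral_cong refl) (simp add: case_prod_beta exp_add[symmetric] algebra_simps)
  qed measurable
  also have "\<dots> = (LINT x|L. LINT w|M. ?f x * ?g w)"
    using LM.integral_fst'[OF int] by simp
  also have "\<dots> = (LINT x|L. ?f x) * (LINT w|M. ?g w)" by simp
  also have "(LINT x|L. ?f x) = char L (u * exp (- lam * t))" by (simp add: char_def)
  also have "(LINT w|M. ?g w) = char (distr M borel (ou_increment G lam t)) u" by (simp add: char_def integral_distr)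
  finally show ?thesis .
qed

text \<open>The increment depends on the rate and the time only through their product. This brings increments with varying rates
within reach of a stationary law that belongs to one fixed rate.\<close>

lemma ou_increment_rescale:
  assumes "0 < lam" "0 < l" shows "ou_increment G l d = ou_increment G lam (l * d / lam)"
  using assms by (intro ext) (simp add: ou_increment_eq)

text \<open>Divide the factorisation of the characteristic function by its first factor, which tends to 1, and apply Levy's
continuity theorem.\<close>

lemma weak_conv_ou:
  assumes G: "gamma_process M G \<theta>" and th: "0 < \<theta>" and lam: "0 < lam" and L: "ou_stationary_law M G lam L"
    and pos: "\<And>n. 0 < lams n \<and> 0 < Dels n" and lim: "(\<lambda>n. exp (- (lams n * Dels n))) \<longlonglongrightarrow> 0"
  shows "weak_conv_m (\<lambda>n. distr M borel (ou_increment G (lams n) (Dels n))) L"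
proof (rule levy_continuity)
  interpret M: prob_space M using G by (simp add: gamma_process_def subordinator_def)
  have L': "prob_space L" and sets: "sets L = sets borel" using L by (auto simp: ou_stationary_law_def)
  have sp: "space L = UNIV" using sets_eq_imp_space_eq[OF sets] by simp
  show rdL: "real_distribution L" using L' sets sp by (simp add: real_distribution_def real_distribution_axioms_def)
  interpret L: real_distribution L by (rule rdL)
  have [measurable]: "ou_increment G (lams n) (Dels n) \<in> borel_measurable M" for n
    using pos[of n] by (intro borel_measurable_ou_increment[OF G th _ _ refl]) auto
  show "real_distribution (distr M borel (ou_increment G (lams n) (Dels n)))" for n
    by (intro M.real_distribution_distr) measurable
  fix u :: real
  have fac: "char L u = char L (u * exp (- (lams n * Dels n))) * char (distr M borel (ou_increment G (lams n) (Dels n))) u" for n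
  proof -
    have t: "0 < lams n * Dels n / lam" using pos[of n] lam by simp
    show ?thesis
      using char_ou_stationary[OF G th lam L t, of u] ou_increment_rescale[OF lam, of "lams n" G "Dels n"] pos[of n] lam
      by simp
  qed
  have "(\<lambda>n. u * exp (- (lams n * Dels n))) \<longlonglongrightarrow> u * 0" by (intro tendsto_intros lim)
  then have "(\<lambda>n. char L (u * exp (- (lams n * Dels n)))) \<longlonglongrightarrow> char L (u * 0)"
    by (intro isCont_tendsto_compose[OF L.isCont_char])
  then have c1: "(\<lambda>n. char L (u * exp (- (lams n * Dels n)))) \<longlonglongrightarrow> 1" by (simp add: L.char_zero)
  have "eventually (\<lambda>n. char L (u * exp (- (lams n * Dels n))) \<noteq> 0) sequentially"
    by (rule tendsto_imp_eventually_ne[OF c1]) simp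
  then have ev: "eventually (\<lambda>n. char L u / char L (u * exp (- (lams n * Dels n))) = char (distr M borel (ou_increment G (lams n) (Dels n))) u) sequentially"
  proof eventually_elim
    case (elim n)
    then show ?case using fac[of n] by (simp add: field_simps)
  qed
  have "(\<lambda>n. char L u / char L (u * exp (- (lams n * Dels n)))) \<longlonglongrightarrow> char L u / 1"
    by (intro tendsto_divide tendsto_const c1) simp
  then show "(\<lambda>n. char (distr M borel (ou_increment G (lams n) (Dels n))) u) \<longlonglongrightarrow> char L u"
    using ev by (simp add: Lim_transform_eventually)
qed

text \<open>The Laplace transforms of the increments converge by weak convergence. Since \<open>exp (- \<omega> * x)\<close> is bounded on the half line
only, it has to be shown first that the limit law does not charge the negative axis.\<close>

lemma levy_exponent_ou_stationary:
  assumes G: "gamma_process M G \<theta>" and th: "0 < \<theta>" and lam: "0 < lam" and L: "ou_stationary_law M G lam L" and w: "0 \<le> \<omega>"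
  shows "levy_exponent L \<omega> = \<theta> * (LBINT u:{0<..1}. ln (1 + \<omega> * u) / u)"
proof -
  interpret M: prob_space M using G by (simp add: gamma_process_def subordinator_def)
  have L': "prob_space L" and sets [measurable_cong]: "sets L = sets borel" using L by (auto simp: ou_stationary_law_def)
  have sp: "space L = UNIV" using sets_eq_imp_space_eq[OF sets] by simp
  interpret L: real_distribution L using L' sets sp by (simp add: real_distribution_def real_distribution_axioms_def)
  define J where "J = (\<lambda>n. ou_increment G lam (real (Suc n) / lam))"
  have pos: "0 < real (Suc n) / lam" and prd: "lam * (real (Suc n) / lam) = real (Suc n)" for n using lam by auto
  have [measurable]: "J n \<in> borel_measurable M" for n
    unfolding J_def by (rule borel_measurable_ou_increment[OF G th lam pos refl])
  have J0: "0 \<le> J n w" for n w unfolding J_def by (rule ou_increment_nonneg[OF G th lam pos refl])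
  have elim: "(\<lambda>n. exp (- real (Suc n))) \<longlonglongrightarrow> 0"
  proof -
    have "(\<lambda>n. exp (- 1 :: real) ^ Suc n) \<longlonglongrightarrow> 0" by (intro LIMSEQ_Suc LIMSEQ_power_zero) auto
    then show ?thesis by (simp add: exp_of_nat_mult[symmetric] del: power_Suc of_nat_Suc)
  qed
  have wc: "weak_conv_m (\<lambda>n. distr M borel (J n)) L"
    unfolding J_def by (rule weak_conv_ou[OF G th lam L]) (use lam elim prd pos in auto)
  have rd: "real_distribution (distr M borel (J n))" for n by (intro M.real_distribution_distr) measurable
  have conv: "(\<lambda>n. LINT x|distr M borel (J n). f x) \<longlonglongrightarrow> (LINT x|L. f x)"
    if "\<And>x. isCont f x" "\<And>x. norm (f x) \<le> 1" for f :: "real \<Rightarrow> real"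
    using weak_conv_imp_integral_bdd_continuous_conv[OF rd L.real_distribution_axioms wc that] .
  \<comment> \<open>A bounded continuous function that is positive exactly on the negative axis.\<close>
  have "(\<lambda>n. LINT x|distr M borel (J n). min 1 (max 0 (- x))) \<longlonglongrightarrow> (LINT x|L. min 1 (max 0 (- x)))"
    by (rule conv) (auto intro!: continuous_intros)
  moreover have "(LINT x|distr M borel (J n). min 1 (max 0 (- x))) = 0" for n
    using J0 by (subst integral_distr) (auto simp: max_absorb1)
  ultimately have "(LINT x|L. min 1 (max 0 (- x))) = 0" by (simp add: LIMSEQ_const_iff)
  then have "AE x in L. min 1 (max 0 (- x)) = 0"
    by (subst (asm) integral_nonneg_eq_0_iff_AE) (auto intro!: L.integrable_const_bound[of _ 1] AE_I2)
  then have L0: "AE x in L. 0 \<le> x" by eventually_elim (auto simp: min_def max_def split: if_splits)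
  have "(\<lambda>n. LINT x|distr M borel (J n). exp (- \<omega> * max 0 x)) \<longlonglongrightarrow> (LINT x|L. exp (- \<omega> * max 0 x))"
    by (rule conv) (use w in \<open>auto intro!: continuous_intros\<close>)
  moreover have "(LINT x|distr M borel (J n). exp (- \<omega> * max 0 x)) = exp (- \<theta> * log_transform (real (Suc n)) \<omega>)" for n
  proof -
    have "(LINT x|distr M borel (J n). exp (- \<omega> * max 0 x)) = (LINT w|M. exp (- \<omega> * J n w))"
      using J0 by (subst integral_distr) (auto simp: max_absorb2)
    then show ?thesis
      using has_bochner_integral_integral_eq[OF laplace_ou_increment[OF G th lam pos prd[symmetric], of \<omega> n]] w by (simp add: J_def)
  qed
  ultimately have l1: "(\<lambda>n. exp (- \<theta> * log_transform (real (Suc n)) \<omega>)) \<longlonglongrightarrow> (LINT x|L. exp (- \<omega> * max 0 x))" by simp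
  have "(\<lambda>n. exp (- \<theta> * log_transform (real (Suc n)) \<omega>)) \<longlonglongrightarrow> exp (- \<theta> * (LBINT u:{0<..1}. ln (1 + \<omega> * u) / u))"
    by (intro tendsto_intros log_transform_tendsto[OF w _ elim]) simp
  with l1 have "(LINT x|L. exp (- \<omega> * max 0 x)) = exp (- \<theta> * (LBINT u:{0<..1}. ln (1 + \<omega> * u) / u))"
    by (rule LIMSEQ_unique)
  moreover have "(LINT x|L. exp (- \<omega> * max 0 x)) = (LINT x|L. exp (- \<omega> * x))"
    by (rule integral_cong_AE, measurable, use L0 in eventually_elim) (simp add: max_absorb2)
  ultimately have "(LINT x|L. exp (- \<omega> * x)) = exp (- \<theta> * (LBINT u:{0<..1}. ln (1 + \<omega> * u) / u))" by simp
  then show ?thesis unfolding levy_exponent_def by (simp only: ln_exp)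
qed

lemma PiM_lborel_scale:
  assumes s: "0 < s" and [simp]: "finite I" and f [measurable]: "f \<in> borel_measurable (PiM I (\<lambda>_. borel))"
  shows "(\<integral>\<^sup>+x. f x \<partial>PiM I (\<lambda>_. lborel)) = ennreal (s ^ card I) * (\<integral>\<^sup>+x. f (\<lambda>i\<in>I. s * x i) \<partial>PiM I (\<lambda>_. lborel))"
proof -
  interpret product_sigma_finite "\<lambda>_. lborel :: real measure" by unfold_locales
  have m [measurable]: "(\<lambda>x. \<lambda>i\<in>I. s * x i) \<in> PiM I (\<lambda>_. lborel) \<rightarrow>\<^sub>M PiM I (\<lambda>_. lborel)" by measurable
  have fl [measurable]: "f \<in> borel_measurable (PiM I (\<lambda>_. lborel))"
    using f by (simp cong: measurable_cong_sets sets_PiM_cong)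
  have "density (distr (PiM I (\<lambda>_. lborel)) (PiM I (\<lambda>_. lborel)) (\<lambda>x. \<lambda>i\<in>I. s * x i)) (\<lambda>_. ennreal (s ^ card I)) = PiM I (\<lambda>_. lborel)"
  proof (rule PiM_eqI)
    fix A :: "'a \<Rightarrow> real set" assume A: "\<And>i. i \<in> I \<Longrightarrow> A i \<in> sets lborel"
    have comp: "ennreal s * emeasure lborel ((*) s -` A i) = emeasure lborel (A i)" if "i \<in> I" for i
    proof -
      have [measurable]: "A i \<in> sets borel" using A[OF that] by simp
      have "emeasure lborel (A i) = emeasure (density (distr lborel borel (\<lambda>x. 0 + s * x)) (\<lambda>_. ennreal \<bar>s\<bar>)) (A i)"
        using lborel_real_affine[of s 0] s by simp
      also have "\<dots> = ennreal s * emeasure (distr lborel borel (\<lambda>x. 0 + s * x)) (A i)"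
        using s by (simp add: emeasure_density nn_integral_cmult_indicator)
      also have "emeasure (distr lborel borel (\<lambda>x. 0 + s * x)) (A i) = emeasure lborel ((*) s -` A i)"
        by (subst emeasure_distr) (auto intro!: arg_cong[where f = "emeasure lborel"])
      finally show ?thesis by simp
    qed
    have [measurable]: "Pi\<^sub>E I A \<in> sets (PiM I (\<lambda>_. lborel))" using A by (intro sets_PiM_I_finite) auto
    have "emeasure (density (distr (PiM I (\<lambda>_. lborel)) (PiM I (\<lambda>_. lborel)) (\<lambda>x. \<lambda>i\<in>I. s * x i)) (\<lambda>_. ennreal (s ^ card I))) (Pi\<^sub>E I A)
        = ennreal (s ^ card I) * emeasure (distr (PiM I (\<lambda>_. lborel)) (PiM I (\<lambda>_. lborel)) (\<lambda>x. \<lambda>i\<in>I. s * x i)) (Pi\<^sub>E I A)"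
      by (simp add: emeasure_density nn_integral_cmult_indicator)
    also have "emeasure (distr (PiM I (\<lambda>_. lborel)) (PiM I (\<lambda>_. lborel)) (\<lambda>x. \<lambda>i\<in>I. s * x i)) (Pi\<^sub>E I A) = emeasure (PiM I (\<lambda>_. lborel)) (Pi\<^sub>E I (\<lambda>i. (*) s -` A i))"
      by (subst emeasure_distr) (auto simp: space_PiM intro!: arg_cong2[where f = emeasure] dest: PiE_mem)
    also have "\<dots> = (\<Prod>i\<in>I. emeasure lborel ((*) s -` A i))"
    proof (rule emeasure_PiM)
      fix i assume "i \<in> I"
      then have "A i \<in> sets borel" using A by simp
      then show "(*) s -` A i \<in> sets lborel"
        using measurable_sets[of "(*) s" borel borel "A i"] by simp
    qed simp
    also have "ennreal (s ^ card I) * (\<Prod>i\<in>I. emeasure lborel ((*) s -` A i)) = (\<Prod>i\<in>I. ennreal s * emeasure lborel ((*) s -` A i))"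
      using s by (simp add: prod.distrib ennreal_power)
    also have "\<dots> = (\<Prod>i\<in>I. emeasure lborel (A i))" by (intro prod.cong refl comp)
    finally show "emeasure (density (distr (PiM I (\<lambda>_. lborel)) (PiM I (\<lambda>_. lborel)) (\<lambda>x. \<lambda>i\<in>I. s * x i)) (\<lambda>_. ennreal (s ^ card I))) (Pi\<^sub>E I A) = (\<Prod>i\<in>I. emeasure lborel (A i))" .
  qed auto
  then have "(\<integral>\<^sup>+x. f x \<partial>PiM I (\<lambda>_. lborel)) = (\<integral>\<^sup>+x. f x \<partial>density (distr (PiM I (\<lambda>_. lborel)) (PiM I (\<lambda>_. lborel)) (\<lambda>x. \<lambda>i\<in>I. s * x i)) (\<lambda>_. ennreal (s ^ card I)))"
    by simp
  also have "\<dots> = ennreal (s ^ card I) * (\<integral>\<^sup>+x. f (\<lambda>i\<in>I. s * x i) \<partial>PiM I (\<lambda>_. lborel))"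
    by (simp add: nn_integral_density nn_integral_distr nn_integral_cmult)
  finally show ?thesis .
qed

text \<open>Independent variables with a common density have the product density.\<close>

lemma PiM_density_lborel:
  fixes f :: "real \<Rightarrow> ennreal"
  assumes [simp]: "finite I" and [measurable]: "f \<in> borel_measurable borel" and sf: "sigma_finite_measure (density lborel f)"
  shows "PiM I (\<lambda>_. density lborel f) = density (PiM I (\<lambda>_. lborel)) (\<lambda>x. \<Prod>i\<in>I. f (x i))"
proof -
  interpret sf: sigma_finite_measure "density lborel f" by fact
  interpret D: product_sigma_finite "\<lambda>_. density lborel f" by unfold_locales
  interpret B: product_sigma_finite "\<lambda>_. lborel :: real measure" by unfold_locales
  have "density (PiM I (\<lambda>_. lborel)) (\<lambda>x. \<Prod>i\<in>I. f (x i)) = PiM I (\<lambda>_. density lborel f)"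
  proof (rule D.PiM_eqI)
    show "sets (density (PiM I (\<lambda>_. lborel)) (\<lambda>x. \<Prod>i\<in>I. f (x i))) = sets (PiM I (\<lambda>_. density lborel f))"
      by (simp cong: sets_PiM_cong)
    fix A :: "'a \<Rightarrow> real set" assume A: "\<And>i. i \<in> I \<Longrightarrow> A i \<in> sets (density lborel f)"
    then have [measurable]: "A i \<in> sets borel" if "i \<in> I" for i using that by simp
    have [measurable]: "Pi\<^sub>E I A \<in> sets (PiM I (\<lambda>_. lborel))" using A by (intro sets_PiM_I_finite) auto
    have "emeasure (density (PiM I (\<lambda>_. lborel)) (\<lambda>x. \<Prod>i\<in>I. f (x i))) (Pi\<^sub>E I A) = (\<integral>\<^sup>+x. (\<Prod>i\<in>I. f (x i)) * indicator (Pi\<^sub>E I A) x \<partial>PiM I (\<lambda>_. lborel))"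
      by (intro emeasure_density) measurable
    also have "\<dots> = (\<integral>\<^sup>+x. (\<Prod>i\<in>I. f (x i) * indicator (A i) (x i)) \<partial>PiM I (\<lambda>_. lborel))"
    proof (intro nn_integral_cong)
      fix x assume "x \<in> space (PiM I (\<lambda>_. lborel :: real measure))"
      then have "indicator (Pi\<^sub>E I A) x = (\<Prod>i\<in>I. indicator (A i) (x i) :: ennreal)"
        by (auto simp: indicator_def space_PiM PiE_iff prod_zero_iff split: if_splits)
      then show "(\<Prod>i\<in>I. f (x i)) * indicator (Pi\<^sub>E I A) x = (\<Prod>i\<in>I. f (x i) * indicator (A i) (x i))"
        by (simp add: prod.distrib)
    qed
    also have "\<dots> = (\<Prod>i\<in>I. \<integral>\<^sup>+y. f y * indicator (A i) y \<partial>lborel)"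
      by (rule B.product_nn_integral_prod) auto
    also have "\<dots> = (\<Prod>i\<in>I. emeasure (density lborel f) (A i))"
      by (intro prod.cong refl emeasure_density[symmetric]) auto
    finally show "emeasure (density (PiM I (\<lambda>_. lborel)) (\<lambda>x. \<Prod>i\<in>I. f (x i))) (Pi\<^sub>E I A) = (\<Prod>i\<in>I. emeasure (density lborel f) (A i))" .
  qed simp
  then show ?thesis by simp
qed

section \<open>Exponential variables and Dirichlet weights\<close>

lemma gamma_law_1: "gamma_law 1 = density lborel (\<lambda>x. ennreal (if 0 < x then exp (- x) else 0))"
  unfolding gamma_law_def by (auto intro!: density_cong)

text \<open>Replace the last coordinate by the sum \<open>s\<close> of all coordinates and scale the remaining ones by \<open>s\<close>: the joint density of
independent exponential variables becomes \<open>exp (- s) * s^k\<close> times the indicator of the simplex, and integrating out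
\<open>s\<close> yields the constant \<open>Gamma (k + 1)\<close>.\<close>

lemma dirichlet_law_from_exponentials:
  "distr (PiM {..<Suc k} (\<lambda>_. gamma_law 1)) (PiM {..<Suc k} (\<lambda>_. borel)) (normalized_weights (Suc k)) = dirichlet_law (Suc k) (\<lambda>_. 1)"
proof (rule measure_eqI)
  show "sets (distr (PiM {..<Suc k} (\<lambda>_. gamma_law 1)) (PiM {..<Suc k} (\<lambda>_. borel)) (normalized_weights (Suc k))) = sets (dirichlet_law (Suc k) (\<lambda>_. 1))"
    by (simp add: dirichlet_law_def)
next
  fix A assume "A \<in> sets (distr (PiM {..<Suc k} (\<lambda>_. gamma_law 1)) (PiM {..<Suc k} (\<lambda>_. borel)) (normalized_weights (Suc k)))"
  then have A [measurable]: "A \<in> sets (PiM {..<Suc k} (\<lambda>_. borel :: real measure))" by simp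
  define F :: "(nat \<Rightarrow> real) \<Rightarrow> ennreal" where "F = indicator A"
  have F [measurable]: "F \<in> borel_measurable (PiM {..<Suc k} (\<lambda>_. borel))" by (simp add: F_def)
  define f where "f = (\<lambda>x::real. ennreal (if 0 < x then exp (- x) else 0))"
  have [measurable]: "f \<in> borel_measurable borel" unfolding f_def by measurable
  interpret g: prob_space "gamma_law 1" by (rule prob_space_gamma_law) simp
  have sf: "sigma_finite_measure (density lborel f)" using g.sigma_finite_measure_axioms by (simp add: gamma_law_1 f_def)
  interpret B: product_sigma_finite "\<lambda>_::nat. lborel :: real measure" by unfold_locales
  interpret FB: finite_product_sigma_finite "\<lambda>_::nat. lborel :: real measure" "{..<k}" by unfold_locales simp
  interpret PB: pair_sigma_finite "PiM {..<k} (\<lambda>_. lborel :: real measure)" "lborel :: real measure" by unfold_locales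
  define dm where "dm = (\<lambda>w::nat\<Rightarrow>real. \<lambda>i\<in>{..<Suc k}. if i < k then w i else 1 - (\<Sum>j<k. w j))"
  define Smp where "Smp = {w::nat\<Rightarrow>real. (\<forall>i<k. 0 < w i) \<and> (\<Sum>i<k. w i) < 1}"
  define C where "C = (\<integral>\<^sup>+w. indicator Smp w * F (dm w) \<partial>PiM {..<k} (\<lambda>_. lborel))"
  have dm [measurable]: "dm \<in> PiM {..<k} (\<lambda>_. lborel) \<rightarrow>\<^sub>M PiM {..<Suc k} (\<lambda>_. borel)"
    unfolding dm_def
  proof (rule measurable_restrict)
    fix i assume "i \<in> {..<Suc k}"
    show "(\<lambda>w. if i < k then w i else 1 - (\<Sum>j<k. w j)) \<in> borel_measurable (PiM {..<k} (\<lambda>_. lborel))"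
      by (cases "i < k") (auto intro!: borel_measurable_diff borel_measurable_sum)
  qed
  have Fdm: "(\<lambda>w. F (dm w)) \<in> borel_measurable (PiM {..<k} (\<lambda>_. lborel))" by (rule measurable_compose[OF dm F])
  have dens_eq: "dirichlet_density (Suc k) (\<lambda>_. 1) w = Gamma (real (Suc k)) * indicator Smp w" for w
  proof (cases "w \<in> Smp")
    case True
    then have "(\<Prod>i<k. w i powr (1 - 1)) = 1" by (intro prod.neutral) (auto simp: Smp_def)
    then show ?thesis using True by (simp add: dirichlet_density_def Smp_def)
  qed (auto simp: dirichlet_density_def Smp_def)
  have dens_meas [measurable]: "dirichlet_density (Suc k) (\<lambda>_. 1) \<in> borel_measurable (PiM {..<k} (\<lambda>_. lborel))"
    unfolding dirichlet_density_def by measurable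
  have sm: "(\<lambda>w. indicator Smp w :: ennreal) \<in> borel_measurable (PiM {..<k} (\<lambda>_. lborel))"
  proof -
    have "(\<lambda>w. ennreal (if (\<forall>i<k. 0 < w i) \<and> (\<Sum>i<k. w i) < 1 then 1 else 0)) \<in> borel_measurable (PiM {..<k} (\<lambda>_. lborel :: real measure))"
      by measurable
    also have "(\<lambda>w. ennreal (if (\<forall>i<k. 0 < w i) \<and> (\<Sum>i<k. w i) < 1 then 1 else 0)) = (\<lambda>w::nat\<Rightarrow>real. indicator Smp w)"
      by (auto simp: Smp_def indicator_def)
    finally show ?thesis .
  qed
  have rhs: "emeasure (dirichlet_law (Suc k) (\<lambda>_. 1)) A = ennreal (Gamma (real (Suc k))) * C"
  proof -
    have "emeasure (dirichlet_law (Suc k) (\<lambda>_. 1)) A = (\<integral>\<^sup>+z. F z \<partial>dirichlet_law (Suc k) (\<lambda>_. 1))"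
      unfolding F_def by (subst nn_integral_indicator) (auto simp: dirichlet_law_def)
    also have "\<dots> = (\<integral>\<^sup>+w. F (dm w) \<partial>density (PiM {..<k} (\<lambda>_. lborel)) (\<lambda>w. ennreal (dirichlet_density (Suc k) (\<lambda>_. 1) w)))"
      unfolding dirichlet_law_def diff_Suc_1 dm_def[symmetric] by (rule nn_integral_distr) measurable
    also have "\<dots> = (\<integral>\<^sup>+w. ennreal (dirichlet_density (Suc k) (\<lambda>_. 1) w) * F (dm w) \<partial>PiM {..<k} (\<lambda>_. lborel))"
      by (rule nn_integral_density) measurable
    also have "\<dots> = (\<integral>\<^sup>+w. ennreal (Gamma (real (Suc k))) * (indicator Smp w * F (dm w)) \<partial>PiM {..<k} (\<lambda>_. lborel))"
      by (intro nn_integral_cong) (auto simp: dens_eq indicator_def)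
    also have "\<dots> = ennreal (Gamma (real (Suc k))) * C"
      unfolding C_def by (rule nn_integral_cmult[OF borel_measurable_times_ennreal[OF sm Fdm]])
    finally show ?thesis .
  qed
  \<comment> \<open>The integrand after the last coordinate has been replaced by the sum \<open>s\<close>.\<close>
  define H where "H = (\<lambda>x s. (\<Prod>i<k. f (x i)) * f (s - (\<Sum>j<k. x j)) * F (\<lambda>i\<in>{..<Suc k}. (if i < k then x i else s - (\<Sum>j<k. x j)) / s))"
  have arg: "(\<lambda>p. \<lambda>i\<in>{..<Suc k}. (if i < k then fst p i else snd p - (\<Sum>j<k. fst p j)) / snd p) \<in> (PiM {..<k} (\<lambda>_. lborel) \<Otimes>\<^sub>M lborel) \<rightarrow>\<^sub>M PiM {..<Suc k} (\<lambda>_. borel :: real measure)"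
  proof (rule measurable_restrict)
    fix i assume "i \<in> {..<Suc k}"
    show "(\<lambda>p::(nat \<Rightarrow> real) \<times> real. (if i < k then fst p i else snd p - (\<Sum>j<k. fst p j)) / snd p) \<in> borel_measurable (PiM {..<k} (\<lambda>_. lborel) \<Otimes>\<^sub>M lborel)"
    proof (cases "i < k")
      case True
      have "(\<lambda>p::(nat \<Rightarrow> real) \<times> real. fst p i) \<in> (PiM {..<k} (\<lambda>_. lborel :: real measure) \<Otimes>\<^sub>M (lborel :: real measure)) \<rightarrow>\<^sub>M lborel"
        using True by (intro measurable_compose[OF measurable_fst measurable_component_singleton]) simp
      then have [measurable]: "(\<lambda>p::(nat \<Rightarrow> real) \<times> real. fst p i) \<in> borel_measurable (PiM {..<k} (\<lambda>_. lborel :: real measure) \<Otimes>\<^sub>M (lborel :: real measure))" by simp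
      have "(\<lambda>p::(nat \<Rightarrow> real) \<times> real. fst p i / snd p) \<in> borel_measurable (PiM {..<k} (\<lambda>_. lborel :: real measure) \<Otimes>\<^sub>M (lborel :: real measure))"
        by (intro borel_measurable_divide) (auto intro!: measurable_compose[OF measurable_snd])
      then show ?thesis using True by simp
    next
      case False
      have "(\<lambda>p::(nat \<Rightarrow> real) \<times> real. (snd p - (\<Sum>j<k. fst p j)) / snd p) \<in> borel_measurable (PiM {..<k} (\<lambda>_. lborel) \<Otimes>\<^sub>M lborel)" by measurable
      then show ?thesis using False by simp
    qed
  qed
  have Hm: "(\<lambda>p. H (fst p) (snd p)) \<in> borel_measurable (PiM {..<k} (\<lambda>_. lborel) \<Otimes>\<^sub>M lborel)"
  proof -
    have "(\<lambda>p. F (\<lambda>i\<in>{..<Suc k}. (if i < k then fst p i else snd p - (\<Sum>j<k. fst p j)) / snd p)) \<in> borel_measurable (PiM {..<k} (\<lambda>_. lborel) \<Otimes>\<^sub>M lborel)"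
      by (rule measurable_compose[OF arg F])
    then show ?thesis unfolding H_def by measurable
  qed
  have nw_meas: "normalized_weights (Suc k) \<in> PiM {..<Suc k} (\<lambda>_. lborel) \<rightarrow>\<^sub>M PiM {..<Suc k} (\<lambda>_. borel)"
    unfolding normalized_weights_def by measurable
  have nw_meas': "normalized_weights (Suc k) \<in> PiM {..<Suc k} (\<lambda>_. gamma_law 1) \<rightarrow>\<^sub>M PiM {..<Suc k} (\<lambda>_. borel)"
    unfolding normalized_weights_def by measurable
  have Fnw: "(\<lambda>t. F (normalized_weights (Suc k) t)) \<in> borel_measurable (PiM {..<Suc k} (\<lambda>_. lborel))"
    by (rule measurable_compose[OF nw_meas F])
  have "emeasure (distr (PiM {..<Suc k} (\<lambda>_. gamma_law 1)) (PiM {..<Suc k} (\<lambda>_. borel)) (normalized_weights (Suc k))) A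
      = (\<integral>\<^sup>+z. F z \<partial>distr (PiM {..<Suc k} (\<lambda>_. gamma_law 1)) (PiM {..<Suc k} (\<lambda>_. borel)) (normalized_weights (Suc k)))"
    unfolding F_def by (subst nn_integral_indicator) auto
  also have "\<dots> = (\<integral>\<^sup>+t. F (normalized_weights (Suc k) t) \<partial>PiM {..<Suc k} (\<lambda>_. gamma_law 1))"
    by (rule nn_integral_distr[OF nw_meas']) measurable
  also have "\<dots> = (\<integral>\<^sup>+t. (\<Prod>i<Suc k. f (t i)) * F (normalized_weights (Suc k) t) \<partial>PiM {..<Suc k} (\<lambda>_. lborel))"
    unfolding gamma_law_1 f_def[symmetric]
    by (subst PiM_density_lborel[OF _ _ sf]) (auto intro!: nn_integral_density Fnw borel_measurable_prod)
  also have "\<dots> = (\<integral>\<^sup>+x. (\<integral>\<^sup>+y. (\<Prod>i<Suc k. f ((x(k := y)) i)) * F (normalized_weights (Suc k) (x(k := y))) \<partial>lborel) \<partial>PiM {..<k} (\<lambda>_. lborel))"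
    unfolding lessThan_Suc[of k]
    by (rule B.product_nn_integral_insert) (use Fnw in \<open>auto simp: lessThan_Suc intro!: borel_measurable_times_ennreal borel_measurable_prod\<close>)
  also have "\<dots> = (\<integral>\<^sup>+x. (\<integral>\<^sup>+s. H x s \<partial>lborel) \<partial>PiM {..<k} (\<lambda>_. lborel))"
  proof (rule nn_integral_cong)
    fix x :: "nat \<Rightarrow> real"
    assume "x \<in> space (PiM {..<k} (\<lambda>_. lborel))"
    have nwx: "normalized_weights (Suc k) (x(k := y)) = (\<lambda>i\<in>{..<Suc k}. (if i < k then x i else y) / ((\<Sum>j<k. x j) + y))" for y
    proof -
      have "(\<Sum>j<Suc k. (x(k := y)) j) = (\<Sum>j<k. x j) + y" by simp
      then show ?thesis unfolding normalized_weights_def by (intro restrict_ext) (auto simp: less_Suc_eq)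
    qed
    have prod: "(\<Prod>i<Suc k. f ((x(k := y)) i)) = (\<Prod>i<k. f (x i)) * f y" for y by simp
    define \<Sigma>x where "\<Sigma>x = (\<Sum>j<k. x j)"
    have m1: "(\<lambda>y. F (\<lambda>i\<in>{..<Suc k}. (if i < k then x i else y) / (\<Sigma>x + y))) \<in> borel_measurable borel"
    proof (rule measurable_compose[OF _ F], rule measurable_restrict)
      fix i
      show "(\<lambda>y. (if i < k then x i else y) / (\<Sigma>x + y)) \<in> borel_measurable borel" by (cases "i < k") auto
    qed
    have "(\<integral>\<^sup>+y. (\<Prod>i<Suc k. f ((x(k := y)) i)) * F (normalized_weights (Suc k) (x(k := y))) \<partial>lborel)
      = (\<integral>\<^sup>+y. (\<Prod>i<k. f (x i)) * f y * F (\<lambda>i\<in>{..<Suc k}. (if i < k then x i else y) / (\<Sigma>x + y)) \<partial>lborel)"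
      by (simp only: prod nwx \<Sigma>x_def)
    also have "\<dots> = ennreal \<bar>1\<bar> * (\<integral>\<^sup>+s. (\<Prod>i<k. f (x i)) * f (- \<Sigma>x + 1 * s) * F (\<lambda>i\<in>{..<Suc k}. (if i < k then x i else - \<Sigma>x + 1 * s) / (\<Sigma>x + (- \<Sigma>x + 1 * s))) \<partial>lborel)"
      using m1 by (intro nn_integral_real_affine) auto
    also have "\<dots> = (\<integral>\<^sup>+s. H x s \<partial>lborel)" by (simp add: H_def \<Sigma>x_def cong: if_cong)
    finally show "(\<integral>\<^sup>+y. (\<Prod>i<Suc k. f ((x(k := y)) i)) * F (normalized_weights (Suc k) (x(k := y))) \<partial>lborel) = (\<integral>\<^sup>+s. H x s \<partial>lborel)" .
  qed
  also have "\<dots> = (\<integral>\<^sup>+s. (\<integral>\<^sup>+x. H x s \<partial>PiM {..<k} (\<lambda>_. lborel)) \<partial>lborel)"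
    using Hm by (intro PB.Fubini'[symmetric]) (simp add: case_prod_beta)
  also have "\<dots> = (\<integral>\<^sup>+s. ennreal (if 0 < s then s powr (real (Suc k) - 1) * exp (- 1 * s) else 0) * C \<partial>lborel)"
  proof (intro nn_integral_cong)
    fix s :: real
    show "(\<integral>\<^sup>+x. H x s \<partial>PiM {..<k} (\<lambda>_. lborel)) = ennreal (if 0 < s then s powr (real (Suc k) - 1) * exp (- 1 * s) else 0) * C"
    proof (cases "0 < s")
      case False
      have "H x s = 0" for x
      proof (cases "\<forall>i<k. 0 < x i")
        case True
        then have "0 \<le> (\<Sum>j<k. x j)" by (intro sum_nonneg) (auto intro: less_imp_le)
        then show ?thesis using False by (simp add: H_def f_def)
      next
        case nt: False
        then have "(\<Prod>i<k. f (x i)) = 0" by (auto simp: f_def prod_zero_iff)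
        then show ?thesis by (simp add: H_def)
      qed
      then show ?thesis using False by simp
    next
      case True
      have Hs: "(\<lambda>x. H x s) \<in> borel_measurable (PiM {..<k} (\<lambda>_. borel))"
        using measurable_compose[OF measurable_Pair2' Hm, of s] by (simp cong: measurable_cong_sets sets_PiM_cong)
      have pt: "H (\<lambda>i\<in>{..<k}. s * w i) s = ennreal (exp (- s)) * (indicator Smp w * F (dm w))" for w
      proof -
        have sum_eq: "(\<Sum>j<k. (\<lambda>i\<in>{..<k}. s * w i) j) = s * (\<Sum>j<k. w j)" by (simp add: sum_distrib_left)
        have arg_eq: "(\<lambda>i\<in>{..<Suc k}. (if i < k then (\<lambda>i\<in>{..<k}. s * w i) i else s - s * (\<Sum>j<k. w j)) / s) = dm w"
          unfolding dm_def using True by (intro restrict_ext) (auto simp: diff_divide_distrib)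
        have prod_eq: "(\<Prod>i<k. f ((\<lambda>i\<in>{..<k}. s * w i) i)) * f (s - s * (\<Sum>j<k. w j)) = ennreal (exp (- s)) * indicator Smp w"
        proof (cases "w \<in> Smp")
          case w: True
          have "(\<Prod>i<k. f ((\<lambda>i\<in>{..<k}. s * w i) i)) = (\<Prod>i<k. ennreal (exp (- (s * w i))))"
            using w True by (intro prod.cong refl) (simp add: f_def Smp_def)
          also have "\<dots> = ennreal (\<Prod>i<k. exp (- (s * w i)))" by (rule prod_ennreal) simp
          also have "(\<Prod>i<k. exp (- (s * w i))) = exp (- (s * (\<Sum>j<k. w j)))" by (simp add: exp_sum[symmetric] sum_negf sum_distrib_left)
          finally have p: "(\<Prod>i<k. f ((\<lambda>i\<in>{..<k}. s * w i) i)) = ennreal (exp (- (s * (\<Sum>j<k. w j))))" .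
          have "s * (\<Sum>j<k. w j) < s * 1" using w True by (intro mult_strict_left_mono) (auto simp: Smp_def)
          then have q: "f (s - s * (\<Sum>j<k. w j)) = ennreal (exp (- (s - s * (\<Sum>j<k. w j))))" by (simp add: f_def)
          show ?thesis using w unfolding p q by (simp add: ennreal_mult[symmetric] exp_add[symmetric])
        next
          case w: False
          show ?thesis
          proof (cases "\<forall>i<k. 0 < w i")
            case t: True
            then have "1 \<le> (\<Sum>j<k. w j)" using w by (auto simp: Smp_def)
            then have "s * 1 \<le> s * (\<Sum>j<k. w j)" using True by (intro mult_left_mono) auto
            then have "f (s - s * (\<Sum>j<k. w j)) = 0" by (simp add: f_def)
            then show ?thesis using w by simp
          next
            case nt: False
            then obtain i where i: "i < k" "\<not> 0 < w i" by blast
            then have "f ((\<lambda>i\<in>{..<k}. s * w i) i) = 0" using True by (simp add: f_def zero_less_mult_iff)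
            then have "(\<Prod>i<k. f ((\<lambda>i\<in>{..<k}. s * w i) i)) = 0" using i by (intro prod_zero) auto
            then show ?thesis using w by simp
          qed
        qed
        show ?thesis unfolding H_def sum_eq arg_eq prod_eq by (simp add: mult.assoc)
      qed
      have "(\<integral>\<^sup>+x. H x s \<partial>PiM {..<k} (\<lambda>_. lborel)) = ennreal (s ^ card {..<k}) * (\<integral>\<^sup>+w. H (\<lambda>i\<in>{..<k}. s * w i) s \<partial>PiM {..<k} (\<lambda>_. lborel))"
        by (rule PiM_lborel_scale[OF True _ Hs]) simp
      also have "(\<integral>\<^sup>+w. H (\<lambda>i\<in>{..<k}. s * w i) s \<partial>PiM {..<k} (\<lambda>_. lborel)) = ennreal (exp (- s)) * C"
        unfolding pt C_def by (rule nn_integral_cmult[OF borel_measurable_times_ennreal[OF sm Fdm]])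
      finally show ?thesis
        using True by (simp add: powr_realpow ennreal_mult mult.assoc)
    qed
  qed
  also have "\<dots> = (\<integral>\<^sup>+s. ennreal (if 0 < s then s powr (real (Suc k) - 1) * exp (- 1 * s) else 0) \<partial>lborel) * C"
    by (rule nn_integral_multc) measurable
  also have "\<dots> = ennreal (Gamma (real (Suc k))) * C"
    by (subst nn_integral_gamma_kernel) auto
  finally show "emeasure (distr (PiM {..<Suc k} (\<lambda>_. gamma_law 1)) (PiM {..<Suc k} (\<lambda>_. borel)) (normalized_weights (Suc k))) A = emeasure (dirichlet_law (Suc k) (\<lambda>_. 1)) A"
    by (simp only: rhs)
qed

text \<open>With independent exponential variables \<open>t i\<close>, put \<open>S = \<Sum> t i\<close> and \<open>Z = \<Sum> t i * x i\<close>. Given the \<open>x i\<close> the joint Laplace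
transform is a product of factors \<open>1 / (1 + s + \<omega> * x i)\<close>, which after integration over the \<open>x i\<close> is an \<open>m\<close>-th power and
has the scaling property of \<open>gamma_sum_ratio_independent\<close>. So \<open>Z / S\<close> has the generalised Stieltjes transform of order
\<open>m\<close> that equals the Laplace transform of \<open>Z\<close>.\<close>

lemma exponential_mixture_stieltjes:
  fixes \<kappa> :: "real measure"
  assumes \<kappa>: "prob_space \<kappa>" "sets \<kappa> = sets borel" "AE x in \<kappa>. 0 \<le> x \<and> x \<le> 1" and m: "0 < m"
  defines "R \<equiv> distr (PiM {..<m} (\<lambda>_. gamma_law 1) \<Otimes>\<^sub>M PiM {..<m} (\<lambda>_. \<kappa>)) borel (\<lambda>(t, x). \<Sum>i<m. normalized_weights m t i * x i)"
  shows "prob_space R" and "sets R = sets borel" and "AE z in R. 0 \<le> z \<and> z \<le> 1"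
    and "\<And>\<omega>. 0 \<le> \<omega> \<Longrightarrow> (LINT z|R. (1 + \<omega> * z) powr (- real m)) = (LINT x|\<kappa>. (1 + \<omega> * x) powr (- 1)) ^ m"
proof -
  note [measurable_cong] = \<kappa>(2)
  interpret \<kappa>: prob_space \<kappa> by fact
  interpret g: prob_space "gamma_law 1" by (rule prob_space_gamma_law) simp
  interpret PG: product_prob_space "\<lambda>_::nat. gamma_law 1" "{..<m}" by unfold_locales
  interpret PK: product_prob_space "\<lambda>_::nat. \<kappa>" "{..<m}" by unfold_locales
  let ?PG = "PiM {..<m} (\<lambda>_. gamma_law 1)" and ?PK = "PiM {..<m} (\<lambda>_. \<kappa>)"
  interpret Q: pair_prob_space ?PG ?PK by unfold_locales
  define S where "S = (\<lambda>p :: (nat \<Rightarrow> real) \<times> (nat \<Rightarrow> real). \<Sum>i<m. fst p i)"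
  define Z where "Z = (\<lambda>p :: (nat \<Rightarrow> real) \<times> (nat \<Rightarrow> real). \<Sum>i<m. fst p i * snd p i)"
  have [measurable]: "S \<in> borel_measurable (?PG \<Otimes>\<^sub>M ?PK)" "Z \<in> borel_measurable (?PG \<Otimes>\<^sub>M ?PK)"
    unfolding S_def Z_def by measurable
  have AEG: "AE t in ?PG. \<forall>i\<in>{..<m}. 0 \<le> t i"
  proof (intro AE_finite_allI finite_lessThan)
    fix i assume "i \<in> {..<m}"
    then show "AE t in ?PG. 0 \<le> t i" using AE_gamma_law_nonneg[of 1] by (intro AE_PiM_component) (auto intro: g.prob_space_axioms)
  qed
  have AEK: "AE x in ?PK. \<forall>i\<in>{..<m}. 0 \<le> x i \<and> x i \<le> 1"
  proof (intro AE_finite_allI finite_lessThan)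
    fix i assume "i \<in> {..<m}"
    then show "AE x in ?PK. 0 \<le> x i \<and> x i \<le> 1" using \<kappa>(3) by (intro AE_PiM_component[where P = "\<lambda>y. 0 \<le> y \<and> y \<le> 1"]) (auto intro: \<kappa>.prob_space_axioms)
  qed
  have AEQ: "AE p in ?PG \<Otimes>\<^sub>M ?PK. \<forall>i\<in>{..<m}. 0 \<le> fst p i \<and> 0 \<le> snd p i \<and> snd p i \<le> 1"
  proof (intro AE_finite_allI finite_lessThan)
    fix i assume i [measurable]: "i \<in> {..<m}"
    show "AE p in ?PG \<Otimes>\<^sub>M ?PK. 0 \<le> fst p i \<and> 0 \<le> snd p i \<and> snd p i \<le> 1"
    proof (rule Q.AE_pair_measure)
      show "AE t in ?PG. AE x in ?PK. 0 \<le> fst (t, x) i \<and> 0 \<le> snd (t, x) i \<and> snd (t, x) i \<le> 1"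
        using AEG
      proof eventually_elim
        case (elim t)
        show ?case using AEK by eventually_elim (use elim i in auto)
      qed
    qed measurable
  qed
  have ZS: "AE p in ?PG \<Otimes>\<^sub>M ?PK. 0 \<le> Z p \<and> Z p \<le> S p"
    using AEQ by eventually_elim (auto simp: Z_def S_def intro!: sum_nonneg sum_mono mult_left_le)
  have joint0: "(LINT p|(?PG \<Otimes>\<^sub>M ?PK). exp (- s * S p - \<omega> * Z p)) = (LINT x|\<kappa>. (1 + (s + \<omega> * x)) powr (- 1)) ^ m"
    if s: "0 \<le> s" and \<omega>: "0 \<le> \<omega>" for s \<omega>
  proof -
    have int: "integrable (?PG \<Otimes>\<^sub>M ?PK) (\<lambda>(t, x). exp (- s * S (t, x) - \<omega> * Z (t, x)))"
    proof (rule Q.P.integrable_const_bound[of _ 1])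
      show "AE p in ?PG \<Otimes>\<^sub>M ?PK. norm (case p of (t, x) \<Rightarrow> exp (- s * S (t, x) - \<omega> * Z (t, x))) \<le> 1"
        using ZS
      proof eventually_elim
        case (elim p)
        then have "0 \<le> s * S p" "0 \<le> \<omega> * Z p" using s \<omega> by auto
        then show ?case by (simp add: case_prod_beta)
      qed
    qed measurable
    have "(LINT p|(?PG \<Otimes>\<^sub>M ?PK). exp (- s * S p - \<omega> * Z p)) = (LINT x|?PK. LINT t|?PG. exp (- s * S (t, x) - \<omega> * Z (t, x)))"
      using Q.integral_snd[OF int] by (simp add: case_prod_beta')
    also have "\<dots> = (LINT x|?PK. (\<Prod>i<m. (1 + (s + \<omega> * x i)) powr (- 1)))"
    proof (rule integral_cong_AE)
      show "AE x in ?PK. (LINT t|?PG. exp (- s * S (t, x) - \<omega> * Z (t, x))) = (\<Prod>i<m. (1 + (s + \<omega> * x i)) powr (- 1))"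
        using AEK
      proof eventually_elim
        case (elim x)
        have "(LINT t|?PG. exp (- s * S (t, x) - \<omega> * Z (t, x))) = (LINT t|?PG. (\<Prod>i<m. exp (- (s + \<omega> * x i) * t i)))"
          by (intro Bochner_Integration.integral_cong refl)
             (simp add: exp_sum[symmetric] S_def Z_def sum_distrib_left sum_subtractf[symmetric] sum_negf[symmetric] algebra_simps)
        also have "\<dots> = (\<Prod>i<m. LINT y|gamma_law 1. exp (- (s + \<omega> * x i) * y))"
        proof (rule PG.product_integral_prod)
          fix i assume "i \<in> {..<m}"
          then have "-1 < s + \<omega> * x i" using elim s \<omega> by (auto intro: less_le_trans[of _ 0])
          then show "integrable (gamma_law 1) (\<lambda>y. exp (- (s + \<omega> * x i) * y))"
            by (intro integrable.intros[OF has_bochner_integral_gamma_law_exp]) simp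
        qed simp
        also have "\<dots> = (\<Prod>i<m. (1 + (s + \<omega> * x i)) powr (- 1))"
        proof (intro prod.cong refl)
          fix i assume "i \<in> {..<m}"
          then have "-1 < s + \<omega> * x i" using elim s \<omega> by (auto intro: less_le_trans[of _ 0])
          then show "(LINT y|gamma_law 1. exp (- (s + \<omega> * x i) * y)) = (1 + (s + \<omega> * x i)) powr (- 1)"
            by (subst has_bochner_integral_integral_eq[OF has_bochner_integral_gamma_law_exp]) auto
        qed
        finally show ?case .
      qed
    qed measurable
    also have "\<dots> = (\<Prod>i<m. LINT x|\<kappa>. (1 + (s + \<omega> * x)) powr (- 1))"
    proof (rule PK.product_integral_prod)
      show "integrable \<kappa> (\<lambda>x. (1 + (s + \<omega> * x)) powr (- 1))"
      proof (rule \<kappa>.integrable_const_bound[of _ 1])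
        show "AE x in \<kappa>. norm ((1 + (s + \<omega> * x)) powr (- 1)) \<le> 1"
          using \<kappa>(3)
        proof eventually_elim
          case (elim x)
          then have "1 \<le> 1 + (s + \<omega> * x)" using s \<omega> by simp
          then show ?case by (simp add: powr_minus powr_one inverse_le_1_iff)
        qed
      qed measurable
    qed simp
    finally show ?thesis by simp
  qed
  have joint: "(LINT p|(?PG \<Otimes>\<^sub>M ?PK). exp (- s * S p - \<omega> * Z p)) = (1 + s) powr (- real m) * (LINT p|(?PG \<Otimes>\<^sub>M ?PK). exp (- (\<omega> / (1 + s)) * Z p))"
    if s: "0 \<le> s" and \<omega>: "0 \<le> \<omega>" for s \<omega>
  proof -
    have "(LINT x|\<kappa>. (1 + (s + \<omega> * x)) powr (- 1)) = (LINT x|\<kappa>. (1 + s) powr (- 1) * (1 + \<omega> / (1 + s) * x) powr (- 1))"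
    proof (rule integral_cong_AE)
      show "AE x in \<kappa>. (1 + (s + \<omega> * x)) powr (- 1) = (1 + s) powr (- 1) * (1 + \<omega> / (1 + s) * x) powr (- 1)"
        using \<kappa>(3)
      proof eventually_elim
        case (elim x)
        then have "0 \<le> \<omega> / (1 + s) * x" using s \<omega> by simp
        then have "(1 + s) powr (- 1) * (1 + \<omega> / (1 + s) * x) powr (- 1) = ((1 + s) * (1 + \<omega> / (1 + s) * x)) powr (- 1)"
          by (simp only: powr_mult)
        also have "(1 + s) * (1 + \<omega> / (1 + s) * x) = 1 + (s + \<omega> * x)" using s by (simp add: field_simps)
        finally show ?case by simp
      qed
    qed measurable
    also have "\<dots> = (1 + s) powr (- 1) * (LINT x|\<kappa>. (1 + (0 + \<omega> / (1 + s) * x)) powr (- 1))"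
      unfolding add_0 by (rule integral_mult_right_zero)
    finally have "(LINT x|\<kappa>. (1 + (s + \<omega> * x)) powr (- 1)) ^ m = ((1 + s) powr (- 1)) ^ m * (LINT x|\<kappa>. (1 + (0 + \<omega> / (1 + s) * x)) powr (- 1)) ^ m"
      by (simp only: power_mult_distrib)
    also have "((1 + s) powr (- 1)) ^ m = (1 + s) powr (- real m)"
      using s powr_power[of "1 + s" "- 1" m] by simp
    also have "(LINT x|\<kappa>. (1 + (0 + \<omega> / (1 + s) * x)) powr (- 1)) ^ m = (LINT p|(?PG \<Otimes>\<^sub>M ?PK). exp (- (\<omega> / (1 + s)) * Z p))"
      using joint0[of 0 "\<omega> / (1 + s)"] s \<omega> by simp
    finally show ?thesis using joint0[OF s \<omega>] by simp
  qed
  have R_eq: "R = distr (?PG \<Otimes>\<^sub>M ?PK) borel (\<lambda>p. Z p / S p)"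
    unfolding R_def
  proof (intro distr_cong refl)
    fix p :: "(nat \<Rightarrow> real) \<times> (nat \<Rightarrow> real)"
    show "(case p of (t, x) \<Rightarrow> \<Sum>i<m. normalized_weights m t i * x i) = Z p / S p"
      by (simp add: case_prod_beta normalized_weights_def Z_def S_def sum_divide_distrib)
  qed
  have law_Z: "distr (?PG \<Otimes>\<^sub>M ?PK) borel Z = distr (gamma_law (real m) \<Otimes>\<^sub>M R) borel (\<lambda>(t, x). t * x)"
    unfolding R_eq
    by (rule gamma_sum_ratio_independent(2)[OF Q.P.prob_space_axioms _ _ _ ZS joint]) (use m in auto)
  show "prob_space R" unfolding R_eq by (rule Q.P.prob_space_distr) measurable
  then interpret R: prob_space R .
  show sR: "sets R = sets borel" by (simp add: R_eq)
  show AER: "AE z in R. 0 \<le> z \<and> z \<le> 1"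
    unfolding R_eq
  proof (subst AE_distr_iff)
    show "AE p in ?PG \<Otimes>\<^sub>M ?PK. 0 \<le> Z p / S p \<and> Z p / S p \<le> 1"
      using ZS
    proof eventually_elim
      case (elim p)
      then show ?case by (cases "S p = 0") (auto simp: divide_le_eq_1)
    qed
  qed auto
  fix \<omega> :: real assume \<omega>: "0 \<le> \<omega>"
  have "(LINT z|R. (1 + \<omega> * z) powr (- real m)) = (LINT z|distr (?PG \<Otimes>\<^sub>M ?PK) borel Z. exp (- \<omega> * z))"
    unfolding law_Z using m sR AER \<omega> R.finite_measure_axioms by (intro laplace_gamma_times[symmetric]) auto
  also have "\<dots> = (LINT p|(?PG \<Otimes>\<^sub>M ?PK). exp (- \<omega> * Z p))" by (subst integral_distr) auto
  also have "\<dots> = (LINT x|\<kappa>. (1 + \<omega> * x) powr (- 1)) ^ m" using joint0[of 0 \<omega>] \<omega> by simp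
  finally show "(LINT z|R. (1 + \<omega> * z) powr (- real m)) = (LINT x|\<kappa>. (1 + \<omega> * x) powr (- 1)) ^ m" .
qed

section \<open>The law of the increment\<close>

lemma levy_exponent_ou:
  assumes G: "gamma_process M G \<theta>" and th: "0 < \<theta>" and lam: "0 < lam" and Del: "0 < Del" and a: "a = lam * Del" and w: "0 \<le> \<omega>"
  shows "levy_exponent (distr M borel (ou_increment G lam Del)) \<omega> = \<theta> * log_transform a \<omega>"
proof -
  note [measurable] = borel_measurable_ou_increment[OF G th lam Del a]
  have "(LINT x|distr M borel (ou_increment G lam Del). exp (- \<omega> * x)) = (LINT x|M. exp (- \<omega> * ou_increment G lam Del x))"
    by (rule integral_distr) measurable
  also have "\<dots> = exp (- \<theta> * log_transform a \<omega>)"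
    using laplace_ou_increment[OF G th lam Del a, of \<omega>] w by (intro has_bochner_integral_integral_eq) simp
  finally show ?thesis by (simp add: levy_exponent_def)
qed

text \<open>Near 0 the function \<open>min 1 y / y\<close> is 1 and afterwards at most 1, so the Levy measure is admissible because \<open>E_diff a\<close> is
integrable.\<close>

lemma levy_khintchine_ou:
  assumes G: "gamma_process M G \<theta>" and th: "0 < \<theta>" and lam: "0 < lam" and Del: "0 < Del" and a: "a = lam * Del"
  shows "levy_khintchine (distr M borel (ou_increment G lam Del)) 0 (\<lambda>y. \<theta> * (1 / y) * E_diff a y)"
  unfolding levy_khintchine_def
proof (intro conjI allI impI)
  have a0: "0 < a" using a lam Del by simp
  show "0 \<le> \<theta> * (1 / y) * E_diff a y" if "0 < y" for y
    using th that E_diff_nonneg[OF a0 that] by simp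
  have int: "set_integrable lborel {0<..} (\<lambda>y. \<theta> * E_diff a y)"
    using integral_power_E_diff(1)[OF a0, of 1] by simp
  show "set_integrable lborel {0<..} (\<lambda>y. min 1 y * (\<theta> * (1 / y) * E_diff a y))"
    unfolding set_integrable_def
  proof (rule Bochner_Integration.integrable_bound[OF int[unfolded set_integrable_def]])
    have "(\<lambda>y. (min 1 y / y) * (indicator {0<..} y *\<^sub>R (\<theta> * E_diff a y))) \<in> borel_measurable lborel"
      using int by (intro borel_measurable_times) (auto simp: set_integrable_def)
    also have "(\<lambda>y. (min 1 y / y) * (indicator {0<..} y *\<^sub>R (\<theta> * E_diff a y))) = (\<lambda>y. indicator {0<..} y *\<^sub>R (min 1 y * (\<theta> * (1 / y) * E_diff a y)))"
      by (auto simp: fun_eq_iff)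
    finally show "(\<lambda>y. indicator {0<..} y *\<^sub>R (min 1 y * (\<theta> * (1 / y) * E_diff a y))) \<in> borel_measurable lborel" .
    show "AE y in lborel. norm (indicator {0<..} y *\<^sub>R (min 1 y * (\<theta> * (1 / y) * E_diff a y))) \<le> norm (indicator {0<..} y *\<^sub>R (\<theta> * E_diff a y))"
    proof (rule AE_I2)
      fix y :: real
      show "norm (indicator {0<..} y *\<^sub>R (min 1 y * (\<theta> * (1 / y) * E_diff a y))) \<le> norm (indicator {0<..} y *\<^sub>R (\<theta> * E_diff a y))"
      proof (cases "0 < y")
        case True
        have "min 1 y / y * (\<theta> * E_diff a y) \<le> 1 * (\<theta> * E_diff a y)"
          using True th E_diff_nonneg[OF a0 True] by (intro mult_right_mono) auto
        then show ?thesis using True th E_diff_nonneg[OF a0 True] by (simp add: abs_mult)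
      qed simp
    qed
  qed
  fix \<omega> :: real assume w: "0 \<le> \<omega>"
  have "(LBINT y:{0<..}. (1 - exp (- \<omega> * y)) * (\<theta> * (1 / y) * E_diff a y)) = (LBINT y:{0<..}. \<theta> * ((1 - exp (- \<omega> * y)) / y * E_diff a y))"
    by (intro set_lebesgue_integral_cong) auto
  also have "\<dots> = \<theta> * log_transform a \<omega>"
    unfolding integral_exp_diff_E_diff(2)[OF a0 w, symmetric] by (rule set_integral_mult_right)
  finally show "levy_exponent (distr M borel (ou_increment G lam Del)) \<omega> = 0 * \<omega> + (LBINT y:{0<..}. (1 - exp (- \<omega> * y)) * (\<theta> * (1 / y) * E_diff a y))"
    using levy_exponent_ou[OF G th lam Del a w] by simp
qed simp

text \<open>Both sides have generalised Stieltjes transform of order \<open>m\<close> equal to \<open>exp (- (m / a) * log_transform a \<omega>)\<close>.\<close>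

lemma mean_law_eq_dirichlet_mixture:
  assumes dir: "dirichlet_process N P (scale_measure (ennreal (real m)) (F_law a))" and a: "0 < a" and m: "0 < m"
    and D: "D = mean_functional_law N P a"
  shows "D = distr (PiM {..<m} (\<lambda>_. gamma_law 1) \<Otimes>\<^sub>M PiM {..<m} (\<lambda>_. density lborel (\<lambda>x. ennreal (density_M1 a x))))
              borel (\<lambda>(t, x). \<Sum>i<m. normalized_weights m t i * x i)"
    (is "_ = ?R")
proof -
  have m0: "0 < real m" using m by simp
  note mix = mean_functional_gamma_mixture[OF dir a m0 D]
  note law = density_M1_law[OF a]
  note R = exponential_mixture_stieltjes[OF law(1-3) m]
  show ?thesis
  proof (rule finite_measure_eqI_stieltjes[OF m0 prob_space.finite_measure[OF mix(1)] prob_space.finite_measure[OF R(1)] mix(2) R(2) mix(3) R(3)])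
    fix w :: real assume w: "0 \<le> w"
    have "(LINT z|?R. (1 + w * z) powr (- real m)) = exp (- (1 / a) * log_transform a w) ^ m"
      using R(4)[OF w] law(4)[OF w] by simp
    also have "\<dots> = exp (- (real m / a) * log_transform a w)"
      by (simp add: exp_of_nat_mult[symmetric])
    finally show "(LINT x|D. (1 + w * x) powr (- real m)) = (LINT z|?R. (1 + w * z) powr (- real m))"
      using mix(4)[OF w] by simp
  qed
qed

theorem proposition3p3:
  fixes M :: "'a measure" and G :: "real \<Rightarrow> 'a \<Rightarrow> real"
    and N :: "'b measure" and P :: "'b \<Rightarrow> real measure"
    and \<theta> lam Del a :: real and Y D :: "real measure"
  assumes "0 < \<theta>" and "0 < lam" and "0 < Del" and "a = lam * Del"
    and "gamma_process M G \<theta>"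
    and "Y = distr M borel (ou_increment G lam Del)"
    and "dirichlet_process N P (scale_measure (ennreal (\<theta> * a)) (F_law a))"
    and "D = mean_functional_law N P a"
  shows
    "\<comment> \<open>the law of Y\<close>
     infinitely_divisible Y \<and> prob_space (F_law a) \<and>
     (\<forall>\<omega>\<ge>0.
        levy_exponent Y \<omega> = (LBINT u:{exp (- a)..1}. d_exponent \<theta> (\<omega> * u) / u) \<and>
        levy_exponent Y \<omega> = (LINT u|F_law a. d_exponent (\<theta> * a) (\<omega> * u)) \<and>
        levy_exponent Y \<omega> = - \<theta> * (Li2 (- \<omega>) - Li2 (- \<omega> * exp (- a)))) \<and>
     \<comment> \<open>(i)\<close>
     Y = distr (gamma_law (\<theta> * a) \<Otimes>\<^sub>M D) borel (\<lambda>(t, x). t * x) \<and>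
     \<comment> \<open>(ii)\<close>
     levy_khintchine Y 0 (\<lambda>y. \<theta> * (1 / y) * (E1 y - E1 (y * exp a))) \<and>
     (\<forall>j::nat. 1 \<le> j \<longrightarrow>
        set_integrable lborel {0<..} (\<lambda>y. y ^ (j - 1) * (E1 y - E1 (y * exp a))) \<and>
        has_cumulant Y j (\<theta> * (LBINT y:{0<..}. y ^ (j - 1) * (E1 y - E1 (y * exp a)))) \<and>
        \<theta> * (LBINT y:{0<..}. y ^ (j - 1) * (E1 y - E1 (y * exp a)))
          = \<theta> * (Gamma (real j) / real j) * (1 - exp (- a * real j))) \<and>
     \<comment> \<open>(iii)\<close>
     (\<theta> * a = 1 \<longrightarrow> D = density lborel (\<lambda>x. ennreal (density_M1 a x))) \<and>
     \<comment> \<open>(iv)\<close>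
     (\<theta> * a = 1 \<longrightarrow>
        distr D borel (\<lambda>x. - ln x / a) = density lborel (\<lambda>v. ennreal (density_V a v))) \<and>
     \<comment> \<open>(v)\<close>
     (\<theta> * a > 1 \<longrightarrow>
        D = density lborel (\<lambda>x. ennreal (density_M \<theta> a x)) \<and>
        distr D borel (\<lambda>x. x / a) = density lborel (\<lambda>y. ennreal (a * density_M \<theta> a (a * y)))) \<and>
     \<comment> \<open>(vi)\<close>
     (\<forall>m::nat. 2 \<le> m \<and> \<theta> * a = real m \<longrightarrow>
        distr (PiM {..<m} (\<lambda>_. gamma_law 1)) (PiM {..<m} (\<lambda>_. borel)) (normalized_weights m)
          = dirichlet_law m (\<lambda>_. 1) \<and>
        D = distr (PiM {..<m} (\<lambda>_. gamma_law 1) \<Otimes>\<^sub>M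
                   PiM {..<m} (\<lambda>_. density lborel (\<lambda>x. ennreal (density_M1 a x))))
              borel (\<lambda>(t, x). \<Sum>i<m. normalized_weights m t i * x i)) \<and>
     \<comment> \<open>(vii)\<close>
     (\<forall>L. ou_stationary_law M G lam L \<longrightarrow>
        (\<forall>\<omega>\<ge>0. levy_exponent L \<omega> = (LBINT u:{0<..1}. d_exponent \<theta> (\<omega> * u) / u) \<and>
                 levy_exponent L \<omega> = - \<theta> * Li2 (- \<omega>)) \<and>
        (\<forall>lams Dels :: nat \<Rightarrow> real.
           (\<forall>n. 0 < lams n \<and> 0 < Dels n) \<and> (\<lambda>n. exp (- (lams n * Dels n))) \<longlonglongrightarrow> 0 \<longrightarrow>
           weak_conv_m (\<lambda>n. distr M borel (ou_increment G (lams n) (Dels n))) L))"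
proof -
  have th: "0 < \<theta>" and lam: "0 < lam" and Del: "0 < Del" and a: "a = lam * Del" and G: "gamma_process M G \<theta>"
    and Y: "Y = distr M borel (ou_increment G lam Del)"
    and dir: "dirichlet_process N P (scale_measure (ennreal (\<theta> * a)) (F_law a))" and D: "D = mean_functional_law N P a"
    using assms by auto
  have a0: "0 < a" using a lam Del by simp
  have over: "(LBINT u:A. d_exponent \<theta> (\<omega> * u) / u) = \<theta> * (LBINT u:A. ln (1 + \<omega> * u) / u)" for A \<omega>
    unfolding d_exponent_def times_divide_eq_right[symmetric] by (rule set_integral_mult_right)
  have levy: "levy_exponent Y \<omega> = \<theta> * log_transform a \<omega>" if "0 \<le> \<omega>" for \<omega>
    unfolding Y by (rule levy_exponent_ou[OF G th lam Del a that])
  have law_Y: "levy_exponent Y \<omega> = (LBINT u:{exp (- a)..1}. d_exponent \<theta> (\<omega> * u) / u) \<and>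
        levy_exponent Y \<omega> = (LINT u|F_law a. d_exponent (\<theta> * a) (\<omega> * u)) \<and>
        levy_exponent Y \<omega> = - \<theta> * (Li2 (- \<omega>) - Li2 (- \<omega> * exp (- a)))" if w: "0 \<le> \<omega>" for \<omega>
  proof (intro conjI)
    show "levy_exponent Y \<omega> = (LBINT u:{exp (- a)..1}. d_exponent \<theta> (\<omega> * u) / u)"
      unfolding over levy[OF w] log_transform_def ..
    have "(LINT u|F_law a. d_exponent (\<theta> * a) (\<omega> * u)) = \<theta> * a * (log_transform a \<omega> / a)"
      using integral_F_law_ln[OF a0, of \<omega>] w by (simp add: d_exponent_def)
    then show "levy_exponent Y \<omega> = (LINT u|F_law a. d_exponent (\<theta> * a) (\<omega> * u))"
      using levy[OF w] a0 by simp
    show "levy_exponent Y \<omega> = - \<theta> * (Li2 (- \<omega>) - Li2 (- \<omega> * exp (- a)))"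
      unfolding levy[OF w] log_transform_Li2[OF a0 w] by (simp add: algebra_simps)
  qed
  have cumulants: "set_integrable lborel {0<..} (\<lambda>y. y ^ (j - 1) * (E1 y - E1 (y * exp a))) \<and>
        has_cumulant Y j (\<theta> * (LBINT y:{0<..}. y ^ (j - 1) * (E1 y - E1 (y * exp a)))) \<and>
        \<theta> * (LBINT y:{0<..}. y ^ (j - 1) * (E1 y - E1 (y * exp a)))
          = \<theta> * (Gamma (real j) / real j) * (1 - exp (- a * real j))" if j: "1 \<le> j" for j
  proof (intro conjI)
    note I = integral_power_E_diff[OF a0 j, unfolded E_diff_def]
    show "set_integrable lborel {0<..} (\<lambda>y. y ^ (j - 1) * (E1 y - E1 (y * exp a)))" by (rule I(1))
    show "has_cumulant Y j (\<theta> * (LBINT y:{0<..}. y ^ (j - 1) * (E1 y - E1 (y * exp a))))"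
      unfolding I(2) Y by (rule has_cumulant_ou[OF G th lam Del a j])
    show "\<theta> * (LBINT y:{0<..}. y ^ (j - 1) * (E1 y - E1 (y * exp a))) = \<theta> * (Gamma (real j) / real j) * (1 - exp (- a * real j))"
      unfolding I(2) by (simp only: mult.assoc)
  qed
  have M1: "D = density lborel (\<lambda>x. ennreal (density_M1 a x))" if "\<theta> * a = 1"
    by (rule mean_law_eq_density_M1[OF _ a0 D]) (use dir that in simp)
  have V: "distr D borel (\<lambda>x. - ln x / a) = density lborel (\<lambda>v. ennreal (density_V a v))" if "\<theta> * a = 1"
    unfolding M1[OF that] by (rule distr_density_M1[OF a0])
  have Mc: "D = density lborel (\<lambda>x. ennreal (density_M \<theta> a x))" if "\<theta> * a > 1"
    by (rule mean_law_eq_density_M[OF dir a0 that D])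
  have Mca: "distr D borel (\<lambda>x. x / a) = density lborel (\<lambda>y. ennreal (a * density_M \<theta> a (a * y)))" if c: "\<theta> * a > 1"
  proof -
    have "integrable lborel (density_M \<theta> a)" using density_M_stieltjes(1)[OF a0 c, of 0] by simp
    then have "density_M \<theta> a \<in> borel_measurable borel" by auto
    then show ?thesis unfolding Mc[OF c] by (rule distr_density_divide[OF a0])
  qed
  have mixture: "distr (PiM {..<m} (\<lambda>_. gamma_law 1)) (PiM {..<m} (\<lambda>_. borel)) (normalized_weights m) = dirichlet_law m (\<lambda>_. 1) \<and>
        D = distr (PiM {..<m} (\<lambda>_. gamma_law 1) \<Otimes>\<^sub>M
                   PiM {..<m} (\<lambda>_. density lborel (\<lambda>x. ennreal (density_M1 a x))))
              borel (\<lambda>(t, x). \<Sum>i<m. normalized_weights m t i * x i)" if m: "2 \<le> m \<and> \<theta> * a = real m" for m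
  proof
    obtain k where k: "m = Suc k" using m by (cases m) auto
    show "distr (PiM {..<m} (\<lambda>_. gamma_law 1)) (PiM {..<m} (\<lambda>_. borel)) (normalized_weights m) = dirichlet_law m (\<lambda>_. 1)"
      unfolding k by (rule dirichlet_law_from_exponentials)
    show "D = distr (PiM {..<m} (\<lambda>_. gamma_law 1) \<Otimes>\<^sub>M
                   PiM {..<m} (\<lambda>_. density lborel (\<lambda>x. ennreal (density_M1 a x))))
              borel (\<lambda>(t, x). \<Sum>i<m. normalized_weights m t i * x i)"
      by (rule mean_law_eq_dirichlet_mixture[OF _ a0 _ D]) (use dir m in auto)
  qed
  have stationary: "levy_exponent L \<omega> = (LBINT u:{0<..1}. d_exponent \<theta> (\<omega> * u) / u) \<and> levy_exponent L \<omega> = - \<theta> * Li2 (- \<omega>)"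
    if L: "ou_stationary_law M G lam L" and w: "0 \<le> \<omega>" for L \<omega>
    unfolding over levy_exponent_ou_stationary[OF G th lam L w] using Li2_neg[OF w zero_le_one] by simp
  show ?thesis
  proof (intro conjI)
    show "infinitely_divisible Y" unfolding Y by (rule infinitely_divisible_ou[OF G th lam Del])
    show "prob_space (F_law a)" by (rule prob_space_F_law[OF a0])
    show "Y = distr (gamma_law (\<theta> * a) \<Otimes>\<^sub>M D) borel (\<lambda>(t, x). t * x)"
      unfolding Y by (rule ou_law_eq_gamma_times_mean[OF G th lam Del a dir D])
    show "levy_khintchine Y 0 (\<lambda>y. \<theta> * (1 / y) * (E1 y - E1 (y * exp a)))"
      using levy_khintchine_ou[OF G th lam Del a] unfolding Y E_diff_def .
    show "\<forall>L. ou_stationary_law M G lam L \<longrightarrow>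
        (\<forall>\<omega>\<ge>0. levy_exponent L \<omega> = (LBINT u:{0<..1}. d_exponent \<theta> (\<omega> * u) / u) \<and>
                 levy_exponent L \<omega> = - \<theta> * Li2 (- \<omega>)) \<and>
        (\<forall>lams Dels :: nat \<Rightarrow> real.
           (\<forall>n. 0 < lams n \<and> 0 < Dels n) \<and> (\<lambda>n. exp (- (lams n * Dels n))) \<longlonglongrightarrow> 0 \<longrightarrow>
           weak_conv_m (\<lambda>n. distr M borel (ou_increment G (lams n) (Dels n))) L)"
      using stationary weak_conv_ou[OF G th lam] by blast
  qed (use law_Y cumulants M1 V Mc Mca mixture in blast)+
qed

end
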